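(* Let $\Gamma$ be a discrete group that acts by an exact action (by automorphisms) on a $C^*$-algebra $A$. If $K$ is an invariant regular ideal of $A$, then $K\rtimes_r\Gamma$ is a regular ideal in $A\rtimes_r\Gamma$. If in addition $A\subseteq A\rtimes_r\Gamma$ has the ideal intersection property, then every regular ideal in $A\rtimes_r\Gamma$ has this form, i.e. equals $K\rtimes_r\Gamma$ for some invariant regular ideal $K$ of $A$.
   Context: Ideals are closed and two-sided. For a $C^*$-algebra $C$ and $X\subseteq C$, $X^\perp=\{c\in C: cx=xc=0 \text{ for all } x\in X\}$; an ideal $J$ of $C$ is regular if $J=J^{\perp\perp}$. $A\rtimes_r\Gamma$ is the reduced crossed product, containing $A$ in the usual way. An ideal $K$ of $A$ is invariant if it is invariant under the action of $\Gamma$; then $K\rtimes_r\Gamma$ is regarded as an ideal of $A\rtimes_r\Gamma$. The action of $\Gamma$ on $A$ is exact if for every invariant ideal $K$ of $A$ the sequence $K\rtimes_r\Gamma\to A\rtimes_r\Gamma\to (A/K)\rtimes_r\Gamma$ is exact in the middle. $A\subseteq A\rtimes_r\Gamma$ has the ideal intersection property if $J\cap A\neq\{0\}$ for every non-zero ideal $J$ of $A\rtimes_r\Gamma$. *)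

theory Defs
  imports
    "HOL-Analysis.Abstract_Metric_Spaces"
    "HOL-Algebra.Module"
    "HOL-Algebra.QuotRing"
    "HOL-Algebra.Group_Action"
begin

section \<open>C*-algebras\<close>

text \<open>The record \<^typ>\<open>(complex, 'a) module\<close> of HOL-Algebra provides carrier, addition,
  multiplication and complex scalar multiplication.  C*-algebras are not assumed to be unital: the
  inherited field \<^const>\<open>one\<close> is not constrained by any axiom and is not used below.\<close>

record 'a cstar = "(complex, 'a) module" +
  star :: "'a \<Rightarrow> 'a"
  nrm :: "'a \<Rightarrow> real"

text \<open>The case distinction is needed because locale \<^locale>\<open>Metric_space\<close> asks for nonnegativity and
  symmetry also outside of the carrier.\<close>

definition cs_dist :: "'a cstar \<Rightarrow> 'a \<Rightarrow> 'a \<Rightarrow> real" where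
  "cs_dist A x y = (if x \<in> carrier A \<and> y \<in> carrier A then nrm A (x \<ominus>\<^bsub>A\<^esub> y) else 0)"

definition cs_top :: "'a cstar \<Rightarrow> 'a topology" where
  "cs_top A = Metric_space.mtopology (carrier A) (cs_dist A)"

locale cstar_algebra = abelian_group A for A :: "'a cstar" (structure) +
  assumes m_closed: "\<lbrakk>x \<in> carrier A; y \<in> carrier A\<rbrakk> \<Longrightarrow> x \<otimes> y \<in> carrier A"
    and m_assoc: "\<lbrakk>x \<in> carrier A; y \<in> carrier A; z \<in> carrier A\<rbrakk>
      \<Longrightarrow> (x \<otimes> y) \<otimes> z = x \<otimes> (y \<otimes> z)"
    and l_distr: "\<lbrakk>x \<in> carrier A; y \<in> carrier A; z \<in> carrier A\<rbrakk>
      \<Longrightarrow> (x \<oplus> y) \<otimes> z = x \<otimes> z \<oplus> y \<otimes> z"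
    and r_distr: "\<lbrakk>x \<in> carrier A; y \<in> carrier A; z \<in> carrier A\<rbrakk>
      \<Longrightarrow> z \<otimes> (x \<oplus> y) = z \<otimes> x \<oplus> z \<otimes> y"
    and smult_closed: "x \<in> carrier A \<Longrightarrow> c \<odot> x \<in> carrier A"
    and smult_l_distr: "x \<in> carrier A \<Longrightarrow> (c + d) \<odot> x = c \<odot> x \<oplus> d \<odot> x"
    and smult_r_distr: "\<lbrakk>x \<in> carrier A; y \<in> carrier A\<rbrakk> \<Longrightarrow> c \<odot> (x \<oplus> y) = c \<odot> x \<oplus> c \<odot> y"
    and smult_assoc: "x \<in> carrier A \<Longrightarrow> (c * d) \<odot> x = c \<odot> (d \<odot> x)"
    and smult_one: "x \<in> carrier A \<Longrightarrow> 1 \<odot> x = x"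
    and smult_mult_left: "\<lbrakk>x \<in> carrier A; y \<in> carrier A\<rbrakk> \<Longrightarrow> (c \<odot> x) \<otimes> y = c \<odot> (x \<otimes> y)"
    and smult_mult_right: "\<lbrakk>x \<in> carrier A; y \<in> carrier A\<rbrakk> \<Longrightarrow> x \<otimes> (c \<odot> y) = c \<odot> (x \<otimes> y)"
    and star_closed: "x \<in> carrier A \<Longrightarrow> star A x \<in> carrier A"
    and star_star: "x \<in> carrier A \<Longrightarrow> star A (star A x) = x"
    and star_add: "\<lbrakk>x \<in> carrier A; y \<in> carrier A\<rbrakk> \<Longrightarrow> star A (x \<oplus> y) = star A x \<oplus> star A y"
    and star_smult: "x \<in> carrier A \<Longrightarrow> star A (c \<odot> x) = cnj c \<odot> star A x"
    and star_mult: "\<lbrakk>x \<in> carrier A; y \<in> carrier A\<rbrakk> \<Longrightarrow> star A (x \<otimes> y) = star A y \<otimes> star A x"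
    and nrm_zero_imp: "\<lbrakk>x \<in> carrier A; nrm A x = 0\<rbrakk> \<Longrightarrow> x = \<zero>"
    and nrm_triangle: "\<lbrakk>x \<in> carrier A; y \<in> carrier A\<rbrakk> \<Longrightarrow> nrm A (x \<oplus> y) \<le> nrm A x + nrm A y"
    and nrm_smult: "x \<in> carrier A \<Longrightarrow> nrm A (c \<odot> x) = cmod c * nrm A x"
    and nrm_mult: "\<lbrakk>x \<in> carrier A; y \<in> carrier A\<rbrakk> \<Longrightarrow> nrm A (x \<otimes> y) \<le> nrm A x * nrm A y"
    and cstar_identity: "x \<in> carrier A \<Longrightarrow> nrm A (star A x \<otimes> x) = (nrm A x)\<^sup>2"
    and complete: "Metric_space.mcomplete (carrier A) (cs_dist A)"

definition star_hom :: "'a cstar \<Rightarrow> 'b cstar \<Rightarrow> ('a \<Rightarrow> 'b) set" where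
  "star_hom A B = {h \<in> carrier A \<rightarrow> carrier B.
     (\<forall>x\<in>carrier A. \<forall>y\<in>carrier A. h (x \<oplus>\<^bsub>A\<^esub> y) = h x \<oplus>\<^bsub>B\<^esub> h y \<and> h (x \<otimes>\<^bsub>A\<^esub> y) = h x \<otimes>\<^bsub>B\<^esub> h y) \<and>
     (\<forall>x\<in>carrier A. h (star A x) = star B (h x) \<and> (\<forall>c. h (c \<odot>\<^bsub>A\<^esub> x) = c \<odot>\<^bsub>B\<^esub> h x))}"

definition cs_ideal :: "'a cstar \<Rightarrow> 'a set \<Rightarrow> bool" where
  "cs_ideal A J \<longleftrightarrow> additive_subgroup J A \<and>
     (\<forall>c. \<forall>x\<in>J. c \<odot>\<^bsub>A\<^esub> x \<in> J) \<and>
     (\<forall>a\<in>carrier A. \<forall>x\<in>J. a \<otimes>\<^bsub>A\<^esub> x \<in> J \<and> x \<otimes>\<^bsub>A\<^esub> a \<in> J) \<and>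
     closedin (cs_top A) J"

definition annihilator :: "'a cstar \<Rightarrow> 'a set \<Rightarrow> 'a set" where
  "annihilator A X = {c \<in> carrier A. \<forall>x\<in>X. c \<otimes>\<^bsub>A\<^esub> x = \<zero>\<^bsub>A\<^esub> \<and> x \<otimes>\<^bsub>A\<^esub> c = \<zero>\<^bsub>A\<^esub>}"

definition regular_ideal :: "'a cstar \<Rightarrow> 'a set \<Rightarrow> bool" where
  "regular_ideal A J \<longleftrightarrow> cs_ideal A J \<and> J = annihilator A (annihilator A J)"

text \<open>As for \<^const>\<open>rcoset_mult\<close>, the operations on cosets are given by the union of the cosets of
  the results.\<close>

definition cs_quot :: "'a cstar \<Rightarrow> 'a set \<Rightarrow> 'a set cstar" where
  "cs_quot A K = \<lparr>carrier = a_rcosets\<^bsub>A\<^esub> K, mult = rcoset_mult A K, one = K +>\<^bsub>A\<^esub> \<one>\<^bsub>A\<^esub>,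
     zero = K, add = set_add A,
     smult = (\<lambda>c X. \<Union>x\<in>X. K +>\<^bsub>A\<^esub> (c \<odot>\<^bsub>A\<^esub> x)),
     star = (\<lambda>X. \<Union>x\<in>X. K +>\<^bsub>A\<^esub> star A x),
     nrm = (\<lambda>X. INF x\<in>X. nrm A x)\<rparr>"


section \<open>Actions of discrete groups\<close>

locale cstar_action = cstar_algebra A + group_action G "carrier A" \<alpha>
  for G :: "('g, 'm) monoid_scheme" and A :: "'a cstar" and \<alpha> :: "'g \<Rightarrow> 'a \<Rightarrow> 'a" +
  assumes automorphism: "g \<in> carrier G \<Longrightarrow> \<alpha> g \<in> star_hom A A"

definition invariant_ideal :: "('g, 'm) monoid_scheme \<Rightarrow> 'a cstar \<Rightarrow> ('g \<Rightarrow> 'a \<Rightarrow> 'a) \<Rightarrow> 'a set \<Rightarrow> bool" where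
  "invariant_ideal G A \<alpha> K \<longleftrightarrow> cs_ideal A K \<and> (\<forall>g\<in>carrier G. \<alpha> g ` K \<subseteq> K)"


section \<open>The Hilbert module of square summable functions and its adjointable operators\<close>

definition l2_has_ip :: "('g, 'm) monoid_scheme \<Rightarrow> 'a cstar \<Rightarrow> ('g \<Rightarrow> 'a) \<Rightarrow> ('g \<Rightarrow> 'a) \<Rightarrow> 'a \<Rightarrow> bool" where
  "l2_has_ip G A \<xi> \<eta> s \<longleftrightarrow>
     limitin (cs_top A) (\<lambda>F. \<Oplus>\<^bsub>A\<^esub>g\<in>F. star A (\<xi> g) \<otimes>\<^bsub>A\<^esub> \<eta> g) s (finite_subsets_at_top (carrier G))"

definition l2 :: "('g, 'm) monoid_scheme \<Rightarrow> 'a cstar \<Rightarrow> ('g \<Rightarrow> 'a) set" where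
  "l2 G A = {\<xi> \<in> carrier G \<rightarrow>\<^sub>E carrier A. \<exists>s. l2_has_ip G A \<xi> \<xi> s}"

definition l2_ip :: "('g, 'm) monoid_scheme \<Rightarrow> 'a cstar \<Rightarrow> ('g \<Rightarrow> 'a) \<Rightarrow> ('g \<Rightarrow> 'a) \<Rightarrow> 'a" where
  "l2_ip G A \<xi> \<eta> = (THE s. l2_has_ip G A \<xi> \<eta> s)"

definition l2_norm :: "('g, 'm) monoid_scheme \<Rightarrow> 'a cstar \<Rightarrow> ('g \<Rightarrow> 'a) \<Rightarrow> real" where
  "l2_norm G A \<xi> = sqrt (nrm A (l2_ip G A \<xi> \<xi>))"

definition is_adjoint :: "('g, 'm) monoid_scheme \<Rightarrow> 'a cstar \<Rightarrow>
    (('g \<Rightarrow> 'a) \<Rightarrow> ('g \<Rightarrow> 'a)) \<Rightarrow> (('g \<Rightarrow> 'a) \<Rightarrow> ('g \<Rightarrow> 'a)) \<Rightarrow> bool" where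
  "is_adjoint G A T S \<longleftrightarrow> S \<in> l2 G A \<rightarrow>\<^sub>E l2 G A \<and>
     (\<forall>\<xi>\<in>l2 G A. \<forall>\<eta>\<in>l2 G A. l2_ip G A (T \<xi>) \<eta> = l2_ip G A \<xi> (S \<eta>))"

text \<open>Maps with an adjoint are automatically linear over \<open>A\<close>.  They are automatically bounded,
  too (by the closed graph theorem), but boundedness is stated explicitly so that the supremum
  defining the operator norm is visibly finite.\<close>

definition adjointables :: "('g, 'm) monoid_scheme \<Rightarrow> 'a cstar \<Rightarrow> (('g \<Rightarrow> 'a) \<Rightarrow> ('g \<Rightarrow> 'a)) cstar" where
  "adjointables G A =
    \<lparr>carrier = {T \<in> l2 G A \<rightarrow>\<^sub>E l2 G A. (\<exists>S. is_adjoint G A T S) \<and>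
       (\<exists>C. \<forall>\<xi>\<in>l2 G A. l2_norm G A (T \<xi>) \<le> C * l2_norm G A \<xi>)},
     mult = (\<lambda>T S. compose (l2 G A) T S),
     one = (\<lambda>\<xi>\<in>l2 G A. \<xi>),
     zero = (\<lambda>\<xi>\<in>l2 G A. \<lambda>h\<in>carrier G. \<zero>\<^bsub>A\<^esub>),
     add = (\<lambda>T S. \<lambda>\<xi>\<in>l2 G A. \<lambda>h\<in>carrier G. T \<xi> h \<oplus>\<^bsub>A\<^esub> S \<xi> h),
     smult = (\<lambda>c T. \<lambda>\<xi>\<in>l2 G A. \<lambda>h\<in>carrier G. c \<odot>\<^bsub>A\<^esub> T \<xi> h),
     star = (\<lambda>T. THE S. is_adjoint G A T S),
     nrm = (\<lambda>T. SUP \<xi>\<in>{\<xi> \<in> l2 G A. l2_norm G A \<xi> \<le> 1}. l2_norm G A (T \<xi>))\<rparr>"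


section \<open>The reduced crossed product\<close>

text \<open>The regular covariant representation on \<open>\<ell>\<^sup>2(G, A)\<close>; it satisfies
  \<open>\<lambda>\<^sub>g \<pi>(a) \<lambda>\<^sub>g\<^sup>* = \<pi>(\<alpha>\<^sub>g(a))\<close>, and the reduced crossed product is the norm closure of the
  linear span of the operators \<open>\<pi>(a) \<lambda>\<^sub>g\<close>.  The map \<open>\<pi>\<close> is the inclusion of \<open>A\<close> into
  the crossed product.\<close>

definition reg_pi :: "('g, 'm) monoid_scheme \<Rightarrow> 'a cstar \<Rightarrow> ('g \<Rightarrow> 'a \<Rightarrow> 'a) \<Rightarrow> 'a \<Rightarrow> ('g \<Rightarrow> 'a) \<Rightarrow> ('g \<Rightarrow> 'a)" where
  "reg_pi G A \<alpha> a = (\<lambda>\<xi>\<in>l2 G A. \<lambda>h\<in>carrier G. \<alpha> (inv\<^bsub>G\<^esub> h) a \<otimes>\<^bsub>A\<^esub> \<xi> h)"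

definition reg_lambda :: "('g, 'm) monoid_scheme \<Rightarrow> 'a cstar \<Rightarrow> 'g \<Rightarrow> ('g \<Rightarrow> 'a) \<Rightarrow> ('g \<Rightarrow> 'a)" where
  "reg_lambda G A g = (\<lambda>\<xi>\<in>l2 G A. \<lambda>h\<in>carrier G. \<xi> (inv\<^bsub>G\<^esub> g \<otimes>\<^bsub>G\<^esub> h))"

definition fin_supp_funs :: "('g, 'm) monoid_scheme \<Rightarrow> 'a cstar \<Rightarrow> ('g \<Rightarrow> 'a) set" where
  "fin_supp_funs G A = {f \<in> carrier G \<rightarrow> carrier A. finite {g \<in> carrier G. f g \<noteq> \<zero>\<^bsub>A\<^esub>}}"

definition reg_rep :: "('g, 'm) monoid_scheme \<Rightarrow> 'a cstar \<Rightarrow> ('g \<Rightarrow> 'a \<Rightarrow> 'a) \<Rightarrow> ('g \<Rightarrow> 'a) \<Rightarrow>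
    ('g \<Rightarrow> 'a) \<Rightarrow> ('g \<Rightarrow> 'a)" where
  "reg_rep G A \<alpha> f = (\<Oplus>\<^bsub>adjointables G A\<^esub>g\<in>{g \<in> carrier G. f g \<noteq> \<zero>\<^bsub>A\<^esub>}.
     reg_pi G A \<alpha> (f g) \<otimes>\<^bsub>adjointables G A\<^esub> reg_lambda G A g)"

definition red_crossed :: "('g, 'm) monoid_scheme \<Rightarrow> 'a cstar \<Rightarrow> ('g \<Rightarrow> 'a \<Rightarrow> 'a) \<Rightarrow>
    (('g \<Rightarrow> 'a) \<Rightarrow> ('g \<Rightarrow> 'a)) cstar" where
  "red_crossed G A \<alpha> = (adjointables G A)
     \<lparr>carrier := Abstract_Topology.closure_of (cs_top (adjointables G A))
       (reg_rep G A \<alpha> ` fin_supp_funs G A)\<rparr>"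

text \<open>The map of reduced crossed products induced by an equivariant *-homomorphism \<open>\<phi>\<close>: the
  continuous extension of \<open>\<Sum>\<^sub>g a\<^sub>g u\<^sub>g \<mapsto> \<Sum>\<^sub>g \<phi>(a\<^sub>g) u\<^sub>g\<close>.\<close>

definition red_crossed_map :: "('g, 'm) monoid_scheme \<Rightarrow> 'a cstar \<Rightarrow> ('g \<Rightarrow> 'a \<Rightarrow> 'a) \<Rightarrow>
    'b cstar \<Rightarrow> ('g \<Rightarrow> 'b \<Rightarrow> 'b) \<Rightarrow> ('a \<Rightarrow> 'b) \<Rightarrow>
    (('g \<Rightarrow> 'a) \<Rightarrow> ('g \<Rightarrow> 'a)) \<Rightarrow> (('g \<Rightarrow> 'b) \<Rightarrow> ('g \<Rightarrow> 'b))" where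
  "red_crossed_map G A \<alpha> B \<beta> \<phi> = (THE \<Phi>. \<Phi> \<in> extensional (carrier (red_crossed G A \<alpha>)) \<and>
     continuous_map (cs_top (red_crossed G A \<alpha>)) (cs_top (red_crossed G B \<beta>)) \<Phi> \<and>
     (\<forall>f\<in>fin_supp_funs G A. \<Phi> (reg_rep G A \<alpha> f) = reg_rep G B \<beta> (\<phi> \<circ> f)))"

text \<open>\<open>K \<rtimes>\<^sub>r G\<close> regarded as a subset of \<open>A \<rtimes>\<^sub>r G\<close>, i.e. the image of the former under the
  map induced by the inclusion of \<open>K\<close> into \<open>A\<close>.\<close>

definition crossed_ideal :: "('g, 'm) monoid_scheme \<Rightarrow> 'a cstar \<Rightarrow> ('g \<Rightarrow> 'a \<Rightarrow> 'a) \<Rightarrow> 'a set \<Rightarrow>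
    (('g \<Rightarrow> 'a) \<Rightarrow> ('g \<Rightarrow> 'a)) set" where
  "crossed_ideal G A \<alpha> K = red_crossed_map G (A\<lparr>carrier := K\<rparr>) \<alpha> A \<alpha> (\<lambda>x. x) `
     carrier (red_crossed G (A\<lparr>carrier := K\<rparr>) \<alpha>)"

definition exact_action :: "('g, 'm) monoid_scheme \<Rightarrow> 'a cstar \<Rightarrow> ('g \<Rightarrow> 'a \<Rightarrow> 'a) \<Rightarrow> bool" where
  "exact_action G A \<alpha> \<longleftrightarrow> (\<forall>K. invariant_ideal G A \<alpha> K \<longrightarrow>
     (let Q = cs_quot A K; \<alpha>Q = (\<lambda>g X. \<alpha> g ` X) in
      crossed_ideal G A \<alpha> K =
        a_kernel (red_crossed G A \<alpha>) (red_crossed G Q \<alpha>Q)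
          (red_crossed_map G A \<alpha> Q \<alpha>Q (\<lambda>a. K +>\<^bsub>A\<^esub> a))))"

definition ideal_intersection_property :: "('g, 'm) monoid_scheme \<Rightarrow> 'a cstar \<Rightarrow> ('g \<Rightarrow> 'a \<Rightarrow> 'a) \<Rightarrow> bool" where
  "ideal_intersection_property G A \<alpha> \<longleftrightarrow>
     (\<forall>J. cs_ideal (red_crossed G A \<alpha>) J \<and> J \<noteq> {\<zero>\<^bsub>red_crossed G A \<alpha>\<^esub>} \<longrightarrow>
        J \<inter> reg_pi G A \<alpha> ` carrier A \<noteq> {\<zero>\<^bsub>red_crossed G A \<alpha>\<^esub>})"

end

theory Submission
  imports Defs "HOL-Analysis.Analysis"
begin

text \<open>By exactness, \<open>K \<rtimes>\<^sub>r G\<close> is the kernel of \<open>A \<rtimes>\<^sub>r G \<rightarrow> (A/K) \<rtimes>\<^sub>r G\<close>, that is, the set of all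
  \<open>x\<close> such that \<open>x \<xi>\<close> has values in \<open>K\<close> for every \<open>\<xi>\<close> in \<open>\<ell>\<^sup>2(G, A)\<close>.  This
  description yields \<open>(K \<rtimes>\<^sub>r G)\<^sup>\<bottom> = K\<^sup>\<bottom> \<rtimes>\<^sub>r G\<close> and hence the first claim.  For the second claim let
  \<open>J\<close> be regular and \<open>K = J \<inter> A\<close>.  The ideal \<open>(K\<^sup>\<bottom>\<^sup>\<bottom> \<rtimes>\<^sub>r G) \<inter> J\<^sup>\<bottom>\<close> meets \<open>A\<close> in
  \<open>K\<^sup>\<bottom>\<^sup>\<bottom> \<inter> J\<^sup>\<bottom> \<subseteq> K\<^sup>\<bottom>\<^sup>\<bottom> \<inter> K\<^sup>\<bottom> = {0}\<close>, so it vanishes by the ideal intersection property and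
  \<open>K\<^sup>\<bottom>\<^sup>\<bottom> \<rtimes>\<^sub>r G \<subseteq> J\<^sup>\<bottom>\<^sup>\<bottom> = J\<close>; in particular \<open>K\<close> is regular.  Likewise \<open>J \<inter> (K \<rtimes>\<^sub>r G)\<^sup>\<bottom>\<close> meets \<open>A\<close>
  trivially, so that \<open>J \<subseteq> (K \<rtimes>\<^sub>r G)\<^sup>\<bottom>\<^sup>\<bottom> = K \<rtimes>\<^sub>r G\<close>.\<close>

section \<open>C*-algebras as a type class\<close>

text \<open>The set \<open>crossed_ideal\<close> is never analysed directly: exactness exchanges it
  for a kernel, and all algebra is done with operators whose values lie in \<open>K\<close>. Reading
  off the kernel requires the map into the crossed product of the quotient to exist, to be bounded
  on finite sums, and to be determined by vectors that come from \<open>A\<close>. Boundedness is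
  the obstacle. It is obtained on the Hilbert modules themselves, by passing from \<xi> to \<xi> (1
  - e) with \<open>e\<close> taken from an approximate unit of \<open>K\<close>. This is what calls
  for positivity, approximate units, quotient algebras, contractivity of *-homomorphisms and
  Cauchy-Schwarz over a C*-algebra. Positivity is derived from norm estimates and Banach's fixed
  point theorem, with no spectrum. Such arguments want a unit and a type, whereas the statement
  concerns nonunital records; so every record is embedded isometrically in the unitization of one
  large product, and expressions like 1 - e are formed there.\<close>

class cscale =
  fixes cscale :: "complex \<Rightarrow> 'a \<Rightarrow> 'a"

class adj =
  fixes adj :: "'a \<Rightarrow> 'a"

text \<open>The inequality \<open>cstar_le\<close> suffices as an axiom: with submultiplicativity it
  first forces \<open>adj\<close> to be isometric and then gives the C*-identity in both orders.
  Each instance has only this one estimate to check.\<close>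

class cstar_type = real_normed_algebra + banach + cscale + adj +
  assumes cscale_of_real: "cscale (complex_of_real r) x = r *\<^sub>R x"
    and cscale_add_left: "cscale (c + d) x = cscale c x + cscale d x"
    and cscale_add_right: "cscale c (x + y) = cscale c x + cscale c y"
    and cscale_cscale [simp]: "cscale c (cscale d x) = cscale (c * d) x"
    and cscale_mult_left: "cscale c x * y = cscale c (x * y)"
    and cscale_mult_right: "x * cscale c y = cscale c (x * y)"
    and norm_cscale: "norm (cscale c x) = cmod c * norm x"
    and adj_adj [simp]: "adj (adj x) = x"
    and adj_add: "adj (x + y) = adj x + adj y"
    and adj_cscale: "adj (cscale c x) = cscale (cnj c) (adj x)"
    and adj_mult: "adj (x * y) = adj y * adj x"
    and cstar_le: "(norm x)\<^sup>2 \<le> norm (adj x * x)"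

lemma adj_scaleR:
  fixes x :: "'a::cstar_type"
  shows "adj (r *\<^sub>R x) = r *\<^sub>R adj x"
  using adj_cscale[of "complex_of_real r" x] by (simp add: cscale_of_real)

lemma adj_zero [simp]: "adj 0 = (0 :: 'a::cstar_type)"
  using adj_scaleR[of 0 "0 :: 'a"] by simp

lemma adj_minus:
  fixes x :: "'a::cstar_type"
  shows "adj (- x) = - adj x"
  using adj_scaleR[of "-1" x] by simp

lemma adj_diff:
  fixes x y :: "'a::cstar_type"
  shows "adj (x - y) = adj x - adj y"
  using adj_add[of x "- y"] by (simp add: adj_minus)

lemma cscale_one [simp]:
  fixes x :: "'a::cstar_type"
  shows "cscale 1 x = x"
  using cscale_of_real[of 1 x] by simp

lemma cscale_zero_left [simp]:
  fixes x :: "'a::cstar_type"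
  shows "cscale 0 x = 0"
  using cscale_of_real[of 0 x] by simp

lemma cscale_zero_right [simp]: "cscale c 0 = (0 :: 'a::cstar_type)"
  using norm_cscale[of c "0 :: 'a"] by simp

lemma cscale_minus_right:
  fixes x :: "'a::cstar_type"
  shows "cscale c (- x) = - cscale c x"
  using cscale_add_right[of c x "- x"] by (simp add: eq_neg_iff_add_eq_0 add.commute)

lemma cscale_minus_left:
  fixes x :: "'a::cstar_type"
  shows "cscale (- c) x = - cscale c x"
  using cscale_add_left[of c "- c" x] by (simp add: eq_neg_iff_add_eq_0 add.commute)

lemma norm_adj [simp]:
  fixes x :: "'a::cstar_type"
  shows "norm (adj x) = norm x"
proof -
  have le: "norm y \<le> norm (adj y)" for y :: 'a
  proof (cases "norm y = 0")
    case False
    have "norm y * norm y \<le> norm (adj y) * norm y"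
      using cstar_le[of y] norm_mult_ineq[of "adj y" y] by (simp add: power2_eq_square)
    then show ?thesis using False by simp
  qed simp
  from le[of x] le[of "adj x"] show ?thesis by simp
qed

lemma norm_adj_mult:
  fixes x :: "'a::cstar_type"
  shows "norm (adj x * x) = (norm x)\<^sup>2"
  using cstar_le[of x] norm_mult_ineq[of "adj x" x] by (simp add: power2_eq_square)

lemma norm_mult_adj:
  fixes x :: "'a::cstar_type"
  shows "norm (x * adj x) = (norm x)\<^sup>2"
  using norm_adj_mult[of "adj x"] by simp

lemma adj_sum:
  fixes f :: "'i \<Rightarrow> 'a::cstar_type"
  shows "adj (sum f F) = (\<Sum>i\<in>F. adj (f i))"
  by (induction F rule: infinite_finite_induct) (auto simp: adj_add)

lemma bounded_linear_adj: "bounded_linear (adj :: 'a::cstar_type \<Rightarrow> 'a)"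
  by (rule bounded_linear_intro[of _ 1]) (auto simp: adj_add adj_scaleR)

lemma bounded_linear_cscale: "bounded_linear (cscale c :: 'a::cstar_type \<Rightarrow> 'a)"
proof (rule bounded_linear_intro[of _ "cmod c"])
  show "cscale c (r *\<^sub>R x) = r *\<^sub>R cscale c x" for r and x :: 'a
    by (simp flip: cscale_of_real add: mult.commute)
qed (auto simp: cscale_add_right norm_cscale mult.commute)

lemmas tendsto_adj = bounded_linear.tendsto[OF bounded_linear_adj]
lemmas tendsto_cscale = bounded_linear.tendsto[OF bounded_linear_cscale]
lemmas continuous_on_adj = bounded_linear.continuous_on[OF bounded_linear_adj]

section \<open>Unitization\<close>

datatype 'b unitz = Uz (sc: complex) (el: 'b)

text \<open>Left multiplication by the formal sum of \<open>sc z\<close> and \<open>el z\<close> on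
  the original algebra, that is, the representation whose operator norm enters the norm of the
  unitization.\<close>

definition uact :: "'b::cstar_type unitz \<Rightarrow> 'b \<Rightarrow> 'b" where
  "uact z y = cscale (sc z) y + el z * y"

lemma bounded_linear_uact: "bounded_linear (uact z)"
  unfolding uact_def
  by (intro bounded_linear_add bounded_linear_cscale bounded_linear_mult_right)

instantiation unitz :: (cstar_type) scaleR
begin

definition "r *\<^sub>R x = Uz (r *\<^sub>R sc x) (r *\<^sub>R el x)"

instance ..

end

text \<open>For an algebra with a unit the left multiplication alone would not separate points, hence the
  maximum in the norm.\<close>

instantiation unitz :: (cstar_type) "{real_normed_algebra, cscale, adj}"
begin

definition "0 = Uz 0 0"
definition "x + y = Uz (sc x + sc y) (el x + el y)"
definition "x - y = Uz (sc x - sc y) (el x - el y)"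
definition "- x = Uz (- sc x) (- el x)"
definition "x * y = Uz (sc x * sc y) (cscale (sc x) (el y) + cscale (sc y) (el x) + el x * el y)"
definition "norm x = max (cmod (sc x)) (onorm (uact x))"
definition "dist x y = norm (x - y :: 'a unitz)"
definition "sgn x = inverse (norm x) *\<^sub>R (x :: 'a unitz)"
definition "uniformity = (INF e\<in>{0<..}. principal {(x, y). dist x (y :: 'a unitz) < e})"
definition "open U \<longleftrightarrow> (\<forall>x\<in>U. \<forall>\<^sub>F (x', y) in uniformity. (x' :: 'a unitz) = x \<longrightarrow> y \<in> U)"
definition "cscale c x = Uz (c * sc x) (cscale c (el x))"
definition "adj x = Uz (cnj (sc x)) (adj (el x))"

lemmas unitz_ops = zero_unitz_def plus_unitz_def minus_unitz_def uminus_unitz_def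
  scaleR_unitz_def times_unitz_def cscale_unitz_def adj_unitz_def

lemma uact_plus: "uact (x + y) = (\<lambda>v. uact x v + uact y v)"
  by (auto simp: uact_def unitz_ops cscale_add_left algebra_simps)

lemma uact_times: "uact (x * y) = uact x \<circ> uact y"
  by (auto simp: uact_def unitz_ops cscale_add_left cscale_add_right cscale_mult_left
      cscale_mult_right algebra_simps)

lemma uact_cscale: "uact (cscale c x) = (\<lambda>v. cscale c (uact x v))"
  by (auto simp: uact_def unitz_ops cscale_add_right cscale_mult_left)

text \<open>Adjointness of the representation when the algebra is viewed as a Hilbert module over
  itself with inner product \<open>adj v * w\<close>.\<close>

lemma uact_adj: "adj (uact (adj x) v) * w = adj v * uact x w"
  by (auto simp: uact_def unitz_ops adj_add adj_cscale adj_mult cscale_mult_left cscale_mult_right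
      algebra_simps)

lemma norm_uact_le: "norm (uact x v) \<le> norm x * norm v"
proof -
  have "norm (uact x v) \<le> onorm (uact x) * norm v"
    by (rule onorm[OF bounded_linear_uact])
  also have "\<dots> \<le> norm x * norm v"
    by (intro mult_right_mono) (auto simp: norm_unitz_def)
  finally show ?thesis .
qed

lemma unitz_norm_leI:
  assumes "cmod (sc x) \<le> K" "\<And>v. norm (uact x v) \<le> K * norm v"
  shows "norm x \<le> K"
proof -
  have "0 \<le> K" using assms(1) norm_ge_zero order_trans by blast
  then show ?thesis using assms by (simp add: norm_unitz_def onorm_bound)
qed

lemma cmod_sc_le: "cmod (sc x) \<le> norm (x :: 'a unitz)"
  by (simp add: norm_unitz_def)

lemma norm_unitz_nonneg: "0 \<le> norm (x :: 'a unitz)"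
  using cmod_sc_le[of x] norm_ge_zero order_trans by blast

lemma norm_unitz_triangle: "norm (x + y) \<le> norm x + norm (y :: 'a unitz)"
proof (rule unitz_norm_leI)
  show "cmod (sc (x + y)) \<le> norm x + norm y"
    using cmod_sc_le[of x] cmod_sc_le[of y] norm_triangle_ineq[of "sc x" "sc y"]
    by (simp add: unitz_ops)
  show "norm (uact (x + y) v) \<le> (norm x + norm y) * norm v" for v
    using norm_triangle_ineq[of "uact x v" "uact y v"] norm_uact_le[of x v] norm_uact_le[of y v]
    by (simp add: uact_plus algebra_simps)
qed

lemma norm_unitz_cscale_le: "norm (cscale c x) \<le> cmod c * norm (x :: 'a unitz)"
proof (rule unitz_norm_leI)
  show "cmod (sc (cscale c x)) \<le> cmod c * norm x"
    using cmod_sc_le[of x] by (simp add: unitz_ops norm_mult mult_left_mono)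
  show "norm (uact (cscale c x) v) \<le> cmod c * norm x * norm v" for v
    using norm_uact_le[of x v] by (simp add: uact_cscale norm_cscale mult_left_mono mult.assoc)
qed

lemma norm_unitz_cscale: "norm (cscale c x) = cmod c * norm (x :: 'a unitz)"
proof (cases "c = 0")
  case True
  have "norm (0 :: 'a unitz) \<le> 0"
    by (rule unitz_norm_leI) (auto simp: unitz_ops uact_def)
  then show ?thesis using True norm_unitz_nonneg[of 0]
    by (simp add: cscale_unitz_def zero_unitz_def)
next
  case False
  have "cscale (inverse c) (cscale c x) = x"
    using False by (simp add: unitz_ops unitz.expand flip: mult.assoc)
  then have "norm x \<le> inverse (cmod c) * norm (cscale c x)"
    using norm_unitz_cscale_le[of "inverse c" "cscale c x"] by (simp add: norm_inverse)
  then have "cmod c * norm x \<le> norm (cscale c x)"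
    using False by (simp add: field_simps)
  then show ?thesis using norm_unitz_cscale_le[of c x] by simp
qed

lemma norm_unitz_mult: "norm (x * y) \<le> norm x * norm (y :: 'a unitz)"
proof (rule unitz_norm_leI)
  show "cmod (sc (x * y)) \<le> norm x * norm y"
    using cmod_sc_le[of x] cmod_sc_le[of y]
    by (simp add: unitz_ops norm_mult mult_mono norm_unitz_nonneg)
  show "norm (uact (x * y) v) \<le> norm x * norm y * norm v" for v
    using norm_uact_le[of x "uact y v"] mult_left_mono[OF norm_uact_le[of y v] norm_unitz_nonneg[of x]]
    by (simp add: uact_times mult.assoc)
qed

text \<open>Left multiplication by \<open>a\<close> is tested on \<open>adj a\<close>: the result
  has norm \<open>norm a\<close> squared, so the operator norm is at least
  \<open>norm a\<close>.\<close>

lemma norm_Uz_el: "norm (Uz 0 a) = norm (a :: 'a)"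
proof (rule antisym)
  show "norm (Uz 0 a) \<le> norm a"
    by (rule unitz_norm_leI) (auto simp: uact_def norm_mult_ineq)
  have "norm (a * adj a) \<le> norm (Uz 0 a) * norm (adj a)"
    using norm_uact_le[of "Uz 0 a" "adj a"] by (simp add: uact_def)
  then have "norm a * norm a \<le> norm (Uz 0 a) * norm a"
    by (simp add: norm_mult_adj power2_eq_square)
  then show "norm a \<le> norm (Uz 0 a)"
    using norm_unitz_nonneg by (cases "a = 0") auto
qed

lemma norm_Uz_sc: "norm (Uz c (0 :: 'a)) \<le> cmod c"
  by (rule unitz_norm_leI) (auto simp: uact_def norm_cscale)

text \<open>Removing the scalar part costs at most another \<open>norm x\<close>, whence the factor
  2. Together with \<open>cmod_sc_le\<close> this makes both coordinates Lipschitz, on which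
  completeness of the unitization rests.\<close>

lemma norm_el_le: "norm (el x) \<le> 2 * norm (x :: 'a unitz)"
proof -
  have "Uz 0 (el x) = x + cscale (-1) (Uz (sc x) 0)"
    by (simp add: unitz_ops)
  then have "norm (el x) \<le> norm x + norm (Uz (sc x) (0 :: 'a))"
    using norm_unitz_triangle[of x "cscale (-1) (Uz (sc x) 0)"]
    by (simp add: norm_unitz_cscale flip: norm_Uz_el)
  then show ?thesis using norm_Uz_sc[of "sc x"] cmod_sc_le[of x] by simp
qed

lemma norm_unitz_eq_0: "norm x = 0 \<longleftrightarrow> x = (0 :: 'a unitz)"
proof
  assume "norm x = 0"
  then have "el x = 0" "sc x = 0"
    using norm_el_le[of x] cmod_sc_le[of x] by simp_all
  then show "x = 0" by (simp add: zero_unitz_def unitz.expand)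
next
  assume "x = 0"
  then show "norm x = 0"
    using norm_unitz_cscale[of 0 x] by (simp add: unitz_ops)
qed

text \<open>The identity \<open>adj (uact x v) * uact x v = adj v * uact (adj x * x) v\<close>
  bounds the operator part by the square root of the norm of \<open>adj x * x\<close>; the scalar
  part of that product has modulus \<open>cmod (sc x)\<close> squared.\<close>

lemma norm_unitz_cstar: "(norm x)\<^sup>2 \<le> norm (adj x * (x :: 'a unitz))"
proof -
  define K where "K = norm (adj x * x)"
  have K: "0 \<le> K" by (simp add: K_def norm_unitz_nonneg)
  have "norm x \<le> sqrt K"
  proof (rule unitz_norm_leI)
    have "(cmod (sc x))\<^sup>2 \<le> K"
      using cmod_sc_le[of "adj x * x"] by (simp add: K_def unitz_ops norm_mult power2_eq_square)
    then show "cmod (sc x) \<le> sqrt K" by (simp add: real_le_rsqrt)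
    fix v
    have "adj (uact x v) * uact x v = adj v * uact (adj x * x) v"
    proof -
      have "adj (uact (adj (adj x)) v) * uact x v = adj v * uact (adj x) (uact x v)"
        by (rule uact_adj)
      moreover have "adj (adj x) = x" by (simp add: unitz_ops)
      ultimately show ?thesis by (simp add: uact_times)
    qed
    then have "(norm (uact x v))\<^sup>2 \<le> norm v * norm (uact (adj x * x) v)"
      by (metis norm_adj_mult norm_adj norm_mult_ineq)
    also have "\<dots> \<le> norm v * (K * norm v)"
      unfolding K_def by (intro mult_left_mono norm_uact_le) auto
    also have "\<dots> = (sqrt K * norm v)\<^sup>2"
      unfolding power_mult_distrib real_sqrt_pow2[OF K] by (simp only: power2_eq_square mult_ac)
    finally have "(norm (uact x v))\<^sup>2 \<le> (sqrt K * norm v)\<^sup>2" .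
    then show "norm (uact x v) \<le> sqrt K * norm v"
      by (rule power2_le_imp_le) (use K in simp)
  qed
  then have "(norm x)\<^sup>2 \<le> (sqrt K)\<^sup>2"
    by (intro power_mono norm_unitz_nonneg)
  then show ?thesis using K by (simp add: K_def)
qed

instance
proof
  fix x y z :: "'a unitz" and r s :: real and c d :: complex
  show "x + y + z = x + (y + z)" "x + y = y + x" "0 + x = x" "- x + x = 0" "x - y = x + - y"
    by (simp_all add: unitz_ops algebra_simps)
  show "r *\<^sub>R (x + y) = r *\<^sub>R x + r *\<^sub>R y" "(r + s) *\<^sub>R x = r *\<^sub>R x + s *\<^sub>R x"
    "r *\<^sub>R s *\<^sub>R x = (r * s) *\<^sub>R x" "1 *\<^sub>R x = x"
    by (simp_all add: unitz_ops algebra_simps)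
  show "x * y * z = x * (y * z)"
    by (simp add: unitz_ops cscale_add_right cscale_mult_left cscale_mult_right algebra_simps)
  show "(x + y) * z = x * z + y * z" "x * (y + z) = x * y + x * z"
    by (simp_all add: unitz_ops cscale_add_right cscale_add_left cscale_mult_left cscale_mult_right algebra_simps)
  have cs: "cscale c (r *\<^sub>R v) = r *\<^sub>R cscale c v" "cscale (complex_of_real r * c) v = r *\<^sub>R cscale c v"
    "cscale (c * complex_of_real r) v = r *\<^sub>R cscale c v" for c r and v :: 'a
    by (simp_all flip: cscale_of_real add: mult_ac)
  show "r *\<^sub>R x * y = r *\<^sub>R (x * y)" "x * r *\<^sub>R y = r *\<^sub>R (x * y)"
    by (simp_all add: unitz_ops scaleR_add_right scaleR_conv_of_real[of r "_ :: complex"] cs mult_ac)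
  show "dist x y = norm (x - y)" "sgn x = x /\<^sub>R norm x"
    "uniformity = (INF e\<in>{0<..}. principal {(x, y). dist x (y :: 'a unitz) < e})"
    by (simp_all add: dist_unitz_def sgn_unitz_def uniformity_unitz_def)
  show "open U \<longleftrightarrow> (\<forall>x\<in>U. \<forall>\<^sub>F (x', y) in uniformity. x' = x \<longrightarrow> y \<in> U)" for U :: "'a unitz set"
    by (simp add: open_unitz_def)
  show "norm x = 0 \<longleftrightarrow> x = 0" by (rule norm_unitz_eq_0)
  show "norm (x + y) \<le> norm x + norm y" by (rule norm_unitz_triangle)
  have sR: "r *\<^sub>R x = cscale (complex_of_real r) x" for r and x :: "'a unitz"
    by (simp add: unitz_ops cscale_of_real scaleR_conv_of_real)
  then show "norm (r *\<^sub>R x) = \<bar>r\<bar> * norm x" by (simp add: norm_unitz_cscale)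
  show "norm (x * y) \<le> norm x * norm y" by (rule norm_unitz_mult)
qed

end

instance unitz :: (cstar_type) banach
proof
  fix X :: "nat \<Rightarrow> 'a unitz"
  assume C: "Cauchy X"
  have "Cauchy (\<lambda>n. sc (X n))"
  proof (rule metric_CauchyI)
    fix e :: real assume "0 < e"
    then obtain M where M: "\<And>m n. m \<ge> M \<Longrightarrow> n \<ge> M \<Longrightarrow> norm (X m - X n) < e"
      using C by (metis Cauchy_iff)
    have "dist (sc (X m)) (sc (X n)) \<le> norm (X m - X n)" for m n
      using cmod_sc_le[of "X m - X n"] by (simp add: dist_norm minus_unitz_def)
    then show "\<exists>M. \<forall>m\<ge>M. \<forall>n\<ge>M. dist (sc (X m)) (sc (X n)) < e"
      using M le_less_trans by blast
  qed
  then obtain c where c: "(\<lambda>n. sc (X n)) \<longlonglongrightarrow> c" using Cauchy_convergent convergent_def by blast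
  have "Cauchy (\<lambda>n. el (X n))"
  proof (rule metric_CauchyI)
    fix e :: real assume "0 < e"
    then obtain M where M: "\<And>m n. m \<ge> M \<Longrightarrow> n \<ge> M \<Longrightarrow> norm (X m - X n) < e / 2"
      using C by (metis Cauchy_iff half_gt_zero)
    have "dist (el (X m)) (el (X n)) \<le> 2 * norm (X m - X n)" for m n
      using norm_el_le[of "X m - X n"] by (simp add: dist_norm minus_unitz_def)
    then have "dist (el (X m)) (el (X n)) < e" if "m \<ge> M" "n \<ge> M" for m n
      using M[OF that] by (smt (verit) field_sum_of_halves)
    then show "\<exists>M. \<forall>m\<ge>M. \<forall>n\<ge>M. dist (el (X m)) (el (X n)) < e" by blast
  qed
  then obtain a where a: "(\<lambda>n. el (X n)) \<longlonglongrightarrow> a" using Cauchy_convergent convergent_def by blast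
  have le: "norm (x :: 'a unitz) \<le> cmod (sc x) + norm (el x)" for x
    using norm_unitz_triangle[of "Uz (sc x) 0" "Uz 0 (el x)"] norm_Uz_sc[of "sc x", where 'a='a]
    by (simp add: plus_unitz_def norm_Uz_el)
  have "(\<lambda>n. cmod (sc (X n) - c) + norm (el (X n) - a)) \<longlonglongrightarrow> 0 + 0"
    by (intro tendsto_add tendsto_norm_zero) (use a c in \<open>simp_all add: LIM_zero_iff\<close>)
  then have lim: "(\<lambda>n. cmod (sc (X n) - c) + norm (el (X n) - a)) \<longlonglongrightarrow> 0" by simp
  have "(\<lambda>n. X n - Uz c a) \<longlonglongrightarrow> 0"
  proof (rule Lim_null_comparison[OF always_eventually lim], rule allI)
    show "norm (X n - Uz c a) \<le> cmod (sc (X n) - c) + norm (el (X n) - a)" for n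
      using le[of "X n - Uz c a"] by (simp add: minus_unitz_def)
  qed
  then show "convergent X" by (auto simp: convergent_def LIM_zero_iff)
qed

instance unitz :: (cstar_type) cstar_type
proof
  fix x y z :: "'a unitz" and r s :: real and c d :: complex
  have sR: "r *\<^sub>R x = cscale (complex_of_real r) x" for r and x :: "'a unitz"
    by (simp add: unitz_ops cscale_of_real scaleR_conv_of_real)
  show "cscale (complex_of_real r) x = r *\<^sub>R x" by (simp add: sR)
  show "cscale (c + d) x = cscale c x + cscale d x" "cscale c (x + y) = cscale c x + cscale c y"
    "cscale c (cscale d x) = cscale (c * d) x"
    by (simp_all add: unitz_ops cscale_add_left cscale_add_right algebra_simps)
  show "cscale c x * y = cscale c (x * y)" "x * cscale c y = cscale c (x * y)"
    by (simp_all add: unitz_ops cscale_add_right cscale_mult_left cscale_mult_right mult_ac)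
  show "norm (cscale c x) = cmod c * norm x" by (rule norm_unitz_cscale)
  show "adj (adj x) = x" "adj (x + y) = adj x + adj y" "adj (cscale c x) = cscale (cnj c) (adj x)"
    "adj (x * y) = adj y * adj x"
    by (simp_all add: unitz_ops adj_add adj_cscale adj_mult algebra_simps)
  show "(norm x)\<^sup>2 \<le> norm (adj x * x)" by (rule norm_unitz_cstar)
qed

instantiation unitz :: (cstar_type) real_normed_algebra_1
begin

definition "1 = Uz 1 0"

instance
proof
  fix x :: "'a unitz"
  show "1 * x = x" "x * 1 = x" "(0 :: 'a unitz) \<noteq> 1"
    by (simp_all add: one_unitz_def unitz_ops)
  show "norm (1 :: 'a unitz) = 1"
    using norm_Uz_sc[of 1, where 'a='a] cmod_sc_le[of "1 :: 'a unitz"] by (simp add: one_unitz_def)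
qed

end

section \<open>Positivity in unital C*-algebras\<close>

class ucstar = cstar_type + real_normed_algebra_1

instance unitz :: (cstar_type) ucstar ..

lemma adj_one [simp]: "adj 1 = (1 :: 'a::ucstar)"
proof -
  have "adj (adj 1 * 1) = adj 1 * adj (adj (1 :: 'a))" by (rule adj_mult)
  then show ?thesis by simp
qed

lemma adj_of_real [simp]: "adj (of_real r) = (of_real r :: 'a::ucstar)"
  by (simp add: of_real_def adj_scaleR)

lemma adj_power: "adj (x ^ n) = adj (x :: 'a::ucstar) ^ n"
  by (induction n) (simp_all add: adj_mult power_commutes)

lemma power_mult_commute: "x * y = y * x \<Longrightarrow> x ^ n * y = y * (x :: 'a::monoid_mult) ^ n"
  by (induction n) (simp_all add: mult.assoc, metis mult.assoc)

lemma cscale_diff_right: "cscale c (x - y) = cscale c x - cscale c (y :: 'a::cstar_type)"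
  using cscale_add_right[of c x "- y"] by (simp add: cscale_minus_right)

text \<open>The element \<open>h + \<i> c\<close> is a multiple of a unitary and \<open>h\<close> is its real part.\<close>

lemma norm_le_if_sum_squares:
  fixes h c :: "'a::ucstar"
  assumes "adj h = h" "adj c = c" "h * c = c * h" "h * h + c * c = of_real (s\<^sup>2)" "0 \<le> s"
  shows "norm h \<le> s"
proof -
  define u where "u = h + cscale \<i> c"
  have au: "adj u = h - cscale \<i> c"
    using assms by (simp add: u_def adj_add adj_cscale cscale_minus_left)
  have "adj u * u = h * h + c * c"
    unfolding au using assms(3) by (simp add: u_def algebra_simps cscale_mult_left cscale_mult_right
        cscale_minus_left cscale_add_right cscale_diff_right)
  then have "(norm u)\<^sup>2 = s\<^sup>2"
    using norm_adj_mult[of u] assms(4) by (simp del: of_real_power)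
  then have "norm u = s" using assms(5) by simp
  moreover have "2 *\<^sub>R h = u + adj u" unfolding au by (simp add: u_def scaleR_2)
  ultimately have "2 * norm h \<le> 2 * s"
    using norm_triangle_ineq[of u "adj u"] norm_scaleR[of 2 h] by simp
  then show ?thesis by simp
qed

text \<open>The equation says that 1 - b is a square root of 1 - k, but it is written without a unit
  so that it can also be solved inside nonunital subalgebras. The map from b to (k + b b)/2
  preserves the ball of radius \<open>norm k\<close> and contracts it by that same factor. The set
  \<open>S\<close> carries along any closed condition that the iteration preserves.\<close>

lemma half_square_fixpoint:
  fixes k :: "'a::{real_normed_algebra,banach}"
  assumes k: "norm k < 1" and S: "closed S" "0 \<in> S"
    and step: "\<And>b. b \<in> S \<Longrightarrow> (1/2) *\<^sub>R (k + b * b) \<in> S"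
  shows "\<exists>b\<in>S. norm b \<le> norm k \<and> b + b - b * b = k"
proof -
  define T where "T = S \<inter> cball 0 (norm k)"
  have "\<exists>!b\<in>T. (1/2) *\<^sub>R (k + b * b) = b"
  proof (rule Banach_fix)
    show "complete T" using S by (simp add: T_def complete_eq_closed closed_Int)
    show "T \<noteq> {}" using S by (auto simp: T_def)
    show "(\<lambda>b. (1/2) *\<^sub>R (k + b * b)) ` T \<subseteq> T"
    proof clarify
      fix b assume b: "b \<in> T"
      then have nb: "norm b \<le> norm k" by (simp add: T_def)
      have "norm (b * b) \<le> norm b * norm b" by (rule norm_mult_ineq)
      also have "\<dots> \<le> norm k * 1" using nb k by (intro mult_mono) auto
      finally have "norm (k + b * b) \<le> norm k + norm k"
        using norm_triangle_ineq[of k "b * b"] by simp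
      then show "(1/2) *\<^sub>R (k + b * b) \<in> T" using b step by (simp add: T_def)
    qed
    fix b c assume bc: "b \<in> T" "c \<in> T"
    have "b * b - c * c = b * (b - c) + (b - c) * c" by (simp add: algebra_simps)
    then have "norm (b * b - c * c) \<le> norm b * norm (b - c) + norm (b - c) * norm c"
      by (metis norm_triangle_le add_mono norm_mult_ineq)
    also have "\<dots> \<le> norm k * norm (b - c) + norm (b - c) * norm k"
      using bc by (intro add_mono mult_mono) (auto simp: T_def)
    finally have "norm (b * b - c * c) \<le> 2 * (norm k * norm (b - c))" by simp
    moreover have "(1/2) *\<^sub>R (k + b * b) - (1/2) *\<^sub>R (k + c * c) = (1/2) *\<^sub>R (b * b - c * c)"
      by (simp add: algebra_simps)
    ultimately show "dist ((1/2) *\<^sub>R (k + b * b)) ((1/2) *\<^sub>R (k + c * c)) \<le> norm k * dist b c"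
      by (simp add: dist_norm)
  qed (use k in auto)
  then obtain b where b: "b \<in> T" "(1/2) *\<^sub>R (k + b * b) = b" by blast
  have "2 *\<^sub>R ((1/2) *\<^sub>R (k + b * b)) = 2 *\<^sub>R b" using b(2) by simp
  then have "k + b * b = b + b" by (simp add: scaleR_2)
  then have "b + b - b * b = k" by (metis add_diff_cancel_right')
  then show ?thesis using b(1) by (auto simp: T_def)
qed

text \<open>\<open>S\<close> consists of the selfadjoint elements commuting with everything that
  commutes with \<open>h\<close>; both conditions are closed and survive the iteration. Roots of
  commuting elements therefore commute, which stands in for the continuous functional
  calculus.\<close>

lemma sqrt_one_minus:
  fixes h :: "'a::ucstar"
  assumes "adj h = h" "norm h < 1"
  obtains b where "adj b = b" "norm b \<le> norm h" "\<And>z. z * h = h * z \<Longrightarrow> z * b = b * z"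
    "(1 - b) * (1 - b) = 1 - h"
proof -
  define S where "S = {b. adj b = b} \<inter> (\<Inter>z\<in>{z. z * h = h * z}. {b. z * b = b * z})"
  have "\<exists>b\<in>S. norm b \<le> norm h \<and> b + b - b * b = h"
  proof (rule half_square_fixpoint[OF assms(2)])
    show "closed S" unfolding S_def
      by (intro closed_Int closed_INT ballI closed_Collect_eq continuous_intros continuous_on_adj)
    show "0 \<in> S" by (simp add: S_def)
    fix b assume b: "b \<in> S"
    have "z * ((1/2) *\<^sub>R (h + b * b)) = (1/2) *\<^sub>R (h + b * b) * z" if zh: "z * h = h * z" for z
    proof -
      have "z * b = b * z" using b zh unfolding S_def by blast
      then have zbb: "z * (b * b) = b * b * z" by (metis mult.assoc)
      show ?thesis
        unfolding mult_scaleR_right mult_scaleR_left distrib_left distrib_right zh zbb ..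
    qed
    moreover have "adj b = b" using b unfolding S_def by blast
    then have "adj ((1/2) *\<^sub>R (h + b * b)) = (1/2) *\<^sub>R (h + b * b)"
      by (simp add: adj_scaleR adj_add adj_mult assms(1))
    ultimately show "(1/2) *\<^sub>R (h + b * b) \<in> S" unfolding S_def by blast
  qed
  then obtain b where b: "b \<in> S" "norm b \<le> norm h" "b + b - b * b = h" by blast
  show ?thesis
  proof (rule that)
    show "adj b = b" using b(1) unfolding S_def by blast
    show "z * b = b * z" if "z * h = h * z" for z using b(1) that unfolding S_def by blast
    show "(1 - b) * (1 - b) = 1 - h" unfolding b(3)[symmetric] by (simp add: algebra_simps)
  qed (rule b(2))
qed

text \<open>Positivity without reference to the spectrum: \<open>\<parallel>t - a\<parallel> \<le> t\<close> says that the spectrum of the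
  self-adjoint element \<open>a\<close> lies in \<open>[0, 2t]\<close>.\<close>

definition pos :: "'a::ucstar \<Rightarrow> bool" where
  "pos a \<longleftrightarrow> adj a = a \<and> (\<exists>t. norm (of_real t - a) \<le> t)"

lemma posI: "adj a = a \<Longrightarrow> norm (of_real t - a) \<le> t \<Longrightarrow> pos a"
  by (auto simp: pos_def)

lemma pos_adj: "pos a \<Longrightarrow> adj a = a"
  by (simp add: pos_def)

lemma pos_witness_mono:
  assumes "norm (of_real t - (a :: 'a::ucstar)) \<le> t" "t \<le> s"
  shows "norm (of_real s - a) \<le> s"
proof -
  have "of_real s - a = (of_real t - a) + of_real (s - t)" by simp
  then have "norm (of_real s - a) \<le> norm (of_real t - a) + \<bar>s - t\<bar>"
    by (metis norm_triangle_ineq norm_of_real)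
  then show ?thesis using assms by simp
qed

lemma pos_add: "pos a \<Longrightarrow> pos b \<Longrightarrow> pos (a + b)"
proof -
  assume "pos a" "pos b"
  then obtain s t where st: "norm (of_real s - a) \<le> s" "norm (of_real t - b) \<le> t"
    and [simp]: "adj a = a" "adj b = b" by (auto simp: pos_def)
  have "of_real (s + t) - (a + b) = (of_real s - a) + (of_real t - b)" by simp
  then have "norm (of_real (s + t) - (a + b)) \<le> s + t"
    using st by (metis norm_triangle_mono)
  then show ?thesis by (intro posI[of _ "s + t"]) (auto simp: adj_add)
qed

lemma pos_of_real: "0 \<le> t \<Longrightarrow> pos (of_real t)"
  by (rule posI[of _ t]) auto

lemma pos_zero [simp]: "pos 0"
  using pos_of_real[of 0] by simp

lemma pos_scaleR: "pos a \<Longrightarrow> 0 \<le> r \<Longrightarrow> pos (r *\<^sub>R a)"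
proof -
  assume "pos a" "0 \<le> r"
  then obtain t where t: "norm (of_real t - a) \<le> t" and [simp]: "adj a = a" by (auto simp: pos_def)
  have "of_real (r * t) - r *\<^sub>R a = r *\<^sub>R (of_real t - a)"
    by (simp add: of_real_def algebra_simps)
  then show ?thesis using t \<open>0 \<le> r\<close> by (intro posI[of _ "r * t"]) (auto simp: adj_scaleR mult_left_mono)
qed

lemma pos_sum: "(\<And>i. i \<in> F \<Longrightarrow> pos (f i)) \<Longrightarrow> pos (sum f F)"
  by (induction F rule: infinite_finite_induct) (auto intro: pos_add)

lemma pos_norm_diff: "adj a = a \<Longrightarrow> norm a \<le> t \<Longrightarrow> pos (of_real t - a)"
  by (rule posI[of _ t]) (auto simp: adj_diff)

lemma pos_norm_add: "adj a = a \<Longrightarrow> norm a \<le> t \<Longrightarrow> pos (of_real t + a)"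
  by (rule posI[of _ t]) (auto simp: adj_add)

text \<open>If \<open>t\<close> witnesses positivity, then h = (t - a)/(t + e) has norm below 1, and
  1 - h is (a + e)/(t + e). The summand \<open>e\<close> makes the inequality strict; only roots of
  perturbed elements are available, and later arguments let \<open>e\<close> tend to 0.\<close>

lemma pos_sqrt:
  fixes a :: "'a::ucstar"
  assumes "pos a" "0 < e"
  obtains c where "adj c = c" "\<And>z. z * a = a * z \<Longrightarrow> z * c = c * z" "c * c = a + of_real e"
proof -
  obtain t where t: "norm (of_real t - a) \<le> t" and [simp]: "adj a = a"
    using assms by (auto simp: pos_def)
  have t0: "0 \<le> t" using t norm_ge_zero order_trans by blast
  define T where "T = t + e"
  have T: "T > 0" using t0 assms by (simp add: T_def)
  define h where "h = (1/T) *\<^sub>R (of_real t - a)"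
  have "adj h = h" by (simp add: h_def adj_scaleR adj_diff)
  moreover have "norm h < 1"
  proof -
    have "norm h = norm (of_real t - a) / T" using T by (simp add: h_def)
    also have "\<dots> < 1" using t assms T by (simp add: T_def)
    finally show ?thesis .
  qed
  ultimately obtain b where b: "adj b = b" "\<And>z. z * h = h * z \<Longrightarrow> z * b = b * z"
    "(1 - b) * (1 - b) = 1 - h" by (metis sqrt_one_minus)
  show ?thesis
  proof
    show "adj (sqrt T *\<^sub>R (1 - b)) = sqrt T *\<^sub>R (1 - b)"
      by (simp add: adj_scaleR adj_diff b)
    show "z * sqrt T *\<^sub>R (1 - b) = sqrt T *\<^sub>R (1 - b) * z" if "z * a = a * z" for z
    proof -
      have "z * h = h * z" using that by (simp add: h_def of_real_def algebra_simps)
      then show ?thesis using b(2)[of z] by (simp add: algebra_simps)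
    qed
    have "sqrt T *\<^sub>R (1 - b) * sqrt T *\<^sub>R (1 - b) = T *\<^sub>R (1 - h)"
      using T by (simp add: b(3))
    also have "\<dots> = a + of_real e"
      using T by (simp add: h_def of_real_def algebra_simps) (simp add: T_def algebra_simps)
    finally show "sqrt T *\<^sub>R (1 - b) * sqrt T *\<^sub>R (1 - b) = a + of_real e" .
  qed
qed

text \<open>After scaling to \<open>norm g < 1\<close>, take the root 1 - b of 1 - g g. It commutes
  with g, and the two squares add up to 1, so its norm is at most 1. Then 1 - g g has norm at most 1
  as well, which makes 1 a witness for g g.\<close>

lemma pos_square:
  fixes h :: "'a::ucstar"
  assumes h: "adj h = h"
  shows "pos (h * h)"
proof -
  define s where "s = norm h + 1"
  have s: "s > 0" using norm_ge_zero[of h] unfolding s_def by linarith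
  define g where "g = (1/s) *\<^sub>R h"
  have g: "adj g = g" by (simp add: g_def adj_scaleR h)
  have "norm g < 1" using s by (simp add: g_def field_simps) (simp add: s_def)
  have "norm (g * g) \<le> norm g * norm g" by (rule norm_mult_ineq)
  also have "\<dots> < 1" using \<open>norm g < 1\<close> by (metis mult.right_neutral mult_strict_mono' norm_ge_zero)
  finally have "norm (g * g) < 1" .
  moreover have "adj (g * g) = g * g" by (simp add: adj_mult g)
  ultimately obtain b where b: "adj b = b" "\<And>z. z * (g * g) = (g * g) * z \<Longrightarrow> z * b = b * z"
    "(1 - b) * (1 - b) = 1 - g * g" by (metis sqrt_one_minus)
  have "g * b = b * g" by (rule b(2)) (simp add: mult.assoc)
  then have "(1 - b) * g = g * (1 - b)" by (simp add: algebra_simps)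
  then have "norm (1 - b) \<le> 1"
    using b g by (intro norm_le_if_sum_squares[of _ g]) (simp_all add: adj_diff)
  then have "norm ((1 - b) * (1 - b)) \<le> 1"
    by (metis norm_mult_ineq mult_le_one norm_ge_zero order_trans)
  then have "pos (g * g)" by (intro posI[of _ 1]) (auto simp: b adj_mult g)
  then have "pos (s\<^sup>2 *\<^sub>R (g * g))" by (rule pos_scaleR) simp
  then show ?thesis using s by (simp add: g_def power2_eq_square)
qed

text \<open>For commuting roots \<open>p\<close> and \<open>q\<close> of s - a + e and s + a + e,
  the square of \<open>p * q\<close> is (s + e)^2 - a a. So \<open>norm_le_if_sum_squares\<close>
  applies to \<open>a\<close> and \<open>p * q\<close> with bound s + e.\<close>

lemma norm_le_if_pos:
  fixes a :: "'a::ucstar"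
  assumes a: "adj a = a" and pm: "pos (of_real s - a)" "pos (of_real s + a)"
  shows "norm a \<le> s"
proof (rule field_le_epsilon)
  fix e :: real assume e: "0 < e"
  \<comment> \<open>The sum of the two positive elements is the scalar 2s. A witness t for it
    satisfies |t - 2s| <= t, and this yields s >= 0.\<close>
  have "(of_real s - a) + (of_real s + a) = of_real (s + s)"
    by (simp only: of_real_add) simp
  then have "pos (of_real (s + s) :: 'a)" using pos_add[OF pm] by (simp only:)
  then obtain t where "norm (of_real t - of_real (s + s) :: 'a) \<le> t" unfolding pos_def by blast
  then have "\<bar>t - (s + s)\<bar> \<le> t" by (metis norm_of_real of_real_diff)
  then have s: "0 \<le> s" by linarith
  obtain p where p: "adj p = p" "\<And>z. z * (of_real s - a) = (of_real s - a) * z \<Longrightarrow> z * p = p * z"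
    "p * p = of_real s - a + of_real e" using pos_sqrt[OF pm(1) e] by metis
  obtain q where q: "adj q = q" "\<And>z. z * (of_real s + a) = (of_real s + a) * z \<Longrightarrow> z * q = q * z"
    "q * q = of_real s + a + of_real e" using pos_sqrt[OF pm(2) e] by metis
  have ap: "a * p = p * a" by (rule p(2)) (simp add: of_real_def algebra_simps)
  have aq: "a * q = q * a" by (rule q(2)) (simp add: of_real_def algebra_simps)
  have pq: "p * q = q * p" by (rule q(2)) (simp add: of_real_def algebra_simps ap)
  show "norm a \<le> s + e"
  proof (rule norm_le_if_sum_squares)
    show "adj (p * q) = p * q" by (simp add: adj_mult p q pq)
    show "a * (p * q) = p * q * a" using ap aq by (metis mult.assoc)
    have "p * q * (p * q) = (p * p) * (q * q)" using pq by (metis mult.assoc)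
    moreover have "of_real ((s + e)\<^sup>2) = (of_real s + of_real e) * (of_real s + of_real e :: 'a)"
      by (simp add: power2_eq_square)
    ultimately show "a * a + p * q * (p * q) = of_real ((s + e)\<^sup>2)"
      unfolding p q by (simp add: of_real_def algebra_simps)
  qed (use a s e in auto)
qed

text \<open>Up to \<open>e\<close> one has 0 <= a <= norm a, so a - norm a / 2 lies between plus and
  minus norm a / 2 and \<open>norm_le_if_pos\<close> applies. Besides closedness of the positive
  cone this produces an explicit witness, half the norm.\<close>

lemma pos_closed:
  fixes a :: "'a::ucstar"
  assumes a: "adj a = a" and "\<And>e. 0 < e \<Longrightarrow> pos (a + of_real e)"
  shows "norm (of_real (norm a / 2) - a) \<le> norm a / 2"
proof (rule field_le_epsilon)
  fix e :: real assume e: "0 < e"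
  let ?x = "of_real (norm a / 2) - a"
  show "norm ?x \<le> norm a / 2 + e"
  proof (rule norm_le_if_pos)
    show "adj ?x = ?x" by (simp add: adj_diff a)
    show "pos (of_real (norm a / 2 + e) - ?x)"
      using assms(2)[OF e] by (simp add: algebra_simps)
    have "of_real (norm a / 2 + e) + ?x = (of_real (norm a) - a) + of_real e"
      by (simp add: of_real_def algebra_simps flip: scaleR_add_left)
    moreover have "pos ((of_real (norm a) - a) + of_real e)"
      using a e by (intro pos_add pos_norm_diff pos_of_real) auto
    ultimately show "pos (of_real (norm a / 2 + e) + ?x)" by (simp only:)
  qed
qed

lemma pos_half_norm: "pos (a :: 'a::ucstar) \<Longrightarrow> norm (of_real (norm a / 2) - a) \<le> norm a / 2"
  by (rule pos_closed) (simp_all add: pos_adj pos_add pos_of_real)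

text \<open>If b is positive and within e of a, then a + e is the sum of b and the positive element
  e + (a - b); now \<open>pos_closed\<close> applies.\<close>

lemma pos_approx:
  fixes a :: "'a::ucstar"
  assumes a: "adj a = a" and "\<And>e. 0 < e \<Longrightarrow> \<exists>b. pos b \<and> norm (a - b) \<le> e"
  shows "pos a"
proof (rule posI[OF a pos_closed[OF a]])
  fix e :: real assume "0 < e"
  then obtain b where b: "pos b" "norm (a - b) \<le> e" using assms(2) by blast
  then have "pos (of_real e + (a - b))"
    by (intro pos_norm_add) (auto simp: adj_diff a pos_adj)
  from pos_add[OF b(1) this] show "pos (a + of_real e)" by (simp add: add.commute)
qed

lemma pos_norm_one_minus:
  fixes a :: "'a::ucstar"
  assumes "pos a" "norm a \<le> 1"
  shows "norm (1 - a) \<le> 1"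
  using pos_witness_mono[OF pos_half_norm[OF assms(1)], of 1] assms(2) norm_ge_zero[of a] by simp

text \<open>The commuting roots of a + e and b + e have a selfadjoint product, whose square (a +
  e)(b + e) differs from a b by e (a + b + e).\<close>

lemma pos_mult_commute:
  fixes a b :: "'a::ucstar"
  assumes ab: "pos a" "pos b" "a * b = b * a"
  shows "pos (a * b)"
proof (rule pos_approx)
  show "adj (a * b) = a * b" using ab by (simp add: adj_mult pos_adj)
  fix d :: real assume d: "0 < d"
  define N where "N = norm a + norm b + 1"
  have N: "N > 0" using norm_ge_zero[of a] norm_ge_zero[of b] unfolding N_def by linarith
  \<comment> \<open>The bound e <= 1 is paid for by the summand 1 in \<open>N\<close>; hence the
    error has norm at most e N, which is at most \<open>d\<close>.\<close>
  define e where "e = min 1 (d / N)"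
  have e: "0 < e" "e \<le> 1" "e * N \<le> d" using d N by (auto simp: e_def min_def field_simps)
  obtain p where p: "adj p = p" "\<And>z. z * a = a * z \<Longrightarrow> z * p = p * z"
    "p * p = a + of_real e" using pos_sqrt[OF ab(1) e(1)] by metis
  obtain q where q: "adj q = q" "\<And>z. z * b = b * z \<Longrightarrow> z * q = q * z"
    "q * q = b + of_real e" using pos_sqrt[OF ab(2) e(1)] by metis
  have pq: "p * q = q * p" using p(2)[of b] q(2)[of p] ab(3) by simp
  have "p * q * (p * q) = (p * p) * (q * q)" using pq by (metis mult.assoc)
  also have "\<dots> = a * b + e *\<^sub>R (a + b + of_real e)"
    unfolding p q by (simp add: of_real_def algebra_simps)
  finally have eq: "p * q * (p * q) = a * b + e *\<^sub>R (a + b + of_real e)" .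
  have "norm (a + b + of_real e) \<le> norm a + norm b + norm (of_real e :: 'a)"
    by (metis norm_triangle_ineq norm_triangle_mono order_refl)
  then have le: "norm (a + b + of_real e) \<le> N" using e by (simp add: N_def)
  have diff: "a * b - p * q * (p * q) = - (e *\<^sub>R (a + b + of_real e))" unfolding eq by simp
  from order_trans[OF mult_left_mono[OF le, of e] e(3)]
  have "e * norm (a + b + of_real e) \<le> d" using e by simp
  then have "norm (a * b - p * q * (p * q)) \<le> d"
    using e diff by (simp only: norm_minus_cancel norm_scaleR abs_of_pos)
  moreover have "pos (p * q * (p * q))" by (rule pos_square) (simp add: adj_mult p q pq)
  ultimately show "\<exists>c. pos c \<and> norm (a * b - c) \<le> d" by blast
qed

lemma pos_power: "pos (k :: 'a::ucstar) \<Longrightarrow> pos (k ^ n)"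
proof (induction n)
  case 0
  then show ?case using pos_of_real[of 1] by simp
next
  case (Suc n)
  then show ?case by (simp add: pos_mult_commute power_commutes)
qed

text \<open>The C*-identity iterated along squarings; it takes the place of the spectral radius
  formula in \<open>norm_le_if_power_growth\<close>.\<close>

lemma norm_power_two_power:
  fixes a :: "'a::ucstar"
  assumes "adj a = a"
  shows "norm (a ^ (2 ^ m)) = norm a ^ (2 ^ m)"
proof (induction m)
  case (Suc m)
  have "a ^ (2 ^ Suc m) = adj (a ^ (2 ^ m)) * a ^ (2 ^ m)"
    by (simp add: adj_power assms power_add mult_2)
  then show ?case using Suc by (simp only: norm_adj_mult) (simp add: power_add mult_2 power2_eq_square)
qed simp

text \<open>At exponents n that are powers of 2 the norm of the power is exact, so q = norm a / r
  would satisfy q^n <= 1 + n C. For q > 1 an exponential would be dominated by a linear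
  function.\<close>

lemma norm_le_if_power_growth:
  fixes a :: "'a::ucstar"
  assumes a: "adj a = a" and r: "0 < r" and growth: "\<And>n. norm (a ^ n) \<le> (1 + real n * C) * r ^ n"
  shows "norm a \<le> r"
proof (rule ccontr)
  assume "\<not> norm a \<le> r"
  define q where "q = norm a / r"
  have q: "1 < q" using \<open>\<not> norm a \<le> r\<close> r by (simp add: q_def)
  have "(\<lambda>n. 1 / q ^ n + C * (real n / q ^ n)) \<longlonglongrightarrow> 0 + C * 0"
    using q by (intro tendsto_intros LIMSEQ_divide_realpow_zero lim_n_over_pown) auto
  then have "\<forall>\<^sub>F n in sequentially. 1 / q ^ n + C * (real n / q ^ n) < 1"
    by (rule order_tendstoD) auto
  then obtain N where N: "\<And>n. n \<ge> N \<Longrightarrow> 1 / q ^ n + C * (real n / q ^ n) < 1"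
    by (auto simp: eventually_sequentially)
  define n where "n = (2::nat) ^ N"
  have "N \<le> n" unfolding n_def by (simp add: less_imp_le)
  from N[OF this] have "(1 + real n * C) / q ^ n < 1" by (simp add: add_divide_distrib mult.commute)
  then have "1 + real n * C < q ^ n" using q by (simp add: divide_less_eq)
  moreover have "q ^ n \<le> 1 + real n * C"
    using growth[of n] r by (simp add: q_def n_def norm_power_two_power[OF a] power_divide divide_le_eq)
  ultimately show False by simp
qed

text \<open>Replaces the fact that \<open>adj y * y\<close> and \<open>y * adj y\<close> have the
  same nonzero spectrum. Powers can be shifted past y, namely y y^* w^n = y h^n y^*, so each further
  power of \<open>w\<close> adds a term of norm at most C r^(n+1). The powers thus grow at most
  linearly relative to r^n, and \<open>norm_le_if_power_growth\<close> applies.\<close>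

lemma norm_add_mult_adj_le:
  fixes y :: "'a::ucstar"
  assumes s: "0 \<le> s" "s \<le> r" and h: "norm (of_real s + adj y * y) \<le> r"
  shows "norm (of_real s + y * adj y) \<le> r"
proof (cases "r = 0")
  case True
  then have "norm (adj y * y) = 0" using assms by simp
  then have "y = 0" by (simp add: norm_adj_mult)
  then show ?thesis using assms by simp
next
  case False
  then have r: "0 < r" using s by simp
  define h where "h = of_real s + adj y * y"
  define w where "w = of_real s + y * adj y"
  have nh: "norm h \<le> r" using h by (simp add: h_def)
  have shift: "y * adj y * w ^ n = y * h ^ n * adj y" for n
  proof (induction n)
    case 0
    show ?case by simp
  next
    case (Suc n)
    have hy: "h * adj y = adj y * w" by (simp add: h_def w_def of_real_def algebra_simps)
    have "y * adj y * w ^ Suc n = (y * adj y * w ^ n) * w"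
      by (simp only: power_Suc2 mult.assoc)
    also have "\<dots> = y * h ^ n * (adj y * w)" unfolding Suc by (simp only: mult.assoc)
    also have "\<dots> = y * h ^ Suc n * adj y" unfolding hy[symmetric] by (simp only: power_Suc2 mult.assoc)
    finally show ?case .
  qed
  define C where "C = (norm y)\<^sup>2 / r"
  have "norm (w ^ n) \<le> (1 + real n * C) * r ^ n" for n
  proof (induction n)
    case 0
    show ?case by simp
  next
    case (Suc n)
    have "norm (y * h ^ n * adj y) \<le> norm y * norm (h ^ n) * norm y"
      by (rule order_trans[OF norm_mult_ineq]) (simp add: norm_mult_ineq mult_right_mono)
    also have "\<dots> \<le> norm y * r ^ n * norm y"
      by (intro mult_mono order_trans[OF norm_power_ineq power_mono[OF nh]]) (use r in auto)
    also have "\<dots> = C * r * r ^ n" using r by (simp add: C_def power2_eq_square)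
    finally have 1: "norm (y * adj y * w ^ n) \<le> C * r * r ^ n" unfolding shift .
    have "norm (s *\<^sub>R w ^ n) \<le> r * ((1 + real n * C) * r ^ n)"
      using Suc s by (simp add: mult_mono)
    moreover have "w ^ Suc n = s *\<^sub>R w ^ n + y * adj y * w ^ n"
      by (simp add: w_def of_real_def distrib_right)
    ultimately have "norm (w ^ Suc n) \<le> r * ((1 + real n * C) * r ^ n) + C * r * r ^ n"
      using 1 norm_triangle_mono by metis
    then show ?case by (simp add: algebra_simps)
  qed
  then show ?thesis unfolding w_def[symmetric] by (intro norm_le_if_power_growth[OF _ r]) (simp_all add: adj_add adj_mult w_def)
qed

text \<open>A witness t for 1 - y^* y may be enlarged to max 1 t. Then t minus this element equals
  (t - 1) + y^* y with t - 1 >= 0, the form in which \<open>norm_add_mult_adj_le\<close> exchanges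
  the factors.\<close>

lemma pos_one_minus_mult_adj:
  fixes y :: "'a::ucstar"
  assumes "pos (1 - adj y * y)"
  shows "pos (1 - y * adj y)"
proof -
  obtain t where "norm (of_real t - (1 - adj y * y)) \<le> t" using assms by (auto simp: pos_def)
  then have "norm (of_real (max 1 t) - (1 - adj y * y)) \<le> max 1 t"
    by (rule pos_witness_mono) simp
  then have "norm (of_real (max 1 t - 1) + adj y * y) \<le> max 1 t" by (simp add: algebra_simps)
  then have "norm (of_real (max 1 t - 1) + y * adj y) \<le> max 1 t"
    by (rule norm_add_mult_adj_le[rotated 2]) auto
  then show ?thesis by (intro posI[of _ "max 1 t"]) (auto simp: adj_diff adj_mult algebra_simps)
qed

text \<open>Induction with the telescoping identity (1 - k) k^m - (1 - k) k^(m+1) = (1 - k)^2 k^m,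
  whose right side is a product of commuting positive elements.\<close>

lemma pos_one_minus_aux:
  fixes k :: "'a::ucstar"
  assumes "pos k"
  shows "pos (1 - (1 - k) * k ^ m)"
proof (induction m)
  case 0
  then show ?case using assms by simp
next
  case (Suc m)
  have "(1 - k) * k ^ m = k ^ m * (1 - k)" by (simp add: algebra_simps power_commutes)
  then have com: "(1 - k) * (1 - k) * k ^ m = k ^ m * ((1 - k) * (1 - k))" by (metis mult.assoc)
  have "pos ((1 - k) * (1 - k))" by (rule pos_square) (simp add: adj_diff pos_adj assms)
  then have "pos ((1 - k) * (1 - k) * k ^ m)" by (rule pos_mult_commute[OF _ pos_power[OF assms] com])
  from pos_add[OF Suc this] show ?case by (simp add: algebra_simps power_commutes)
qed

text \<open>Kaplansky's theorem.  With \<open>k = 1 - x\<^sup>*x\<close> and \<open>y = x k\<^sup>n\<close> one has \<open>y\<^sup>*y = (1 - k) k\<^sup>2\<^sup>n \<le> 1\<close>, hence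
  \<open>yy\<^sup>* \<le> 1\<close> and, as \<open>y\<^sup>*y + yy\<^sup>* \<ge> 0\<close>, also \<open>- 1 \<le> y\<^sup>*y\<close>.  Thus the powers of \<open>k\<close> grow at most
  linearly, and \<open>\<parallel>k\<parallel> \<le> 1\<close>.\<close>

lemma pos_adj_mult: "pos (adj x * x :: 'a::ucstar)"
proof -
  have main: "pos (adj x * x)" if x: "norm x \<le> 1" for x :: 'a
  proof -
    define h where "h = adj x * x"
    define k where "k = 1 - h"
    have h: "adj h = h" "norm h \<le> 1"
      using x by (simp_all add: h_def adj_mult norm_adj_mult power_le_one)
    have k: "adj k = k" "h = 1 - k" by (simp_all add: k_def adj_diff h)
    have "pos k" using h by (intro posI[of _ 1]) (simp add: k(1), simp add: k_def)
    have even: "norm (h * k ^ (2 * n)) \<le> 1" for n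
    proof -
      define y where "y = x * k ^ n"
      have hk: "h * k ^ n = k ^ n * h" unfolding k(2) by (simp add: algebra_simps power_commutes)
      have "adj y * y = k ^ n * h * k ^ n" unfolding y_def h_def
        by (simp only: adj_mult adj_power k(1) mult.assoc)
      also have "\<dots> = h * k ^ (2 * n)" by (simp flip: hk add: mult_2 power_add mult.assoc)
      finally have yy: "adj y * y = h * k ^ (2 * n)" .
      have p1: "pos (1 - adj y * y)"
        unfolding yy using pos_one_minus_aux[OF \<open>pos k\<close>, of "2 * n"] by (simp add: k)
      \<comment> \<open>Twice the real part of \<open>y\<close> and, up to sign, twice its imaginary
        part. Their squares are positive and add up to twice the sum of \<open>adj y * y\<close> and
        \<open>y * adj y\<close>, so that sum is positive although nothing is known yet about either
        summand.\<close>
      define u where "u = y + adj y"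
      define v where "v = cscale \<i> (y - adj y)"
      have "adj u = u" by (simp add: u_def adj_add add.commute)
      have vv: "v * v = - ((y - adj y) * (y - adj y))"
        by (simp add: v_def cscale_mult_left cscale_mult_right cscale_minus_left)
      have "adj v = v"
        by (simp add: v_def adj_cscale adj_diff cscale_minus_left flip: cscale_minus_right)
      have "u * u + v * v = 2 *\<^sub>R (adj y * y + y * adj y)"
        unfolding vv u_def by (simp add: scaleR_2 algebra_simps)
      then have "pos (2 *\<^sub>R (adj y * y + y * adj y))"
        using pos_add[OF pos_square[OF \<open>adj u = u\<close>] pos_square[OF \<open>adj v = v\<close>]] by simp
      then have "pos ((1/2) *\<^sub>R 2 *\<^sub>R (adj y * y + y * adj y))" by (rule pos_scaleR) simp
      then have "pos (adj y * y + y * adj y)" by simp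
      from pos_add[OF this pos_one_minus_mult_adj[OF p1]] have p2: "pos (1 + adj y * y)"
        by (simp add: algebra_simps)
      show ?thesis
        unfolding yy[symmetric] using p1 p2 by (intro norm_le_if_pos) (simp_all add: adj_mult)
    qed
    have "norm k \<le> 2" unfolding k_def using norm_triangle_ineq4[of 1 h] h by simp
    \<comment> \<open>The elements x k^n reach only even exponents; an odd exponent costs one more
      factor \<open>k\<close>, hence the constant 2.\<close>
    have any: "norm (h * k ^ n) \<le> 2" for n
    proof (cases "even n")
      case True
      then obtain m where "n = 2 * m" by (auto elim: evenE)
      then show ?thesis using even[of m] by simp
    next
      case False
      then obtain m where m: "n = 2 * m + 1" by (auto elim: oddE)
      have "norm (h * k ^ (2 * m) * k) \<le> 1 * 2"
        using norm_mult_ineq[of "h * k ^ (2 * m)" k] even[of m] \<open>norm k \<le> 2\<close>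
        by (meson mult_mono norm_ge_zero order_trans zero_le_one)
      then show ?thesis by (simp add: m mult.assoc power_commutes)
    qed
    have "norm (k ^ n) \<le> (1 + real n * 2) * 1 ^ n" for n
    proof (induction n)
      case (Suc n)
      have "k ^ Suc n = k ^ n - h * k ^ n" unfolding k(2) by (simp add: algebra_simps)
      then have "norm (k ^ Suc n) \<le> norm (k ^ n) + norm (h * k ^ n)" by (simp add: norm_triangle_ineq4)
      then show ?case using Suc any[of n] by simp
    qed simp
    then have "norm k \<le> 1" by (intro norm_le_if_power_growth[OF k(1), of 1 2]) auto
    then have "pos h" using h by (intro posI[of _ 1]) (auto simp: k_def)
    then show ?thesis by (simp add: h_def)
  qed
  define t where "t = norm x + 1"
  have t: "t > 0" using norm_ge_zero[of x] unfolding t_def by linarith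
  have "norm ((1/t) *\<^sub>R x) \<le> 1" using t by (simp add: field_simps) (simp add: t_def)
  from main[OF this] have "pos (t\<^sup>2 *\<^sub>R (adj ((1/t) *\<^sub>R x) * (1/t) *\<^sub>R x))"
    by (rule pos_scaleR) simp
  then show ?thesis using t by (simp add: adj_scaleR power2_eq_square)
qed

text \<open>With \<open>c\<close> a root of a + e, the element x^* (a + e) x equals
  \<open>adj (c * x) * (c * x)\<close>, positive by \<open>pos_adj_mult\<close>. The error is e
  times x^* x.\<close>

lemma pos_conj:
  fixes a x :: "'a::ucstar"
  assumes "pos a"
  shows "pos (adj x * a * x)"
proof (rule pos_approx)
  show "adj (adj x * a * x) = adj x * a * x" using assms by (simp add: adj_mult pos_adj mult.assoc)
  fix d :: real assume d: "0 < d"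
  define N where "N = (norm x)\<^sup>2 + 1"
  have N: "N > 0" by (simp add: N_def add_nonneg_pos)
  obtain c where c: "adj c = c" "c * c = a + of_real (d / N)"
    using pos_sqrt[OF assms divide_pos_pos[OF d N]] by metis
  have "adj (c * x) * (c * x) = adj x * (c * c) * x" by (simp only: adj_mult c(1) mult.assoc)
  also have "\<dots> = adj x * a * x + (d / N) *\<^sub>R (adj x * x)"
    unfolding c by (simp add: of_real_def algebra_simps)
  finally have eq: "adj (c * x) * (c * x) = adj x * a * x + (d / N) *\<^sub>R (adj x * x)" .
  have "d / N * (norm x)\<^sup>2 \<le> d / N * N" using d N by (intro mult_left_mono) (auto simp: N_def)
  then have "norm (adj x * a * x - adj (c * x) * (c * x)) \<le> d"
    unfolding eq using d N by (simp add: norm_adj_mult)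
  then show "\<exists>b. pos b \<and> norm (adj x * a * x - b) \<le> d" using pos_adj_mult by blast
qed

text \<open>The chain 0 <= p <= q <= norm q puts p between minus and plus
  \<open>norm q\<close>.\<close>

lemma norm_mono_pos:
  fixes p q :: "'a::ucstar"
  assumes "pos p" "pos (q - p)"
  shows "norm p \<le> norm q"
proof (rule norm_le_if_pos)
  show "adj p = p" using assms by (simp add: pos_adj)
  have "adj q = q" using pos_add[OF assms] by (auto dest: pos_adj)
  from pos_add[OF pos_norm_diff[OF this order_refl] assms(2)]
  show "pos (of_real (norm q) - p)" by simp
  show "pos (of_real (norm q) + p)" using assms by (intro pos_add pos_of_real) auto
qed

section \<open>Approximate units\<close>

text \<open>A substitute for estimating t (1 - t)^n on [0, 1]. With c = 1 - b, positivity of 1 - (n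
  + 1) b c^n goes by induction: since b + c = 1, the next such element is c times the present one
  plus b (1 - c^(n+1)).\<close>

lemma norm_mult_power_le:
  fixes b :: "'a::ucstar"
  assumes b: "pos b" "norm b \<le> 1"
  shows "norm (b * (1 - b) ^ n) \<le> 1 / (real n + 1)"
proof -
  define c where "c = 1 - b"
  have bc: "b * c = c * b" by (simp add: c_def algebra_simps)
  have bcn: "b * c ^ n = c ^ n * b" for n using power_mult_commute[OF bc[symmetric]] by simp
  have c: "adj c = c" "norm c \<le> 1" using b by (simp_all add: c_def adj_diff pos_adj pos_norm_one_minus)
  have "pos c" using b by (intro posI[of _ 1]) (auto simp: c, simp add: c_def)
  have pbc: "pos (b * c ^ n)" for n by (intro pos_mult_commute pos_power b \<open>pos c\<close> bcn)
  have D: "pos (1 - (real n + 1) *\<^sub>R (b * c ^ n))" for n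
  proof (induction n)
    case 0
    then show ?case using \<open>pos c\<close> by (simp add: c_def)
  next
    case (Suc n)
    have "norm (c ^ Suc n) \<le> 1" using norm_power_ineq[of c "Suc n"] power_le_one[OF _ c(2), of "Suc n"]
      by (meson norm_ge_zero order_trans)
    moreover have "adj (c ^ Suc n) = c ^ Suc n" by (simp only: adj_power c(1))
    ultimately have "pos (1 - c ^ Suc n)" using pos_norm_diff[of "c ^ Suc n" 1] by (simp only: of_real_1)
    then have "pos (b * (1 - c ^ Suc n))"
      using bcn[of "Suc n"] by (intro pos_mult_commute b) (auto simp: algebra_simps simp del: power_Suc)
    moreover have "pos (c * (1 - (real n + 1) *\<^sub>R (b * c ^ n)))"
    proof (intro pos_mult_commute \<open>pos c\<close> Suc)
      have "c * (b * c ^ n) = b * c ^ n * c" by (metis bc mult.assoc power_commutes)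
      then show "c * (1 - (real n + 1) *\<^sub>R (b * c ^ n)) = (1 - (real n + 1) *\<^sub>R (b * c ^ n)) * c"
        by (simp add: right_diff_distrib left_diff_distrib)
    qed
    ultimately have "pos (c * (1 - (real n + 1) *\<^sub>R (b * c ^ n)) + b * (1 - c ^ Suc n))"
      by (rule pos_add[rotated])
    moreover have "c * (1 - (real n + 1) *\<^sub>R (b * c ^ n)) + b * (1 - c ^ Suc n)
      = 1 - (real (Suc n) + 1) *\<^sub>R (b * c ^ Suc n)"
    proof -
      define Y where "Y = b * c ^ Suc n"
      have "c * (b * c ^ n) = Y" unfolding Y_def by (metis bc mult.assoc power_Suc)
      then have 1: "c * (1 - (real n + 1) *\<^sub>R (b * c ^ n)) = c - (real n + 1) *\<^sub>R Y"
        by (simp only: right_diff_distrib mult_1_right mult_scaleR_right)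
      have 2: "b * (1 - c ^ Suc n) = b - Y" by (simp only: right_diff_distrib mult_1_right Y_def)
      have "c - (real n + 1) *\<^sub>R Y + (b - Y) = 1 - (real (Suc n) + 1) *\<^sub>R Y"
        by (simp add: c_def scaleR_add_left scaleR_2)
      then show ?thesis unfolding 1 2 Y_def[symmetric] .
    qed
    ultimately show ?case by simp
  qed
  have "pos ((1 / (real n + 1)) *\<^sub>R (1 - (real n + 1) *\<^sub>R (b * c ^ n)))" by (intro pos_scaleR D) simp
  moreover have "(1 / (real n + 1)) *\<^sub>R (1 - (real n + 1) *\<^sub>R (b * c ^ n)) = of_real (1 / (real n + 1)) - b * c ^ n"
    by (simp add: of_real_def scaleR_diff_right add_eq_0_iff)
  moreover have "pos (of_real (1 / (real n + 1)) + b * c ^ n)" by (intro pos_add pos_of_real pbc) simp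
  ultimately show ?thesis
    using pos_adj[OF pbc] by (intro norm_le_if_pos) (auto simp: c_def)
qed

text \<open>For b = k^* k / t^2 the element e = 1 - (1 - b)^n is a polynomial in
  \<open>adj k * k\<close> without constant term, so it lies in \<open>K\<close>. The squared norm
  of k (1 - e) is t^2 times the norm of b (1 - b)^(2n), at most t^2 / (2n + 1). The element
  \<open>k\<close> itself may lie outside \<open>K\<close>; this is what later allows membership of
  an element to be deduced from that of its square.\<close>

lemma approx_unit:
  fixes k :: "'a::ucstar"
  assumes kk: "adj k * k \<in> K" and "0 \<in> K" "\<And>x y. x \<in> K \<Longrightarrow> y \<in> K \<Longrightarrow> x + y \<in> K"
    "\<And>r x. x \<in> K \<Longrightarrow> r *\<^sub>R x \<in> K" "\<And>x. x \<in> K \<Longrightarrow> x * (adj k * k) \<in> K" and d: "0 < d"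
  obtains e where "e \<in> K" "adj e = e" "norm (1 - e) \<le> 1" "norm (k * (1 - e)) < d"
proof -
  define t where "t = norm k + 1"
  have t: "t > 0" using norm_ge_zero[of k] unfolding t_def by linarith
  define b where "b = (1/t\<^sup>2) *\<^sub>R (adj k * k)"
  have "pos b" unfolding b_def by (intro pos_scaleR pos_adj_mult) simp
  have bK: "b \<in> K" using assms by (simp add: b_def)
  have nb: "norm b \<le> 1"
    using t by (simp add: b_def norm_adj_mult divide_le_eq_1) (simp add: t_def power_mono)
  have c: "adj (1 - b) = 1 - b" "norm (1 - b) \<le> 1"
    using nb \<open>pos b\<close> by (simp_all add: adj_diff pos_adj pos_norm_one_minus)
  define e where "e n = 1 - (1 - b) ^ n" for n
  have eK: "e n \<in> K" for n
  proof (induction n)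
    case 0
    then show ?case using assms by (simp add: e_def)
  next
    case (Suc n)
    \<comment> \<open>The recursion e (n+1) = e n + (1 - e n) b is rewritten so that the unit
      disappears and only operations available in \<open>K\<close> remain.\<close>
    have eq: "e (Suc n) = e n + b + (-1/t\<^sup>2) *\<^sub>R (e n * (adj k * k))"
    proof -
      have "e (Suc n) = e n + (1 - e n) * b"
        unfolding e_def power_Suc2 by (simp add: algebra_simps)
      also have "\<dots> = e n + b + (-1/t\<^sup>2) *\<^sub>R (e n * (adj k * k))"
        by (simp add: b_def algebra_simps)
      finally show ?thesis .
    qed
    show ?case unfolding eq by (intro assms(3,4,5) Suc bK)
  qed
  obtain n where n: "t\<^sup>2 / d\<^sup>2 < real n" using reals_Archimedean2 by blast
  have "(norm (k * (1 - b) ^ n))\<^sup>2 = norm (adj (k * (1 - b) ^ n) * (k * (1 - b) ^ n))"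
    by (simp add: norm_adj_mult)
  also have "adj (k * (1 - b) ^ n) * (k * (1 - b) ^ n) = (1 - b) ^ n * (t\<^sup>2 *\<^sub>R b) * (1 - b) ^ n"
  proof -
    have "t\<^sup>2 *\<^sub>R b = adj k * k" using t by (simp add: b_def)
    then show ?thesis by (simp only: adj_mult adj_power c(1) mult.assoc)
  qed
  also have "\<dots> = t\<^sup>2 *\<^sub>R (b * (1 - b) ^ (n + n))"
  proof -
    have "(1 - b) * b = b * (1 - b)" by (simp add: algebra_simps)
    from power_mult_commute[OF this] have "(1 - b) ^ n * b = b * (1 - b) ^ n" .
    then show ?thesis
      unfolding mult_scaleR_right mult_scaleR_left power_add by (simp only: mult.assoc)
  qed
  also have "norm \<dots> \<le> t\<^sup>2 * (1 / (real (n + n) + 1))"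
    unfolding norm_scaleR abs_of_nonneg[OF zero_le_power2]
    by (rule mult_left_mono[OF norm_mult_power_le[OF \<open>pos b\<close> nb]]) simp
  also have "\<dots> < d\<^sup>2"
  proof -
    have "t\<^sup>2 < real n * d\<^sup>2" using n d by (simp add: divide_less_eq)
    also have "\<dots> \<le> (real (n + n) + 1) * d\<^sup>2" by (intro mult_right_mono) auto
    finally show ?thesis by (simp add: divide_less_eq mult.commute)
  qed
  finally have "norm (k * (1 - e n)) < d" using d by (simp add: e_def power_less_imp_less_base)
  moreover have "norm (1 - e n) \<le> 1"
    using norm_power_ineq[of "1 - b" n] power_le_one[OF norm_ge_zero c(2), of n] by (simp add: e_def)
  moreover have "adj (e n) = e n" by (simp add: e_def adj_diff adj_power) (metis adj_diff adj_one c(1))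
  ultimately show ?thesis using that eK by blast
qed

section \<open>Embedding carrier-based C*-algebras into a type\<close>

context abelian_group
begin

lemma diff_telescope:
  "x \<in> carrier G \<Longrightarrow> y \<in> carrier G \<Longrightarrow> z \<in> carrier G \<Longrightarrow> x \<ominus> z = (x \<ominus> y) \<oplus> (y \<ominus> z)"
  by (simp add: a_minus_def a_assoc) (metis a_assoc a_inv_closed l_neg l_zero)

lemma diff_eq_zero_iff: "x \<in> carrier G \<Longrightarrow> y \<in> carrier G \<Longrightarrow> x \<ominus> y = \<zero> \<longleftrightarrow> x = y"
  by (metis a_inv_closed a_minus_def add.inv_equality minus_minus r_neg)

lemma a_diff_self: "x \<in> carrier G \<Longrightarrow> x \<ominus> x = \<zero>"
  by (simp add: diff_eq_zero_iff)

lemma minus_diff: "x \<in> carrier G \<Longrightarrow> y \<in> carrier G \<Longrightarrow> \<ominus> (x \<ominus> y) = y \<ominus> x"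
  by (simp add: a_minus_def minus_add a_comm)

lemma is_abelian_group: "abelian_group G"
  by unfold_locales

end

text \<open>Formulated for bare norm laws, because adjointable operators, subalgebras and quotients
  need the metric before they are known to be C*-algebras.\<close>

lemma Metric_space_cs_dist:
  assumes "abelian_group A" and zero_imp: "\<And>x. x \<in> carrier A \<Longrightarrow> nrm A x = 0 \<Longrightarrow> x = \<zero>\<^bsub>A\<^esub>"
    and zero: "nrm A \<zero>\<^bsub>A\<^esub> = 0" and minus: "\<And>x. x \<in> carrier A \<Longrightarrow> nrm A (\<ominus>\<^bsub>A\<^esub> x) = nrm A x"
    and triangle: "\<And>x y. x \<in> carrier A \<Longrightarrow> y \<in> carrier A \<Longrightarrow> nrm A (x \<oplus>\<^bsub>A\<^esub> y) \<le> nrm A x + nrm A y"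
  shows "Metric_space (carrier A) (cs_dist A)"
proof -
  interpret abelian_group A by fact
  have nonneg: "0 \<le> nrm A x" if "x \<in> carrier A" for x
    using triangle[of x "\<ominus>\<^bsub>A\<^esub> x"] that by (simp add: minus zero r_neg)
  show ?thesis
  proof
    show "0 \<le> cs_dist A x y" for x y by (simp add: cs_dist_def nonneg)
    show "cs_dist A x y = cs_dist A y x" for x y
      using minus[of "x \<ominus>\<^bsub>A\<^esub> y"] by (auto simp: cs_dist_def minus_diff)
    fix x y z assume xy [simp]: "x \<in> carrier A" "y \<in> carrier A"
    show "cs_dist A x y = 0 \<longleftrightarrow> x = y"
      using zero_imp[of "x \<ominus>\<^bsub>A\<^esub> y"] by (auto simp: cs_dist_def zero diff_eq_zero_iff a_diff_self)
    assume [simp]: "z \<in> carrier A"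
    have "nrm A (x \<ominus>\<^bsub>A\<^esub> z) \<le> nrm A (x \<ominus>\<^bsub>A\<^esub> y) + nrm A (y \<ominus>\<^bsub>A\<^esub> z)"
      by (subst diff_telescope[of x y z]) (auto intro: triangle)
    then show "cs_dist A x z \<le> cs_dist A x y + cs_dist A y z" by (simp add: cs_dist_def)
  qed
qed

lemma cs_mcompleteI:
  assumes "Metric_space (carrier A) (cs_dist A)"
    and "\<And>s :: nat \<Rightarrow> 'a. (\<And>n. s n \<in> carrier A) \<Longrightarrow>
      (\<And>e. 0 < e \<Longrightarrow> \<exists>N. \<forall>m\<ge>N. \<forall>n\<ge>N. nrm A (s m \<ominus>\<^bsub>A\<^esub> s n) < e) \<Longrightarrow>
      \<exists>l\<in>carrier A. \<forall>e>0. \<exists>N. \<forall>n\<ge>N. nrm A (s n \<ominus>\<^bsub>A\<^esub> l) < e"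
  shows "Metric_space.mcomplete (carrier A) (cs_dist (A :: 'a cstar))"
proof -
  interpret Metric_space "carrier A" "cs_dist A" by fact
  show ?thesis
    unfolding mcomplete_def
  proof (intro allI impI)
    fix s :: "nat \<Rightarrow> 'a" assume s: "MCauchy s"
    then have c: "s n \<in> carrier A" for n by (auto simp: MCauchy_def)
    have "\<exists>N. \<forall>m\<ge>N. \<forall>n\<ge>N. nrm A (s m \<ominus>\<^bsub>A\<^esub> s n) < e" if "0 < e" for e
      using s that c unfolding MCauchy_def by (simp add: cs_dist_def)
    then obtain l where "l \<in> carrier A" "\<forall>e>0. \<exists>N. \<forall>n\<ge>N. nrm A (s n \<ominus>\<^bsub>A\<^esub> l) < e"
      using assms(2)[of s] c by blast
    then have "limitin mtopology s l sequentially"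
      using c by (simp add: limit_metric_sequentially cs_dist_def)
    then show "\<exists>x. limitin mtopology s x sequentially" ..
  qed
qed

context cstar_algebra
begin

lemma smult_zero_left: "x \<in> carrier A \<Longrightarrow> 0 \<odot> x = \<zero>"
  using smult_l_distr[of x 0 0] smult_closed[of x 0] by (metis add.r_cancel_one' add_0)

lemma smult_minus_one: "x \<in> carrier A \<Longrightarrow> (- 1) \<odot> x = \<ominus> x"
  using smult_l_distr[of x 1 "- 1"] smult_closed[of x "- 1"] smult_zero_left smult_one
  by (metis add.inv_equality add.m_comm add.right_inverse)

lemma mult_zero_left: "x \<in> carrier A \<Longrightarrow> \<zero> \<otimes> x = \<zero>"
  using l_distr[of \<zero> \<zero> x] m_closed[of \<zero> x] by (metis add.r_cancel_one' l_zero zero_closed)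

lemma mult_zero_right: "x \<in> carrier A \<Longrightarrow> x \<otimes> \<zero> = \<zero>"
  using r_distr[of \<zero> \<zero> x] m_closed[of x \<zero>] by (metis add.r_cancel_one' l_zero zero_closed)

lemma smult_zero_right: "c \<odot> \<zero> = \<zero>"
  using smult_r_distr[of \<zero> \<zero> c] smult_closed[of \<zero> c] by (metis add.r_cancel_one' l_zero zero_closed)

lemma star_zero: "star A \<zero> = \<zero>"
  using star_add[of \<zero> \<zero>] star_closed[of \<zero>] by (metis add.r_cancel_one' l_zero zero_closed)

lemma nrm_zero: "nrm A \<zero> = 0"
  using nrm_smult[of \<zero> 0] smult_zero_left[of \<zero>] by simp

lemma nrm_minus: "x \<in> carrier A \<Longrightarrow> nrm A (\<ominus> x) = nrm A x"
  using nrm_smult[of x "- 1"] by (simp add: smult_minus_one)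

lemma nrm_nonneg: "x \<in> carrier A \<Longrightarrow> 0 \<le> nrm A x"
  using nrm_triangle[of x "\<ominus> x"] by (simp add: nrm_minus nrm_zero r_neg)

lemma nrm_diff_triangle:
  "x \<in> carrier A \<Longrightarrow> y \<in> carrier A \<Longrightarrow> z \<in> carrier A \<Longrightarrow> nrm A (x \<ominus> z) \<le> nrm A (x \<ominus> y) + nrm A (y \<ominus> z)"
  by (subst diff_telescope[of x y z]) (auto intro: nrm_triangle)

lemma nrm_diff_commute:
  "x \<in> carrier A \<Longrightarrow> y \<in> carrier A \<Longrightarrow> nrm A (x \<ominus> y) = nrm A (y \<ominus> x)"
  using nrm_minus[of "x \<ominus> y"] by (simp add: a_minus_def minus_add a_comm)

sublocale metric: Metric_space "carrier A" "cs_dist A"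
  by (rule Metric_space_cs_dist) (auto simp: nrm_zero nrm_minus nrm_triangle nrm_zero_imp is_abelian_group)

lemma Cauchy_imp_limit:
  fixes s :: "nat \<Rightarrow> 'a"
  assumes s: "\<And>n. s n \<in> carrier A"
    and C: "\<And>e. 0 < e \<Longrightarrow> \<exists>N. \<forall>m\<ge>N. \<forall>n\<ge>N. nrm A (s m \<ominus> s n) < e"
  obtains l where "l \<in> carrier A" "\<And>e. 0 < e \<Longrightarrow> \<exists>N. \<forall>n\<ge>N. nrm A (s n \<ominus> l) < e"
proof -
  have "metric.MCauchy s"
    unfolding metric.MCauchy_def
  proof (intro conjI allI impI)
    show "range s \<subseteq> carrier A" using s by blast
    fix e :: real assume "0 < e"
    then show "\<exists>N. \<forall>n n'. N \<le> n \<longrightarrow> N \<le> n' \<longrightarrow> cs_dist A (s n) (s n') < e"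
      using C[of e] s by (simp add: cs_dist_def)
  qed
  then obtain l where "limitin metric.mtopology s l sequentially"
    using complete by (auto simp: metric.mcomplete_def)
  then show ?thesis
    using that[of l] s by (auto simp: metric.limit_metric_sequentially cs_dist_def)
qed

end

text \<open>A type cannot depend on a term, so the type below has as elements the bounded families of
  elements of all C*-algebras with underlying type \<open>'a\<close> at once; every one of these algebras is
  embedded as one factor.\<close>

definition fam_set :: "('a cstar \<Rightarrow> 'a) set" where
  "fam_set = {x. (\<forall>A. cstar_algebra A \<longrightarrow> x A \<in> carrier A) \<and> (\<forall>A. \<not> cstar_algebra A \<longrightarrow> x A = undefined) \<and>
     (\<exists>M. \<forall>A. cstar_algebra A \<longrightarrow> nrm A (x A) \<le> M)}"

text \<open>The fixed value \<open>undefined\<close> away from C*-algebras makes a family determined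
  by its values on them, as \<open>fam_eqI\<close> needs.\<close>

definition fam_restrict :: "('a cstar \<Rightarrow> 'a) \<Rightarrow> 'a cstar \<Rightarrow> 'a" where
  "fam_restrict f A = (if cstar_algebra A then f A else undefined)"

lemma fam_restrict_mem:
  assumes "\<And>A. cstar_algebra A \<Longrightarrow> f A \<in> carrier A" "\<And>A. cstar_algebra A \<Longrightarrow> nrm A (f A) \<le> M"
  shows "fam_restrict f \<in> fam_set"
  using assms by (auto simp: fam_set_def fam_restrict_def)

typedef 'a fam = "fam_set :: ('a cstar \<Rightarrow> 'a) set" morphisms fam_at Fam
proof
  show "fam_restrict (\<lambda>A. \<zero>\<^bsub>A\<^esub>) \<in> (fam_set :: ('a cstar \<Rightarrow> 'a) set)"
    by (rule fam_restrict_mem[where M = 0])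
      (simp_all add: cstar_algebra.nrm_zero abelian_monoid.zero_closed cstar_algebra_def abelian_group_def)
qed

definition mk_fam :: "('a cstar \<Rightarrow> 'a) \<Rightarrow> 'a fam" where
  "mk_fam f = Fam (fam_restrict f)"

lemma fam_at_mk_fam:
  assumes "\<And>A. cstar_algebra A \<Longrightarrow> f A \<in> carrier A" "\<And>A. cstar_algebra A \<Longrightarrow> nrm A (f A) \<le> M"
    "cstar_algebra A"
  shows "fam_at (mk_fam f) A = f A"
  using Fam_inverse[OF fam_restrict_mem[OF assms(1,2)]] assms(3)
  by (simp add: mk_fam_def fam_restrict_def)

lemma fam_at_closed: "cstar_algebra A \<Longrightarrow> fam_at x A \<in> carrier A"
  using fam_at[of x] by (simp add: fam_set_def)

lemma fam_eqI: "(\<And>A. cstar_algebra A \<Longrightarrow> fam_at x A = fam_at y A) \<Longrightarrow> x = y"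
proof (rule fam_at_inject[THEN iffD1], rule ext)
  fix A
  show "(\<And>A. cstar_algebra A \<Longrightarrow> fam_at x A = fam_at y A) \<Longrightarrow> fam_at x A = fam_at y A"
    using fam_at[of x] fam_at[of y] by (cases "cstar_algebra A") (simp_all add: fam_set_def)
qed

text \<open>The inserted 0 keeps the set nonempty and the supremum nonnegative.\<close>

definition fam_norm :: "'a fam \<Rightarrow> real" where
  "fam_norm x = Sup (insert 0 ((\<lambda>A. nrm A (fam_at x A)) ` Collect cstar_algebra))"

lemma nrm_fam_at_le: "cstar_algebra A \<Longrightarrow> nrm A (fam_at x A) \<le> fam_norm x"
proof -
  obtain M where "\<And>A. cstar_algebra A \<Longrightarrow> nrm A (fam_at x A) \<le> M"
    using fam_at[of x] by (auto simp: fam_set_def)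
  then have "bdd_above (insert 0 ((\<lambda>A. nrm A (fam_at x A)) ` Collect cstar_algebra))"
    by (auto intro!: bdd_aboveI[of _ M])
  then show "cstar_algebra A \<Longrightarrow> ?thesis" unfolding fam_norm_def by (intro cSup_upper) auto
qed

lemma fam_norm_nonneg: "0 \<le> fam_norm x"
proof -
  obtain M where "\<And>A. cstar_algebra A \<Longrightarrow> nrm A (fam_at x A) \<le> M"
    using fam_at[of x] by (auto simp: fam_set_def)
  then have "bdd_above (insert 0 ((\<lambda>A. nrm A (fam_at x A)) ` Collect cstar_algebra))"
    by (auto intro!: bdd_aboveI[of _ M])
  then show ?thesis unfolding fam_norm_def by (intro cSup_upper) auto
qed

lemma fam_norm_leI: "0 \<le> K \<Longrightarrow> (\<And>A. cstar_algebra A \<Longrightarrow> nrm A (fam_at x A) \<le> K) \<Longrightarrow> fam_norm x \<le> K"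
  unfolding fam_norm_def by (rule cSup_least) auto

lemmas cstar_abelian_group = cstar_algebra.axioms(1)
lemmas cstar_zero_closed = abelian_monoid.zero_closed[OF abelian_group.axioms(1)[OF cstar_abelian_group]]
lemmas cstar_add_closed = abelian_monoid.a_closed[OF abelian_group.axioms(1)[OF cstar_abelian_group]]
lemmas cstar_minus_closed = abelian_group.a_inv_closed[OF cstar_abelian_group]

instantiation fam :: (type) scaleR
begin

definition "r *\<^sub>R x = mk_fam (\<lambda>A. complex_of_real r \<odot>\<^bsub>A\<^esub> fam_at x A)"

instance ..

end

lemma nrm_star_le:
  assumes "cstar_algebra A" "x \<in> carrier A"
  shows "nrm A (star A x) \<le> nrm A x"
proof -
  interpret cstar_algebra A by fact
  have s: "star A x \<in> carrier A" using assms star_closed by simp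
  have "(nrm A (star A x))\<^sup>2 \<le> nrm A x * nrm A (star A x)"
    using cstar_identity[OF s] nrm_mult[of x "star A x"] assms s by (simp add: star_star)
  then show ?thesis using nrm_nonneg[OF s] nrm_nonneg[OF assms(2)]
    by (cases "nrm A (star A x) = 0") (auto simp: power2_eq_square)
qed

instantiation fam :: (type) "{real_normed_algebra, cscale, adj}"
begin

definition "0 = mk_fam (\<lambda>A. \<zero>\<^bsub>A\<^esub>)"
definition "x + y = mk_fam (\<lambda>A. fam_at x A \<oplus>\<^bsub>A\<^esub> fam_at y A)"
definition "x - y = mk_fam (\<lambda>A. fam_at x A \<oplus>\<^bsub>A\<^esub> (\<ominus>\<^bsub>A\<^esub> fam_at y A))"
definition "- x = mk_fam (\<lambda>A. \<ominus>\<^bsub>A\<^esub> fam_at x A)"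
definition "x * y = mk_fam (\<lambda>A. fam_at x A \<otimes>\<^bsub>A\<^esub> fam_at y A)"
definition "norm x = fam_norm x"
definition "dist x y = norm (x - y :: 'a fam)"
definition "sgn x = inverse (norm x) *\<^sub>R (x :: 'a fam)"
definition "uniformity = (INF e\<in>{0<..}. principal {(x, y). dist x (y :: 'a fam) < e})"
definition "open U \<longleftrightarrow> (\<forall>x\<in>U. \<forall>\<^sub>F (x', y) in uniformity. (x' :: 'a fam) = x \<longrightarrow> y \<in> U)"
definition "cscale c x = mk_fam (\<lambda>A. c \<odot>\<^bsub>A\<^esub> fam_at x A)"
definition "adj x = mk_fam (\<lambda>A. star A (fam_at x A))"

lemma fam_at_zero: "cstar_algebra A \<Longrightarrow> fam_at 0 A = \<zero>\<^bsub>A\<^esub>"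
  unfolding zero_fam_def by (rule fam_at_mk_fam[where M = 0]) (auto simp: cstar_algebra.nrm_zero cstar_zero_closed)

lemma fam_at_add: "cstar_algebra A \<Longrightarrow> fam_at (x + y) A = fam_at x A \<oplus>\<^bsub>A\<^esub> fam_at y A"
  unfolding plus_fam_def
  by (rule fam_at_mk_fam[where M = "fam_norm x + fam_norm y"])
    (auto intro!: cstar_add_closed fam_at_closed
      order_trans[OF cstar_algebra.nrm_triangle add_mono] nrm_fam_at_le)

lemma fam_at_minus: "cstar_algebra A \<Longrightarrow> fam_at (- x) A = \<ominus>\<^bsub>A\<^esub> fam_at x A"
  unfolding uminus_fam_def
  by (rule fam_at_mk_fam[where M = "fam_norm x"])
    (auto intro!: cstar_minus_closed fam_at_closed nrm_fam_at_le simp: cstar_algebra.nrm_minus fam_at_closed)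

lemma fam_minus_conv: "x - y = x + - (y :: 'a fam)"
  unfolding minus_fam_def plus_fam_def mk_fam_def
  by (rule arg_cong[where f = Fam]) (auto simp: fam_restrict_def fam_at_minus)

lemma nrm_fam_mult_le: "cstar_algebra A \<Longrightarrow> nrm A (fam_at x A \<otimes>\<^bsub>A\<^esub> fam_at y A) \<le> fam_norm x * fam_norm y"
  by (rule order_trans[OF cstar_algebra.nrm_mult mult_mono])
    (simp_all add: fam_at_closed nrm_fam_at_le cstar_algebra.nrm_nonneg fam_norm_nonneg)

lemma fam_at_mult: "cstar_algebra A \<Longrightarrow> fam_at (x * y) A = fam_at x A \<otimes>\<^bsub>A\<^esub> fam_at y A"
  unfolding times_fam_def
  by (rule fam_at_mk_fam[where M = "fam_norm x * fam_norm y"])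
    (simp_all add: cstar_algebra.m_closed fam_at_closed nrm_fam_mult_le)

lemma fam_at_cscale: "cstar_algebra A \<Longrightarrow> fam_at (cscale c x) A = c \<odot>\<^bsub>A\<^esub> fam_at x A"
  unfolding cscale_fam_def
  by (rule fam_at_mk_fam[where M = "cmod c * fam_norm x"])
    (auto intro!: cstar_algebra.smult_closed fam_at_closed mult_left_mono nrm_fam_at_le simp: cstar_algebra.nrm_smult fam_at_closed)

lemma fam_at_scaleR: "cstar_algebra A \<Longrightarrow> fam_at (r *\<^sub>R x) A = complex_of_real r \<odot>\<^bsub>A\<^esub> fam_at x A"
  unfolding scaleR_fam_def
  by (rule fam_at_mk_fam[where M = "\<bar>r\<bar> * fam_norm x"])
    (auto intro!: cstar_algebra.smult_closed fam_at_closed mult_left_mono nrm_fam_at_le simp: cstar_algebra.nrm_smult fam_at_closed)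

lemma fam_at_adj: "cstar_algebra A \<Longrightarrow> fam_at (adj x) A = star A (fam_at x A)"
  unfolding adj_fam_def
  by (rule fam_at_mk_fam[where M = "fam_norm x"])
    (auto intro!: cstar_algebra.star_closed fam_at_closed order_trans[OF nrm_star_le] nrm_fam_at_le)

lemmas fam_at_simps = fam_at_zero fam_at_add fam_at_minus fam_at_mult fam_at_cscale fam_at_scaleR fam_at_adj
  fam_at_closed cstar_zero_closed cstar_add_closed cstar_minus_closed cstar_algebra.m_closed
  cstar_algebra.smult_closed cstar_algebra.star_closed

lemma fam_norm_cscale_le: "norm (cscale c x) \<le> cmod c * norm (x :: 'a fam)"
  unfolding norm_fam_def
  by (rule fam_norm_leI) (auto simp: fam_norm_nonneg fam_at_simps cstar_algebra.nrm_smult intro!: mult_left_mono nrm_fam_at_le)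

lemma fam_cscale_one: "cscale 1 x = (x :: 'a fam)"
  by (rule fam_eqI) (simp add: fam_at_simps cstar_algebra.smult_one)

lemma fam_cscale_cscale: "cscale c (cscale d x) = cscale (c * d) (x :: 'a fam)"
  by (rule fam_eqI) (simp add: fam_at_simps cstar_algebra.smult_assoc)

lemma fam_scaleR_cscale: "r *\<^sub>R x = cscale (complex_of_real r) (x :: 'a fam)"
  by (rule fam_eqI) (simp add: fam_at_simps)

lemma fam_cscale_zero: "cscale 0 x = (0 :: 'a fam)"
  by (rule fam_eqI) (simp add: fam_at_simps cstar_algebra.smult_zero_left)

lemma fam_norm_eq_0: "norm x = 0 \<longleftrightarrow> x = (0 :: 'a fam)"
proof
  assume 0: "norm x = 0"
  show "x = 0"
  proof (rule fam_eqI)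
    fix A :: "'a cstar" assume A: "cstar_algebra A"
    then have "nrm A (fam_at x A) \<le> 0" using nrm_fam_at_le[of A x] 0 by (simp add: norm_fam_def)
    then show "fam_at x A = fam_at 0 A"
      using A cstar_algebra.nrm_nonneg[OF A, of "fam_at x A"] cstar_algebra.nrm_zero_imp[OF A, of "fam_at x A"]
      by (simp add: fam_at_simps)
  qed
next
  assume "x = 0"
  moreover have "norm (0 :: 'a fam) \<le> 0"
    unfolding norm_fam_def by (rule fam_norm_leI) (auto simp: fam_at_simps cstar_algebra.nrm_zero)
  ultimately show "norm x = 0" using fam_norm_nonneg[of x] by (simp add: norm_fam_def)
qed

lemma fam_norm_cscale: "norm (cscale c x) = cmod c * norm (x :: 'a fam)"
proof (cases "c = 0")
  case True
  then show ?thesis using fam_norm_eq_0[of 0] by (simp add: fam_cscale_zero)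
next
  case False
  then have "norm x \<le> inverse (cmod c) * norm (cscale c x)"
    using fam_norm_cscale_le[of "inverse c" "cscale c x"]
    by (simp add: norm_inverse fam_cscale_cscale fam_cscale_one)
  then have "cmod c * norm x \<le> norm (cscale c x)" using False by (simp add: field_simps)
  then show ?thesis using fam_norm_cscale_le[of c x] by simp
qed

instance
proof
  fix x y z :: "'a fam" and r s :: real
  have ag: "fam_at (x + y + z) A = fam_at (x + (y + z)) A" "fam_at (x + y) A = fam_at (y + x) A"
    "fam_at (0 + x) A = fam_at x A" "fam_at (- x + x) A = fam_at 0 A"
    "fam_at (r *\<^sub>R (x + y)) A = fam_at (r *\<^sub>R x + r *\<^sub>R y) A"
    "fam_at ((r + s) *\<^sub>R x) A = fam_at (r *\<^sub>R x + s *\<^sub>R x) A"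
    "fam_at (r *\<^sub>R s *\<^sub>R x) A = fam_at ((r * s) *\<^sub>R x) A"
    "fam_at (1 *\<^sub>R x) A = fam_at x A"
    "fam_at (x * y * z) A = fam_at (x * (y * z)) A"
    "fam_at ((x + y) * z) A = fam_at (x * z + y * z) A"
    "fam_at (x * (y + z)) A = fam_at (x * y + x * z) A"
    "fam_at (r *\<^sub>R x * y) A = fam_at (r *\<^sub>R (x * y)) A"
    "fam_at (x * r *\<^sub>R y) A = fam_at (r *\<^sub>R (x * y)) A"
    if A: "cstar_algebra A" for A
  proof -
    interpret cstar_algebra A by fact
    note c = fam_at_closed[OF A]
    show "fam_at (x + y + z) A = fam_at (x + (y + z)) A" "fam_at (x + y) A = fam_at (y + x) A"
      "fam_at (0 + x) A = fam_at x A" "fam_at (- x + x) A = fam_at 0 A"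
      using A by (simp_all add: fam_at_simps a_ac r_neg l_neg)
    show "fam_at (r *\<^sub>R (x + y)) A = fam_at (r *\<^sub>R x + r *\<^sub>R y) A"
      "fam_at ((r + s) *\<^sub>R x) A = fam_at (r *\<^sub>R x + s *\<^sub>R x) A"
      "fam_at (r *\<^sub>R s *\<^sub>R x) A = fam_at ((r * s) *\<^sub>R x) A"
      "fam_at (1 *\<^sub>R x) A = fam_at x A"
      using A by (simp_all add: fam_at_simps smult_r_distr smult_l_distr smult_assoc smult_one)
    show "fam_at (x * y * z) A = fam_at (x * (y * z)) A"
      "fam_at ((x + y) * z) A = fam_at (x * z + y * z) A"
      "fam_at (x * (y + z)) A = fam_at (x * y + x * z) A"
      "fam_at (r *\<^sub>R x * y) A = fam_at (r *\<^sub>R (x * y)) A"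
      "fam_at (x * r *\<^sub>R y) A = fam_at (r *\<^sub>R (x * y)) A"
      using A by (simp_all add: fam_at_simps m_assoc l_distr r_distr smult_mult_left smult_mult_right)
  qed
  show "x + y + z = x + (y + z)" by (rule fam_eqI) (rule ag)
  show "x + y = y + x" by (rule fam_eqI) (rule ag)
  show "0 + x = x" by (rule fam_eqI) (rule ag)
  show "- x + x = 0" by (rule fam_eqI) (rule ag)
  show "r *\<^sub>R (x + y) = r *\<^sub>R x + r *\<^sub>R y" by (rule fam_eqI) (rule ag)
  show "(r + s) *\<^sub>R x = r *\<^sub>R x + s *\<^sub>R x" by (rule fam_eqI) (rule ag)
  show "r *\<^sub>R s *\<^sub>R x = (r * s) *\<^sub>R x" by (rule fam_eqI) (rule ag)
  show "1 *\<^sub>R x = x" by (rule fam_eqI) (rule ag)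
  show "x * y * z = x * (y * z)" by (rule fam_eqI) (rule ag)
  show "(x + y) * z = x * z + y * z" by (rule fam_eqI) (rule ag)
  show "x * (y + z) = x * y + x * z" by (rule fam_eqI) (rule ag)
  show "r *\<^sub>R x * y = r *\<^sub>R (x * y)" by (rule fam_eqI) (rule ag)
  show "x * r *\<^sub>R y = r *\<^sub>R (x * y)" by (rule fam_eqI) (rule ag)
  show "x - y = x + - y" by (rule fam_minus_conv)
  show "dist x y = norm (x - y)" "sgn x = x /\<^sub>R norm x"
    "uniformity = (INF e\<in>{0<..}. principal {(x, y). dist x (y :: 'a fam) < e})"
    by (simp_all add: dist_fam_def sgn_fam_def uniformity_fam_def)
  show "open U \<longleftrightarrow> (\<forall>x\<in>U. \<forall>\<^sub>F (x', y) in uniformity. x' = x \<longrightarrow> y \<in> U)" for U :: "'a fam set"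
    by (simp add: open_fam_def)
  show "norm x = 0 \<longleftrightarrow> x = 0" by (rule fam_norm_eq_0)
  show "norm (x + y) \<le> norm x + norm y"
    unfolding norm_fam_def
    by (rule fam_norm_leI) (auto simp: fam_at_simps fam_norm_nonneg
        intro!: order_trans[OF cstar_algebra.nrm_triangle add_mono] nrm_fam_at_le)
  show "norm (r *\<^sub>R x) = \<bar>r\<bar> * norm x" by (simp add: fam_scaleR_cscale fam_norm_cscale)
  show "norm (x * y) \<le> norm x * norm y"
    unfolding norm_fam_def
    by (rule fam_norm_leI) (simp_all add: fam_norm_nonneg fam_at_mult nrm_fam_mult_le)
qed

end

lemma fam_at_diff: "cstar_algebra A \<Longrightarrow> fam_at (x - y) A = fam_at x A \<ominus>\<^bsub>A\<^esub> fam_at y A"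
  by (simp only: fam_minus_conv fam_at_add fam_at_minus a_minus_def)

instance fam :: (type) banach
proof
  fix X :: "nat \<Rightarrow> 'a fam"
  assume C: "Cauchy X"
  have C': "\<exists>N. \<forall>m\<ge>N. \<forall>n\<ge>N. norm (X m - X n) < e" if "0 < e" for e
    using C that by (auto simp: Cauchy_iff)
  have le: "nrm A (fam_at (X m) A \<ominus>\<^bsub>A\<^esub> fam_at (X n) A) \<le> norm (X m - X n)" if "cstar_algebra A" for A m n
    using nrm_fam_at_le[OF that, of "X m - X n"] that by (simp add: fam_at_diff norm_fam_def)
  have "\<exists>l. l \<in> carrier A \<and> (\<forall>e>0. \<exists>N. \<forall>n\<ge>N. nrm A (fam_at (X n) A \<ominus>\<^bsub>A\<^esub> l) < e)" if A: "cstar_algebra A" for A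
  proof -
    have "\<exists>N. \<forall>m\<ge>N. \<forall>n\<ge>N. nrm A (fam_at (X m) A \<ominus>\<^bsub>A\<^esub> fam_at (X n) A) < e" if "0 < e" for e
      using C'[OF that] le[OF A] by (meson le_less_trans)
    then show ?thesis
      using cstar_algebra.Cauchy_imp_limit[OF A, of "\<lambda>n. fam_at (X n) A"] fam_at_closed[OF A] by metis
  qed
  then obtain l where l: "\<And>A. cstar_algebra A \<Longrightarrow> l A \<in> carrier A"
    "\<And>A e. cstar_algebra A \<Longrightarrow> 0 < e \<Longrightarrow> \<exists>N. \<forall>n\<ge>N. nrm A (fam_at (X n) A \<ominus>\<^bsub>A\<^esub> l A) < e"
    by metis
  have unif: "nrm A (fam_at (X n) A \<ominus>\<^bsub>A\<^esub> l A) \<le> e"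
    if A: "cstar_algebra A" and N: "\<forall>m\<ge>N. \<forall>n\<ge>N. norm (X m - X n) < e" "n \<ge> N" for A n N e
  proof (rule field_le_epsilon)
    interpret cstar_algebra A by fact
    fix d :: real assume "0 < d"
    then obtain M where M: "\<And>m. m \<ge> M \<Longrightarrow> nrm A (fam_at (X m) A \<ominus>\<^bsub>A\<^esub> l A) < d" using l(2)[OF A] by blast
    \<comment> \<open>The index \<open>M\<close> depends on the factor \<open>A\<close>, but
      \<open>m\<close> is auxiliary and drops out of the final bound, which is therefore uniform
      over all factors.\<close>
    define m where "m = max M N"
    have "nrm A (fam_at (X n) A \<ominus>\<^bsub>A\<^esub> l A)
        \<le> nrm A (fam_at (X n) A \<ominus>\<^bsub>A\<^esub> fam_at (X m) A) + nrm A (fam_at (X m) A \<ominus>\<^bsub>A\<^esub> l A)"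
      by (intro nrm_diff_triangle fam_at_closed l A)
    moreover have "nrm A (fam_at (X n) A \<ominus>\<^bsub>A\<^esub> fam_at (X m) A) < e"
      using le[OF A, of n m] N by (auto simp: m_def intro: le_less_trans)
    moreover have "nrm A (fam_at (X m) A \<ominus>\<^bsub>A\<^esub> l A) < d" using M by (simp add: m_def)
    ultimately show "nrm A (fam_at (X n) A \<ominus>\<^bsub>A\<^esub> l A) \<le> e + d" by simp
  qed
  \<comment> \<open>A Cauchy index for the tolerance 1 bounds all coordinatewise limits by
    \<open>norm (X N) + 1\<close>, so that they form a bounded family.\<close>
  obtain N where N: "\<forall>m\<ge>N. \<forall>n\<ge>N. norm (X m - X n) < 1" using C'[of 1] by auto
  have L: "fam_at (mk_fam l) A = l A" if A: "cstar_algebra A" for A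
  proof (rule fam_at_mk_fam[where M = "norm (X N) + 1", OF l(1) _ A])
    fix B :: "'a cstar" assume B: "cstar_algebra B"
    interpret cstar_algebra B by fact
    have "l B = fam_at (X N) B \<ominus>\<^bsub>B\<^esub> (fam_at (X N) B \<ominus>\<^bsub>B\<^esub> l B)"
      using l(1)[OF B] fam_at_closed[OF B, of "X N"]
      by (simp add: a_minus_def minus_add r_neg1 r_neg2 minus_minus)
    then have "nrm B (l B) \<le> nrm B (fam_at (X N) B) + nrm B (fam_at (X N) B \<ominus>\<^bsub>B\<^esub> l B)"
      using nrm_triangle[of "fam_at (X N) B" "\<ominus>\<^bsub>B\<^esub> (fam_at (X N) B \<ominus>\<^bsub>B\<^esub> l B)"]
        l(1)[OF B] fam_at_closed[OF B, of "X N"]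
      by (simp add: a_minus_def[of B "fam_at (X N) B" "fam_at (X N) B \<ominus>\<^bsub>B\<^esub> l B"] nrm_minus)
    then show "nrm B (l B) \<le> norm (X N) + 1"
      using unif[OF B N order_refl] nrm_fam_at_le[OF B, of "X N"] by (simp add: norm_fam_def)
  qed
  have "X \<longlonglongrightarrow> mk_fam l"
  proof (rule LIMSEQ_I)
    fix r :: real assume r: "0 < r"
    then obtain M where M: "\<forall>m\<ge>M. \<forall>n\<ge>M. norm (X m - X n) < r / 2" using C'[of "r/2"] by auto
    have "norm (X n - mk_fam l) \<le> r / 2" if "n \<ge> M" for n
      unfolding norm_fam_def
    proof (rule fam_norm_leI)
      fix A :: "'a cstar" assume A: "cstar_algebra A"
      show "nrm A (fam_at (X n - mk_fam l) A) \<le> r / 2"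
        unfolding fam_at_diff[OF A] L[OF A] by (rule unif[OF A M that])
    qed (use r in simp)
    then show "\<exists>no. \<forall>n\<ge>no. norm (X n - mk_fam l) < r" using r by (intro exI[of _ M]) force
  qed
  then show "convergent X" by (auto simp: convergent_def)
qed

instance fam :: (type) cstar_type
proof
  fix x y :: "'a fam" and r :: real and c d :: complex
  have "fam_at (cscale (c + d) x) A = fam_at (cscale c x + cscale d x) A"
    "fam_at (cscale c (x + y)) A = fam_at (cscale c x + cscale c y) A"
    "fam_at (cscale c x * y) A = fam_at (cscale c (x * y)) A"
    "fam_at (x * cscale c y) A = fam_at (cscale c (x * y)) A"
    "fam_at (adj (adj x)) A = fam_at x A"
    "fam_at (adj (x + y)) A = fam_at (adj x + adj y) A"
    "fam_at (adj (cscale c x)) A = fam_at (cscale (cnj c) (adj x)) A"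
    "fam_at (adj (x * y)) A = fam_at (adj y * adj x) A" if A: "cstar_algebra A" for A
    using A by (simp_all add: fam_at_simps cstar_algebra.smult_l_distr cstar_algebra.smult_r_distr
        cstar_algebra.smult_mult_left cstar_algebra.smult_mult_right cstar_algebra.star_star cstar_algebra.star_add
        cstar_algebra.star_smult cstar_algebra.star_mult)
  note * = this
  show "cscale (c + d) x = cscale c x + cscale d x" by (rule fam_eqI) (rule *)
  show "cscale c (x + y) = cscale c x + cscale c y" by (rule fam_eqI) (rule *)
  show "cscale c x * y = cscale c (x * y)" by (rule fam_eqI) (rule *)
  show "x * cscale c y = cscale c (x * y)" by (rule fam_eqI) (rule *)
  show "adj (adj x) = x" by (rule fam_eqI) (rule *)
  show "adj (x + y) = adj x + adj y" by (rule fam_eqI) (rule *)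
  show "adj (cscale c x) = cscale (cnj c) (adj x)" by (rule fam_eqI) (rule *)
  show "adj (x * y) = adj y * adj x" by (rule fam_eqI) (rule *)
  show "cscale c (cscale d x) = cscale (c * d) x" by (rule fam_cscale_cscale)
  show "cscale (complex_of_real r) x = r *\<^sub>R x" by (simp add: fam_scaleR_cscale)
  show "norm (cscale c x) = cmod c * norm x" by (rule fam_norm_cscale)
  have "norm x \<le> sqrt (norm (adj x * x))"
    unfolding norm_fam_def
  proof (rule fam_norm_leI)
    fix A :: "'a cstar" assume A: "cstar_algebra A"
    then have "(nrm A (fam_at x A))\<^sup>2 = nrm A (fam_at (adj x * x) A)"
      by (simp add: fam_at_simps cstar_algebra.cstar_identity)
    also have "\<dots> \<le> fam_norm (adj x * x)" by (rule nrm_fam_at_le[OF A])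
    finally show "nrm A (fam_at x A) \<le> sqrt (fam_norm (adj x * x))" by (rule real_le_rsqrt)
  qed (simp add: fam_norm_nonneg)
  then have "(norm x)\<^sup>2 \<le> (sqrt (norm (adj x * x)))\<^sup>2" by (intro power_mono) auto
  then show "(norm x)\<^sup>2 \<le> norm (adj x * x)" by simp
qed

section \<open>The isometric embedding of a single C*-algebra\<close>

lemma image_seqE:
  assumes "\<forall>n. z n \<in> f ` S"
  obtains s where "\<And>n. s n \<in> S" "z = (\<lambda>n. f (s n))"
proof
  show "inv_into S f (z n) \<in> S" for n using assms by (simp add: inv_into_into)
  show "z = (\<lambda>n. f (inv_into S f (z n)))" using assms by (simp add: f_inv_into_f)
qed

type_synonym 'a cst = "'a fam unitz"

text \<open>Puts \<open>a\<close> into the factor that belongs to the record \<open>A\<close> and 0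
  into all others, with scalar part 0. The unit of the ambient type never lies in the image, so 1 -
  e can be formed for elements of any algebra, with or without unit.\<close>

definition emb :: "'a cstar \<Rightarrow> 'a \<Rightarrow> 'a cst" where
  "emb A a = Uz 0 (mk_fam (\<lambda>B. if B = A then a else \<zero>\<^bsub>B\<^esub>))"

context cstar_algebra
begin

lemma cstar: "cstar_algebra A"
  by unfold_locales

definition single :: "'a \<Rightarrow> 'a fam" where
  "single a = mk_fam (\<lambda>B. if B = A then a else \<zero>\<^bsub>B\<^esub>)"

lemma fam_at_single:
  "a \<in> carrier A \<Longrightarrow> cstar_algebra B \<Longrightarrow> fam_at (single a) B = (if B = A then a else \<zero>\<^bsub>B\<^esub>)"
  unfolding single_def
  by (rule fam_at_mk_fam[where M = "nrm A a"]) (auto simp: cstar_algebra.nrm_zero cstar_zero_closed nrm_nonneg)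

lemma emb_single: "emb A a = Uz 0 (single a)"
  by (simp add: emb_def single_def)

lemma
  assumes [simp]: "x \<in> carrier A" "y \<in> carrier A"
  shows single_add: "single (x \<oplus> y) = single x + single y"
    and single_mult: "single (x \<otimes> y) = single x * single y"
    and single_smult: "single (c \<odot> x) = cscale c (single x)"
    and single_star: "single (star A x) = adj (single x)"
  by (rule fam_eqI; simp add: fam_at_single fam_at_simps m_closed smult_closed star_closed
      abelian_monoid.l_zero[OF abelian_group.axioms(1)[OF cstar_abelian_group]] cstar_zero_closed
      cstar_algebra.mult_zero_left cstar_algebra.smult_zero_right cstar_algebra.star_zero)+

lemma norm_single:
  assumes "x \<in> carrier A"
  shows "norm (single x) = nrm A x"
proof (rule antisym)
  show "norm (single x) \<le> nrm A x"
    unfolding norm_fam_def using assms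
    by (intro fam_norm_leI) (auto simp: fam_at_single nrm_nonneg cstar_algebra.nrm_zero)
  show "nrm A x \<le> norm (single x)"
    using nrm_fam_at_le[OF cstar, of "single x"] assms by (simp add: norm_fam_def fam_at_single cstar)
qed

abbreviation E where "E \<equiv> emb A"

lemma
  assumes "x \<in> carrier A" "y \<in> carrier A"
  shows emb_add: "E (x \<oplus> y) = E x + E y"
    and emb_mult: "E (x \<otimes> y) = E x * E y"
  using assms by (simp_all add: emb_single single_add single_mult unitz_ops)

lemma emb_smult: "x \<in> carrier A \<Longrightarrow> E (c \<odot> x) = cscale c (E x)"
  by (simp add: emb_single single_smult unitz_ops)

lemma emb_star: "x \<in> carrier A \<Longrightarrow> E (star A x) = adj (E x)"
  by (simp add: emb_single single_star unitz_ops)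

lemma norm_emb: "x \<in> carrier A \<Longrightarrow> norm (E x) = nrm A x"
  by (simp add: emb_single norm_single norm_Uz_el)

lemma emb_zero: "E \<zero> = 0"
  using norm_emb[of \<zero>] by (simp add: nrm_zero)

lemma emb_minus: "x \<in> carrier A \<Longrightarrow> E (\<ominus> x) = - E x"
  using emb_add[of "\<ominus> x" x] by (simp add: l_neg emb_zero eq_neg_iff_add_eq_0)

lemma emb_diff: "x \<in> carrier A \<Longrightarrow> y \<in> carrier A \<Longrightarrow> E (x \<ominus> y) = E x - E y"
  by (simp add: a_minus_def emb_add emb_minus)

lemma emb_eq_iff:
  assumes "x \<in> carrier A" "y \<in> carrier A"
  shows "E x = E y \<longleftrightarrow> x = y"
proof
  assume "E x = E y"
  then have "E (x \<ominus> y) = 0" using assms by (simp add: emb_diff)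
  then have "nrm A (x \<ominus> y) = 0" using norm_emb[of "x \<ominus> y"] assms by simp
  then have "x \<ominus> y = \<zero>" using nrm_zero_imp assms by simp
  then show "x = y" using assms by (simp only: diff_eq_zero_iff)
qed simp

lemma inj_on_emb: "inj_on E (carrier A)"
  by (simp add: inj_on_def emb_eq_iff)

lemma cs_dist_eq: "x \<in> carrier A \<Longrightarrow> y \<in> carrier A \<Longrightarrow> cs_dist A x y = dist (E x) (E y)"
  by (simp add: cs_dist_def dist_norm norm_emb flip: emb_diff)

lemma limitin_cs_top:
  "limitin (cs_top A) f l F \<longleftrightarrow> l \<in> carrier A \<and> (\<forall>\<^sub>F x in F. f x \<in> carrier A) \<and> ((\<lambda>x. E (f x)) \<longlongrightarrow> E l) F"
proof (cases "l \<in> carrier A \<and> (\<forall>\<^sub>F x in F. f x \<in> carrier A)")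
  case True
  have "(\<forall>\<^sub>F x in F. f x \<in> carrier A \<and> cs_dist A (f x) l < e) \<longleftrightarrow> (\<forall>\<^sub>F x in F. dist (E (f x)) (E l) < e)" for e
  proof (rule eventually_subst)
    from True have "\<forall>\<^sub>F x in F. f x \<in> carrier A" by simp
    then show "\<forall>\<^sub>F x in F. (f x \<in> carrier A \<and> cs_dist A (f x) l < e) = (dist (E (f x)) (E l) < e)"
      by (rule eventually_mono) (use True in \<open>simp add: cs_dist_eq\<close>)
  qed
  then show ?thesis using True
    unfolding cs_top_def metric.limitin_metric by (simp add: tendsto_iff)
next
  case False
  have "\<forall>\<^sub>F x in F. f x \<in> carrier A" if "limitin metric.mtopology f l F"
    using that unfolding metric.limitin_metric by (auto elim!: allE[of _ "1::real"] elim: eventually_mono)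
  then show ?thesis using False unfolding cs_top_def by (auto simp: metric.limitin_metric)
qed

text \<open>This is completeness of \<open>A\<close>: a convergent sequence of embedded elements is
  Cauchy in \<open>A\<close>, and the limit found there has the same image.\<close>

lemma emb_Cauchy_limit:
  assumes "\<And>n. s n \<in> carrier A" "(\<lambda>n. E (s n)) \<longlonglongrightarrow> z"
  shows "\<exists>l\<in>carrier A. z = E l"
proof -
  have C: "Cauchy (\<lambda>n. E (s n))" using assms(2) by (rule LIMSEQ_imp_Cauchy)
  have "\<exists>N. \<forall>m\<ge>N. \<forall>n\<ge>N. nrm A (s m \<ominus> s n) < e" if "0 < e" for e
    using C that assms(1) by (simp add: Cauchy_iff norm_emb flip: emb_diff)
  then obtain l where l: "l \<in> carrier A" "\<And>e. 0 < e \<Longrightarrow> \<exists>N. \<forall>n\<ge>N. nrm A (s n \<ominus> l) < e"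
    using Cauchy_imp_limit[of s] assms(1) by metis
  have "(\<lambda>n. E (s n)) \<longlonglongrightarrow> E l"
    using l assms(1) by (intro LIMSEQ_I) (simp add: norm_emb flip: emb_diff)
  then show ?thesis using assms(2) l(1) LIMSEQ_unique by blast
qed

lemma closed_emb_carrier: "closed (E ` carrier A)"
  unfolding closed_sequential_limits
proof (intro allI impI, elim conjE)
  fix z l assume z: "\<forall>n. z n \<in> E ` carrier A" and "z \<longlonglongrightarrow> l"
  from z obtain s where "\<And>n. s n \<in> carrier A" "z = (\<lambda>n. E (s n))" by (rule image_seqE) blast
  then show "l \<in> E ` carrier A" using emb_Cauchy_limit \<open>z \<longlonglongrightarrow> l\<close> by blast
qed

lemma closedin_cs_top: "closedin (cs_top A) S \<longleftrightarrow> S \<subseteq> carrier A \<and> closed (E ` S)"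
proof (cases "S \<subseteq> carrier A")
  case True
  have "closedin (cs_top A) S \<longleftrightarrow> (\<forall>\<sigma> l. range \<sigma> \<subseteq> S \<and> limitin (cs_top A) \<sigma> l sequentially \<longrightarrow> l \<in> S)"
    unfolding cs_top_def metric.metric_closedin_iff_sequentially_closed using True by simp
  also have "\<dots> \<longleftrightarrow> closed (E ` S)"
    unfolding closed_sequential_limits
  proof (intro iffI allI impI; elim conjE)
    fix z l assume cl: "\<forall>\<sigma> l. range \<sigma> \<subseteq> S \<and> limitin (cs_top A) \<sigma> l sequentially \<longrightarrow> l \<in> S"
      and z: "\<forall>n. z n \<in> E ` S" "z \<longlonglongrightarrow> l"
    from z(1) obtain s where s: "\<And>n. s n \<in> S" "z = (\<lambda>n. E (s n))" by (rule image_seqE) blast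
    then have sc: "\<And>n. s n \<in> carrier A" using True by blast
    then obtain k where k: "k \<in> carrier A" "l = E k" using emb_Cauchy_limit s z(2) by blast
    then have "limitin (cs_top A) s k sequentially" using s z(2) sc by (simp add: limitin_cs_top)
    then show "l \<in> E ` S" using cl s k by blast
  next
    fix \<sigma> l assume cl: "\<forall>z l. (\<forall>n. z n \<in> E ` S) \<and> z \<longlonglongrightarrow> l \<longrightarrow> l \<in> E ` S"
      and s: "range \<sigma> \<subseteq> S" "limitin (cs_top A) \<sigma> l sequentially"
    then have "l \<in> carrier A" "(\<lambda>n. E (\<sigma> n)) \<longlonglongrightarrow> E l" by (simp_all add: limitin_cs_top)
    moreover from this have "E l \<in> E ` S"
      using cl[rule_format, of "\<lambda>n. E (\<sigma> n)"] s(1) by blast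
    ultimately show "l \<in> S" using True emb_eq_iff by blast
  qed
  finally show ?thesis using True by simp
next
  case False
  then show ?thesis unfolding cs_top_def using closedin_subset[of metric.mtopology S] by auto
qed

lemma closure_of_cs_top:
  assumes "S \<subseteq> carrier A"
  shows "x \<in> Abstract_Topology.closure_of (cs_top A) S \<longleftrightarrow> x \<in> carrier A \<and> E x \<in> closure (E ` S)"
proof -
  have "x \<in> Abstract_Topology.closure_of (cs_top A) S \<longleftrightarrow>
      x \<in> carrier A \<and> (\<exists>s. (\<forall>n. s n \<in> S) \<and> limitin (cs_top A) s x sequentially)"
    unfolding cs_top_def metric.closure_of_sequentially using assms by (auto simp: image_subset_iff)
  also have "\<dots> \<longleftrightarrow> x \<in> carrier A \<and> (\<exists>s. (\<forall>n. s n \<in> S) \<and> (\<lambda>n. E (s n)) \<longlonglongrightarrow> E x)"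
    using assms by (auto simp: limitin_cs_top intro!: always_eventually)
  also have "\<dots> \<longleftrightarrow> x \<in> carrier A \<and> E x \<in> closure (E ` S)"
  proof -
    have "(\<exists>s. (\<forall>n. s n \<in> S) \<and> (\<lambda>n. E (s n)) \<longlonglongrightarrow> E x) \<longleftrightarrow> (\<exists>z. (\<forall>n. z n \<in> E ` S) \<and> z \<longlonglongrightarrow> E x)"
    proof safe
      fix z assume z: "\<forall>n. z n \<in> E ` S" and "z \<longlonglongrightarrow> E x"
      moreover from z obtain s where "\<And>n. s n \<in> S" "z = (\<lambda>n. E (s n))" by (rule image_seqE) blast
      ultimately show "\<exists>s. (\<forall>n. s n \<in> S) \<and> (\<lambda>n. E (s n)) \<longlonglongrightarrow> E x" by blast
    next
      fix s assume "\<forall>n. s n \<in> S" "(\<lambda>n. E (s n)) \<longlonglongrightarrow> E x"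
      then show "\<exists>z. (\<forall>n. z n \<in> E ` S) \<and> z \<longlonglongrightarrow> E x"
        by (intro exI[of _ "\<lambda>n. E (s n)"]) auto
    qed
    then show ?thesis by (simp add: closure_sequential)
  qed
  finally show ?thesis .
qed

end

lemma finsum_hom:
  fixes A :: "('a, 'm) ring_scheme" and B :: "('b, 'n) ring_scheme"
  assumes "abelian_monoid A" "abelian_monoid B" "h \<in> carrier A \<rightarrow> carrier B" "h \<zero>\<^bsub>A\<^esub> = \<zero>\<^bsub>B\<^esub>"
    and add: "\<And>x y. x \<in> carrier A \<Longrightarrow> y \<in> carrier A \<Longrightarrow> h (x \<oplus>\<^bsub>A\<^esub> y) = h x \<oplus>\<^bsub>B\<^esub> h y"
    and f: "f \<in> F \<rightarrow> carrier A"
  shows "h (finsum A f F) = (\<Oplus>\<^bsub>B\<^esub>i\<in>F. h (f i))"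
proof -
  interpret A: abelian_monoid A by fact
  interpret B: abelian_monoid B by fact
  show ?thesis using f
  proof (induction F rule: infinite_finite_induct)
    case (insert x F)
    then have "f \<in> F \<rightarrow> carrier A" "f x \<in> carrier A" by auto
    moreover from this have "finsum A f F \<in> carrier A" by simp
    moreover have "(\<lambda>i. h (f i)) \<in> F \<rightarrow> carrier B" "h (f x) \<in> carrier B" using assms(3) insert.prems by auto
    ultimately show ?case using insert by (simp add: add)
  qed (simp_all add: assms(4))
qed

context cstar_algebra
begin

lemma emb_finsum: "f \<in> F \<rightarrow> carrier A \<Longrightarrow> E (finsum A f F) = (\<Sum>i\<in>F. E (f i))"
proof (induction F rule: infinite_finite_induct)
  case (insert x F)
  then show ?case by (simp add: emb_add Pi_def)
qed (simp_all add: emb_zero)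

end

section \<open>Contractivity of *-homomorphisms\<close>

lemma star_homD:
  assumes "\<phi> \<in> star_hom A B" "x \<in> carrier A"
  shows "\<phi> x \<in> carrier B" "\<phi> (star A x) = star B (\<phi> x)" "\<phi> (c \<odot>\<^bsub>A\<^esub> x) = c \<odot>\<^bsub>B\<^esub> \<phi> x"
    and "y \<in> carrier A \<Longrightarrow> \<phi> (x \<oplus>\<^bsub>A\<^esub> y) = \<phi> x \<oplus>\<^bsub>B\<^esub> \<phi> y"
    and "y \<in> carrier A \<Longrightarrow> \<phi> (x \<otimes>\<^bsub>A\<^esub> y) = \<phi> x \<otimes>\<^bsub>B\<^esub> \<phi> y"
  using assms by (auto simp: star_hom_def)

lemma star_hom_zero:
  assumes "cstar_algebra A" "cstar_algebra B" "\<phi> \<in> star_hom A B"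
  shows "\<phi> \<zero>\<^bsub>A\<^esub> = \<zero>\<^bsub>B\<^esub>"
proof -
  have z: "\<zero>\<^bsub>A\<^esub> \<in> carrier A" using assms(1) by (rule cstar_zero_closed)
  have "\<phi> (0 \<odot>\<^bsub>A\<^esub> \<zero>\<^bsub>A\<^esub>) = 0 \<odot>\<^bsub>B\<^esub> \<phi> \<zero>\<^bsub>A\<^esub>" by (rule star_homD(3)[OF assms(3) z])
  then show ?thesis
    using cstar_algebra.smult_zero_left[OF assms(1) z]
      cstar_algebra.smult_zero_left[OF assms(2) star_homD(1)[OF assms(3) z]] by simp
qed

lemma star_hom_minus:
  assumes "cstar_algebra A" "cstar_algebra B" "\<phi> \<in> star_hom A B" "x \<in> carrier A"
  shows "\<phi> (\<ominus>\<^bsub>A\<^esub> x) = \<ominus>\<^bsub>B\<^esub> \<phi> x"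
  using star_homD(3)[OF assms(3,4), of "- 1"] cstar_algebra.smult_minus_one[OF assms(1,4)]
    cstar_algebra.smult_minus_one[OF assms(2) star_homD(1)[OF assms(3,4)]] by simp

lemma star_hom_diff:
  assumes "cstar_algebra A" "cstar_algebra B" "\<phi> \<in> star_hom A B" "x \<in> carrier A" "y \<in> carrier A"
  shows "\<phi> (x \<ominus>\<^bsub>A\<^esub> y) = \<phi> x \<ominus>\<^bsub>B\<^esub> \<phi> y"
  using star_homD(4)[OF assms(3,4) cstar_minus_closed[OF assms(1,5)]] star_hom_minus[OF assms(1-3,5)]
  by (simp add: a_minus_def)

text \<open>If \<open>\<parallel>h\<parallel> < 1\<close> for a self-adjoint \<open>h\<close>, then \<open>h\<^sup>2 + (1 - b)\<^sup>2 = 1\<close> for some self-adjoint \<open>b\<close> commuting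
  with \<open>h\<close>; this relation is preserved by homomorphisms and it implies \<open>\<parallel>h\<parallel> \<le> 1\<close>.\<close>

lemma star_hom_nrm_le_one:
  assumes A: "cstar_algebra A" and B: "cstar_algebra B" and \<phi>: "\<phi> \<in> star_hom A B"
    and h: "h \<in> carrier A" "star A h = h" "nrm A h < 1"
  shows "nrm B (\<phi> h) \<le> 1"
proof -
  interpret A: cstar_algebra A by fact
  interpret B: cstar_algebra B by fact
  \<comment> \<open>Membership in the image of \<open>A\<close> is one of the closed conditions kept
    by the iteration. The resulting equation 2 b - b b = h h contains no unit, so it can be pulled
    back to \<open>A\<close> and then transported by \<phi>.\<close>
  define S where "S = emb A ` carrier A \<inter> {b. adj b = b} \<inter> {b. emb A h * b = b * emb A h}"
  let ?k = "emb A h * emb A h"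
  have nh: "norm (emb A h) < 1" using h by (simp add: A.norm_emb)
  have "norm ?k \<le> norm (emb A h) * norm (emb A h)" by (rule norm_mult_ineq)
  also have "\<dots> < 1" using nh by (metis mult.right_neutral mult_strict_mono' norm_ge_zero)
  finally have nk: "norm ?k < 1" .
  have "\<exists>b\<in>S. norm b \<le> norm ?k \<and> b + b - b * b = ?k"
  proof (rule half_square_fixpoint[OF nk])
    show "closed S" unfolding S_def
      by (intro closed_Int A.closed_emb_carrier closed_Collect_eq continuous_intros continuous_on_adj)
    have "0 \<in> emb A ` carrier A" by (metis A.emb_zero A.zero_closed imageI)
    then show "0 \<in> S" by (simp add: S_def)
    fix b assume b: "b \<in> S"
    then obtain b0 where b0: "b0 \<in> carrier A" "b = emb A b0" and
      ab: "adj b = b" and hb: "emb A h * b = b * emb A h" unfolding S_def by blast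
    have eq: "(1/2) *\<^sub>R (?k + b * b) = emb A ((1/2) \<odot>\<^bsub>A\<^esub> (h \<otimes>\<^bsub>A\<^esub> h \<oplus>\<^bsub>A\<^esub> b0 \<otimes>\<^bsub>A\<^esub> b0))"
      using h b0 cscale_of_real[of "1/2" "emb A (h \<otimes>\<^bsub>A\<^esub> h \<oplus>\<^bsub>A\<^esub> b0 \<otimes>\<^bsub>A\<^esub> b0)"]
      by (simp add: A.emb_smult A.emb_add A.emb_mult A.m_closed)
    have ah: "adj (emb A h) = emb A h" using h A.emb_star[of h] by simp
    have "emb A h * (b * b) = b * b * emb A h" using hb by (metis mult.assoc)
    then have "emb A h * ((1/2) *\<^sub>R (?k + b * b)) = (1/2) *\<^sub>R (?k + b * b) * emb A h"
      by (simp add: distrib_left distrib_right mult.assoc)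
    moreover have "adj ((1/2) *\<^sub>R (?k + b * b)) = (1/2) *\<^sub>R (?k + b * b)"
      by (simp add: adj_scaleR adj_add adj_mult ab ah)
    moreover have "(1/2) *\<^sub>R (?k + b * b) \<in> emb A ` carrier A"
      unfolding eq using h b0 by (intro imageI A.smult_closed A.a_closed A.m_closed)
    ultimately show "(1/2) *\<^sub>R (?k + b * b) \<in> S" unfolding S_def by blast
  qed
  then obtain b where "b \<in> S" "b + b - b * b = ?k" by blast
  then obtain b0 where b0: "b0 \<in> carrier A" and "adj (emb A b0) = emb A b0"
    "emb A h * emb A b0 = emb A b0 * emb A h" and eq: "emb A b0 + emb A b0 = ?k + emb A b0 * emb A b0"
    unfolding S_def by (auto simp: algebra_simps)
  then have b0': "star A b0 = b0" "h \<otimes>\<^bsub>A\<^esub> b0 = b0 \<otimes>\<^bsub>A\<^esub> h"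
    "b0 \<oplus>\<^bsub>A\<^esub> b0 = h \<otimes>\<^bsub>A\<^esub> h \<oplus>\<^bsub>A\<^esub> b0 \<otimes>\<^bsub>A\<^esub> b0"
    using h by (simp_all add: A.m_closed A.star_closed A.emb_star A.emb_mult A.emb_add flip: A.emb_eq_iff)
  note D = star_homD[OF \<phi>]
  let ?h = "emb B (\<phi> h)" and ?b = "emb B (\<phi> b0)"
  have c: "\<phi> h \<in> carrier B" "\<phi> b0 \<in> carrier B" using D h b0 by auto
  have "adj ?h = ?h" "adj ?b = ?b" using D(2)[OF h(1)] D(2)[OF b0] b0' h c by (simp_all flip: B.emb_star)
  moreover have com: "?h * ?b = ?b * ?h"
    using D(5)[OF h(1) b0] D(5)[OF b0 h(1)] b0'(2) c by (simp flip: B.emb_mult)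
  have "\<phi> (b0 \<oplus>\<^bsub>A\<^esub> b0) = \<phi> (h \<otimes>\<^bsub>A\<^esub> h \<oplus>\<^bsub>A\<^esub> b0 \<otimes>\<^bsub>A\<^esub> b0)" by (simp only: b0'(3))
  then have "\<phi> b0 \<oplus>\<^bsub>B\<^esub> \<phi> b0 = \<phi> h \<otimes>\<^bsub>B\<^esub> \<phi> h \<oplus>\<^bsub>B\<^esub> \<phi> b0 \<otimes>\<^bsub>B\<^esub> \<phi> b0"
    using h b0 by (simp add: D A.m_closed)
  then have "emb B (\<phi> b0 \<oplus>\<^bsub>B\<^esub> \<phi> b0) = emb B (\<phi> h \<otimes>\<^bsub>B\<^esub> \<phi> h \<oplus>\<^bsub>B\<^esub> \<phi> b0 \<otimes>\<^bsub>B\<^esub> \<phi> b0)" by (rule arg_cong)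
  then have "?b + ?b = ?h * ?h + ?b * ?b"
    using c by (simp add: B.emb_add B.emb_mult B.m_closed)
  then have "?h * ?h + (1 - ?b) * (1 - ?b) = of_real (1\<^sup>2)"
    by (simp add: algebra_simps)
  moreover have "?h * (1 - ?b) = (1 - ?b) * ?h" using com by (simp add: algebra_simps)
  ultimately have "norm ?h \<le> 1" by (intro norm_le_if_sum_squares) (simp_all add: adj_diff)
  then show ?thesis using c by (simp add: B.norm_emb)
qed

text \<open>The C*-identity reduces the claim to the selfadjoint element \<open>p\<close>, and
  dividing by any t above its norm reduces that to \<open>star_hom_nrm_le_one\<close>.\<close>

lemma star_hom_nrm_le:
  assumes A: "cstar_algebra A" and B: "cstar_algebra B" and \<phi>: "\<phi> \<in> star_hom A B"
    and x: "x \<in> carrier A"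
  shows "nrm B (\<phi> x) \<le> nrm A x"
proof -
  interpret A: cstar_algebra A by fact
  interpret B: cstar_algebra B by fact
  note D = star_homD[OF \<phi>]
  define p where "p = star A x \<otimes>\<^bsub>A\<^esub> x"
  have p: "p \<in> carrier A" "star A p = p"
    using x by (simp_all add: p_def A.star_closed A.m_closed A.star_mult A.star_star)
  have "nrm B (\<phi> p) \<le> nrm A p"
  proof (rule dense_ge)
    fix t assume t: "nrm A p < t"
    then have t0: "0 < t" using A.nrm_nonneg[OF p(1)] by simp
    define h where "h = complex_of_real (1 / t) \<odot>\<^bsub>A\<^esub> p"
    have "nrm A h < 1" using t t0 p by (simp add: h_def A.nrm_smult field_simps norm_divide)
    moreover have "h \<in> carrier A" "star A h = h" using p by (simp_all add: h_def A.smult_closed A.star_smult)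
    ultimately have "nrm B (\<phi> h) \<le> 1" by (intro star_hom_nrm_le_one[OF A B \<phi>])
    then show "nrm B (\<phi> p) \<le> t" using t0 p
      by (simp add: h_def D B.nrm_smult norm_divide field_simps)
  qed
  moreover have "nrm B (\<phi> p) = (nrm B (\<phi> x))\<^sup>2"
    using x by (simp add: p_def D A.star_closed B.cstar_identity)
  moreover have "nrm A p = (nrm A x)\<^sup>2" using x by (simp add: p_def A.cstar_identity)
  ultimately have "(nrm B (\<phi> x))\<^sup>2 \<le> (nrm A x)\<^sup>2" by simp
  then show ?thesis using A.nrm_nonneg[OF x] by (rule power2_le_imp_le)
qed

section \<open>Square summable families\<close>

lemma summable_on_iff_Cauchy:
  fixes f :: "'i \<Rightarrow> 'b::banach"
  shows "f summable_on I \<longleftrightarrow>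
    (\<forall>e>0. \<exists>F0. finite F0 \<and> F0 \<subseteq> I \<and> (\<forall>F. finite F \<longrightarrow> F \<subseteq> I - F0 \<longrightarrow> norm (sum f F) < e))"
proof
  assume "f summable_on I"
  then obtain l where l: "(sum f \<longlongrightarrow> l) (finite_subsets_at_top I)" by (auto simp: summable_on_def has_sum_def)
  show "\<forall>e>0. \<exists>F0. finite F0 \<and> F0 \<subseteq> I \<and> (\<forall>F. finite F \<longrightarrow> F \<subseteq> I - F0 \<longrightarrow> norm (sum f F) < e)"
  proof (intro allI impI)
    fix e :: real assume "0 < e"
    then have "\<forall>\<^sub>F F in finite_subsets_at_top I. dist (sum f F) l < e / 2"
      using l half_gt_zero unfolding tendsto_iff by blast
    then obtain F0 where F0: "finite F0" "F0 \<subseteq> I"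
      "\<And>F. finite F \<Longrightarrow> F0 \<subseteq> F \<Longrightarrow> F \<subseteq> I \<Longrightarrow> dist (sum f F) l < e / 2"
      by (auto simp: eventually_finite_subsets_at_top)
    have "norm (sum f F) < e" if F: "finite F" "F \<subseteq> I - F0" for F
    proof -
      have "sum f (F0 \<union> F) = sum f F0 + sum f F" using F F0 by (intro sum.union_disjoint) auto
      then have "norm (sum f F) = dist (sum f (F0 \<union> F)) (sum f F0)" by (simp add: dist_norm)
      also have "\<dots> \<le> dist (sum f (F0 \<union> F)) l + dist (sum f F0) l" by (rule dist_triangle2)
      also have "\<dots> < e" using F0(3)[of "F0 \<union> F"] F0(3)[of F0] F F0(1,2) by force
      finally show ?thesis .
    qed
    then show "\<exists>F0. finite F0 \<and> F0 \<subseteq> I \<and> (\<forall>F. finite F \<longrightarrow> F \<subseteq> I - F0 \<longrightarrow> norm (sum f F) < e)"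
      using F0 by blast
  qed
next
  assume C: "\<forall>e>0. \<exists>F0. finite F0 \<and> F0 \<subseteq> I \<and> (\<forall>F. finite F \<longrightarrow> F \<subseteq> I - F0 \<longrightarrow> norm (sum f F) < e)"
  have "cauchy_filter (filtermap (sum f) (finite_subsets_at_top I))"
    unfolding cauchy_filter_metric_filtermap
  proof (intro allI impI)
    fix e :: real assume "0 < e"
    then obtain F0 where F0: "finite F0" "F0 \<subseteq> I"
      "\<And>F. finite F \<Longrightarrow> F \<subseteq> I - F0 \<Longrightarrow> norm (sum f F) < e / 2" using C by (metis half_gt_zero)
    let ?P = "\<lambda>F. finite F \<and> F0 \<subseteq> F \<and> F \<subseteq> I"
    have d: "dist (sum f F) (sum f F0) < e / 2" if "?P F" for F
    proof -
      have "sum f F = sum f F0 + sum f (F - F0)" using that F0 by (metis sum.subset_diff add.commute)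
      then show ?thesis using F0(3)[of "F - F0"] that by (simp add: dist_norm Diff_mono)
    qed
    have ev: "eventually ?P (finite_subsets_at_top I)"
      unfolding eventually_finite_subsets_at_top using F0(1,2) by blast
    show "\<exists>P. eventually P (finite_subsets_at_top I) \<and>
        (\<forall>x y. P x \<and> P y \<longrightarrow> dist (sum f x) (sum f y) < e)"
    proof (intro exI[of _ ?P] conjI[OF ev] allI impI, elim conjE)
      fix F F' assume "finite F" "F0 \<subseteq> F" "F \<subseteq> I" "finite F'" "F0 \<subseteq> F'" "F' \<subseteq> I"
      then show "dist (sum f F) (sum f F') < e"
        using d[of F] d[of F'] dist_triangle2[of "sum f F" "sum f F'" "sum f F0"] by simp
    qed
  qed
  then obtain l where "filtermap (sum f) (finite_subsets_at_top I) \<le> nhds l"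
    using cauchy_filter_complete_converges[of "filtermap (sum f) (finite_subsets_at_top I)" UNIV]
      complete_UNIV by (auto simp: filtermap_bot_iff)
  then show "f summable_on I" by (auto simp: summable_on_def has_sum_def filterlim_def)
qed

lemma infsum_bounded_linear':
  assumes "bounded_linear h" "f summable_on I"
  shows "infsum (\<lambda>i. h (f i)) I = h (infsum f I)"
  using has_sum_bounded_linear[OF assms(1) has_sum_infsum[OF assms(2)]]
  by (intro infsumI) (simp add: comp_def)

text \<open>By Kaplansky's theorem every term is positive, so the partial sums increase in the order
  and hence in norm.\<close>

lemma norm_sum_sq_mono:
  fixes \<xi> :: "'i \<Rightarrow> 'u::ucstar"
  assumes "F \<subseteq> F'" "finite F'"
  shows "norm (\<Sum>i\<in>F. adj (\<xi> i) * \<xi> i) \<le> norm (\<Sum>i\<in>F'. adj (\<xi> i) * \<xi> i)"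
proof (rule norm_mono_pos)
  have "(\<Sum>i\<in>F'. adj (\<xi> i) * \<xi> i) - (\<Sum>i\<in>F. adj (\<xi> i) * \<xi> i) = (\<Sum>i\<in>F' - F. adj (\<xi> i) * \<xi> i)"
    using assms by (simp add: sum_diff)
  then show "pos ((\<Sum>i\<in>F'. adj (\<xi> i) * \<xi> i) - (\<Sum>i\<in>F. adj (\<xi> i) * \<xi> i))"
    by (simp add: pos_sum pos_adj_mult)
qed (simp add: pos_sum pos_adj_mult)

text \<open>Each term \<xi>_i^* (M^2 - x_i^* x_i) \<xi>_i is positive by \<open>pos_conj\<close>;
  summation compares the two sums in the order and therefore in norm.\<close>

lemma norm_sum_weighted_le:
  fixes \<xi> x :: "'i \<Rightarrow> 'u::ucstar"
  assumes "\<And>i. i \<in> F \<Longrightarrow> norm (x i) \<le> M"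
  shows "norm (\<Sum>i\<in>F. adj (x i * \<xi> i) * (x i * \<xi> i)) \<le> M\<^sup>2 * norm (\<Sum>i\<in>F. adj (\<xi> i) * \<xi> i)"
proof -
  have "pos (adj (\<xi> i) * (of_real (M\<^sup>2) - adj (x i) * x i) * \<xi> i)" if "i \<in> F" for i
    using assms[OF that] by (intro pos_conj pos_norm_diff) (simp_all add: adj_mult norm_adj_mult power_mono)
  then have "pos (\<Sum>i\<in>F. adj (\<xi> i) * (of_real (M\<^sup>2) - adj (x i) * x i) * \<xi> i)" by (rule pos_sum)
  moreover have "(\<Sum>i\<in>F. adj (\<xi> i) * (of_real (M\<^sup>2) - adj (x i) * x i) * \<xi> i) =
      M\<^sup>2 *\<^sub>R (\<Sum>i\<in>F. adj (\<xi> i) * \<xi> i) - (\<Sum>i\<in>F. adj (x i * \<xi> i) * (x i * \<xi> i))"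
    by (simp add: of_real_def scaleR_sum_right adj_mult algebra_simps sum_subtractf mult.assoc del: of_real_power)
  ultimately have "norm (\<Sum>i\<in>F. adj (x i * \<xi> i) * (x i * \<xi> i)) \<le> norm (M\<^sup>2 *\<^sub>R (\<Sum>i\<in>F. adj (\<xi> i) * \<xi> i))"
    by (intro norm_mono_pos) (simp_all add: pos_sum pos_adj_mult)
  then show ?thesis by simp
qed

text \<open>For t > norm P, expand the inner product of \<xi> a / t - \<eta> with itself, a positive
  element. Since a^* P a <= t a^* a, it is dominated by Q - a^* a / t. Monotonicity of the norm
  bounds \<open>norm a\<close> squared by t times \<open>norm Q\<close>, and t may decrease to
  \<open>norm P\<close>.\<close>

lemma sum_Cauchy_Schwarz:
  fixes \<xi> \<eta> :: "'i \<Rightarrow> 'u::ucstar"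
  shows "(norm (\<Sum>i\<in>F. adj (\<xi> i) * \<eta> i))\<^sup>2 \<le>
    norm (\<Sum>i\<in>F. adj (\<xi> i) * \<xi> i) * norm (\<Sum>i\<in>F. adj (\<eta> i) * \<eta> i)"
proof -
  define P where "P = (\<Sum>i\<in>F. adj (\<xi> i) * \<xi> i)"
  define Q where "Q = (\<Sum>i\<in>F. adj (\<eta> i) * \<eta> i)"
  define a where "a = (\<Sum>i\<in>F. adj (\<xi> i) * \<eta> i)"
  have pos: "pos P" "pos Q" by (simp_all add: P_def Q_def pos_sum pos_adj_mult)
  have aa: "adj a = (\<Sum>i\<in>F. adj (\<eta> i) * \<xi> i)" by (simp add: a_def adj_sum adj_mult)
  have le: "(norm a)\<^sup>2 \<le> t * norm Q" if t: "norm P < t" for t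
  proof -
    have t0: "0 < t" using t norm_ge_zero[of P] by linarith
    define r where "r = 1 / t"
    have "pos (\<Sum>i\<in>F. adj (r *\<^sub>R (\<xi> i * a) - \<eta> i) * (r *\<^sub>R (\<xi> i * a) - \<eta> i))"
      by (intro pos_sum pos_adj_mult)
    also have "(\<Sum>i\<in>F. adj (r *\<^sub>R (\<xi> i * a) - \<eta> i) * (r *\<^sub>R (\<xi> i * a) - \<eta> i)) =
      (\<Sum>i\<in>F. (r * r) *\<^sub>R (adj a * (adj (\<xi> i) * \<xi> i) * a) - r *\<^sub>R (adj a * (adj (\<xi> i) * \<eta> i))
        - r *\<^sub>R (adj (\<eta> i) * \<xi> i * a) + adj (\<eta> i) * \<eta> i)"
      by (intro sum.cong refl) (simp add: adj_diff adj_scaleR adj_mult algebra_simps mult.assoc)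
    also have "\<dots> = (r * r) *\<^sub>R (adj a * P * a) - r *\<^sub>R (adj a * a) - r *\<^sub>R (adj a * a) + Q"
      by (simp add: sum.distrib sum_subtractf P_def Q_def aa[symmetric]
          flip: scaleR_sum_right sum_distrib_left sum_distrib_right a_def)
    finally have 1: "pos ((r * r) *\<^sub>R (adj a * P * a) - r *\<^sub>R (adj a * a) - r *\<^sub>R (adj a * a) + Q)" .
    have "pos ((r * r) *\<^sub>R (adj a * (of_real t - P) * a))"
      using t t0 by (intro pos_scaleR pos_conj pos_norm_diff pos_adj pos) (auto simp: r_def)
    moreover have "(r * r) *\<^sub>R (adj a * (of_real t - P) * a) = r *\<^sub>R (adj a * a) - (r * r) *\<^sub>R (adj a * P * a)"
      using t0 by (simp add: of_real_def r_def algebra_simps)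
    ultimately have 2: "pos (r *\<^sub>R (adj a * a) - (r * r) *\<^sub>R (adj a * P * a))" by simp
    have "pos (Q - r *\<^sub>R (adj a * a))" using pos_add[OF 1 2] by (simp add: algebra_simps)
    then have "norm (r *\<^sub>R (adj a * a)) \<le> norm Q"
      using t0 by (intro norm_mono_pos pos_scaleR pos_adj_mult) (auto simp: r_def)
    then show ?thesis using t0 by (simp add: r_def norm_adj_mult field_simps)
  qed
  have "(norm a)\<^sup>2 \<le> norm P * norm Q"
  proof (cases "norm Q = 0")
    case True
    then show ?thesis using le[of "norm P + 1"] by simp
  next
    case False
    then have q: "0 < norm Q" by simp
    have "(norm a)\<^sup>2 / norm Q \<le> norm P"
      by (rule dense_ge) (use le q in \<open>simp add: divide_le_eq\<close>)
    then show ?thesis using q by (simp add: divide_le_eq)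
  qed
  then show ?thesis by (simp add: a_def P_def Q_def)
qed

text \<open>Norm convergence of the algebra-valued series, as in the standard Hilbert module;
  summability of the squared norms of the terms would be a stronger requirement.\<close>

definition sq_summable :: "'i set \<Rightarrow> ('i \<Rightarrow> 'u::ucstar) \<Rightarrow> bool" where
  "sq_summable I \<xi> \<longleftrightarrow> (\<lambda>i. adj (\<xi> i) * \<xi> i) summable_on I"

definition ip :: "'i set \<Rightarrow> ('i \<Rightarrow> 'u::ucstar) \<Rightarrow> ('i \<Rightarrow> 'u) \<Rightarrow> 'u" where
  "ip I \<xi> \<eta> = (\<Sum>\<^sub>\<infinity>i\<in>I. adj (\<xi> i) * \<eta> i)"

definition hnorm :: "'i set \<Rightarrow> ('i \<Rightarrow> 'u::ucstar) \<Rightarrow> real" where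
  "hnorm I \<xi> = sqrt (norm (ip I \<xi> \<xi>))"

lemma hnorm_nonneg [simp]: "0 \<le> hnorm I \<xi>"
  by (simp add: hnorm_def)

lemma hnorm_power2: "(hnorm I \<xi>)\<^sup>2 = norm (ip I \<xi> \<xi>)"
  by (simp add: hnorm_def)

lemma ip_cong: "(\<And>i. i \<in> I \<Longrightarrow> \<xi> i = \<xi>' i) \<Longrightarrow> (\<And>i. i \<in> I \<Longrightarrow> \<eta> i = \<eta>' i) \<Longrightarrow> ip I \<xi> \<eta> = ip I \<xi>' \<eta>'"
  unfolding ip_def by (rule infsum_cong) simp

lemma hnorm_cong: "(\<And>i. i \<in> I \<Longrightarrow> \<xi> i = \<xi>' i) \<Longrightarrow> hnorm I \<xi> = hnorm I \<xi>'"
  unfolding hnorm_def by (simp cong: ip_cong)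

lemma sq_summable_cong: "(\<And>i. i \<in> I \<Longrightarrow> \<xi> i = \<xi>' i) \<Longrightarrow> sq_summable I \<xi> \<longleftrightarrow> sq_summable I \<xi>'"
  unfolding sq_summable_def by (rule summable_on_cong) simp

text \<open>Cauchy-Schwarz is applied to finite sets that avoid the indices needed to make both
  tails small.\<close>

lemma ip_summable:
  assumes "sq_summable I \<xi>" "sq_summable I \<eta>"
  shows "(\<lambda>i. adj (\<xi> i) * \<eta> i) summable_on I"
  unfolding summable_on_iff_Cauchy
proof (intro allI impI)
  fix e :: real assume e: "0 < e"
  obtain F1 where F1: "finite F1" "F1 \<subseteq> I"
    "\<And>F. finite F \<Longrightarrow> F \<subseteq> I - F1 \<Longrightarrow> norm (\<Sum>i\<in>F. adj (\<xi> i) * \<xi> i) < e"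
    using assms(1) e unfolding sq_summable_def summable_on_iff_Cauchy by metis
  obtain F2 where F2: "finite F2" "F2 \<subseteq> I"
    "\<And>F. finite F \<Longrightarrow> F \<subseteq> I - F2 \<Longrightarrow> norm (\<Sum>i\<in>F. adj (\<eta> i) * \<eta> i) < e"
    using assms(2) e unfolding sq_summable_def summable_on_iff_Cauchy by metis
  have "norm (\<Sum>i\<in>F. adj (\<xi> i) * \<eta> i) < e" if F: "finite F" "F \<subseteq> I - (F1 \<union> F2)" for F
  proof -
    have "(norm (\<Sum>i\<in>F. adj (\<xi> i) * \<eta> i))\<^sup>2 \<le>
        norm (\<Sum>i\<in>F. adj (\<xi> i) * \<xi> i) * norm (\<Sum>i\<in>F. adj (\<eta> i) * \<eta> i)" by (rule sum_Cauchy_Schwarz)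
    also have "\<dots> < e * e" using F F1(3)[of F] F2(3)[of F] e by (intro mult_strict_mono) auto
    finally show ?thesis using e by (simp add: power2_eq_square[symmetric] power_less_imp_less_base)
  qed
  then show "\<exists>F0. finite F0 \<and> F0 \<subseteq> I \<and> (\<forall>F. finite F \<longrightarrow> F \<subseteq> I - F0 \<longrightarrow> norm (\<Sum>i\<in>F. adj (\<xi> i) * \<eta> i) < e)"
    using F1 F2 by (intro exI[of _ "F1 \<union> F2"]) auto
qed

lemma ip_tendsto:
  "sq_summable I \<xi> \<Longrightarrow> sq_summable I \<eta> \<Longrightarrow>
    ((\<lambda>F. \<Sum>i\<in>F. adj (\<xi> i) * \<eta> i) \<longlongrightarrow> ip I \<xi> \<eta>) (finite_subsets_at_top I)"
  unfolding ip_def by (intro infsum_tendsto ip_summable)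

lemma norm_sum_sq_le:
  assumes "sq_summable I \<xi>" "finite F" "F \<subseteq> I"
  shows "norm (\<Sum>i\<in>F. adj (\<xi> i) * \<xi> i) \<le> (hnorm I \<xi>)\<^sup>2"
  unfolding hnorm_power2
proof (rule tendsto_lowerbound[OF tendsto_norm[OF ip_tendsto[OF assms(1,1)]]])
  show "\<forall>\<^sub>F F' in finite_subsets_at_top I.
      norm (\<Sum>i\<in>F. adj (\<xi> i) * \<xi> i) \<le> norm (\<Sum>i\<in>F'. adj (\<xi> i) * \<xi> i)"
    unfolding eventually_finite_subsets_at_top using assms
    by (intro exI[of _ F]) (simp add: norm_sum_sq_mono)
qed simp

lemma norm_le_hnorm:
  assumes "sq_summable I \<xi>" "i \<in> I"
  shows "norm (\<xi> i) \<le> hnorm I \<xi>"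
  using norm_sum_sq_le[OF assms(1), of "{i}"] assms(2)
  by (intro power2_le_imp_le[OF _ hnorm_nonneg]) (simp add: norm_adj_mult)

lemma hnorm_leI:
  assumes "sq_summable I \<xi>" "0 \<le> K"
    and "\<And>F. finite F \<Longrightarrow> F \<subseteq> I \<Longrightarrow> norm (\<Sum>i\<in>F. adj (\<xi> i) * \<xi> i) \<le> K\<^sup>2"
  shows "hnorm I \<xi> \<le> K"
proof -
  have "(hnorm I \<xi>)\<^sup>2 \<le> K\<^sup>2"
    unfolding hnorm_power2
  proof (rule tendsto_upperbound[OF tendsto_norm[OF ip_tendsto[OF assms(1,1)]]])
    show "\<forall>\<^sub>F F in finite_subsets_at_top I. norm (\<Sum>i\<in>F. adj (\<xi> i) * \<xi> i) \<le> K\<^sup>2"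
      using assms(3) by (rule eventually_finite_subsets_at_top_weakI)
  qed simp
  then show ?thesis using assms(2) by (rule power2_le_imp_le)
qed

lemma norm_ip_le:
  assumes "sq_summable I \<xi>" "sq_summable I \<eta>"
  shows "norm (ip I \<xi> \<eta>) \<le> hnorm I \<xi> * hnorm I \<eta>"
proof (rule tendsto_upperbound[OF tendsto_norm[OF ip_tendsto[OF assms]]])
  show "\<forall>\<^sub>F F in finite_subsets_at_top I. norm (\<Sum>i\<in>F. adj (\<xi> i) * \<eta> i) \<le> hnorm I \<xi> * hnorm I \<eta>"
  proof (rule eventually_finite_subsets_at_top_weakI)
    fix F assume F: "finite F" "F \<subseteq> I"
    have "(norm (\<Sum>i\<in>F. adj (\<xi> i) * \<eta> i))\<^sup>2 \<le> (hnorm I \<xi>)\<^sup>2 * (hnorm I \<eta>)\<^sup>2"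
      by (rule order_trans[OF sum_Cauchy_Schwarz]) (intro mult_mono norm_sum_sq_le assms F, simp_all)
    then have "(norm (\<Sum>i\<in>F. adj (\<xi> i) * \<eta> i))\<^sup>2 \<le> (hnorm I \<xi> * hnorm I \<eta>)\<^sup>2"
      by (simp only: power_mult_distrib)
    then show "norm (\<Sum>i\<in>F. adj (\<xi> i) * \<eta> i) \<le> hnorm I \<xi> * hnorm I \<eta>"
      by (rule power2_le_imp_le) simp
  qed
qed simp

lemma sq_summable_add:
  assumes "sq_summable I \<xi>" "sq_summable I \<eta>"
  shows "sq_summable I (\<lambda>i. \<xi> i + \<eta> i)"
proof -
  have "(\<lambda>i. (adj (\<xi> i) * \<xi> i + adj (\<xi> i) * \<eta> i) + (adj (\<eta> i) * \<xi> i + adj (\<eta> i) * \<eta> i)) summable_on I"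
    by (intro summable_on_add ip_summable assms)
  then show ?thesis unfolding sq_summable_def by (simp add: adj_add algebra_simps)
qed

lemma sq_summable_cscale:
  assumes "sq_summable I \<xi>"
  shows "sq_summable I (\<lambda>i. cscale c (\<xi> i))"
  using summable_on_bounded_linear[OF bounded_linear_cscale[of "c * cnj c"] assms[unfolded sq_summable_def]]
  unfolding sq_summable_def by (simp add: adj_cscale cscale_mult_left cscale_mult_right)

lemma sq_summable_mult_right:
  assumes "sq_summable I \<xi>"
  shows "sq_summable I (\<lambda>i. \<xi> i * a)"
proof -
  have "bounded_linear (\<lambda>x. adj a * x * a)"
    by (rule bounded_linear_compose[OF bounded_linear_mult_left bounded_linear_mult_right])
  from summable_on_bounded_linear[OF this assms[unfolded sq_summable_def]]
  show ?thesis unfolding sq_summable_def by (simp add: adj_mult mult.assoc)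
qed

lemma sq_summable_minus: "sq_summable I \<xi> \<Longrightarrow> sq_summable I (\<lambda>i. - \<xi> i)"
  unfolding sq_summable_def by (simp add: adj_minus)

lemma sq_summable_diff: "sq_summable I \<xi> \<Longrightarrow> sq_summable I \<eta> \<Longrightarrow> sq_summable I (\<lambda>i. \<xi> i - \<eta> i)"
  using sq_summable_add[of I \<xi> "\<lambda>i. - \<eta> i"] sq_summable_minus[of I \<eta>] by simp

lemma sq_summable_finite_support:
  assumes "finite {i \<in> I. \<xi> i \<noteq> 0}"
  shows "sq_summable I \<xi>"
  unfolding sq_summable_def
proof (rule summable_on_cong_neutral[THEN iffD1])
  show "(\<lambda>i. adj (\<xi> i) * \<xi> i) summable_on {i \<in> I. \<xi> i \<noteq> 0}" using assms by (rule summable_on_finite)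
qed auto

lemma sq_summable_weighted:
  assumes "sq_summable I \<xi>" and x: "\<And>i. i \<in> I \<Longrightarrow> norm (x i) \<le> M"
  shows "sq_summable I (\<lambda>i. x i * \<xi> i)"
  unfolding sq_summable_def summable_on_iff_Cauchy
proof (intro allI impI)
  fix e :: real assume "0 < e"
  \<comment> \<open>The summand 1 keeps \<open>K\<close> positive, so that e / K is an admissible
    tolerance even for M = 0.\<close>
  define K where "K = M\<^sup>2 + 1"
  have K: "0 < K" by (simp add: K_def add_nonneg_pos)
  with \<open>0 < e\<close> have "0 < e / K" by simp
  then obtain F0 where F0: "finite F0" "F0 \<subseteq> I"
    "\<And>F. finite F \<Longrightarrow> F \<subseteq> I - F0 \<Longrightarrow> norm (\<Sum>i\<in>F. adj (\<xi> i) * \<xi> i) < e / K"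
    using assms(1) unfolding sq_summable_def summable_on_iff_Cauchy by metis
  have "norm (\<Sum>i\<in>F. adj (x i * \<xi> i) * (x i * \<xi> i)) < e" if F: "finite F" "F \<subseteq> I - F0" for F
  proof -
    have "norm (\<Sum>i\<in>F. adj (x i * \<xi> i) * (x i * \<xi> i)) \<le> M\<^sup>2 * norm (\<Sum>i\<in>F. adj (\<xi> i) * \<xi> i)"
      using F x by (intro norm_sum_weighted_le) auto
    also have "\<dots> \<le> K * norm (\<Sum>i\<in>F. adj (\<xi> i) * \<xi> i)" by (intro mult_right_mono) (auto simp: K_def)
    also have "\<dots> < e" using F0(3)[OF F] K by (simp add: field_simps)
    finally show ?thesis .
  qed
  then show "\<exists>F0. finite F0 \<and> F0 \<subseteq> I \<and>
      (\<forall>F. finite F \<longrightarrow> F \<subseteq> I - F0 \<longrightarrow> norm (\<Sum>i\<in>F. adj (x i * \<xi> i) * (x i * \<xi> i)) < e)"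
    using F0 by blast
qed

lemma hnorm_weighted_le:
  assumes "sq_summable I \<xi>" and x: "\<And>i. i \<in> I \<Longrightarrow> norm (x i) \<le> M" and M: "0 \<le> M"
  shows "hnorm I (\<lambda>i. x i * \<xi> i) \<le> M * hnorm I \<xi>"
proof (rule hnorm_leI)
  show "sq_summable I (\<lambda>i. x i * \<xi> i)" using assms by (intro sq_summable_weighted)
  fix F assume F: "finite F" "F \<subseteq> I"
  have "norm (\<Sum>i\<in>F. adj (x i * \<xi> i) * (x i * \<xi> i)) \<le> M\<^sup>2 * norm (\<Sum>i\<in>F. adj (\<xi> i) * \<xi> i)"
    using F x by (intro norm_sum_weighted_le) auto
  also have "\<dots> \<le> M\<^sup>2 * (hnorm I \<xi>)\<^sup>2" by (intro mult_left_mono norm_sum_sq_le assms F) auto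
  finally show "norm (\<Sum>i\<in>F. adj (x i * \<xi> i) * (x i * \<xi> i)) \<le> (M * hnorm I \<xi>)\<^sup>2"
    by (simp add: power_mult_distrib)
qed (use M in simp)

lemma ip_add_right:
  "sq_summable I \<xi> \<Longrightarrow> sq_summable I \<eta> \<Longrightarrow> sq_summable I \<zeta> \<Longrightarrow> ip I \<xi> (\<lambda>i. \<eta> i + \<zeta> i) = ip I \<xi> \<eta> + ip I \<xi> \<zeta>"
  unfolding ip_def by (simp add: distrib_left infsum_add ip_summable)

lemma ip_adj: "sq_summable I \<xi> \<Longrightarrow> sq_summable I \<eta> \<Longrightarrow> adj (ip I \<xi> \<eta>) = ip I \<eta> \<xi>"
  using infsum_bounded_linear'[OF bounded_linear_adj ip_summable, of I \<xi> \<eta>]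
  by (simp add: ip_def adj_mult)

lemma ip_add_left:
  "sq_summable I \<xi> \<Longrightarrow> sq_summable I \<eta> \<Longrightarrow> sq_summable I \<zeta> \<Longrightarrow> ip I (\<lambda>i. \<eta> i + \<zeta> i) \<xi> = ip I \<eta> \<xi> + ip I \<zeta> \<xi>"
  unfolding ip_def by (simp add: adj_add distrib_right infsum_add ip_summable)

lemma ip_cscale_right:
  "sq_summable I \<xi> \<Longrightarrow> sq_summable I \<eta> \<Longrightarrow> ip I \<xi> (\<lambda>i. cscale c (\<eta> i)) = cscale c (ip I \<xi> \<eta>)"
  using infsum_bounded_linear'[OF bounded_linear_cscale ip_summable, of I \<xi> \<eta> c]
  by (simp add: ip_def cscale_mult_right)

lemma ip_cscale_left:
  "sq_summable I \<xi> \<Longrightarrow> sq_summable I \<eta> \<Longrightarrow> ip I (\<lambda>i. cscale c (\<xi> i)) \<eta> = cscale (cnj c) (ip I \<xi> \<eta>)"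
  using infsum_bounded_linear'[OF bounded_linear_cscale ip_summable, of I \<xi> \<eta> "cnj c"]
  by (simp add: ip_def adj_cscale cscale_mult_left)

lemma ip_mult_right:
  "sq_summable I \<xi> \<Longrightarrow> sq_summable I \<eta> \<Longrightarrow> ip I \<xi> (\<lambda>i. \<eta> i * a) = ip I \<xi> \<eta> * a"
  using infsum_bounded_linear'[OF bounded_linear_mult_left ip_summable, of I \<xi> \<eta> a]
  by (simp add: ip_def mult.assoc)

lemma ip_mult_left:
  "sq_summable I \<xi> \<Longrightarrow> sq_summable I \<eta> \<Longrightarrow> ip I (\<lambda>i. \<xi> i * a) \<eta> = adj a * ip I \<xi> \<eta>"
  using infsum_bounded_linear'[OF bounded_linear_mult_right ip_summable, of I \<xi> \<eta> "adj a"]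
  by (simp add: ip_def adj_mult mult.assoc)

lemma hnorm_cscale: "sq_summable I \<xi> \<Longrightarrow> hnorm I (\<lambda>i. cscale c (\<xi> i)) = cmod c * hnorm I \<xi>"
  unfolding hnorm_def
  by (simp add: ip_cscale_left ip_cscale_right sq_summable_cscale norm_cscale norm_mult real_sqrt_mult)

lemma hnorm_minus: "hnorm I (\<lambda>i. - \<xi> i) = hnorm I \<xi>"
  unfolding hnorm_def ip_def by (simp add: adj_minus)

lemma hnorm_triangle:
  assumes "sq_summable I \<xi>" "sq_summable I \<eta>"
  shows "hnorm I (\<lambda>i. \<xi> i + \<eta> i) \<le> hnorm I \<xi> + hnorm I \<eta>"
proof (rule power2_le_imp_le)
  note s = assms sq_summable_add[OF assms]
  have "ip I (\<lambda>i. \<xi> i + \<eta> i) (\<lambda>i. \<xi> i + \<eta> i) = (ip I \<xi> \<xi> + ip I \<eta> \<xi>) + (ip I \<xi> \<eta> + ip I \<eta> \<eta>)"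
    by (simp add: ip_add_right ip_add_left s)
  also have "norm \<dots> \<le> (norm (ip I \<xi> \<xi>) + norm (ip I \<eta> \<xi>)) + (norm (ip I \<xi> \<eta>) + norm (ip I \<eta> \<eta>))"
    by (intro norm_triangle_mono norm_triangle_ineq)
  also have "\<dots> \<le> ((hnorm I \<xi>)\<^sup>2 + hnorm I \<eta> * hnorm I \<xi>) + (hnorm I \<xi> * hnorm I \<eta> + (hnorm I \<eta>)\<^sup>2)"
    by (intro add_mono norm_ip_le assms) (simp_all add: hnorm_power2)
  also have "\<dots> = (hnorm I \<xi> + hnorm I \<eta>)\<^sup>2" by (simp add: power2_eq_square algebra_simps)
  finally show "(hnorm I (\<lambda>i. \<xi> i + \<eta> i))\<^sup>2 \<le> (hnorm I \<xi> + hnorm I \<eta>)\<^sup>2" by (simp only: hnorm_power2)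
qed simp

lemma hnorm_diff_triangle:
  assumes "sq_summable I \<xi>" "sq_summable I \<eta>"
  shows "hnorm I (\<lambda>i. \<xi> i - \<eta> i) \<le> hnorm I \<xi> + hnorm I \<eta>"
  using hnorm_triangle[OF assms(1) sq_summable_minus[OF assms(2)]] by (simp add: hnorm_minus)

lemma hnorm_eq_0:
  assumes "sq_summable I \<xi>" "hnorm I \<xi> = 0" "i \<in> I"
  shows "\<xi> i = 0"
  using norm_le_hnorm[OF assms(1,3)] assms(2) by simp

lemma hnorm_truncation:
  assumes \<xi>: "sq_summable I \<xi>" and e: "0 < e"
  obtains F where "finite F" "F \<subseteq> I" "hnorm I (\<lambda>i. if i \<in> F then 0 else \<xi> i) \<le> e"
proof -
  have "0 < e\<^sup>2" using e by simp
  then obtain F0 where F0: "finite F0" "F0 \<subseteq> I"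
    "\<And>F. finite F \<Longrightarrow> F \<subseteq> I - F0 \<Longrightarrow> norm (\<Sum>i\<in>F. adj (\<xi> i) * \<xi> i) < e\<^sup>2"
    using \<xi> unfolding sq_summable_def summable_on_iff_Cauchy by metis
  have eq: "(\<lambda>i. if i \<in> F0 then 0 else \<xi> i) = (\<lambda>i. (if i \<in> F0 then 0 else 1) * \<xi> i)" by auto
  have "hnorm I (\<lambda>i. if i \<in> F0 then 0 else \<xi> i) \<le> e"
  proof (rule hnorm_leI)
    show "sq_summable I (\<lambda>i. if i \<in> F0 then 0 else \<xi> i)"
      unfolding eq by (rule sq_summable_weighted[OF \<xi>, of _ 1]) auto
    fix F assume F: "finite F" "F \<subseteq> I"
    let ?\<zeta> = "\<lambda>i. if i \<in> F0 then 0 else \<xi> i"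
    have "(\<Sum>i\<in>F. adj (?\<zeta> i) * ?\<zeta> i) = (\<Sum>i\<in>F - F0. adj (\<xi> i) * \<xi> i)"
      using F by (intro sum.mono_neutral_cong_right) auto
    then show "norm (\<Sum>i\<in>F. adj (?\<zeta> i) * ?\<zeta> i) \<le> e\<^sup>2"
      using F0(3)[of "F - F0"] F by (simp add: Diff_mono)
  qed (use e in simp)
  then show ?thesis using that F0 by blast
qed

text \<open>The limit is given coordinatewise, and finite sums pass to it, which is the Fatou-type
  estimate \<open>fin\<close>. The second conclusion retains the \<open>e\<close> and
  \<open>N\<close> of the hypothesis on differences, so that rates of convergence survive.\<close>

lemma hnorm_complete:
  fixes \<xi> :: "nat \<Rightarrow> 'i \<Rightarrow> 'u::ucstar"
  assumes \<xi>: "\<And>n. sq_summable I (\<xi> n)"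
    and C: "\<And>e. 0 < e \<Longrightarrow> \<exists>N. \<forall>m\<ge>N. \<forall>n\<ge>N. hnorm I (\<lambda>i. \<xi> m i - \<xi> n i) < e"
    and lim: "\<And>i. i \<in> I \<Longrightarrow> (\<lambda>n. \<xi> n i) \<longlonglongrightarrow> \<eta> i"
  shows "sq_summable I \<eta>" "\<And>e N. 0 \<le> e \<Longrightarrow> (\<And>m n. m \<ge> N \<Longrightarrow> n \<ge> N \<Longrightarrow> hnorm I (\<lambda>i. \<xi> m i - \<xi> n i) \<le> e) \<Longrightarrow>
      n \<ge> N \<Longrightarrow> hnorm I (\<lambda>i. \<xi> n i - \<eta> i) \<le> e"
proof -
  have fin: "norm (\<Sum>i\<in>F. adj (\<xi> n i - \<eta> i) * (\<xi> n i - \<eta> i)) \<le> e\<^sup>2"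
    if N: "\<And>m n. m \<ge> N \<Longrightarrow> n \<ge> N \<Longrightarrow> hnorm I (\<lambda>i. \<xi> m i - \<xi> n i) \<le> e" and "n \<ge> N" "finite F" "F \<subseteq> I" for F n N e
  proof (rule Lim_bounded)
    show "(\<lambda>m. norm (\<Sum>i\<in>F. adj (\<xi> n i - \<xi> m i) * (\<xi> n i - \<xi> m i))) \<longlonglongrightarrow>
        norm (\<Sum>i\<in>F. adj (\<xi> n i - \<eta> i) * (\<xi> n i - \<eta> i))"
      using that by (intro tendsto_intros tendsto_adj lim) auto
    show "\<forall>m\<ge>N. norm (\<Sum>i\<in>F. adj (\<xi> n i - \<xi> m i) * (\<xi> n i - \<xi> m i)) \<le> e\<^sup>2"
    proof (intro allI impI)
      fix m assume "m \<ge> N"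
      have "norm (\<Sum>i\<in>F. adj (\<xi> n i - \<xi> m i) * (\<xi> n i - \<xi> m i)) \<le> (hnorm I (\<lambda>i. \<xi> n i - \<xi> m i))\<^sup>2"
        using that by (intro norm_sum_sq_le sq_summable_diff \<xi>)
      also have "\<dots> \<le> e\<^sup>2" using N \<open>n \<ge> N\<close> \<open>m \<ge> N\<close> by (intro power_mono) auto
      finally show "norm (\<Sum>i\<in>F. adj (\<xi> n i - \<xi> m i) * (\<xi> n i - \<xi> m i)) \<le> e\<^sup>2" .
    qed
  qed
  have diff: "sq_summable I (\<lambda>i. \<xi> N i - \<eta> i) \<Longrightarrow> sq_summable I \<eta>" for N
    using sq_summable_diff[OF \<xi>[of N], of "\<lambda>i. \<xi> N i - \<eta> i"] by simp
  show \<eta>: "sq_summable I \<eta>"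
    unfolding sq_summable_def summable_on_iff_Cauchy
  proof (intro allI impI)
    fix e :: real assume e: "0 < e"
    \<comment> \<open>Two terms of size \<open>d\<close> add up to 2 d, and the square of that is
      4/9 of \<open>e\<close>.\<close>
    define d where "d = sqrt e / 3"
    have d: "0 < d" using e by (simp add: d_def)
    then obtain N where N: "\<And>m n. m \<ge> N \<Longrightarrow> n \<ge> N \<Longrightarrow> hnorm I (\<lambda>i. \<xi> m i - \<xi> n i) \<le> d"
      using C[OF d] by (meson less_imp_le)
    have "0 < d\<^sup>2" using d by simp
    then obtain F0 where F0: "finite F0" "F0 \<subseteq> I"
      "\<And>F. finite F \<Longrightarrow> F \<subseteq> I - F0 \<Longrightarrow> norm (\<Sum>i\<in>F. adj (\<xi> N i) * \<xi> N i) < d\<^sup>2"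
      using \<xi>[of N] unfolding sq_summable_def summable_on_iff_Cauchy by metis
    have "norm (\<Sum>i\<in>F. adj (\<eta> i) * \<eta> i) < e" if F: "finite F" "F \<subseteq> I - F0" for F
    proof -
      \<comment> \<open>On the finite index set \<open>F\<close> every family is square summable.
        The triangle inequality for \<open>hnorm F\<close> is thus available before \<eta> is known
        to be square summable on \<open>I\<close>.\<close>
      have ss: "sq_summable F \<zeta>" for \<zeta> :: "'i \<Rightarrow> 'u" using F by (intro sq_summable_finite_support) simp
      have hn: "(hnorm F \<zeta>)\<^sup>2 = norm (\<Sum>i\<in>F. adj (\<zeta> i) * \<zeta> i)" for \<zeta> :: "'i \<Rightarrow> 'u"
        unfolding hnorm_power2 ip_def using F by simp
      have "(hnorm F (\<lambda>i. \<xi> N i - \<eta> i))\<^sup>2 \<le> d\<^sup>2"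
        unfolding hn
      proof (rule fin[where N = N])
        show "hnorm I (\<lambda>i. \<xi> m i - \<xi> n i) \<le> d" if "m \<ge> N" "n \<ge> N" for m n using that by (rule N)
      qed (use F in auto)
      then have 1: "hnorm F (\<lambda>i. \<xi> N i - \<eta> i) \<le> d" by (rule power2_le_imp_le) (use d in simp)
      have "(hnorm F (\<xi> N))\<^sup>2 \<le> d\<^sup>2" unfolding hn using F0(3)[OF F] by simp
      then have 2: "hnorm F (\<xi> N) \<le> d" by (rule power2_le_imp_le) (use d in simp)
      have "hnorm F (\<lambda>i. \<xi> N i - (\<xi> N i - \<eta> i)) \<le> hnorm F (\<xi> N) + hnorm F (\<lambda>i. \<xi> N i - \<eta> i)"
        by (rule hnorm_diff_triangle[OF ss ss])
      then have "hnorm F \<eta> \<le> 2 * d" using 1 2 by simp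
      then have "(hnorm F \<eta>)\<^sup>2 \<le> (2 * d)\<^sup>2" by (intro power_mono) auto
      also have "\<dots> < e" using e by (simp add: d_def power_mult_distrib power_divide)
      finally show ?thesis unfolding hn .
    qed
    then show "\<exists>F0. finite F0 \<and> F0 \<subseteq> I \<and> (\<forall>F. finite F \<longrightarrow> F \<subseteq> I - F0 \<longrightarrow> norm (\<Sum>i\<in>F. adj (\<eta> i) * \<eta> i) < e)"
      using F0 by blast
  qed
  show "hnorm I (\<lambda>i. \<xi> n i - \<eta> i) \<le> e"
    if "0 \<le> e" "\<And>m n. m \<ge> N \<Longrightarrow> n \<ge> N \<Longrightarrow> hnorm I (\<lambda>i. \<xi> m i - \<xi> n i) \<le> e" "n \<ge> N" for e N n
    using that(1) by (intro hnorm_leI sq_summable_diff \<xi> \<eta> fin[OF that(2,3)])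
qed

section \<open>The Hilbert module and its adjointable operators\<close>

locale l2_space = cstar_algebra A for A :: "'a cstar" (structure) +
  fixes G :: "('g, 'm) monoid_scheme"
begin

abbreviation "I \<equiv> carrier G"
abbreviation "H \<equiv> l2 G A"
abbreviation "em \<xi> \<equiv> \<lambda>g. E (\<xi> g)"

lemma l2_has_ip_iff:
  assumes "\<xi> \<in> I \<rightarrow> carrier A" "\<eta> \<in> I \<rightarrow> carrier A"
  shows "l2_has_ip G A \<xi> \<eta> s \<longleftrightarrow> s \<in> carrier A \<and> ((\<lambda>g. adj (E (\<xi> g)) * E (\<eta> g)) has_sum E s) I"
proof -
  let ?f = "\<lambda>g. star A (\<xi> g) \<otimes> \<eta> g"
  have c: "?f \<in> F \<rightarrow> carrier A" if "F \<subseteq> I" for F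
    using that assms by (auto intro!: m_closed star_closed)
  have "E (finsum A ?f F) = (\<Sum>g\<in>F. adj (E (\<xi> g)) * E (\<eta> g))" if "F \<subseteq> I" for F
    using that assms by (subst emb_finsum[OF c[OF that]])
      (intro sum.cong refl, auto simp: Pi_iff subset_iff emb_mult emb_star star_closed)
  then have "((\<lambda>F. E (finsum A ?f F)) \<longlongrightarrow> E s) (finite_subsets_at_top I) \<longleftrightarrow>
      ((\<lambda>F. \<Sum>g\<in>F. adj (E (\<xi> g)) * E (\<eta> g)) \<longlongrightarrow> E s) (finite_subsets_at_top I)"
    by (intro tendsto_cong eventually_finite_subsets_at_top_weakI)
  moreover have "\<forall>\<^sub>F F in finite_subsets_at_top I. finsum A ?f F \<in> carrier A"
    using c by (intro eventually_finite_subsets_at_top_weakI finsum_closed)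
  ultimately show ?thesis unfolding l2_has_ip_def limitin_cs_top has_sum_def by auto
qed

lemma has_sum_in_emb:
  assumes "\<xi> \<in> I \<rightarrow> carrier A" "\<eta> \<in> I \<rightarrow> carrier A" "((\<lambda>g. adj (E (\<xi> g)) * E (\<eta> g)) has_sum z) I"
  shows "z \<in> E ` carrier A"
proof (rule Lim_in_closed_set[OF closed_emb_carrier])
  show "((\<lambda>F. \<Sum>g\<in>F. adj (E (\<xi> g)) * E (\<eta> g)) \<longlongrightarrow> z) (finite_subsets_at_top I)"
    using assms(3) by (simp add: has_sum_def)
  show "\<forall>\<^sub>F F in finite_subsets_at_top I. (\<Sum>g\<in>F. adj (E (\<xi> g)) * E (\<eta> g)) \<in> E ` carrier A"
  proof (rule eventually_finite_subsets_at_top_weakI)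
    fix F assume F: "F \<subseteq> I"
    have c: "(\<lambda>g. star A (\<xi> g) \<otimes> \<eta> g) \<in> F \<rightarrow> carrier A"
      using F assms by (auto intro!: m_closed star_closed)
    have "E (\<Oplus>g\<in>F. star A (\<xi> g) \<otimes> \<eta> g) = (\<Sum>g\<in>F. adj (E (\<xi> g)) * E (\<eta> g))"
      using F assms by (subst emb_finsum[OF c])
        (intro sum.cong refl, auto simp: Pi_iff subset_iff emb_mult emb_star star_closed)
    then show "(\<Sum>g\<in>F. adj (E (\<xi> g)) * E (\<eta> g)) \<in> E ` carrier A"
      using finsum_closed[OF c] by (metis imageI)
  qed
qed simp

lemma l2_iff: "\<xi> \<in> H \<longleftrightarrow> \<xi> \<in> I \<rightarrow>\<^sub>E carrier A \<and> sq_summable I (em \<xi>)"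
proof (cases "\<xi> \<in> I \<rightarrow>\<^sub>E carrier A")
  case True
  then have c: "\<xi> \<in> I \<rightarrow> carrier A" by (auto simp: PiE_def)
  have "(\<exists>s. l2_has_ip G A \<xi> \<xi> s) \<longleftrightarrow> sq_summable I (em \<xi>)"
    unfolding sq_summable_def summable_on_def l2_has_ip_iff[OF c c]
    using has_sum_in_emb[OF c c] by blast
  then show ?thesis using True by (simp add: l2_def)
qed (simp add: l2_def)

lemma l2_carrier: "\<xi> \<in> H \<Longrightarrow> g \<in> I \<Longrightarrow> \<xi> g \<in> carrier A"
  by (auto simp: l2_iff)

lemma l2_Pi: "\<xi> \<in> H \<Longrightarrow> \<xi> \<in> I \<rightarrow> carrier A"
  by (auto simp: l2_carrier)

lemma l2_summable: "\<xi> \<in> H \<Longrightarrow> sq_summable I (em \<xi>)"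
  by (simp add: l2_iff)

lemma l2I:
  assumes "\<xi> \<in> extensional I" "\<And>g. g \<in> I \<Longrightarrow> \<xi> g \<in> carrier A" "sq_summable I (em \<xi>)"
  shows "\<xi> \<in> H"
  using assms by (auto simp: l2_iff PiE_def)

lemma l2_eqI: "\<xi> \<in> H \<Longrightarrow> \<eta> \<in> H \<Longrightarrow> (\<And>g. g \<in> I \<Longrightarrow> \<xi> g = \<eta> g) \<Longrightarrow> \<xi> = \<eta>"
  by (rule extensionalityI[of _ I]) (auto simp: l2_iff PiE_def)

lemma
  assumes "\<xi> \<in> H" "\<eta> \<in> H"
  shows l2_ip_closed: "l2_ip G A \<xi> \<eta> \<in> carrier A"
    and emb_l2_ip: "E (l2_ip G A \<xi> \<eta>) = ip I (em \<xi>) (em \<eta>)"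
proof -
  note c = l2_Pi[OF assms(1)] l2_Pi[OF assms(2)]
  have hs: "((\<lambda>g. adj (E (\<xi> g)) * E (\<eta> g)) has_sum ip I (em \<xi>) (em \<eta>)) I"
    unfolding ip_def by (intro has_sum_infsum ip_summable l2_summable assms)
  then obtain s where s: "s \<in> carrier A" "ip I (em \<xi>) (em \<eta>) = E s"
    using has_sum_in_emb[OF c] by blast
  have "l2_has_ip G A \<xi> \<eta> t \<longleftrightarrow> t = s" for t
    using hs s emb_eq_iff[of t s] has_sum_unique unfolding l2_has_ip_iff[OF c] by metis
  then have "l2_ip G A \<xi> \<eta> = s" by (simp add: l2_ip_def)
  then show "l2_ip G A \<xi> \<eta> \<in> carrier A" "E (l2_ip G A \<xi> \<eta>) = ip I (em \<xi>) (em \<eta>)" using s by simp_all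
qed

lemma l2_ip_has: "\<xi> \<in> H \<Longrightarrow> \<eta> \<in> H \<Longrightarrow> l2_has_ip G A \<xi> \<eta> (l2_ip G A \<xi> \<eta>)"
  unfolding l2_has_ip_iff[OF l2_Pi l2_Pi]
  by (simp add: l2_ip_closed emb_l2_ip) (simp add: ip_def ip_summable l2_summable)

lemma l2_ip_eqI:
  assumes "\<xi> \<in> H" "\<eta> \<in> H" "l2_has_ip G A \<xi> \<eta> s"
  shows "l2_ip G A \<xi> \<eta> = s"
  using assms l2_ip_has[OF assms(1,2)] has_sum_unique emb_eq_iff
  unfolding l2_has_ip_iff[OF l2_Pi[OF assms(1)] l2_Pi[OF assms(2)]] by metis

lemma l2_norm_eq: "\<xi> \<in> H \<Longrightarrow> l2_norm G A \<xi> = hnorm I (em \<xi>)"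
  by (simp add: l2_norm_def hnorm_def l2_ip_closed norm_emb flip: emb_l2_ip)

lemma l2_norm_nonneg: "\<xi> \<in> H \<Longrightarrow> 0 \<le> l2_norm G A \<xi>"
  by (simp add: l2_norm_eq)

lemma l2_norm_power2: "\<xi> \<in> H \<Longrightarrow> (l2_norm G A \<xi>)\<^sup>2 = nrm A (l2_ip G A \<xi> \<xi>)"
  by (simp add: l2_norm_def l2_ip_closed nrm_nonneg)

lemma nrm_l2_ip_le:
  assumes "\<xi> \<in> H" "\<eta> \<in> H"
  shows "nrm A (l2_ip G A \<xi> \<eta>) \<le> l2_norm G A \<xi> * l2_norm G A \<eta>"
  using norm_ip_le[OF assms[THEN l2_summable]] assms
  by (simp add: l2_norm_eq l2_ip_closed norm_emb flip: emb_l2_ip)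

lemma nrm_le_l2_norm: "\<xi> \<in> H \<Longrightarrow> g \<in> I \<Longrightarrow> nrm A (\<xi> g) \<le> l2_norm G A \<xi>"
  using norm_le_hnorm[OF l2_summable] by (simp add: l2_norm_eq l2_carrier flip: norm_emb)

definition vadd where "vadd \<xi> \<eta> = (\<lambda>h\<in>I. \<xi> h \<oplus> \<eta> h)"
definition vsm where "vsm c \<xi> = (\<lambda>h\<in>I. c \<odot> \<xi> h)"
definition vzero where "vzero = (\<lambda>h\<in>I. \<zero>)"
definition vmul where "vmul \<xi> a = (\<lambda>h\<in>I. \<xi> h \<otimes> a)"

lemma em_vadd: "\<xi> \<in> H \<Longrightarrow> \<eta> \<in> H \<Longrightarrow> g \<in> I \<Longrightarrow> E (vadd \<xi> \<eta> g) = E (\<xi> g) + E (\<eta> g)"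
  by (simp add: vadd_def emb_add l2_carrier)

lemma em_vsm: "\<xi> \<in> H \<Longrightarrow> g \<in> I \<Longrightarrow> E (vsm c \<xi> g) = cscale c (E (\<xi> g))"
  by (simp add: vsm_def emb_smult l2_carrier)

lemma em_vmul: "\<xi> \<in> H \<Longrightarrow> a \<in> carrier A \<Longrightarrow> g \<in> I \<Longrightarrow> E (vmul \<xi> a g) = E (\<xi> g) * E a"
  by (simp add: vmul_def emb_mult l2_carrier)

lemma vadd_closed [simp]: "\<xi> \<in> H \<Longrightarrow> \<eta> \<in> H \<Longrightarrow> vadd \<xi> \<eta> \<in> H"
  by (rule l2I) (auto simp: vadd_def l2_carrier emb_add cong: sq_summable_cong intro!: sq_summable_add l2_summable)

lemma vsm_closed [simp]: "\<xi> \<in> H \<Longrightarrow> vsm c \<xi> \<in> H"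
  by (rule l2I) (auto simp: vsm_def l2_carrier smult_closed emb_smult cong: sq_summable_cong
      intro!: sq_summable_cscale l2_summable)

lemma vmul_closed [simp]: "\<xi> \<in> H \<Longrightarrow> a \<in> carrier A \<Longrightarrow> vmul \<xi> a \<in> H"
  by (rule l2I) (auto simp: vmul_def l2_carrier m_closed emb_mult cong: sq_summable_cong
      intro!: sq_summable_mult_right l2_summable)

lemma l2_finite_support:
  assumes "\<xi> \<in> I \<rightarrow>\<^sub>E carrier A" "finite {g \<in> I. \<xi> g \<noteq> \<zero>}"
  shows "\<xi> \<in> H"
proof (rule l2I)
  have "{g \<in> I. E (\<xi> g) \<noteq> 0} \<subseteq> {g \<in> I. \<xi> g \<noteq> \<zero>}" using emb_zero by auto
  then show "sq_summable I (em \<xi>)" by (intro sq_summable_finite_support finite_subset[OF _ assms(2)])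
qed (use assms in \<open>auto simp: PiE_def\<close>)

lemma vzero_closed [simp]: "vzero \<in> H"
  by (rule l2_finite_support) (auto simp: vzero_def)

lemma ip_vadd_right: "\<xi> \<in> H \<Longrightarrow> \<eta> \<in> H \<Longrightarrow> \<zeta> \<in> H \<Longrightarrow>
    l2_ip G A \<xi> (vadd \<eta> \<zeta>) = l2_ip G A \<xi> \<eta> \<oplus> l2_ip G A \<xi> \<zeta>"
  by (subst emb_eq_iff[symmetric])
    (simp_all add: l2_ip_closed emb_l2_ip emb_add em_vadd ip_add_right l2_summable cong: ip_cong)

lemma ip_vsm_right: "\<xi> \<in> H \<Longrightarrow> \<eta> \<in> H \<Longrightarrow> l2_ip G A \<xi> (vsm c \<eta>) = c \<odot> l2_ip G A \<xi> \<eta>"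
  by (subst emb_eq_iff[symmetric])
    (simp_all add: l2_ip_closed emb_l2_ip emb_smult smult_closed em_vsm ip_cscale_right l2_summable cong: ip_cong)

lemma ip_vmul_right: "\<xi> \<in> H \<Longrightarrow> \<eta> \<in> H \<Longrightarrow> a \<in> carrier A \<Longrightarrow> l2_ip G A \<xi> (vmul \<eta> a) = l2_ip G A \<xi> \<eta> \<otimes> a"
  by (subst emb_eq_iff[symmetric])
    (simp_all add: l2_ip_closed emb_l2_ip emb_mult m_closed em_vmul ip_mult_right l2_summable cong: ip_cong)

lemma ip_star: "\<xi> \<in> H \<Longrightarrow> \<eta> \<in> H \<Longrightarrow> star A (l2_ip G A \<xi> \<eta>) = l2_ip G A \<eta> \<xi>"
  by (subst emb_eq_iff[symmetric])
    (simp_all add: l2_ip_closed emb_l2_ip emb_star star_closed ip_adj l2_summable)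

lemma ip_vadd_left: "\<xi> \<in> H \<Longrightarrow> \<eta> \<in> H \<Longrightarrow> \<zeta> \<in> H \<Longrightarrow>
    l2_ip G A (vadd \<eta> \<zeta>) \<xi> = l2_ip G A \<eta> \<xi> \<oplus> l2_ip G A \<zeta> \<xi>"
  by (subst emb_eq_iff[symmetric])
    (simp_all add: l2_ip_closed emb_l2_ip emb_add em_vadd ip_add_left l2_summable cong: ip_cong)

lemma ip_vsm_left: "\<xi> \<in> H \<Longrightarrow> \<eta> \<in> H \<Longrightarrow> l2_ip G A (vsm c \<xi>) \<eta> = cnj c \<odot> l2_ip G A \<xi> \<eta>"
  by (subst emb_eq_iff[symmetric])
    (simp_all add: l2_ip_closed emb_l2_ip emb_smult smult_closed em_vsm ip_cscale_left l2_summable cong: ip_cong)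

lemma ip_vmul_left: "\<xi> \<in> H \<Longrightarrow> \<eta> \<in> H \<Longrightarrow> a \<in> carrier A \<Longrightarrow> l2_ip G A (vmul \<xi> a) \<eta> = star A a \<otimes> l2_ip G A \<xi> \<eta>"
  by (subst emb_eq_iff[symmetric])
    (simp_all add: l2_ip_closed emb_l2_ip emb_mult emb_star star_closed m_closed em_vmul ip_mult_left l2_summable cong: ip_cong)

lemma l2_norm_vadd_le:
  assumes "\<xi> \<in> H" "\<eta> \<in> H"
  shows "l2_norm G A (vadd \<xi> \<eta>) \<le> l2_norm G A \<xi> + l2_norm G A \<eta>"
  using hnorm_triangle[OF assms[THEN l2_summable]] assms by (simp add: l2_norm_eq em_vadd cong: hnorm_cong)

lemma l2_norm_vsm: "\<xi> \<in> H \<Longrightarrow> l2_norm G A (vsm c \<xi>) = cmod c * l2_norm G A \<xi>"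
  by (simp add: l2_norm_eq em_vsm hnorm_cscale l2_summable cong: hnorm_cong)

lemma l2_norm_vzero: "l2_norm G A vzero = 0"
proof -
  have "vsm 0 vzero = vzero" by (rule ext) (simp add: vsm_def vzero_def smult_zero_right)
  then show ?thesis using l2_norm_vsm[OF vzero_closed, of 0] by simp
qed

lemma l2_norm_eq_0:
  assumes \<xi>: "\<xi> \<in> H" "l2_norm G A \<xi> = 0"
  shows "\<xi> = vzero"
proof (rule l2_eqI)
  fix g assume g: "g \<in> I"
  have "hnorm I (em \<xi>) = 0" using assms by (simp only: l2_norm_eq)
  from hnorm_eq_0[OF l2_summable[OF \<xi>(1)] this g] have "E (\<xi> g) = E \<zero>" by (simp only: emb_zero)
  then show "\<xi> g = vzero g" using g by (simp add: emb_eq_iff l2_carrier \<xi> vzero_def)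
qed (simp_all add: \<xi>)

lemma vdiff_apply: "\<xi> \<in> H \<Longrightarrow> \<eta> \<in> H \<Longrightarrow> g \<in> I \<Longrightarrow> vadd \<xi> (vsm (- 1) \<eta>) g = \<xi> g \<ominus> \<eta> g"
  by (simp add: vadd_def vsm_def smult_minus_one l2_carrier a_minus_def)

lemma vdiff_eq_vzero:
  assumes "\<xi> \<in> H" "\<eta> \<in> H" "vadd \<xi> (vsm (- 1) \<eta>) = vzero"
  shows "\<xi> = \<eta>"
proof (rule l2_eqI)
  fix g assume g: "g \<in> I"
  have "\<xi> g \<ominus> \<eta> g = \<zero>" unfolding vdiff_apply[OF assms(1,2) g, symmetric] assms(3) using g by (simp add: vzero_def)
  then show "\<xi> g = \<eta> g" using l2_carrier assms(1,2) g by (simp only: diff_eq_zero_iff)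
qed (simp_all add: assms)

lemma l2_norm_vdiff: "\<xi> \<in> H \<Longrightarrow> \<eta> \<in> H \<Longrightarrow>
    l2_norm G A (vadd \<xi> (vsm (- 1) \<eta>)) = hnorm I (\<lambda>g. E (\<xi> g) - E (\<eta> g))"
  by (simp add: l2_norm_eq em_vadd em_vsm cscale_minus_left cong: hnorm_cong)

text \<open>Tested on the difference of the two vectors. Uniqueness of adjoints and the linearity of
  adjointable maps come from this.\<close>

lemma l2_eq_if_ip_left:
  assumes "\<xi> \<in> H" "\<eta> \<in> H" "\<And>\<zeta>. \<zeta> \<in> H \<Longrightarrow> l2_ip G A \<xi> \<zeta> = l2_ip G A \<eta> \<zeta>"
  shows "\<xi> = \<eta>"
proof (rule vdiff_eq_vzero[OF assms(1,2)])
  let ?d = "vadd \<xi> (vsm (- 1) \<eta>)"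
  have d: "?d \<in> H" using assms by simp
  have "l2_ip G A ?d ?d = l2_ip G A \<xi> ?d \<oplus> (- 1) \<odot> l2_ip G A \<eta> ?d"
    using assms(1,2) d by (simp add: ip_vadd_left[OF d] ip_vsm_left)
  also have "\<dots> = \<zero>" using assms d by (simp add: smult_minus_one l2_ip_closed r_neg)
  finally have "l2_norm G A ?d = 0" by (simp add: l2_norm_def nrm_zero)
  then show "?d = vzero" by (rule l2_norm_eq_0[OF d])
qed

text \<open>The estimate is claimed for all \<open>e\<close> and \<open>N\<close> with the same rate
  on both sides. For a Cauchy sequence of operators, \<open>e\<close> is then taken to be a multiple
  of the norm of the vector, which gives convergence in operator norm.\<close>

lemma l2_complete:
  fixes \<xi> :: "nat \<Rightarrow> 'g \<Rightarrow> 'a"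
  assumes \<xi>: "\<And>n. \<xi> n \<in> H"
    and C: "\<And>e. 0 < e \<Longrightarrow> \<exists>N. \<forall>m\<ge>N. \<forall>n\<ge>N. l2_norm G A (vadd (\<xi> m) (vsm (- 1) (\<xi> n))) < e"
  shows "\<exists>\<eta>\<in>H. \<forall>e\<ge>0. \<forall>N. (\<forall>m\<ge>N. \<forall>n\<ge>N. l2_norm G A (vadd (\<xi> m) (vsm (- 1) (\<xi> n))) \<le> e) \<longrightarrow>
    (\<forall>n\<ge>N. l2_norm G A (vadd (\<xi> n) (vsm (- 1) \<eta>)) \<le> e)"
proof -
  have C': "\<exists>N. \<forall>m\<ge>N. \<forall>n\<ge>N. hnorm I (\<lambda>g. E (\<xi> m g) - E (\<xi> n g)) < e" if "0 < e" for e
    using C[OF that] \<xi> by (simp add: l2_norm_vdiff)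
  have "\<exists>z\<in>carrier A. (\<lambda>n. E (\<xi> n g)) \<longlonglongrightarrow> E z" if g: "g \<in> I" for g
  proof -
    have "Cauchy (\<lambda>n. E (\<xi> n g))"
    proof (rule CauchyI)
      fix e :: real assume "0 < e"
      then obtain N where "\<forall>m\<ge>N. \<forall>n\<ge>N. hnorm I (\<lambda>g. E (\<xi> m g) - E (\<xi> n g)) < e" using C' by blast
      moreover have "norm (E (\<xi> m g) - E (\<xi> n g)) \<le> hnorm I (\<lambda>g. E (\<xi> m g) - E (\<xi> n g))" for m n
        by (rule norm_le_hnorm[OF _ g]) (intro sq_summable_diff l2_summable \<xi>)
      ultimately show "\<exists>M. \<forall>m\<ge>M. \<forall>n\<ge>M. norm (E (\<xi> m g) - E (\<xi> n g)) < e"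
        using le_less_trans by blast
    qed
    then obtain z where z: "(\<lambda>n. E (\<xi> n g)) \<longlonglongrightarrow> z" using Cauchy_convergent convergent_def by blast
    then show ?thesis using emb_Cauchy_limit[of "\<lambda>n. \<xi> n g" z] \<xi> g l2_carrier by blast
  qed
  then obtain z where z: "\<And>g. g \<in> I \<Longrightarrow> z g \<in> carrier A" "\<And>g. g \<in> I \<Longrightarrow> (\<lambda>n. E (\<xi> n g)) \<longlonglongrightarrow> E (z g)" by metis
  define \<eta> where "\<eta> = restrict z I"
  have lim: "(\<lambda>n. E (\<xi> n g)) \<longlonglongrightarrow> E (\<eta> g)" if "g \<in> I" for g using z that by (simp add: \<eta>_def)
  note complete = hnorm_complete[OF l2_summable[OF \<xi>] C' lim]
  have \<eta>: "\<eta> \<in> H" by (rule l2I) (use z complete(1) in \<open>auto simp: \<eta>_def\<close>)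
  show ?thesis
  proof (intro bexI[OF _ \<eta>] allI impI)
    fix e :: real and N n
    assume e: "0 \<le> e" and N: "\<forall>m\<ge>N. \<forall>n\<ge>N. l2_norm G A (vadd (\<xi> m) (vsm (- 1) (\<xi> n))) \<le> e" and n: "N \<le> n"
    have N': "hnorm I (\<lambda>g. E (\<xi> m g) - E (\<xi> n g)) \<le> e" if "N \<le> m" "N \<le> n" for m n
      using N that \<xi> by (simp flip: l2_norm_vdiff)
    show "l2_norm G A (vadd (\<xi> n) (vsm (- 1) \<eta>)) \<le> e"
      unfolding l2_norm_vdiff[OF \<xi> \<eta>]
      by (rule complete(2)[where N = N], assumption, assumption, rule e, rule N', assumption+, rule n)
  qed
qed

text \<open>Finitely supported vectors are dense, and cutting off does not increase the norm. Both
  facts serve to test operators over a quotient on vectors that can be lifted.\<close>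

lemma l2_truncation:
  assumes \<xi>: "\<xi> \<in> H" and "0 < e"
  obtains F \<eta> where "finite F" "F \<subseteq> I" "\<eta> = (\<lambda>g\<in>I. if g \<in> F then \<xi> g else \<zero>)" "\<eta> \<in> H"
    "l2_norm G A (vadd \<xi> (vsm (- 1) \<eta>)) \<le> e" "l2_norm G A \<eta> \<le> l2_norm G A \<xi>"
proof -
  obtain F where F: "finite F" "F \<subseteq> I" "hnorm I (\<lambda>i. if i \<in> F then 0 else E (\<xi> i)) \<le> e"
    using hnorm_truncation[OF l2_summable[OF \<xi>] \<open>0 < e\<close>] by metis
  define \<eta> where "\<eta> = (\<lambda>g\<in>I. if g \<in> F then \<xi> g else \<zero>)"
  have \<eta>: "\<eta> \<in> H"
    by (rule l2_finite_support) (use F \<xi> l2_carrier in \<open>auto simp: \<eta>_def elim!: finite_subset[rotated] split: if_splits\<close>)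
  have "hnorm I (\<lambda>g. E (\<xi> g) - E (\<eta> g)) = hnorm I (\<lambda>i. if i \<in> F then 0 else E (\<xi> i))"
    by (rule hnorm_cong) (auto simp: \<eta>_def emb_zero)
  then have "l2_norm G A (vadd \<xi> (vsm (- 1) \<eta>)) \<le> e" using F \<xi> \<eta> by (simp add: l2_norm_vdiff)
  moreover have "l2_norm G A \<eta> \<le> l2_norm G A \<xi>"
  proof -
    have "hnorm I (em \<eta>) = hnorm I (\<lambda>g. (if g \<in> F then 1 else 0) * E (\<xi> g))"
      by (rule hnorm_cong) (auto simp: \<eta>_def emb_zero)
    also have "\<dots> \<le> 1 * hnorm I (em \<xi>)" by (rule hnorm_weighted_le[OF l2_summable[OF \<xi>]]) auto
    finally show ?thesis using \<xi> \<eta> by (simp add: l2_norm_eq)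
  qed
  ultimately show ?thesis using that F \<eta> \<eta>_def by blast
qed

section \<open>The C*-algebra of adjointable operators\<close>

abbreviation "B \<equiv> adjointables G A"

lemma op_carrier: "carrier B = {T \<in> H \<rightarrow>\<^sub>E H. (\<exists>S. is_adjoint G A T S) \<and>
    (\<exists>C. \<forall>\<xi>\<in>H. l2_norm G A (T \<xi>) \<le> C * l2_norm G A \<xi>)}"
  by (simp add: adjointables_def)

lemma op_add: "T \<oplus>\<^bsub>B\<^esub> S = (\<lambda>\<xi>\<in>H. vadd (T \<xi>) (S \<xi>))"
  by (simp add: adjointables_def vadd_def)

lemma op_smult: "c \<odot>\<^bsub>B\<^esub> T = (\<lambda>\<xi>\<in>H. vsm c (T \<xi>))"
  by (simp add: adjointables_def vsm_def)

lemma op_zero: "\<zero>\<^bsub>B\<^esub> = (\<lambda>\<xi>\<in>H. vzero)"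
  by (simp add: adjointables_def vzero_def)

lemma op_mult: "T \<otimes>\<^bsub>B\<^esub> S = compose H T S"
  by (simp add: adjointables_def)

lemma op_star: "star B T = (THE S. is_adjoint G A T S)"
  by (simp add: adjointables_def)

lemma op_nrm: "nrm B T = (SUP \<xi>\<in>{\<xi> \<in> H. l2_norm G A \<xi> \<le> 1}. l2_norm G A (T \<xi>))"
  by (simp add: adjointables_def)

lemma op_closed: "T \<in> carrier B \<Longrightarrow> \<xi> \<in> H \<Longrightarrow> T \<xi> \<in> H"
  by (auto simp: op_carrier)

lemma op_eqI: "T \<in> carrier B \<Longrightarrow> S \<in> carrier B \<Longrightarrow> (\<And>\<xi>. \<xi> \<in> H \<Longrightarrow> T \<xi> = S \<xi>) \<Longrightarrow> T = S"
  by (rule extensionalityI[of _ H]) (auto simp: op_carrier PiE_def)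

lemma is_adjoint_sym:
  assumes "is_adjoint G A T S" "T \<in> H \<rightarrow>\<^sub>E H"
  shows "is_adjoint G A S T"
proof -
  have "l2_ip G A (S \<xi>) \<eta> = l2_ip G A \<xi> (T \<eta>)" if "\<xi> \<in> H" "\<eta> \<in> H" for \<xi> \<eta>
  proof -
    have m: "S \<xi> \<in> H" "T \<eta> \<in> H" using assms that by (auto simp: is_adjoint_def)
    have "l2_ip G A (S \<xi>) \<eta> = star A (l2_ip G A \<eta> (S \<xi>))" using m that by (simp add: ip_star)
    also have "l2_ip G A \<eta> (S \<xi>) = l2_ip G A (T \<eta>) \<xi>" using assms that by (simp add: is_adjoint_def)
    finally show ?thesis using m that by (simp add: ip_star)
  qed
  then show ?thesis using assms(2) by (simp add: is_adjoint_def)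
qed

lemma is_adjoint_unique:
  assumes "is_adjoint G A T S" "is_adjoint G A T S'" "T \<in> H \<rightarrow>\<^sub>E H"
  shows "S = S'"
proof (rule extensionalityI[of _ H])
  note s = is_adjoint_sym[OF assms(1,3)] is_adjoint_sym[OF assms(2,3)]
  fix \<xi> assume "\<xi> \<in> H"
  then show "S \<xi> = S' \<xi>"
    using assms s by (intro l2_eq_if_ip_left) (auto simp: is_adjoint_def)
qed (use assms in \<open>auto simp: is_adjoint_def PiE_def\<close>)

lemma op_star_eqI: "T \<in> carrier B \<Longrightarrow> is_adjoint G A T S \<Longrightarrow> star B T = S"
  unfolding op_star using is_adjoint_unique by (intro the_equality) (auto simp: op_carrier)

lemma op_star_is_adjoint: "T \<in> carrier B \<Longrightarrow> is_adjoint G A T (star B T)"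
  using op_star_eqI by (auto simp: op_carrier)

lemma op_star_ip: "T \<in> carrier B \<Longrightarrow> \<xi> \<in> H \<Longrightarrow> \<eta> \<in> H \<Longrightarrow> l2_ip G A (T \<xi>) \<eta> = l2_ip G A \<xi> (star B T \<eta>)"
  using op_star_is_adjoint by (simp add: is_adjoint_def)

text \<open>The square of the norm of \<open>S \<eta>\<close> is the norm of the inner product of T
  (S \<eta>) with \<eta>; after Cauchy-Schwarz one factor cancels, and the adjoint inherits the
  constant.\<close>

lemma is_adjoint_bound:
  assumes T: "T \<in> H \<rightarrow>\<^sub>E H" "is_adjoint G A T S" and C: "\<And>\<xi>. \<xi> \<in> H \<Longrightarrow> l2_norm G A (T \<xi>) \<le> C * l2_norm G A \<xi>"
    and \<eta>: "\<eta> \<in> H"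
  shows "l2_norm G A (S \<eta>) \<le> C * l2_norm G A \<eta>"
proof (cases "l2_norm G A (S \<eta>) = 0")
  case True
  have "0 \<le> C * l2_norm G A \<eta>" using C[OF \<eta>] l2_norm_nonneg[of "T \<eta>"] T \<eta> by (auto intro: order_trans)
  then show ?thesis using True by simp
next
  case False
  have S: "S \<eta> \<in> H" "T (S \<eta>) \<in> H" using T \<eta> by (auto simp: is_adjoint_def)
  have "(l2_norm G A (S \<eta>))\<^sup>2 = nrm A (l2_ip G A (T (S \<eta>)) \<eta>)"
    using T \<eta> S by (simp add: l2_norm_power2 is_adjoint_def)
  also have "\<dots> \<le> l2_norm G A (T (S \<eta>)) * l2_norm G A \<eta>" by (intro nrm_l2_ip_le S \<eta>)
  also have "\<dots> \<le> C * l2_norm G A (S \<eta>) * l2_norm G A \<eta>"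
    by (intro mult_right_mono C S l2_norm_nonneg \<eta>)
  finally show ?thesis using False l2_norm_nonneg[OF S(1)] by (simp add: power2_eq_square)
qed

lemma op_intro:
  assumes "T \<in> H \<rightarrow>\<^sub>E H" "is_adjoint G A T S" "\<And>\<xi>. \<xi> \<in> H \<Longrightarrow> l2_norm G A (T \<xi>) \<le> C * l2_norm G A \<xi>"
  shows "T \<in> carrier B"
  using assms by (auto simp: op_carrier)

lemma op_star_closed: "T \<in> carrier B \<Longrightarrow> star B T \<in> carrier B"
proof -
  assume T: "T \<in> carrier B"
  then obtain C where C: "\<And>\<xi>. \<xi> \<in> H \<Longrightarrow> l2_norm G A (T \<xi>) \<le> C * l2_norm G A \<xi>" and TH: "T \<in> H \<rightarrow>\<^sub>E H"
    by (auto simp: op_carrier)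
  note a = op_star_is_adjoint[OF T]
  show ?thesis
    by (rule op_intro[OF _ is_adjoint_sym[OF a TH] is_adjoint_bound[OF TH a C]])
      (use a in \<open>auto simp: is_adjoint_def\<close>)
qed

text \<open>Each law is checked after pairing with a vector: \<open>T\<close> moves to the other
  side as \<open>star B T\<close>, and what remains is a law of the inner product.\<close>

lemma op_linear:
  assumes "T \<in> carrier B" "\<xi> \<in> H"
  shows "\<eta> \<in> H \<Longrightarrow> T (vadd \<xi> \<eta>) = vadd (T \<xi>) (T \<eta>)" "T (vsm c \<xi>) = vsm c (T \<xi>)"
    "a \<in> carrier A \<Longrightarrow> T (vmul \<xi> a) = vmul (T \<xi>) a"
  by (rule l2_eq_if_ip_left; simp add: assms op_closed op_star_closed op_star_ip
      ip_vadd_left ip_vsm_left ip_vmul_left)+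

lemma op_bdd: "T \<in> carrier B \<Longrightarrow> bdd_above ((\<lambda>\<xi>. l2_norm G A (T \<xi>)) ` {\<xi> \<in> H. l2_norm G A \<xi> \<le> 1})"
proof -
  assume "T \<in> carrier B"
  then obtain C where C: "\<And>\<xi>. \<xi> \<in> H \<Longrightarrow> l2_norm G A (T \<xi>) \<le> C * l2_norm G A \<xi>" by (auto simp: op_carrier)
  have "l2_norm G A (T \<xi>) \<le> \<bar>C\<bar>" if "\<xi> \<in> H" "l2_norm G A \<xi> \<le> 1" for \<xi>
  proof -
    have "l2_norm G A (T \<xi>) \<le> C * l2_norm G A \<xi>" by (rule C[OF that(1)])
    also have "\<dots> \<le> \<bar>C\<bar> * 1" using that l2_norm_nonneg[OF that(1)] by (intro mult_mono) auto
    finally show ?thesis by simp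
  qed
  then show ?thesis by (auto intro!: bdd_aboveI[of _ "\<bar>C\<bar>"])
qed

lemma op_norm_le:
  assumes T: "T \<in> carrier B" and \<xi>: "\<xi> \<in> H"
  shows "l2_norm G A (T \<xi>) \<le> nrm B T * l2_norm G A \<xi>"
proof (cases "l2_norm G A \<xi> = 0")
  case True
  obtain C where "\<And>\<xi>. \<xi> \<in> H \<Longrightarrow> l2_norm G A (T \<xi>) \<le> C * l2_norm G A \<xi>" using T by (auto simp: op_carrier)
  from this[OF \<xi>] show ?thesis using True by simp
next
  case False
  then have pos: "0 < l2_norm G A \<xi>" using l2_norm_nonneg[OF \<xi>] by simp
  let ?\<xi> = "vsm (complex_of_real (1 / l2_norm G A \<xi>)) \<xi>"
  have 1: "l2_norm G A (T ?\<xi>) \<le> nrm B T"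
    unfolding op_nrm using \<xi> pos
    by (intro cSUP_upper op_bdd T) (simp add: l2_norm_vsm norm_divide)
  have 2: "l2_norm G A (T ?\<xi>) = l2_norm G A (T \<xi>) / l2_norm G A \<xi>"
    using T \<xi> pos by (simp add: op_linear l2_norm_vsm op_closed norm_divide)
  have "l2_norm G A (T \<xi>) / l2_norm G A \<xi> \<le> nrm B T" using 1 unfolding 2 .
  then show ?thesis using pos by (simp add: divide_le_eq)
qed

lemma op_nrm_leI:
  assumes C: "0 \<le> C" and le: "\<And>\<xi>. \<xi> \<in> H \<Longrightarrow> l2_norm G A (T \<xi>) \<le> C * l2_norm G A \<xi>"
  shows "nrm B T \<le> C"
  unfolding op_nrm
proof (rule cSUP_least)
  have "vzero \<in> {\<xi> \<in> H. l2_norm G A \<xi> \<le> 1}" by (simp add: l2_norm_vzero)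
  then show "{\<xi> \<in> H. l2_norm G A \<xi> \<le> 1} \<noteq> {}" by blast
  fix \<xi> assume "\<xi> \<in> {\<xi> \<in> H. l2_norm G A \<xi> \<le> 1}"
  then have "l2_norm G A (T \<xi>) \<le> C * l2_norm G A \<xi>" "C * l2_norm G A \<xi> \<le> C * 1"
    using le mult_left_mono[OF _ C, of "l2_norm G A \<xi>" 1] by auto
  then show "l2_norm G A (T \<xi>) \<le> C" by simp
qed

lemma op_nrm_nonneg: "T \<in> carrier B \<Longrightarrow> 0 \<le> nrm B T"
proof -
  assume T: "T \<in> carrier B"
  have "l2_norm G A (T vzero) \<le> nrm B T"
    unfolding op_nrm by (intro cSUP_upper op_bdd T) (simp add: l2_norm_vzero)
  then show ?thesis using l2_norm_nonneg[OF op_closed[OF T vzero_closed]] by simp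
qed

lemma vadd_assoc: "\<xi> \<in> H \<Longrightarrow> \<eta> \<in> H \<Longrightarrow> \<zeta> \<in> H \<Longrightarrow> vadd (vadd \<xi> \<eta>) \<zeta> = vadd \<xi> (vadd \<eta> \<zeta>)"
  by (rule ext) (simp add: vadd_def a_assoc l2_carrier)

lemma vadd_comm: "\<xi> \<in> H \<Longrightarrow> \<eta> \<in> H \<Longrightarrow> vadd \<xi> \<eta> = vadd \<eta> \<xi>"
  by (rule ext) (simp add: vadd_def a_comm l2_carrier)

lemma vadd_vzero: "\<xi> \<in> H \<Longrightarrow> vadd vzero \<xi> = \<xi>"
  by (rule l2_eqI) (simp, assumption, simp add: vadd_def vzero_def l2_carrier)

lemma vadd_neg: "\<xi> \<in> H \<Longrightarrow> vadd (vsm (- 1) \<xi>) \<xi> = vzero"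
  by (rule ext) (simp add: vadd_def vsm_def vzero_def smult_minus_one l_neg l2_carrier)

lemma vsm_vadd: "\<xi> \<in> H \<Longrightarrow> \<eta> \<in> H \<Longrightarrow> vsm c (vadd \<xi> \<eta>) = vadd (vsm c \<xi>) (vsm c \<eta>)"
  by (rule ext) (simp add: vadd_def vsm_def smult_r_distr l2_carrier)

lemma vsm_add: "\<xi> \<in> H \<Longrightarrow> vsm (c + d) \<xi> = vadd (vsm c \<xi>) (vsm d \<xi>)"
  by (rule ext) (simp add: vadd_def vsm_def smult_l_distr l2_carrier)

lemma vsm_vsm: "\<xi> \<in> H \<Longrightarrow> vsm (c * d) \<xi> = vsm c (vsm d \<xi>)"
  by (rule ext) (simp add: vsm_def smult_assoc l2_carrier)

lemma vsm_one: "\<xi> \<in> H \<Longrightarrow> vsm 1 \<xi> = \<xi>"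
  by (rule l2_eqI) (simp, simp, simp add: vsm_def smult_one l2_carrier)

lemma op_add_closed:
  assumes T: "T \<in> carrier B" and S: "S \<in> carrier B"
  shows "T \<oplus>\<^bsub>B\<^esub> S \<in> carrier B" "star B (T \<oplus>\<^bsub>B\<^esub> S) = star B T \<oplus>\<^bsub>B\<^esub> star B S"
proof -
  note c = op_closed[OF T] op_closed[OF S] op_closed[OF op_star_closed[OF T]] op_closed[OF op_star_closed[OF S]]
  have a: "is_adjoint G A (T \<oplus>\<^bsub>B\<^esub> S) (star B T \<oplus>\<^bsub>B\<^esub> star B S)"
    unfolding is_adjoint_def op_add using c
    by (auto simp: ip_vadd_left ip_vadd_right op_star_ip[OF T] op_star_ip[OF S])
  show cl: "T \<oplus>\<^bsub>B\<^esub> S \<in> carrier B"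
  proof (rule op_intro[OF _ a])
    show "T \<oplus>\<^bsub>B\<^esub> S \<in> H \<rightarrow>\<^sub>E H" using c by (auto simp: op_add)
    show "l2_norm G A ((T \<oplus>\<^bsub>B\<^esub> S) \<xi>) \<le> (nrm B T + nrm B S) * l2_norm G A \<xi>" if "\<xi> \<in> H" for \<xi>
      using that l2_norm_vadd_le[OF c(1,2)[OF that]] op_norm_le[OF T that] op_norm_le[OF S that]
      by (simp add: op_add algebra_simps)
  qed
  show "star B (T \<oplus>\<^bsub>B\<^esub> S) = star B T \<oplus>\<^bsub>B\<^esub> star B S" by (rule op_star_eqI[OF cl a])
qed

lemma op_smult_closed:
  assumes T: "T \<in> carrier B"
  shows "c \<odot>\<^bsub>B\<^esub> T \<in> carrier B" "star B (c \<odot>\<^bsub>B\<^esub> T) = cnj c \<odot>\<^bsub>B\<^esub> star B T"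
proof -
  note cl = op_closed[OF T] op_closed[OF op_star_closed[OF T]]
  have a: "is_adjoint G A (c \<odot>\<^bsub>B\<^esub> T) (cnj c \<odot>\<^bsub>B\<^esub> star B T)"
    unfolding is_adjoint_def op_smult using cl
    by (auto simp: ip_vsm_left ip_vsm_right op_star_ip[OF T])
  show c: "c \<odot>\<^bsub>B\<^esub> T \<in> carrier B"
  proof (rule op_intro[OF _ a])
    show "c \<odot>\<^bsub>B\<^esub> T \<in> H \<rightarrow>\<^sub>E H" using cl by (auto simp: op_smult)
    show "l2_norm G A ((c \<odot>\<^bsub>B\<^esub> T) \<xi>) \<le> (cmod c * nrm B T) * l2_norm G A \<xi>" if "\<xi> \<in> H" for \<xi>
      using that mult_left_mono[OF op_norm_le[OF T that], of "cmod c"] cl by (simp add: op_smult l2_norm_vsm mult.assoc)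
  qed
  show "star B (c \<odot>\<^bsub>B\<^esub> T) = cnj c \<odot>\<^bsub>B\<^esub> star B T" by (rule op_star_eqI[OF c a])
qed

lemma op_mult_closed:
  assumes T: "T \<in> carrier B" and S: "S \<in> carrier B"
  shows "T \<otimes>\<^bsub>B\<^esub> S \<in> carrier B" "star B (T \<otimes>\<^bsub>B\<^esub> S) = star B S \<otimes>\<^bsub>B\<^esub> star B T" "nrm B (T \<otimes>\<^bsub>B\<^esub> S) \<le> nrm B T * nrm B S"
proof -
  note c = op_closed[OF T] op_closed[OF S] op_closed[OF op_star_closed[OF T]] op_closed[OF op_star_closed[OF S]]
  have a: "is_adjoint G A (T \<otimes>\<^bsub>B\<^esub> S) (star B S \<otimes>\<^bsub>B\<^esub> star B T)"
    unfolding is_adjoint_def op_mult using c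
    by (auto simp: compose_def op_star_ip[OF T] op_star_ip[OF S])
  have le: "l2_norm G A ((T \<otimes>\<^bsub>B\<^esub> S) \<xi>) \<le> (nrm B T * nrm B S) * l2_norm G A \<xi>" if "\<xi> \<in> H" for \<xi>
    using that op_norm_le[OF T c(2)[OF that]] mult_left_mono[OF op_norm_le[OF S that] op_nrm_nonneg[OF T]]
    by (simp add: op_mult compose_def mult.assoc)
  show cl: "T \<otimes>\<^bsub>B\<^esub> S \<in> carrier B"
    by (rule op_intro[OF _ a le]) (use c in \<open>auto simp: op_mult compose_def\<close>)
  show "star B (T \<otimes>\<^bsub>B\<^esub> S) = star B S \<otimes>\<^bsub>B\<^esub> star B T" by (rule op_star_eqI[OF cl a])
  show "nrm B (T \<otimes>\<^bsub>B\<^esub> S) \<le> nrm B T * nrm B S"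
    by (rule op_nrm_leI[OF _ le]) (simp add: op_nrm_nonneg T S)
qed

lemma op_zero_closed: "\<zero>\<^bsub>B\<^esub> \<in> carrier B"
proof -
  have z: "l2_ip G A vzero \<xi> = \<zero>" "l2_ip G A \<xi> vzero = \<zero>" if "\<xi> \<in> H" for \<xi>
  proof -
    have v: "vzero = vsm 0 vzero" by (rule ext) (simp add: vzero_def vsm_def smult_zero_right)
    show "l2_ip G A vzero \<xi> = \<zero>" "l2_ip G A \<xi> vzero = \<zero>"
      using that by (subst v, simp add: ip_vsm_left ip_vsm_right smult_zero_left l2_ip_closed)+
  qed
  show ?thesis
    by (rule op_intro[of _ "\<lambda>\<xi>\<in>H. vzero" 0]) (auto simp: op_zero is_adjoint_def z l2_norm_vzero)
qed

lemma op_abelian_group: "abelian_group B"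
proof (rule abelian_groupI)
  fix T S U assume "T \<in> carrier B" "S \<in> carrier B" "U \<in> carrier B"
  then show "T \<oplus>\<^bsub>B\<^esub> S \<oplus>\<^bsub>B\<^esub> U = T \<oplus>\<^bsub>B\<^esub> (S \<oplus>\<^bsub>B\<^esub> U)"
    by (intro op_eqI op_add_closed) (simp_all add: op_add vadd_assoc op_closed)
next
  fix T S assume "T \<in> carrier B" "S \<in> carrier B"
  then show "T \<oplus>\<^bsub>B\<^esub> S \<in> carrier B" "T \<oplus>\<^bsub>B\<^esub> S = S \<oplus>\<^bsub>B\<^esub> T"
    by (simp add: op_add_closed, intro op_eqI op_add_closed) (simp_all add: op_add vadd_comm op_closed)
next
  fix T assume T: "T \<in> carrier B"
  then show "\<zero>\<^bsub>B\<^esub> \<oplus>\<^bsub>B\<^esub> T = T"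
    by (intro op_eqI op_add_closed op_zero_closed) (simp_all add: op_add op_zero vadd_vzero op_closed)
  have "((- 1) \<odot>\<^bsub>B\<^esub> T) \<oplus>\<^bsub>B\<^esub> T = \<zero>\<^bsub>B\<^esub>"
    using T by (intro op_eqI op_add_closed op_zero_closed op_smult_closed)
      (simp_all add: op_add op_zero op_smult vadd_neg op_closed)
  then show "\<exists>S\<in>carrier B. S \<oplus>\<^bsub>B\<^esub> T = \<zero>\<^bsub>B\<^esub>" using T op_smult_closed by blast
qed (rule op_zero_closed)

lemma op_minus: "T \<in> carrier B \<Longrightarrow> \<ominus>\<^bsub>B\<^esub> T = (- 1) \<odot>\<^bsub>B\<^esub> T"
proof -
  interpret B: abelian_group B by (rule op_abelian_group)
  assume T: "T \<in> carrier B"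
  have "((- 1) \<odot>\<^bsub>B\<^esub> T) \<oplus>\<^bsub>B\<^esub> T = \<zero>\<^bsub>B\<^esub>"
    using T by (intro op_eqI op_add_closed op_zero_closed op_smult_closed)
      (simp_all add: op_add op_zero op_smult vadd_neg op_closed)
  then show ?thesis using T op_smult_closed(1) by (intro B.minus_equality)
qed

lemma op_diff_apply: "T \<in> carrier B \<Longrightarrow> S \<in> carrier B \<Longrightarrow> \<xi> \<in> H \<Longrightarrow>
    (T \<ominus>\<^bsub>B\<^esub> S) \<xi> = vadd (T \<xi>) (vsm (- 1) (S \<xi>))"
  by (simp add: a_minus_def op_minus op_add op_smult)

lemma op_nrm_smult_le: "T \<in> carrier B \<Longrightarrow> nrm B (c \<odot>\<^bsub>B\<^esub> T) \<le> cmod c * nrm B T"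
  using mult_left_mono[OF op_norm_le, of T _ "cmod c"]
  by (intro op_nrm_leI) (auto simp: op_nrm_nonneg op_smult l2_norm_vsm op_closed mult.assoc)

lemma op_nrm_smult: "T \<in> carrier B \<Longrightarrow> nrm B (c \<odot>\<^bsub>B\<^esub> T) = cmod c * nrm B T"
proof (cases "c = 0")
  case True
  assume T: "T \<in> carrier B"
  then show ?thesis using op_nrm_smult_le[OF T, of 0] op_nrm_nonneg[OF op_smult_closed(1)[OF T], of 0] True by simp
next
  case False
  assume T: "T \<in> carrier B"
  have "inverse c \<odot>\<^bsub>B\<^esub> (c \<odot>\<^bsub>B\<^esub> T) = T"
    using T False by (intro op_eqI op_smult_closed) (simp_all add: op_smult op_closed vsm_one flip: vsm_vsm)
  then have "nrm B T \<le> inverse (cmod c) * nrm B (c \<odot>\<^bsub>B\<^esub> T)"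
    using op_nrm_smult_le[OF op_smult_closed(1)[OF T], of "inverse c" c] by (simp add: norm_inverse)
  then have "cmod c * nrm B T \<le> nrm B (c \<odot>\<^bsub>B\<^esub> T)" using False by (simp add: field_simps)
  then show ?thesis using op_nrm_smult_le[OF T, of c] by simp
qed

lemma op_nrm_triangle: "T \<in> carrier B \<Longrightarrow> S \<in> carrier B \<Longrightarrow> nrm B (T \<oplus>\<^bsub>B\<^esub> S) \<le> nrm B T + nrm B S"
proof (rule op_nrm_leI)
  fix \<xi> assume a: "T \<in> carrier B" "S \<in> carrier B" "\<xi> \<in> H"
  then show "l2_norm G A ((T \<oplus>\<^bsub>B\<^esub> S) \<xi>) \<le> (nrm B T + nrm B S) * l2_norm G A \<xi>"
    using l2_norm_vadd_le[OF op_closed op_closed, OF a(1,3,2,3)] op_norm_le[OF a(1,3)] op_norm_le[OF a(2,3)]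
    by (simp add: op_add algebra_simps)
qed (simp add: op_nrm_nonneg)

lemma op_nrm_zero_imp: "T \<in> carrier B \<Longrightarrow> nrm B T = 0 \<Longrightarrow> T = \<zero>\<^bsub>B\<^esub>"
proof (rule op_eqI)
  fix \<xi> assume a: "T \<in> carrier B" "nrm B T = 0" "\<xi> \<in> H"
  have "l2_norm G A (T \<xi>) = 0"
    using op_norm_le[OF a(1,3)] l2_norm_nonneg[OF op_closed[OF a(1,3)]] a(2) by simp
  then have "T \<xi> = vzero" by (rule l2_norm_eq_0[OF op_closed[OF a(1,3)]])
  then show "T \<xi> = \<zero>\<^bsub>B\<^esub> \<xi>" using a(3) by (simp add: op_zero)
qed (simp_all add: op_zero_closed)

text \<open>One inequality is the bound on the adjoint. The other is Cauchy-Schwarz for the inner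
  product of T \<xi> with itself, rewritten as that of \<xi> with T^* T \<xi>.\<close>

lemma op_cstar_identity:
  assumes T: "T \<in> carrier B"
  shows "nrm B (star B T \<otimes>\<^bsub>B\<^esub> T) = (nrm B T)\<^sup>2"
proof (rule antisym)
  note S = op_star_closed[OF T]
  have "nrm B (star B T) \<le> nrm B T"
    by (rule op_nrm_leI[OF op_nrm_nonneg[OF T]])
      (rule is_adjoint_bound[OF _ op_star_is_adjoint[OF T] op_norm_le[OF T]], use T in \<open>auto simp: op_carrier\<close>)
  then have "nrm B (star B T) * nrm B T \<le> nrm B T * nrm B T"
    by (intro mult_right_mono op_nrm_nonneg T)
  then show "nrm B (star B T \<otimes>\<^bsub>B\<^esub> T) \<le> (nrm B T)\<^sup>2"
    using op_mult_closed(3)[OF S T] by (simp add: power2_eq_square)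
  define K where "K = nrm B (star B T \<otimes>\<^bsub>B\<^esub> T)"
  note M = op_mult_closed(1)[OF S T]
  have K: "0 \<le> K" by (simp add: K_def op_nrm_nonneg M)
  have "nrm B T \<le> sqrt K"
  proof (rule op_nrm_leI)
    fix \<xi> assume \<xi>: "\<xi> \<in> H"
    note t = op_closed[OF T \<xi>]
    have "(l2_norm G A (T \<xi>))\<^sup>2 = nrm A (l2_ip G A \<xi> ((star B T \<otimes>\<^bsub>B\<^esub> T) \<xi>))"
      using \<xi> t by (simp add: l2_norm_power2 op_star_ip[OF T] op_mult compose_def)
    also have "\<dots> \<le> l2_norm G A \<xi> * l2_norm G A ((star B T \<otimes>\<^bsub>B\<^esub> T) \<xi>)"
      by (intro nrm_l2_ip_le op_closed[OF M] \<xi>)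
    also have "\<dots> \<le> l2_norm G A \<xi> * (K * l2_norm G A \<xi>)"
      unfolding K_def by (intro mult_left_mono op_norm_le[OF M] l2_norm_nonneg \<xi>)
    also have "\<dots> = (sqrt K * l2_norm G A \<xi>)\<^sup>2"
      unfolding power_mult_distrib real_sqrt_pow2[OF K] by (simp only: power2_eq_square mult_ac)
    finally show "l2_norm G A (T \<xi>) \<le> sqrt K * l2_norm G A \<xi>"
      by (rule power2_le_imp_le) (simp add: K l2_norm_nonneg[OF \<xi>])
  qed (simp add: K)
  then have "(nrm B T)\<^sup>2 \<le> (sqrt K)\<^sup>2" by (intro power_mono op_nrm_nonneg T)
  then show "(nrm B T)\<^sup>2 \<le> nrm B (star B T \<otimes>\<^bsub>B\<^esub> T)" using K by (simp add: K_def)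
qed

lemma op_nrm_star: "T \<in> carrier B \<Longrightarrow> nrm B (star B T) \<le> nrm B T"
  by (rule op_nrm_leI[OF op_nrm_nonneg])
    (simp, rule is_adjoint_bound[OF _ op_star_is_adjoint op_norm_le], auto simp: op_carrier)

lemma adj_Metric_space: "Metric_space (carrier B) (cs_dist B)"
proof (rule Metric_space_cs_dist[OF op_abelian_group])
  show "nrm B \<zero>\<^bsub>B\<^esub> = 0"
    using op_nrm_leI[of 0 "\<zero>\<^bsub>B\<^esub>"] op_nrm_nonneg[OF op_zero_closed] by (simp add: op_zero l2_norm_vzero)
  show "nrm B (\<ominus>\<^bsub>B\<^esub> T) = nrm B T" if "T \<in> carrier B" for T using that by (simp add: op_minus op_nrm_smult)
qed (auto intro: op_nrm_zero_imp op_nrm_triangle)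

text \<open>The limit has to be adjointable as well: pointwise limits are formed of the operators
  and of their adjoints, and the adjoint relation passes to the limit.\<close>

lemma op_mcomplete: "Metric_space.mcomplete (carrier B) (cs_dist B)"
proof (rule cs_mcompleteI[OF adj_Metric_space])
  interpret B: abelian_group B by (rule op_abelian_group)
  fix T :: "nat \<Rightarrow> ('g \<Rightarrow> 'a) \<Rightarrow> 'g \<Rightarrow> 'a"
  assume T: "\<And>n. T n \<in> carrier B"
    and C: "\<And>e. 0 < e \<Longrightarrow> \<exists>N. \<forall>m\<ge>N. \<forall>n\<ge>N. nrm B (T m \<ominus>\<^bsub>B\<^esub> T n) < e"
  \<comment> \<open>Stated for an arbitrary Cauchy sequence \<open>S\<close>, because it is used
    both for \<open>T\<close> and for the sequence of adjoints.\<close>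
  have limit: "\<exists>L. \<forall>\<xi>\<in>H. L \<xi> \<in> H \<and> (\<forall>e\<ge>0. \<forall>N. (\<forall>m\<ge>N. \<forall>n\<ge>N. nrm B (S m \<ominus>\<^bsub>B\<^esub> S n) \<le> e) \<longrightarrow>
      (\<forall>n\<ge>N. l2_norm G A (vadd (S n \<xi>) (vsm (- 1) (L \<xi>))) \<le> e * l2_norm G A \<xi>))"
    if S: "\<And>n. S n \<in> carrier B" and C: "\<And>e. 0 < e \<Longrightarrow> \<exists>N. \<forall>m\<ge>N. \<forall>n\<ge>N. nrm B (S m \<ominus>\<^bsub>B\<^esub> S n) < e"
    for S :: "nat \<Rightarrow> ('g \<Rightarrow> 'a) \<Rightarrow> 'g \<Rightarrow> 'a"
  proof -
    have "\<exists>\<eta>. \<eta> \<in> H \<and> (\<forall>e\<ge>0. \<forall>N. (\<forall>m\<ge>N. \<forall>n\<ge>N. nrm B (S m \<ominus>\<^bsub>B\<^esub> S n) \<le> e) \<longrightarrow>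
      (\<forall>n\<ge>N. l2_norm G A (vadd (S n \<xi>) (vsm (- 1) \<eta>)) \<le> e * l2_norm G A \<xi>))" if \<xi>: "\<xi> \<in> H" for \<xi>
    proof -
      note c = op_closed[OF S \<xi>]
      have le: "l2_norm G A (vadd (S m \<xi>) (vsm (- 1) (S n \<xi>))) \<le> nrm B (S m \<ominus>\<^bsub>B\<^esub> S n) * l2_norm G A \<xi>" for m n
        using op_norm_le[of "S m \<ominus>\<^bsub>B\<^esub> S n" \<xi>] S \<xi> by (simp add: op_diff_apply)
      have "\<exists>N. \<forall>m\<ge>N. \<forall>n\<ge>N. l2_norm G A (vadd (S m \<xi>) (vsm (- 1) (S n \<xi>))) < e" if e: "0 < e" for e
      proof -
        define K where "K = l2_norm G A \<xi> + 1"
        have K: "0 < K" using l2_norm_nonneg[OF \<xi>] by (simp add: K_def)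
        obtain N where N: "\<forall>m\<ge>N. \<forall>n\<ge>N. nrm B (S m \<ominus>\<^bsub>B\<^esub> S n) < e / K"
          using C[OF divide_pos_pos[OF e K]] by blast
        have "l2_norm G A (vadd (S m \<xi>) (vsm (- 1) (S n \<xi>))) < e" if "m \<ge> N" "n \<ge> N" for m n
        proof -
          have "nrm B (S m \<ominus>\<^bsub>B\<^esub> S n) * l2_norm G A \<xi> \<le> nrm B (S m \<ominus>\<^bsub>B\<^esub> S n) * K"
            by (intro mult_left_mono op_nrm_nonneg B.minus_closed S) (simp add: K_def)
          also have "\<dots> < e" using N that K by (simp add: field_simps)
          finally show ?thesis using le[of m n] by simp
        qed
        then show ?thesis by blast
      qed
      from l2_complete[of "\<lambda>n. S n \<xi>", OF c this] obtain \<eta> where \<eta>: "\<eta> \<in> H"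
        "\<And>e N. 0 \<le> e \<Longrightarrow> (\<forall>m\<ge>N. \<forall>n\<ge>N. l2_norm G A (vadd (S m \<xi>) (vsm (- 1) (S n \<xi>))) \<le> e) \<Longrightarrow>
          (\<forall>n\<ge>N. l2_norm G A (vadd (S n \<xi>) (vsm (- 1) \<eta>)) \<le> e)" by blast
      have "\<forall>n\<ge>N. l2_norm G A (vadd (S n \<xi>) (vsm (- 1) \<eta>)) \<le> e * l2_norm G A \<xi>"
        if "0 \<le> e" "\<forall>m\<ge>N. \<forall>n\<ge>N. nrm B (S m \<ominus>\<^bsub>B\<^esub> S n) \<le> e" for e N
      proof (rule \<eta>(2))
        show "0 \<le> e * l2_norm G A \<xi>" using that l2_norm_nonneg[OF \<xi>] by simp
        show "\<forall>m\<ge>N. \<forall>n\<ge>N. l2_norm G A (vadd (S m \<xi>) (vsm (- 1) (S n \<xi>))) \<le> e * l2_norm G A \<xi>"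
          using that(2) le order_trans mult_right_mono[OF _ l2_norm_nonneg[OF \<xi>]] by meson
      qed
      then show ?thesis using \<eta>(1) by blast
    qed
    then show ?thesis by metis
  qed
  have nstar: "nrm B (star B (T m) \<ominus>\<^bsub>B\<^esub> star B (T n)) \<le> nrm B (T m \<ominus>\<^bsub>B\<^esub> T n)" for m n
  proof -
    have "star B (T m) \<ominus>\<^bsub>B\<^esub> star B (T n) = star B (T m \<ominus>\<^bsub>B\<^esub> T n)"
      using T by (simp add: a_minus_def op_minus op_star_closed op_add_closed op_smult_closed)
    then show ?thesis using op_nrm_star[of "T m \<ominus>\<^bsub>B\<^esub> T n"] T by simp
  qed
  have C2: "\<exists>N. \<forall>m\<ge>N. \<forall>n\<ge>N. nrm B (star B (T m) \<ominus>\<^bsub>B\<^esub> star B (T n)) < e" if "0 < e" for e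
    using C[OF that] nstar le_less_trans by meson
  obtain L where L: "\<And>\<xi>. \<xi> \<in> H \<Longrightarrow> L \<xi> \<in> H"
    "\<And>\<xi> e N n. \<xi> \<in> H \<Longrightarrow> 0 \<le> e \<Longrightarrow> \<forall>m\<ge>N. \<forall>n\<ge>N. nrm B (T m \<ominus>\<^bsub>B\<^esub> T n) \<le> e \<Longrightarrow> n \<ge> N \<Longrightarrow>
      l2_norm G A (vadd (T n \<xi>) (vsm (- 1) (L \<xi>))) \<le> e * l2_norm G A \<xi>"
    using limit[OF T C] by blast
  obtain S where S: "\<And>\<xi>. \<xi> \<in> H \<Longrightarrow> S \<xi> \<in> H"
    "\<And>\<xi> e N n. \<xi> \<in> H \<Longrightarrow> 0 \<le> e \<Longrightarrow> \<forall>m\<ge>N. \<forall>n\<ge>N. nrm B (star B (T m) \<ominus>\<^bsub>B\<^esub> star B (T n)) \<le> e \<Longrightarrow> n \<ge> N \<Longrightarrow>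
      l2_norm G A (vadd (star B (T n) \<xi>) (vsm (- 1) (S \<xi>))) \<le> e * l2_norm G A \<xi>"
    using limit[OF op_star_closed[OF T] C2] by blast
  have ip: "l2_ip G A (L \<xi>) \<eta> = l2_ip G A \<xi> (S \<eta>)" if \<xi>: "\<xi> \<in> H" and \<eta>: "\<eta> \<in> H" for \<xi> \<eta>
  proof -
    let ?x = "l2_ip G A (L \<xi>) \<eta>" and ?y = "l2_ip G A \<xi> (S \<eta>)"
    note c = l2_ip_closed[OF L(1)[OF \<xi>] \<eta>] l2_ip_closed[OF \<xi> S(1)[OF \<eta>]]
    define K where "K = l2_norm G A \<xi> * l2_norm G A \<eta>"
    have K: "0 \<le> K" by (simp add: K_def l2_norm_nonneg \<xi> \<eta>)
    have "nrm A (?x \<ominus> ?y) \<le> 0 + e" if e: "0 < e" for e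
    proof -
      \<comment> \<open>The two errors are at most d K each and add up to at most \<open>e\<close>;
        K + 1 covers the case K = 0.\<close>
      define d where "d = e / (2 * (K + 1))"
      have d: "0 < d" using e K by (simp add: d_def)
      obtain N where N: "\<forall>m\<ge>N. \<forall>n\<ge>N. nrm B (T m \<ominus>\<^bsub>B\<^esub> T n) < d" using C[OF d] by blast
      then have N1: "\<forall>m\<ge>N. \<forall>n\<ge>N. nrm B (T m \<ominus>\<^bsub>B\<^esub> T n) \<le> d" by (meson less_imp_le)
      then have N2: "\<forall>m\<ge>N. \<forall>n\<ge>N. nrm B (star B (T m) \<ominus>\<^bsub>B\<^esub> star B (T n)) \<le> d" using nstar order_trans by meson
      let ?z = "l2_ip G A (T N \<xi>) \<eta>"
      note cT = op_closed[OF T[of N] \<xi>] op_closed[OF op_star_closed[OF T[of N]] \<eta>]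
      have z: "?z = l2_ip G A \<xi> (star B (T N) \<eta>)" by (rule op_star_ip[OF T \<xi> \<eta>])
      have "nrm A (?z \<ominus> ?x) \<le> d * K"
      proof -
        have "?z \<ominus> ?x = l2_ip G A (vadd (T N \<xi>) (vsm (- 1) (L \<xi>))) \<eta>"
          using cT L(1)[OF \<xi>] \<eta> by (simp add: ip_vadd_left ip_vsm_left smult_minus_one l2_ip_closed a_minus_def)
        also have "nrm A \<dots> \<le> l2_norm G A (vadd (T N \<xi>) (vsm (- 1) (L \<xi>))) * l2_norm G A \<eta>"
          by (intro nrm_l2_ip_le vadd_closed vsm_closed cT L \<xi> \<eta>)
        also have "\<dots> \<le> (d * l2_norm G A \<xi>) * l2_norm G A \<eta>"
          by (intro mult_right_mono L(2)[OF \<xi> _ N1] l2_norm_nonneg \<eta>) (use d in auto)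
        finally show ?thesis by (simp add: K_def mult.assoc)
      qed
      moreover have "nrm A (?z \<ominus> ?y) \<le> d * K"
      proof -
        have "?z \<ominus> ?y = l2_ip G A \<xi> (vadd (star B (T N) \<eta>) (vsm (- 1) (S \<eta>)))"
          using cT S(1)[OF \<eta>] \<xi> by (simp add: z ip_vadd_right ip_vsm_right smult_minus_one l2_ip_closed a_minus_def)
        also have "nrm A \<dots> \<le> l2_norm G A \<xi> * l2_norm G A (vadd (star B (T N) \<eta>) (vsm (- 1) (S \<eta>)))"
          by (intro nrm_l2_ip_le vadd_closed vsm_closed cT S \<xi> \<eta>)
        also have "\<dots> \<le> l2_norm G A \<xi> * (d * l2_norm G A \<eta>)"
          by (intro mult_left_mono S(2)[OF \<eta> _ N2] l2_norm_nonneg \<xi>) (use d in auto)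
        finally show ?thesis by (simp add: K_def mult_ac)
      qed
      moreover have "nrm A (?x \<ominus> ?y) \<le> nrm A (?x \<ominus> ?z) + nrm A (?z \<ominus> ?y)"
        using cT \<eta> by (intro nrm_diff_triangle c l2_ip_closed)
      moreover have "nrm A (?x \<ominus> ?z) = nrm A (?z \<ominus> ?x)"
        using cT \<eta> by (intro nrm_diff_commute c l2_ip_closed)
      moreover have "d * K + d * K \<le> e"
      proof -
        have "d * K + d * K \<le> d * (2 * (K + 1))" using d by (simp add: algebra_simps)
        also have "\<dots> = e" using K by (simp add: d_def)
        finally show ?thesis .
      qed
      ultimately show ?thesis by linarith
    qed
    then have "nrm A (?x \<ominus> ?y) \<le> 0" by (rule field_le_epsilon)
    then have "?x \<ominus> ?y = \<zero>" using nrm_nonneg[of "?x \<ominus> ?y"] c by (intro nrm_zero_imp) auto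
    then show ?thesis using c by (simp add: diff_eq_zero_iff)
  qed
  define L' where "L' = restrict L H"
  have a: "is_adjoint G A L' (restrict S H)"
    using S(1) ip by (auto simp: is_adjoint_def L'_def)
  obtain N0 where N0: "\<forall>m\<ge>N0. \<forall>n\<ge>N0. nrm B (T m \<ominus>\<^bsub>B\<^esub> T n) \<le> 1" using C[of 1] by (meson less_imp_le zero_less_one)
  have L'B: "L' \<in> carrier B"
  proof (rule op_intro[OF _ a])
    show "L' \<in> H \<rightarrow>\<^sub>E H" using L(1) by (auto simp: L'_def)
    fix \<xi> assume \<xi>: "\<xi> \<in> H"
    note c = op_closed[OF T[of N0] \<xi>] L(1)[OF \<xi>]
    have "L \<xi> = vadd (T N0 \<xi>) (vsm (- 1) (vadd (T N0 \<xi>) (vsm (- 1) (L \<xi>))))"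
      using c by (intro l2_eqI vadd_closed vsm_closed)
        (simp_all add: vadd_def vsm_def smult_minus_one l2_carrier minus_add r_neg1 r_neg2)
    then have "l2_norm G A (L \<xi>) \<le> l2_norm G A (T N0 \<xi>) + l2_norm G A (vadd (T N0 \<xi>) (vsm (- 1) (L \<xi>)))"
      using l2_norm_vadd_le[of "T N0 \<xi>" "vsm (- 1) (vadd (T N0 \<xi>) (vsm (- 1) (L \<xi>)))"] c by (simp add: l2_norm_vsm)
    then show "l2_norm G A (L' \<xi>) \<le> (nrm B (T N0) + 1) * l2_norm G A \<xi>"
      using op_norm_le[OF T \<xi>, of N0] L(2)[OF \<xi> _ N0 order_refl] \<xi> by (simp add: L'_def algebra_simps)
  qed
  show "\<exists>L\<in>carrier B. \<forall>e>0. \<exists>N. \<forall>n\<ge>N. nrm B (T n \<ominus>\<^bsub>B\<^esub> L) < e"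
  proof (intro bexI[OF _ L'B] allI impI)
    fix e :: real assume e: "0 < e"
    then obtain N where N: "\<forall>m\<ge>N. \<forall>n\<ge>N. nrm B (T m \<ominus>\<^bsub>B\<^esub> T n) \<le> e / 2" using C[of "e/2"] by (meson half_gt_zero less_imp_le)
    have "nrm B (T n \<ominus>\<^bsub>B\<^esub> L') \<le> e / 2" if "n \<ge> N" for n
    proof (rule op_nrm_leI)
      fix \<xi> assume \<xi>: "\<xi> \<in> H"
      then show "l2_norm G A ((T n \<ominus>\<^bsub>B\<^esub> L') \<xi>) \<le> e / 2 * l2_norm G A \<xi>"
        using L(2)[OF \<xi> _ N that] e T L'B by (simp add: op_diff_apply) (simp add: L'_def)
    qed (use e in simp)
    then show "\<exists>N. \<forall>n\<ge>N. nrm B (T n \<ominus>\<^bsub>B\<^esub> L') < e" using e by (intro exI[of _ N]) force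
  qed
qed

lemma op_cstar: "cstar_algebra B"
proof (intro cstar_algebra.intro op_abelian_group cstar_algebra_axioms.intro)
  note cl = op_add_closed(1) op_smult_closed(1) op_mult_closed(1) op_star_closed op_closed
  note ops = op_add op_smult op_mult compose_def
  fix x y z c d
  assume x: "x \<in> carrier B"
  show "c \<odot>\<^bsub>B\<^esub> x \<in> carrier B" "star B x \<in> carrier B" using x by (simp_all add: cl)
  show "(c + d) \<odot>\<^bsub>B\<^esub> x = c \<odot>\<^bsub>B\<^esub> x \<oplus>\<^bsub>B\<^esub> d \<odot>\<^bsub>B\<^esub> x"
    using x by (intro op_eqI cl) (simp_all add: ops cl vsm_add)
  show "(c * d) \<odot>\<^bsub>B\<^esub> x = c \<odot>\<^bsub>B\<^esub> (d \<odot>\<^bsub>B\<^esub> x)"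
    using x by (intro op_eqI cl) (simp_all add: ops cl vsm_vsm)
  show "1 \<odot>\<^bsub>B\<^esub> x = x" using x by (intro op_eqI cl) (simp_all add: ops cl vsm_one)
  show "star B (star B x) = x"
    by (rule op_star_eqI[OF op_star_closed[OF x] is_adjoint_sym[OF op_star_is_adjoint[OF x]]])
      (use x in \<open>auto simp: op_carrier\<close>)
  show "star B (c \<odot>\<^bsub>B\<^esub> x) = cnj c \<odot>\<^bsub>B\<^esub> star B x" using x by (rule op_smult_closed)
  show "nrm B x = 0 \<Longrightarrow> x = \<zero>\<^bsub>B\<^esub>" using x by (rule op_nrm_zero_imp)
  show "nrm B (c \<odot>\<^bsub>B\<^esub> x) = cmod c * nrm B x" using x by (rule op_nrm_smult)
  show "nrm B (star B x \<otimes>\<^bsub>B\<^esub> x) = (nrm B x)\<^sup>2" using x by (rule op_cstar_identity)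
  assume y: "y \<in> carrier B"
  show "x \<otimes>\<^bsub>B\<^esub> y \<in> carrier B" using x y by (simp add: cl)
  show "c \<odot>\<^bsub>B\<^esub> (x \<oplus>\<^bsub>B\<^esub> y) = c \<odot>\<^bsub>B\<^esub> x \<oplus>\<^bsub>B\<^esub> c \<odot>\<^bsub>B\<^esub> y"
    using x y by (intro op_eqI cl) (simp_all add: ops cl vsm_vadd)
  show "(c \<odot>\<^bsub>B\<^esub> x) \<otimes>\<^bsub>B\<^esub> y = c \<odot>\<^bsub>B\<^esub> (x \<otimes>\<^bsub>B\<^esub> y)"
    using x y by (intro op_eqI cl) (simp_all add: ops cl)
  show "x \<otimes>\<^bsub>B\<^esub> (c \<odot>\<^bsub>B\<^esub> y) = c \<odot>\<^bsub>B\<^esub> (x \<otimes>\<^bsub>B\<^esub> y)"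
    using x y by (intro op_eqI cl) (simp_all add: ops cl op_linear)
  show "star B (x \<oplus>\<^bsub>B\<^esub> y) = star B x \<oplus>\<^bsub>B\<^esub> star B y" using x y by (rule op_add_closed)
  show "star B (x \<otimes>\<^bsub>B\<^esub> y) = star B y \<otimes>\<^bsub>B\<^esub> star B x" using x y by (rule op_mult_closed)
  show "nrm B (x \<oplus>\<^bsub>B\<^esub> y) \<le> nrm B x + nrm B y" using x y by (rule op_nrm_triangle)
  show "nrm B (x \<otimes>\<^bsub>B\<^esub> y) \<le> nrm B x * nrm B y" using x y by (rule op_mult_closed)
  assume z: "z \<in> carrier B"
  show "x \<otimes>\<^bsub>B\<^esub> y \<otimes>\<^bsub>B\<^esub> z = x \<otimes>\<^bsub>B\<^esub> (y \<otimes>\<^bsub>B\<^esub> z)"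
    using x y z by (intro op_eqI cl) (simp_all add: ops cl)
  show "(x \<oplus>\<^bsub>B\<^esub> y) \<otimes>\<^bsub>B\<^esub> z = x \<otimes>\<^bsub>B\<^esub> z \<oplus>\<^bsub>B\<^esub> y \<otimes>\<^bsub>B\<^esub> z"
    using x y z by (intro op_eqI cl) (simp_all add: ops cl)
  show "z \<otimes>\<^bsub>B\<^esub> (x \<oplus>\<^bsub>B\<^esub> y) = z \<otimes>\<^bsub>B\<^esub> x \<oplus>\<^bsub>B\<^esub> z \<otimes>\<^bsub>B\<^esub> y"
    using x y z by (intro op_eqI cl) (simp_all add: ops cl op_linear)
qed (rule op_mcomplete)

end

section \<open>Closed *-subalgebras and ideals\<close>

context cstar_algebra
begin

lemma closed_limitI:
  assumes S: "S \<subseteq> carrier A" "closed (E ` S)" and x: "x \<in> carrier A"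
    and approx: "\<And>d. 0 < d \<Longrightarrow> \<exists>y\<in>S. nrm A (x \<ominus> y) < d"
  shows "x \<in> S"
proof -
  have "\<exists>z\<in>E ` S. dist z (E x) < d" if d: "0 < d" for d
  proof -
    obtain y where y: "y \<in> S" "nrm A (x \<ominus> y) < d" using approx[OF d] by blast
    then have "y \<in> carrier A" using S by blast
    then have "dist (E y) (E x) < d" using y x norm_emb[of "x \<ominus> y"] by (simp add: dist_norm emb_diff norm_minus_commute)
    then show ?thesis using y by blast
  qed
  then have "E x \<in> E ` S" using S(2) closed_approachable by blast
  then show ?thesis using S(1) x emb_eq_iff by blast
qed

lemma closed_Cauchy_limit:
  fixes s :: "nat \<Rightarrow> 'a"
  assumes S: "S \<subseteq> carrier A" "closed (E ` S)" and s: "\<And>n. s n \<in> S" "\<And>e. 0 < e \<Longrightarrow> \<exists>N. \<forall>n\<ge>N. nrm A (s n \<ominus> l) < e"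
    and l: "l \<in> carrier A"
  shows "l \<in> S"
proof (rule closed_limitI[OF S l])
  fix d :: real assume d: "0 < d"
  obtain N where "\<forall>n\<ge>N. nrm A (s n \<ominus> l) < d" using s(2)[OF d] ..
  then have "nrm A (s N \<ominus> l) < d" by simp
  moreover have "s N \<in> carrier A" using s(1) S(1) by blast
  ultimately show "\<exists>y\<in>S. nrm A (l \<ominus> y) < d"
    using s(1)[of N] nrm_diff_commute[OF l, of "s N"] by (intro bexI[of _ "s N"]) simp_all
qed

end

locale cstar_subalgebra = cstar_algebra A for A :: "'a cstar" (structure) +
  fixes S :: "'a set"
  assumes sub: "S \<subseteq> carrier A" and sub_zero: "\<zero> \<in> S"
    and sub_add: "x \<in> S \<Longrightarrow> y \<in> S \<Longrightarrow> x \<oplus> y \<in> S"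
    and sub_smult: "x \<in> S \<Longrightarrow> c \<odot> x \<in> S"
    and sub_mult: "x \<in> S \<Longrightarrow> y \<in> S \<Longrightarrow> x \<otimes> y \<in> S"
    and sub_star: "x \<in> S \<Longrightarrow> star A x \<in> S"
    and sub_closed: "closed (E ` S)"
begin

abbreviation "A' \<equiv> A\<lparr>carrier := S\<rparr>"

lemma sub_carrier: "x \<in> S \<Longrightarrow> x \<in> carrier A"
  using sub by blast

lemma sub_minus: "x \<in> S \<Longrightarrow> \<ominus> x \<in> S"
  using sub_smult[of x "- 1"] by (simp add: smult_minus_one sub_carrier)

lemma sub_abelian_group: "abelian_group A'"
  by (rule abelian_groupI) (auto simp: sub_zero sub_add sub_carrier a_ac l_neg r_neg intro!: bexI[OF _ sub_minus])

lemma sub_a_inv: "x \<in> S \<Longrightarrow> \<ominus>\<^bsub>A'\<^esub> x = \<ominus> x"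
proof -
  interpret A': abelian_group A' by (rule sub_abelian_group)
  assume "x \<in> S"
  then show ?thesis by (intro A'.minus_equality) (auto simp: sub_minus sub_carrier l_neg)
qed

lemma sub_diff: "x \<in> S \<Longrightarrow> y \<in> S \<Longrightarrow> x \<ominus>\<^bsub>A'\<^esub> y = x \<ominus> y"
  by (simp add: a_minus_def sub_a_inv)

lemma sub_diff_closed: "x \<in> S \<Longrightarrow> y \<in> S \<Longrightarrow> x \<ominus> y \<in> S"
  by (simp add: a_minus_def sub_add sub_minus)

lemma sub_cstar: "cstar_algebra A'"
proof (intro cstar_algebra.intro sub_abelian_group cstar_algebra_axioms.intro)
  show "Metric_space.mcomplete (carrier A') (cs_dist A')"
  proof (rule cs_mcompleteI)
    show "Metric_space (carrier A') (cs_dist A')"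
      by (rule Metric_space_cs_dist[OF sub_abelian_group])
        (auto simp: sub_a_inv sub_carrier nrm_zero_imp nrm_zero nrm_minus nrm_triangle)
    fix s :: "nat \<Rightarrow> 'a"
    assume "\<And>n. s n \<in> carrier A'"
    then have s: "\<And>n. s n \<in> S" by simp
    assume "\<And>e. 0 < e \<Longrightarrow> \<exists>N. \<forall>m\<ge>N. \<forall>n\<ge>N. nrm A' (s m \<ominus>\<^bsub>A'\<^esub> s n) < e"
    then have "\<And>e. 0 < e \<Longrightarrow> \<exists>N. \<forall>m\<ge>N. \<forall>n\<ge>N. nrm A (s m \<ominus> s n) < e" using s by (simp add: sub_diff)
    then obtain l where l: "l \<in> carrier A" "\<And>e. 0 < e \<Longrightarrow> \<exists>N. \<forall>n\<ge>N. nrm A (s n \<ominus> l) < e"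
      using Cauchy_imp_limit[of s] s sub_carrier by metis
    have "l \<in> S" by (rule closed_Cauchy_limit[OF sub sub_closed s l(2,1)])
    then show "\<exists>l\<in>carrier A'. \<forall>e>0. \<exists>N. \<forall>n\<ge>N. nrm A' (s n \<ominus>\<^bsub>A'\<^esub> l) < e"
      using l s by (intro bexI[of _ l]) (simp_all add: sub_diff)
  qed
qed (auto simp: sub_carrier sub_mult sub_smult sub_star m_assoc l_distr r_distr smult_l_distr smult_r_distr
    smult_assoc smult_one smult_mult_left smult_mult_right star_star star_add star_smult star_mult nrm_zero_imp
    nrm_triangle nrm_smult nrm_mult cstar_identity)

text \<open>The records \<open>A'\<close> and \<open>A\<close> may be different factors of the
  ambient type, so their embeddings are different maps. They induce the same distances, and
  convergence is compared through these.\<close>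

lemma sub_limitin:
  assumes "x \<in> S" "\<And>i. s i \<in> S"
  shows "limitin (cs_top A') s x F \<longleftrightarrow> limitin (cs_top A) s x F"
proof -
  interpret A': cstar_algebra A' by (rule sub_cstar)
  have "dist (emb A' (s i)) (emb A' x) = dist (E (s i)) (E x)" for i
    using assms by (simp add: dist_norm sub_carrier norm_emb A'.norm_emb sub_diff sub_diff_closed flip: A'.emb_diff emb_diff)
  then have "((\<lambda>i. emb A' (s i)) \<longlongrightarrow> emb A' x) F \<longleftrightarrow> ((\<lambda>i. E (s i)) \<longlongrightarrow> E x) F"
    by (simp only: tendsto_iff)
  then show ?thesis using assms by (simp add: limitin_cs_top A'.limitin_cs_top sub_carrier)
qed

lemma sub_closed_iff: "T \<subseteq> S \<Longrightarrow> closed (emb A' ` T) \<longleftrightarrow> closed (E ` T)"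
proof -
  interpret A': cstar_algebra A' by (rule sub_cstar)
  assume T: "T \<subseteq> S"
  then have TA: "T \<subseteq> carrier A" using sub by blast
  have "closedin (cs_top A') T \<longleftrightarrow> closedin (cs_top A) T"
  proof -
    have "closedin (cs_top A) T \<longleftrightarrow> (\<forall>s l. range s \<subseteq> T \<and> limitin (cs_top A) s l sequentially \<longrightarrow> l \<in> T)"
      unfolding cs_top_def metric.metric_closedin_iff_sequentially_closed using TA by simp
    also have "\<dots> \<longleftrightarrow> (\<forall>s l. range s \<subseteq> T \<and> limitin (cs_top A') s l sequentially \<longrightarrow> l \<in> T)"
    proof -
      have "limitin (cs_top A) s l sequentially \<longleftrightarrow> limitin (cs_top A') s l sequentially" if s: "range s \<subseteq> T" for s l
      proof (cases "l \<in> S")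
        case True
        then show ?thesis using s T by (intro sub_limitin[symmetric]) auto
      next
        case False
        \<comment> \<open>A limit formed in \<open>A\<close> stays in \<open>S\<close> because
          \<open>S\<close> is closed.\<close>
        have "l \<in> S" if "limitin (cs_top A) s l sequentially"
        proof -
          have "closedin (cs_top A) S" using sub sub_closed by (simp add: closedin_cs_top)
          then show "l \<in> S" using that s T
            unfolding cs_top_def metric.metric_closedin_iff_sequentially_closed by blast
        qed
        then show ?thesis using False by (auto simp: A'.limitin_cs_top)
      qed
      then show ?thesis by blast
    qed
    also have "\<dots> \<longleftrightarrow> closedin (cs_top A') T"
      unfolding cs_top_def A'.metric.metric_closedin_iff_sequentially_closed using T by simp
    finally show ?thesis by simp
  qed
  then show ?thesis using T TA by (simp add: closedin_cs_top A'.closedin_cs_top)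
qed

end

section \<open>Closed ideals and their annihilators\<close>

context cstar_algebra
begin

lemma cs_idealD:
  assumes "cs_ideal A K"
  shows "K \<subseteq> carrier A" "\<zero> \<in> K" "x \<in> K \<Longrightarrow> y \<in> K \<Longrightarrow> x \<oplus> y \<in> K" "x \<in> K \<Longrightarrow> c \<odot> x \<in> K"
    "a \<in> carrier A \<Longrightarrow> x \<in> K \<Longrightarrow> a \<otimes> x \<in> K" "a \<in> carrier A \<Longrightarrow> x \<in> K \<Longrightarrow> x \<otimes> a \<in> K"
    "closed (E ` K)"
  using assms additive_subgroup.a_subset[of K A] additive_subgroup.zero_closed[of K A]
    additive_subgroup.a_closed[of K A x y]
  by (auto simp: cs_ideal_def closedin_cs_top)

lemma cs_idealI:
  assumes K: "K \<subseteq> carrier A" "\<zero> \<in> K" "\<And>x y. x \<in> K \<Longrightarrow> y \<in> K \<Longrightarrow> x \<oplus> y \<in> K"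
    "\<And>c x. x \<in> K \<Longrightarrow> c \<odot> x \<in> K" "\<And>a x. a \<in> carrier A \<Longrightarrow> x \<in> K \<Longrightarrow> a \<otimes> x \<in> K"
    "\<And>a x. a \<in> carrier A \<Longrightarrow> x \<in> K \<Longrightarrow> x \<otimes> a \<in> K" "closed (E ` K)"
  shows "cs_ideal A K"
proof -
  have "\<ominus> x \<in> K" if "x \<in> K" for x
    using K(4)[OF that, of "- 1"] that K(1) smult_minus_one[of x] by auto
  then have "additive_subgroup K A"
    using K(1-3) by (intro additive_subgroup.intro subgroup.intro) (auto simp: a_inv_def)
  then show ?thesis using K by (simp add: cs_ideal_def closedin_cs_top)
qed

lemma cs_ideal_minus: "cs_ideal A K \<Longrightarrow> x \<in> K \<Longrightarrow> \<ominus> x \<in> K"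
  using cs_idealD(4)[of K x "- 1"] cs_idealD(1)[of K] smult_minus_one[of x] by auto

text \<open>Transfers \<open>approx_unit\<close> to an ideal of a record. Only
  \<open>star A k \<otimes> k\<close> has to lie in \<open>K\<close>, and 1 - e is formed in the
  ambient type.\<close>

lemma ideal_approx_unit:
  assumes K: "cs_ideal A K" and k: "k \<in> carrier A" "star A k \<otimes> k \<in> K" and d: "0 < d"
  obtains e where "e \<in> K" "star A e = e" "norm (1 - E e) \<le> 1" "norm (E k * (1 - E e)) < d"
proof -
  note D = cs_idealD[OF K]
  have c: "x \<in> K \<Longrightarrow> x \<in> carrier A" for x using D(1) by blast
  have kk: "adj (E k) * E k = E (star A k \<otimes> k)" using k by (simp add: emb_mult emb_star star_closed)
  have 1: "adj (E k) * E k \<in> E ` K" unfolding kk using k by blast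
  have 2: "0 \<in> E ` K" using D(2) emb_zero by (metis imageI)
  have 3: "x + y \<in> E ` K" if xy: "x \<in> E ` K" "y \<in> E ` K" for x y
  proof -
    obtain x' y' where "x' \<in> K" "y' \<in> K" "x = E x'" "y = E y'" using xy by blast
    then show ?thesis using D(3)[of x' y'] emb_add[of x' y'] c by (metis imageI)
  qed
  have 4: "r *\<^sub>R x \<in> E ` K" if x: "x \<in> E ` K" for r x
  proof -
    obtain x' where "x' \<in> K" "x = E x'" using x by blast
    then show ?thesis using D(4)[of x' "complex_of_real r"] emb_smult[of x' "complex_of_real r"] c cscale_of_real[of r x]
      by (metis imageI)
  qed
  have 5: "x * (adj (E k) * E k) \<in> E ` K" if x: "x \<in> E ` K" for x
  proof -
    obtain x' where "x' \<in> K" "x = E x'" using x by blast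
    then show ?thesis using D(6)[of "star A k \<otimes> k" x'] emb_mult[of x' "star A k \<otimes> k"] c k unfolding kk by (metis imageI)
  qed
  obtain u where u: "u \<in> E ` K" "adj u = u" "norm (1 - u) \<le> 1" "norm (E k * (1 - u)) < d"
    using approx_unit[OF 1 2 3 4 5 d] by metis
  then obtain e where e: "e \<in> K" "u = E e" by blast
  then have "star A e = e" using u(2) c[OF e(1)] by (simp add: star_closed flip: emb_star emb_eq_iff)
  then show ?thesis using that e u by blast
qed

lemma emb_mult_one_minus:
  "x \<in> carrier A \<Longrightarrow> e \<in> carrier A \<Longrightarrow> E x * (1 - E e) = E (x \<ominus> x \<otimes> e)"
  by (simp add: emb_diff emb_mult m_closed algebra_simps)

lemma ideal_right_unit:
  assumes K: "cs_ideal A K" and k: "k \<in> K" and d: "0 < d"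
  obtains e where "e \<in> K" "star A e = e" "nrm A (k \<ominus> k \<otimes> e) < d"
proof -
  note D = cs_idealD[OF K]
  have kc: "k \<in> carrier A" using D(1) k by blast
  obtain e where e: "e \<in> K" "star A e = e" "norm (E k * (1 - E e)) < d"
    using ideal_approx_unit[OF K kc D(5)[OF star_closed[OF kc] k] d] by metis
  then have ec: "e \<in> carrier A" using D(1) by blast
  have "nrm A (k \<ominus> k \<otimes> e) < d" using e(3) kc ec by (simp add: emb_mult_one_minus norm_emb m_closed)
  then show ?thesis using that e by blast
qed

lemma nrm_star: "x \<in> carrier A \<Longrightarrow> nrm A (star A x) = nrm A x"
  using nrm_star_le[OF cstar, of x] nrm_star_le[OF cstar, of "star A x"] by (simp add: star_closed star_star)

lemma star_minus: "x \<in> carrier A \<Longrightarrow> star A (\<ominus> x) = \<ominus> star A x"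
  using star_smult[of x "- 1"] by (simp add: smult_minus_one star_closed)

lemma star_diff: "x \<in> carrier A \<Longrightarrow> y \<in> carrier A \<Longrightarrow> star A (x \<ominus> y) = star A x \<ominus> star A y"
  by (simp add: a_minus_def star_add star_minus)

text \<open>If \<open>e\<close> in \<open>K\<close> is nearly a right unit for \<open>k\<close>,
  then the adjoint of k e, which is e k^*, lies in the ideal and is close to k^*.\<close>

lemma cs_ideal_star:
  assumes K: "cs_ideal A K" and k: "k \<in> K"
  shows "star A k \<in> K"
proof -
  note D = cs_idealD[OF K]
  have kc: "k \<in> carrier A" using D(1) k by blast
  show ?thesis
  proof (rule closed_limitI[OF D(1,7) star_closed[OF kc]])
    fix d :: real assume "0 < d"
    then obtain e where e: "e \<in> K" "star A e = e" "nrm A (k \<ominus> k \<otimes> e) < d" using ideal_right_unit[OF K k] by metis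
    then have ec: "e \<in> carrier A" using D(1) by blast
    have "star A (k \<ominus> k \<otimes> e) = star A k \<ominus> e \<otimes> star A k"
      using kc ec e(2) by (simp add: star_diff star_mult m_closed)
    then have "nrm A (star A k \<ominus> e \<otimes> star A k) < d" using e(3) kc ec nrm_star[of "k \<ominus> k \<otimes> e"] by (simp add: m_closed)
    then show "\<exists>y\<in>K. nrm A (star A k \<ominus> y) < d" using D(6)[OF star_closed[OF kc] e(1)] by blast
  qed
qed

text \<open>The approximate unit is built from a^* a alone, so a is close to a e, which lies in the
  ideal. This is the device for returning from quadratic expressions to the elements
  themselves.\<close>

lemma cs_ideal_if_star_mult:
  assumes K: "cs_ideal A K" and a: "a \<in> carrier A" "star A a \<otimes> a \<in> K"
  shows "a \<in> K"
proof (rule closed_limitI[OF cs_idealD(1,7)[OF K] a(1)])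
  note D = cs_idealD[OF K]
  fix d :: real assume "0 < d"
  then obtain e where e: "e \<in> K" "norm (E a * (1 - E e)) < d" using ideal_approx_unit[OF K a] by metis
  then have ec: "e \<in> carrier A" using D(1) by blast
  have "nrm A (a \<ominus> a \<otimes> e) < d" using e(2) a ec by (simp add: emb_mult_one_minus norm_emb m_closed)
  then show "\<exists>y\<in>K. nrm A (a \<ominus> y) < d" using D(5)[OF a(1) e(1)] by blast
qed

lemma cs_ideal_if_mult_star:
  assumes K: "cs_ideal A K" and a: "a \<in> carrier A" "a \<otimes> star A a \<in> K"
  shows "a \<in> K"
  using cs_ideal_star[OF K cs_ideal_if_star_mult[OF K star_closed[OF a(1)]]] a by (simp add: star_star)

lemma cs_ideal_inter:
  assumes "cs_ideal A J" "cs_ideal A K"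
  shows "cs_ideal A (J \<inter> K)"
proof (rule cs_idealI)
  note D = cs_idealD[OF assms(1)] cs_idealD[OF assms(2)]
  have "E ` (J \<inter> K) = E ` J \<inter> E ` K"
    by (rule inj_on_image_Int[OF inj_on_emb]) (use D in auto)
  then show "closed (E ` (J \<inter> K))" using D by (simp add: closed_Int)
qed (use cs_idealD[OF assms(1)] cs_idealD[OF assms(2)] in auto)

lemma nrm_star_mult_eq_0: "a \<in> carrier A \<Longrightarrow> star A a \<otimes> a = \<zero> \<Longrightarrow> a = \<zero>"
  using cstar_identity[of a] nrm_zero_imp[of a] by (simp add: nrm_zero)

text \<open>For x in \<open>K\<close> the element \<open>star A (c \<otimes> x)\<close> lies in
  \<open>K\<close>, so its product with \<open>c\<close> vanishes, and then so does its product with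
  \<open>c \<otimes> x\<close>. The C*-identity gives
  \<open>c \<otimes> x = \<zero>\<close>.\<close>

lemma annihilatorI_left:
  assumes K: "cs_ideal A K" and c: "c \<in> carrier A" "\<And>x. x \<in> K \<Longrightarrow> x \<otimes> c = \<zero>"
  shows "c \<in> annihilator A K"
proof -
  note D = cs_idealD[OF K]
  have "c \<otimes> x = \<zero>" if x: "x \<in> K" for x
  proof (rule nrm_star_mult_eq_0)
    have xc: "x \<in> carrier A" using x D(1) by blast
    then show "c \<otimes> x \<in> carrier A" using c by (simp add: m_closed)
    have "star A (c \<otimes> x) \<in> K" by (intro cs_ideal_star[OF K] D(5) c x)
    then have "star A (c \<otimes> x) \<otimes> c = \<zero>" by (rule c(2))
    then show "star A (c \<otimes> x) \<otimes> (c \<otimes> x) = \<zero>"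
      using xc c(1) by (simp add: m_assoc[symmetric] star_closed m_closed mult_zero_left)
  qed
  then show ?thesis using c by (simp add: annihilator_def)
qed

lemma annihilator_ideal:
  assumes K: "cs_ideal A K"
  shows "cs_ideal A (annihilator A K)"
proof (rule cs_idealI)
  note D = cs_idealD[OF K]
  have cK: "x \<in> K \<Longrightarrow> x \<in> carrier A" for x using D(1) by blast
  have ann: "c \<in> annihilator A K \<longleftrightarrow> c \<in> carrier A \<and> (\<forall>x\<in>K. c \<otimes> x = \<zero> \<and> x \<otimes> c = \<zero>)" for c
    by (simp add: annihilator_def)
  show "annihilator A K \<subseteq> carrier A" by (auto simp: ann)
  show "\<zero> \<in> annihilator A K" by (simp add: ann cK mult_zero_left mult_zero_right)
  show "x \<oplus> y \<in> annihilator A K" if "x \<in> annihilator A K" "y \<in> annihilator A K" for x y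
    using that by (simp add: ann cK l_distr r_distr)
  show "c \<odot> x \<in> annihilator A K" if "x \<in> annihilator A K" for c x
    using that by (simp add: ann cK smult_closed smult_mult_left smult_mult_right smult_zero_right)
  show "a \<otimes> c \<in> annihilator A K" if "a \<in> carrier A" "c \<in> annihilator A K" for a c
    using that D(6)[OF that(1)] by (simp add: ann cK m_closed m_assoc mult_zero_right)
      (simp add: cK m_assoc[symmetric])
  show "c \<otimes> a \<in> annihilator A K" if "a \<in> carrier A" "c \<in> annihilator A K" for a c
    using that D(5)[OF that(1)] by (simp add: ann cK m_closed m_assoc)
      (simp add: cK m_assoc[symmetric] mult_zero_left)
  have "E ` annihilator A K = E ` carrier A \<inter> (\<Inter>x\<in>K. {z. z * E x = 0} \<inter> {z. E x * z = 0})"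
  proof -
    have "E c * E x = 0 \<longleftrightarrow> c \<otimes> x = \<zero>" "E x * E c = 0 \<longleftrightarrow> x \<otimes> c = \<zero>" if "c \<in> carrier A" "x \<in> K" for c x
      using that cK by (simp_all add: m_closed flip: emb_mult emb_zero) (simp_all add: emb_eq_iff m_closed)
    then show ?thesis by (auto simp: ann)
  qed
  then show "closed (E ` annihilator A K)"
    by (auto intro!: closed_Int closed_emb_carrier closed_INT closed_Collect_eq continuous_intros)
qed

lemma annihilator_inter:
  assumes K: "cs_ideal A K" and x: "x \<in> K" "x \<in> annihilator A K"
  shows "x = \<zero>"
proof (rule nrm_star_mult_eq_0)
  show "x \<in> carrier A" using x(2) by (simp add: annihilator_def)
  show "star A x \<otimes> x = \<zero>" using cs_ideal_star[OF K x(1)] x(2) by (simp add: annihilator_def)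
qed

end

section \<open>Norm closures of subsets\<close>

context cstar_algebra
begin

definition clos :: "'a set \<Rightarrow> 'a set" where
  "clos S = {x \<in> carrier A. E x \<in> closure (E ` S)}"

lemma closure_of_eq_clos: "S \<subseteq> carrier A \<Longrightarrow> Abstract_Topology.closure_of (cs_top A) S = clos S"
  using closure_of_cs_top by (auto simp: clos_def)

lemma clos_carrier: "clos S \<subseteq> carrier A"
  by (auto simp: clos_def)

lemma clos_subset: "S \<subseteq> carrier A \<Longrightarrow> S \<subseteq> clos S"
  using closure_subset[of "E ` S"] by (auto simp: clos_def)

lemma clos_seqE:
  assumes "x \<in> clos S"
  obtains s where "\<And>n. s n \<in> S" "(\<lambda>n. E (s n)) \<longlonglongrightarrow> E x"
proof -
  obtain z where z: "\<forall>n. z n \<in> E ` S" "z \<longlonglongrightarrow> E x"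
    using assms unfolding clos_def closure_sequential by blast
  from z(1) obtain s where s: "\<And>n. s n \<in> S" "z = (\<lambda>n. E (s n))" by (rule image_seqE) blast
  show ?thesis by (rule that[OF s(1) z(2)[unfolded s(2)]])
qed

lemma clos_seqI: "x \<in> carrier A \<Longrightarrow> (\<And>n. s n \<in> S) \<Longrightarrow> (\<lambda>n. E (s n)) \<longlonglongrightarrow> E x \<Longrightarrow> x \<in> clos S"
  unfolding clos_def closure_sequential by (auto intro!: exI[of _ "\<lambda>n. E (s n)"])

lemma emb_clos: "S \<subseteq> carrier A \<Longrightarrow> E ` clos S = closure (E ` S)"
  using closure_minimal[OF image_mono closed_emb_carrier, of S] by (auto simp: clos_def)

lemma closed_clos: "S \<subseteq> carrier A \<Longrightarrow> closed (E ` clos S)"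
  by (simp add: emb_clos)

lemma clos_add:
  assumes S: "S \<subseteq> carrier A" "T \<subseteq> carrier A" "\<And>s t. s \<in> S \<Longrightarrow> t \<in> T \<Longrightarrow> s \<oplus> t \<in> R"
    and x: "x \<in> clos S" "y \<in> clos T"
  shows "x \<oplus> y \<in> clos R"
proof -
  obtain s where s: "\<And>n. s n \<in> S" "(\<lambda>n. E (s n)) \<longlonglongrightarrow> E x" using x(1) by (rule clos_seqE) blast
  obtain t where t: "\<And>n. t n \<in> T" "(\<lambda>n. E (t n)) \<longlonglongrightarrow> E y" using x(2) by (rule clos_seqE) blast
  have xy: "x \<in> carrier A" "y \<in> carrier A" using x clos_carrier by auto
  show ?thesis
  proof (rule clos_seqI[of _ "\<lambda>n. s n \<oplus> t n"])
    have "E (s n \<oplus> t n) = E (s n) + E (t n)" for n using s(1)[of n] t(1)[of n] S by (intro emb_add) auto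
    then show "(\<lambda>n. E (s n \<oplus> t n)) \<longlonglongrightarrow> E (x \<oplus> y)" using s t xy by (simp add: emb_add tendsto_add)
  qed (use xy s t S in auto)
qed

lemma clos_mult:
  assumes S: "S \<subseteq> carrier A" "T \<subseteq> carrier A" "\<And>s t. s \<in> S \<Longrightarrow> t \<in> T \<Longrightarrow> s \<otimes> t \<in> R"
    and x: "x \<in> clos S" "y \<in> clos T"
  shows "x \<otimes> y \<in> clos R"
proof -
  obtain s where s: "\<And>n. s n \<in> S" "(\<lambda>n. E (s n)) \<longlonglongrightarrow> E x" using x(1) by (rule clos_seqE) blast
  obtain t where t: "\<And>n. t n \<in> T" "(\<lambda>n. E (t n)) \<longlonglongrightarrow> E y" using x(2) by (rule clos_seqE) blast
  have xy: "x \<in> carrier A" "y \<in> carrier A" using x clos_carrier by auto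
  show ?thesis
  proof (rule clos_seqI[of _ "\<lambda>n. s n \<otimes> t n"])
    have "E (s n \<otimes> t n) = E (s n) * E (t n)" for n using s(1)[of n] t(1)[of n] S by (intro emb_mult) auto
    then show "(\<lambda>n. E (s n \<otimes> t n)) \<longlonglongrightarrow> E (x \<otimes> y)" using s t xy by (simp add: emb_mult tendsto_mult)
  qed (use xy s t S m_closed in auto)
qed

lemma clos_smult:
  assumes S: "S \<subseteq> carrier A" "\<And>s. s \<in> S \<Longrightarrow> c \<odot> s \<in> R" and x: "x \<in> clos S"
  shows "c \<odot> x \<in> clos R"
proof -
  obtain s where s: "\<And>n. s n \<in> S" "(\<lambda>n. E (s n)) \<longlonglongrightarrow> E x" using x by (rule clos_seqE) blast
  have xc: "x \<in> carrier A" using x clos_carrier by auto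
  show ?thesis
  proof (rule clos_seqI[of _ "\<lambda>n. c \<odot> s n"])
    have "E (c \<odot> s n) = cscale c (E (s n))" for n using s(1)[of n] S by (intro emb_smult) auto
    then show "(\<lambda>n. E (c \<odot> s n)) \<longlonglongrightarrow> E (c \<odot> x)" using s xc by (simp add: emb_smult tendsto_cscale)
  qed (use xc s S smult_closed in auto)
qed

lemma clos_star:
  assumes S: "S \<subseteq> carrier A" "\<And>s. s \<in> S \<Longrightarrow> star A s \<in> R" and x: "x \<in> clos S"
  shows "star A x \<in> clos R"
proof -
  obtain s where s: "\<And>n. s n \<in> S" "(\<lambda>n. E (s n)) \<longlonglongrightarrow> E x" using x by (rule clos_seqE) blast
  have xc: "x \<in> carrier A" using x clos_carrier by auto
  show ?thesis
  proof (rule clos_seqI[of _ "\<lambda>n. star A (s n)"])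
    have "E (star A (s n)) = adj (E (s n))" for n using s(1)[of n] S by (intro emb_star) auto
    then show "(\<lambda>n. E (star A (s n))) \<longlonglongrightarrow> E (star A x)" using s xc by (simp add: emb_star tendsto_adj)
  qed (use xc s S star_closed in auto)
qed

lemma clos_subalgebra:
  assumes S: "S \<subseteq> carrier A" "\<zero> \<in> S" "\<And>x y. x \<in> S \<Longrightarrow> y \<in> S \<Longrightarrow> x \<oplus> y \<in> S"
    "\<And>c x. x \<in> S \<Longrightarrow> c \<odot> x \<in> S" "\<And>x y. x \<in> S \<Longrightarrow> y \<in> S \<Longrightarrow> x \<otimes> y \<in> S" "\<And>x. x \<in> S \<Longrightarrow> star A x \<in> S"
  shows "cstar_subalgebra A (clos S)"
proof unfold_locales
  show "clos S \<subseteq> carrier A" by (rule clos_carrier)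
  show "\<zero> \<in> clos S" using clos_subset[OF S(1)] S(2) by blast
  show "x \<oplus> y \<in> clos S" if "x \<in> clos S" "y \<in> clos S" for x y using that by (intro clos_add[OF S(1,1)] S)
  show "x \<otimes> y \<in> clos S" if "x \<in> clos S" "y \<in> clos S" for x y using that by (intro clos_mult[OF S(1,1)] S)
  show "c \<odot> x \<in> clos S" if "x \<in> clos S" for x c using that by (intro clos_smult[OF S(1)] S)
  show "star A x \<in> clos S" if "x \<in> clos S" for x using that by (intro clos_star[OF S(1)] S)
  show "closed (E ` clos S)" by (rule closed_clos[OF S(1)])
qed

end

section \<open>The regular covariant representation\<close>

sublocale l2_space \<subseteq> op: cstar_algebra B
  by (rule op_cstar)

context l2_space
begin

lemma op_finsum_apply:
  assumes "T \<in> F \<rightarrow> carrier B" "\<xi> \<in> H" "h \<in> I"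
  shows "E (finsum B T F \<xi> h) = (\<Sum>g\<in>F. E (T g \<xi> h))"
  using assms(1)
proof (induction F rule: infinite_finite_induct)
  case (infinite F)
  then show ?case using assms by (simp add: op_zero vzero_def emb_zero)
next
  case empty
  then show ?case using assms by (simp add: op_zero vzero_def emb_zero)
next
  case (insert x F)
  then have c: "T \<in> F \<rightarrow> carrier B" "T x \<in> carrier B" by auto
  then have "finsum B T (insert x F) \<xi> = vadd (T x \<xi>) (finsum B T F \<xi>)"
    using insert assms by (simp add: op_add)
  then show ?case using insert c assms
    by (simp add: em_vadd op_closed op.finsum_closed)
qed

text \<open>Norm convergence of operators implies convergence at every vector and coordinate.
  Pointwise properties of finite sums reach the reduced crossed product through this.\<close>

lemma op_tendsto_apply:
  assumes T: "\<And>n. T n \<in> carrier B" "L \<in> carrier B" "(\<lambda>n. op.E (T n)) \<longlonglongrightarrow> op.E L"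
    and \<xi>: "\<xi> \<in> H" and h: "h \<in> I"
  shows "(\<lambda>n. E (T n \<xi> h)) \<longlonglongrightarrow> E (L \<xi> h)"
proof (rule metric_LIMSEQ_I)
  fix e :: real assume e: "0 < e"
  define K where "K = l2_norm G A \<xi> + 1"
  have K: "0 < K" using l2_norm_nonneg[OF \<xi>] by (simp add: K_def)
  obtain N where N: "\<And>n. n \<ge> N \<Longrightarrow> dist (op.E (T n)) (op.E L) < e / K"
    using metric_LIMSEQ_D[OF T(3) divide_pos_pos[OF e K]] by blast
  have "dist (E (T n \<xi> h)) (E (L \<xi> h)) < e" if n: "n \<ge> N" for n
  proof -
    have d: "T n \<ominus>\<^bsub>B\<^esub> L \<in> carrier B" using T by simp
    have "dist (E (T n \<xi> h)) (E (L \<xi> h)) = nrm A ((T n \<ominus>\<^bsub>B\<^esub> L) \<xi> h)"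
      using T \<xi> h by (simp add: op_diff_apply vdiff_apply op_closed dist_norm l2_carrier norm_emb flip: emb_diff)
    also have "\<dots> \<le> l2_norm G A ((T n \<ominus>\<^bsub>B\<^esub> L) \<xi>)" by (intro nrm_le_l2_norm op_closed[OF d] \<xi> h)
    also have "\<dots> \<le> nrm B (T n \<ominus>\<^bsub>B\<^esub> L) * l2_norm G A \<xi>" by (intro op_norm_le d \<xi>)
    also have "\<dots> \<le> nrm B (T n \<ominus>\<^bsub>B\<^esub> L) * K" by (intro mult_left_mono op_nrm_nonneg d) (simp add: K_def)
    also have "\<dots> < e" using N[OF n] K T by (simp add: dist_norm op.norm_emb field_simps flip: op.emb_diff)
    finally show ?thesis .
  qed
  then show "\<exists>N. \<forall>n\<ge>N. dist (E (T n \<xi> h)) (E (L \<xi> h)) < e" by blast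
qed

end

text \<open>The action laws are required on the carrier only, without the extensionality that is
  built into \<open>group_action\<close>; the locale thus also covers the action on cosets by
  images.\<close>

locale cs_dyn = l2_space A G + G: group G
  for A :: "'a cstar" (structure) and G :: "('g, 'm) monoid_scheme" +
  fixes \<alpha> :: "'g \<Rightarrow> 'a \<Rightarrow> 'a"
  assumes alpha_hom: "g \<in> I \<Longrightarrow> \<alpha> g \<in> star_hom A A"
    and alpha_one: "x \<in> carrier A \<Longrightarrow> \<alpha> \<one>\<^bsub>G\<^esub> x = x"
    and alpha_mult: "g \<in> I \<Longrightarrow> h \<in> I \<Longrightarrow> x \<in> carrier A \<Longrightarrow> \<alpha> (g \<otimes>\<^bsub>G\<^esub> h) x = \<alpha> g (\<alpha> h x)"
begin

lemma alpha_closed: "g \<in> I \<Longrightarrow> x \<in> carrier A \<Longrightarrow> \<alpha> g x \<in> carrier A"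
  using star_homD(1)[OF alpha_hom] .

lemma alpha_zero: "g \<in> I \<Longrightarrow> \<alpha> g \<zero> = \<zero>"
  by (rule star_hom_zero[OF cstar cstar alpha_hom])

lemmas alpha_star = star_homD(2)[OF alpha_hom]
lemmas alpha_smult = star_homD(3)[OF alpha_hom]
lemmas alpha_add = star_homD(4)[OF alpha_hom]
lemmas alpha_prod = star_homD(5)[OF alpha_hom]
lemmas alpha_diff = star_hom_diff[OF cstar cstar alpha_hom]

lemma alpha_inv: "g \<in> I \<Longrightarrow> x \<in> carrier A \<Longrightarrow> \<alpha> (inv\<^bsub>G\<^esub> g) (\<alpha> g x) = x"
  "g \<in> I \<Longrightarrow> x \<in> carrier A \<Longrightarrow> \<alpha> g (\<alpha> (inv\<^bsub>G\<^esub> g) x) = x"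
  by (simp_all add: alpha_one flip: alpha_mult)

lemma nrm_alpha_le: "g \<in> I \<Longrightarrow> x \<in> carrier A \<Longrightarrow> nrm A (\<alpha> g x) \<le> nrm A x"
  by (rule star_hom_nrm_le[OF cstar cstar alpha_hom])

abbreviation "rpi \<equiv> reg_pi G A \<alpha>"
abbreviation "lam \<equiv> reg_lambda G A"

lemma pi_apply: "\<xi> \<in> H \<Longrightarrow> h \<in> I \<Longrightarrow> rpi a \<xi> h = \<alpha> (inv\<^bsub>G\<^esub> h) a \<otimes> \<xi> h"
  by (simp add: reg_pi_def)

lemma emb_pi_apply: "a \<in> carrier A \<Longrightarrow> \<xi> \<in> H \<Longrightarrow> h \<in> I \<Longrightarrow> E (rpi a \<xi> h) = E (\<alpha> (inv\<^bsub>G\<^esub> h) a) * E (\<xi> h)"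
  by (simp add: pi_apply emb_mult alpha_closed l2_carrier)

text \<open>The twisted coefficients of \<open>rpi a\<close> are bounded by \<open>nrm A a\<close>
  uniformly over the group, since *-homomorphisms are contractive; the weighted estimates do the
  rest.\<close>

lemma pi_in_H:
  assumes "a \<in> carrier A" "\<xi> \<in> H"
  shows "rpi a \<xi> \<in> H" "l2_norm G A (rpi a \<xi>) \<le> nrm A a * l2_norm G A \<xi>"
proof -
  have le: "norm (E (\<alpha> (inv\<^bsub>G\<^esub> h) a)) \<le> nrm A a" if "h \<in> I" for h
    using that assms by (simp add: norm_emb alpha_closed nrm_alpha_le)
  show H: "rpi a \<xi> \<in> H"
  proof (rule l2I)
    have "sq_summable I (\<lambda>h. E (\<alpha> (inv\<^bsub>G\<^esub> h) a) * E (\<xi> h))"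
      by (rule sq_summable_weighted[OF l2_summable[OF assms(2)] le])
    then show "sq_summable I (em (rpi a \<xi>))" using assms by (simp add: emb_pi_apply cong: sq_summable_cong)
  qed (use assms in \<open>auto simp: reg_pi_def m_closed alpha_closed l2_carrier\<close>)
  have "hnorm I (\<lambda>h. E (\<alpha> (inv\<^bsub>G\<^esub> h) a) * E (\<xi> h)) \<le> nrm A a * hnorm I (em \<xi>)"
    by (rule hnorm_weighted_le[OF l2_summable[OF assms(2)] le nrm_nonneg[OF assms(1)]])
  then show "l2_norm G A (rpi a \<xi>) \<le> nrm A a * l2_norm G A \<xi>"
    using assms H by (simp add: l2_norm_eq emb_pi_apply cong: hnorm_cong)
qed

lemma pi_is_adjoint:
  assumes a: "a \<in> carrier A"
  shows "is_adjoint G A (rpi a) (rpi (star A a))"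
proof -
  have sa: "star A a \<in> carrier A" using a by (rule star_closed)
  have "l2_ip G A (rpi a \<xi>) \<eta> = l2_ip G A \<xi> (rpi (star A a) \<eta>)" if \<xi>: "\<xi> \<in> H" "\<eta> \<in> H" for \<xi> \<eta>
  proof -
    have "ip I (em (rpi a \<xi>)) (em \<eta>) = ip I (em \<xi>) (em (rpi (star A a) \<eta>))"
      unfolding ip_def
    proof (rule infsum_cong)
      fix h assume h: "h \<in> I"
      have "E (\<alpha> (inv\<^bsub>G\<^esub> h) (star A a)) = adj (E (\<alpha> (inv\<^bsub>G\<^esub> h) a))"
        using a h by (simp add: alpha_star emb_star alpha_closed)
      then show "adj (E (rpi a \<xi> h)) * E (\<eta> h) = adj (E (\<xi> h)) * E (rpi (star A a) \<eta> h)"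
        using a sa \<xi> h by (simp add: emb_pi_apply adj_mult mult.assoc)
    qed
    then show ?thesis using \<xi> pi_in_H a sa by (simp add: l2_ip_closed flip: emb_eq_iff emb_l2_ip)
  qed
  then show ?thesis using pi_in_H[OF sa] by (auto simp: is_adjoint_def reg_pi_def)
qed

lemma pi_closed: "a \<in> carrier A \<Longrightarrow> rpi a \<in> carrier B"
  by (rule op_intro[OF _ pi_is_adjoint pi_in_H(2)]) (auto simp: reg_pi_def dest: pi_in_H(1)[unfolded reg_pi_def])

lemma lam_apply: "\<xi> \<in> H \<Longrightarrow> h \<in> I \<Longrightarrow> lam g \<xi> h = \<xi> (inv\<^bsub>G\<^esub> g \<otimes>\<^bsub>G\<^esub> h)"
  by (simp add: reg_lambda_def)

lemma bij_left_mult: "g \<in> I \<Longrightarrow> bij_betw (\<lambda>h. g \<otimes>\<^bsub>G\<^esub> h) I I"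
  by (rule bij_betw_byWitness[of _ "\<lambda>h. inv\<^bsub>G\<^esub> g \<otimes>\<^bsub>G\<^esub> h"]) (auto simp: G.m_assoc[symmetric])

lemma lam_in_H:
  assumes g: "g \<in> I" and \<xi>: "\<xi> \<in> H"
  shows "lam g \<xi> \<in> H"
proof (rule l2I)
  have "(\<lambda>h. adj (E (\<xi> (inv\<^bsub>G\<^esub> g \<otimes>\<^bsub>G\<^esub> h))) * E (\<xi> (inv\<^bsub>G\<^esub> g \<otimes>\<^bsub>G\<^esub> h))) summable_on I"
    using summable_on_reindex_bij_betw[OF bij_left_mult[OF G.inv_closed[OF g]], of "\<lambda>h. adj (E (\<xi> h)) * E (\<xi> h)"]
      l2_summable[OF \<xi>] by (simp add: sq_summable_def)
  then show "sq_summable I (em (lam g \<xi>))"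
    unfolding sq_summable_def using \<xi> by (simp add: lam_apply cong: summable_on_cong)
qed (use g \<xi> in \<open>auto simp: reg_lambda_def l2_carrier\<close>)

lemma lam_ip:
  assumes g: "g \<in> I" and \<xi>: "\<xi> \<in> H" "\<eta> \<in> H"
  shows "l2_ip G A (lam g \<xi>) (lam g \<eta>) = l2_ip G A \<xi> \<eta>"
proof -
  have "ip I (em (lam g \<xi>)) (em (lam g \<eta>)) = (\<Sum>\<^sub>\<infinity>h\<in>I. adj (E (\<xi> (inv\<^bsub>G\<^esub> g \<otimes>\<^bsub>G\<^esub> h))) * E (\<eta> (inv\<^bsub>G\<^esub> g \<otimes>\<^bsub>G\<^esub> h)))"
    unfolding ip_def using \<xi> by (intro infsum_cong) (simp add: lam_apply)
  also have "\<dots> = ip I (em \<xi>) (em \<eta>)"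
    unfolding ip_def
    by (rule infsum_reindex_bij_betw[OF bij_left_mult[OF G.inv_closed[OF g]], of "\<lambda>h. adj (E (\<xi> h)) * E (\<eta> h)"])
  finally show ?thesis using \<xi> g by (simp add: lam_in_H l2_ip_closed flip: emb_eq_iff emb_l2_ip)
qed

lemma lam_lam_inv: "g \<in> I \<Longrightarrow> \<xi> \<in> H \<Longrightarrow> lam g (lam (inv\<^bsub>G\<^esub> g) \<xi>) = \<xi>"
  by (rule l2_eqI) (simp_all add: lam_in_H lam_apply G.m_assoc[symmetric])

lemma lam_is_adjoint:
  assumes g: "g \<in> I"
  shows "is_adjoint G A (lam g) (lam (inv\<^bsub>G\<^esub> g))"
proof -
  have "l2_ip G A (lam g \<xi>) \<eta> = l2_ip G A \<xi> (lam (inv\<^bsub>G\<^esub> g) \<eta>)" if \<xi>: "\<xi> \<in> H" "\<eta> \<in> H" for \<xi> \<eta>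
    using lam_ip[OF g \<xi>(1) lam_in_H[OF G.inv_closed[OF g] \<xi>(2)]] g \<xi> by (simp add: lam_lam_inv)
  then show ?thesis using lam_in_H[OF G.inv_closed[OF g]] by (auto simp: is_adjoint_def reg_lambda_def)
qed

lemma lam_closed: "g \<in> I \<Longrightarrow> lam g \<in> carrier B"
proof (rule op_intro[OF _ lam_is_adjoint, of _ 1])
  fix \<xi> assume "g \<in> I" "\<xi> \<in> H"
  then show "l2_norm G A (lam g \<xi>) \<le> 1 * l2_norm G A \<xi>" by (simp add: l2_norm_def lam_ip)
qed (auto simp: reg_lambda_def dest: lam_in_H[unfolded reg_lambda_def])

text \<open>The generator commonly written a u_g, realised on the Hilbert module.\<close>

definition u :: "'a \<Rightarrow> 'g \<Rightarrow> ('g \<Rightarrow> 'a) \<Rightarrow> 'g \<Rightarrow> 'a" where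
  "u a g = rpi a \<otimes>\<^bsub>B\<^esub> lam g"

lemma u_closed: "a \<in> carrier A \<Longrightarrow> g \<in> I \<Longrightarrow> u a g \<in> carrier B"
  unfolding u_def by (intro op.m_closed pi_closed lam_closed)

lemma u_apply: "g \<in> I \<Longrightarrow> \<xi> \<in> H \<Longrightarrow> h \<in> I \<Longrightarrow> u a g \<xi> h = \<alpha> (inv\<^bsub>G\<^esub> h) a \<otimes> \<xi> (inv\<^bsub>G\<^esub> g \<otimes>\<^bsub>G\<^esub> h)"
  by (simp add: u_def op_mult compose_def pi_apply lam_in_H lam_apply)

lemma u_eqI:
  assumes "T \<in> carrier B" "S \<in> carrier B" "\<And>\<xi> h. \<xi> \<in> H \<Longrightarrow> h \<in> I \<Longrightarrow> T \<xi> h = S \<xi> h"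
  shows "T = S"
  using assms by (intro op_eqI l2_eqI) (auto simp: op_closed)

lemma op_mult_apply: "\<xi> \<in> H \<Longrightarrow> (T \<otimes>\<^bsub>B\<^esub> S) \<xi> = T (S \<xi>)"
  by (simp add: op_mult compose_def)

lemma op_add_apply: "\<xi> \<in> H \<Longrightarrow> h \<in> I \<Longrightarrow> (T \<oplus>\<^bsub>B\<^esub> S) \<xi> h = T \<xi> h \<oplus> S \<xi> h"
  by (simp add: op_add vadd_def)

lemma op_smult_apply: "\<xi> \<in> H \<Longrightarrow> h \<in> I \<Longrightarrow> (c \<odot>\<^bsub>B\<^esub> T) \<xi> h = c \<odot> T \<xi> h"
  by (simp add: op_smult vsm_def)

lemma op_zero_apply: "\<xi> \<in> H \<Longrightarrow> h \<in> I \<Longrightarrow> \<zero>\<^bsub>B\<^esub> \<xi> h = \<zero>"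
  by (simp add: op_zero vzero_def)

lemma u_add: "a \<in> carrier A \<Longrightarrow> b \<in> carrier A \<Longrightarrow> g \<in> I \<Longrightarrow> u (a \<oplus> b) g = u a g \<oplus>\<^bsub>B\<^esub> u b g"
  by (rule u_eqI) (simp_all add: u_closed u_apply op_add_apply alpha_add l_distr alpha_closed l2_carrier)

lemma u_smult: "a \<in> carrier A \<Longrightarrow> g \<in> I \<Longrightarrow> u (c \<odot> a) g = c \<odot>\<^bsub>B\<^esub> u a g"
  by (rule u_eqI) (simp_all add: u_closed smult_closed op.smult_closed u_apply op_smult_apply alpha_smult
      smult_mult_left alpha_closed l2_carrier)

lemma u_zero: "g \<in> I \<Longrightarrow> u \<zero> g = \<zero>\<^bsub>B\<^esub>"
  by (rule u_eqI) (simp_all add: u_closed u_apply op_zero_apply alpha_zero mult_zero_left l2_carrier)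

text \<open>The covariance relation of the regular representation: a coefficient is transported by
  \<open>\<alpha> g\<close> when it passes \<open>lam g\<close>.\<close>

lemma u_mult:
  assumes "a \<in> carrier A" "b \<in> carrier A" "g \<in> I" "h \<in> I"
  shows "u a g \<otimes>\<^bsub>B\<^esub> u b h = u (a \<otimes> \<alpha> g b) (g \<otimes>\<^bsub>G\<^esub> h)"
proof (rule u_eqI)
  fix \<xi> k assume \<xi>: "\<xi> \<in> H" and k: "k \<in> I"
  have "u b h \<xi> \<in> H" using assms \<xi> by (simp add: op_closed u_closed)
  then show "(u a g \<otimes>\<^bsub>B\<^esub> u b h) \<xi> k = u (a \<otimes> \<alpha> g b) (g \<otimes>\<^bsub>G\<^esub> h) \<xi> k"
    using assms \<xi> k
    by (simp add: op_mult_apply u_apply G.inv_mult_group alpha_prod alpha_mult alpha_closed l2_carrier m_assoc G.m_assoc)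
qed (use assms in \<open>simp_all add: u_closed op.m_closed m_closed alpha_closed\<close>)

lemma u_star:
  assumes a: "a \<in> carrier A" and g: "g \<in> I"
  shows "star B (u a g) = u (\<alpha> (inv\<^bsub>G\<^esub> g) (star A a)) (inv\<^bsub>G\<^esub> g)"
proof -
  have s: "star B (rpi a) = rpi (star A a)" "star B (lam g) = lam (inv\<^bsub>G\<^esub> g)"
    by (rule op_star_eqI[OF pi_closed[OF a] pi_is_adjoint[OF a]], rule op_star_eqI[OF lam_closed[OF g] lam_is_adjoint[OF g]])
  have sa: "star A a \<in> carrier A" using a by (rule star_closed)
  have "lam (inv\<^bsub>G\<^esub> g) \<otimes>\<^bsub>B\<^esub> rpi (star A a) = u (\<alpha> (inv\<^bsub>G\<^esub> g) (star A a)) (inv\<^bsub>G\<^esub> g)"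
  proof (rule u_eqI)
    fix \<xi> k assume \<xi>: "\<xi> \<in> H" and k: "k \<in> I"
    then show "(lam (inv\<^bsub>G\<^esub> g) \<otimes>\<^bsub>B\<^esub> rpi (star A a)) \<xi> k = u (\<alpha> (inv\<^bsub>G\<^esub> g) (star A a)) (inv\<^bsub>G\<^esub> g) \<xi> k"
      using g sa by (simp add: op_mult_apply lam_apply pi_in_H pi_apply u_apply G.inv_mult_group alpha_mult)
  qed (use g sa in \<open>simp_all add: u_closed op.m_closed pi_closed lam_closed alpha_closed\<close>)
  then show ?thesis unfolding u_def op.star_mult[OF pi_closed[OF a] lam_closed[OF g]] s by (simp add: u_def)
qed

lemma nrm_u_le:
  assumes "a \<in> carrier A" "g \<in> I"
  shows "nrm B (u a g) \<le> nrm A a"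
proof (rule op_nrm_leI)
  fix \<xi> assume \<xi>: "\<xi> \<in> H"
  have "l2_norm G A (u a g \<xi>) \<le> nrm A a * l2_norm G A (lam g \<xi>)"
    using assms \<xi> by (simp add: u_def op_mult_apply lam_in_H pi_in_H)
  then show "l2_norm G A (u a g \<xi>) \<le> nrm A a * l2_norm G A \<xi>"
    using assms \<xi> by (simp add: l2_norm_def lam_ip)
qed (use assms nrm_nonneg in simp)

lemma u_one: "a \<in> carrier A \<Longrightarrow> u a \<one>\<^bsub>G\<^esub> = rpi a"
  by (rule u_eqI) (simp_all add: u_closed pi_closed u_apply pi_apply)

section \<open>Finite sums of generators and their closure\<close>

abbreviation "reg \<equiv> reg_rep G A \<alpha>"

definition D :: "'a set \<Rightarrow> (('g \<Rightarrow> 'a) \<Rightarrow> 'g \<Rightarrow> 'a) set" where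
  "D S = reg ` fin_supp_funs G (A\<lparr>carrier := S\<rparr>)"

lemma fin_supp_sub: "f \<in> fin_supp_funs G (A\<lparr>carrier := S\<rparr>) \<longleftrightarrow> f \<in> I \<rightarrow> S \<and> finite {g \<in> I. f g \<noteq> \<zero>}"
  by (simp add: fin_supp_funs_def)

lemma fin_supp_iff: "f \<in> fin_supp_funs G A \<longleftrightarrow> f \<in> I \<rightarrow> carrier A \<and> finite {g \<in> I. f g \<noteq> \<zero>}"
  by (simp add: fin_supp_funs_def)

text \<open>Any finite set that contains the support may index the sum, which is what makes
  functions with different supports addable.\<close>

lemma reg_eq:
  assumes f: "f \<in> I \<rightarrow> carrier A" and F: "finite F" "F \<subseteq> I" "{g \<in> I. f g \<noteq> \<zero>} \<subseteq> F"
  shows "reg f = (\<Oplus>\<^bsub>B\<^esub>g\<in>F. u (f g) g)"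
proof -
  have "(\<Oplus>\<^bsub>B\<^esub>g\<in>{g \<in> I. f g \<noteq> \<zero>}. u (f g) g) = (\<Oplus>\<^bsub>B\<^esub>g\<in>F. u (f g) g)"
  proof (rule op.add.finprod_mono_neutral_cong_left[OF F(1,3)])
    show "u (f g) g = \<zero>\<^bsub>B\<^esub>" if "g \<in> F - {g \<in> I. f g \<noteq> \<zero>}" for g
      using that F by (auto simp: u_zero)
  qed (use f F in \<open>auto intro!: u_closed\<close>)
  then show ?thesis by (simp add: reg_rep_def u_def)
qed

lemma reg_closed: "f \<in> I \<rightarrow> carrier A \<Longrightarrow> reg f \<in> carrier B"
  unfolding reg_rep_def u_def[symmetric] by (intro op.finsum_closed) (auto intro!: u_closed)

lemma emb_reg_apply:
  assumes f: "f \<in> I \<rightarrow> carrier A" and F: "finite F" "F \<subseteq> I" "{g \<in> I. f g \<noteq> \<zero>} \<subseteq> F" and \<xi>: "\<xi> \<in> H" and h: "h \<in> I"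
  shows "E (reg f \<xi> h) = (\<Sum>g\<in>F. E (\<alpha> (inv\<^bsub>G\<^esub> h) (f g) \<otimes> \<xi> (inv\<^bsub>G\<^esub> g \<otimes>\<^bsub>G\<^esub> h)))"
proof -
  have c: "(\<lambda>g. u (f g) g) \<in> F \<rightarrow> carrier B" using f F by (auto intro!: u_closed)
  have "E (reg f \<xi> h) = (\<Sum>g\<in>F. E (u (f g) g \<xi> h))"
    unfolding reg_eq[OF f F] by (rule op_finsum_apply[OF c \<xi> h])
  also have "\<dots> = (\<Sum>g\<in>F. E (\<alpha> (inv\<^bsub>G\<^esub> h) (f g) \<otimes> \<xi> (inv\<^bsub>G\<^esub> g \<otimes>\<^bsub>G\<^esub> h)))"
    by (rule sum.cong) (use F \<xi> h in \<open>auto simp: u_apply\<close>)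
  finally show ?thesis .
qed

lemma reg_apply:
  assumes f: "f \<in> I \<rightarrow> carrier A" and F: "finite F" "F \<subseteq> I" "{g \<in> I. f g \<noteq> \<zero>} \<subseteq> F" and \<xi>: "\<xi> \<in> H" and h: "h \<in> I"
  shows "reg f \<xi> h = (\<Oplus>g\<in>F. \<alpha> (inv\<^bsub>G\<^esub> h) (f g) \<otimes> \<xi> (inv\<^bsub>G\<^esub> g \<otimes>\<^bsub>G\<^esub> h))"
proof -
  have c: "(\<lambda>g. \<alpha> (inv\<^bsub>G\<^esub> h) (f g) \<otimes> \<xi> (inv\<^bsub>G\<^esub> g \<otimes>\<^bsub>G\<^esub> h)) \<in> F \<rightarrow> carrier A"
    using f F h by (auto intro!: m_closed alpha_closed l2_carrier[OF \<xi>])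
  have "reg f \<xi> h \<in> carrier A"
    by (rule l2_carrier[OF op_closed[OF reg_closed[OF f] \<xi>] h])
  then show ?thesis using emb_reg_apply[OF assms] c by (simp add: finsum_closed flip: emb_finsum emb_eq_iff)
qed

lemma reg_add:
  assumes f: "f \<in> fin_supp_funs G A" "f' \<in> fin_supp_funs G A"
  shows "reg (\<lambda>g. f g \<oplus> f' g) = reg f \<oplus>\<^bsub>B\<^esub> reg f'"
proof -
  define F where "F = {g \<in> I. f g \<noteq> \<zero>} \<union> {g \<in> I. f' g \<noteq> \<zero>}"
  have c: "f \<in> I \<rightarrow> carrier A" "f' \<in> I \<rightarrow> carrier A" "(\<lambda>g. f g \<oplus> f' g) \<in> I \<rightarrow> carrier A" "finite F" "F \<subseteq> I"
    using f by (auto simp: fin_supp_iff F_def)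
  have s: "{g \<in> I. f g \<noteq> \<zero>} \<subseteq> F" "{g \<in> I. f' g \<noteq> \<zero>} \<subseteq> F" "{g \<in> I. f g \<oplus> f' g \<noteq> \<zero>} \<subseteq> F"
    by (auto simp: F_def)
  have "(\<Oplus>\<^bsub>B\<^esub>g\<in>F. u (f g \<oplus> f' g) g) = (\<Oplus>\<^bsub>B\<^esub>g\<in>F. u (f g) g \<oplus>\<^bsub>B\<^esub> u (f' g) g)"
    using c by (intro op.finsum_cong') (auto intro!: u_closed u_add simp: Pi_iff subset_iff)
  also have "\<dots> = (\<Oplus>\<^bsub>B\<^esub>g\<in>F. u (f g) g) \<oplus>\<^bsub>B\<^esub> (\<Oplus>\<^bsub>B\<^esub>g\<in>F. u (f' g) g)"
    using c by (intro op.finsum_addf) (auto intro!: u_closed)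
  finally show ?thesis using c s by (simp add: reg_eq[of _ F])
qed

lemma reg_single: "a \<in> carrier A \<Longrightarrow> g \<in> I \<Longrightarrow> reg (\<lambda>h. if h = g then a else \<zero>) = u a g"
  by (subst reg_eq[of _ "{g}"]) (auto simp: u_closed split: if_splits)

lemma D_carrier: "S \<subseteq> carrier A \<Longrightarrow> D S \<subseteq> carrier B"
  by (auto simp: D_def fin_supp_sub Pi_iff subset_iff intro!: reg_closed)

lemma D_u: "a \<in> S \<Longrightarrow> \<zero> \<in> S \<Longrightarrow> S \<subseteq> carrier A \<Longrightarrow> g \<in> I \<Longrightarrow> u a g \<in> D S"
  unfolding D_def using reg_single[of a g]
  by (intro image_eqI[of _ _ "\<lambda>h. if h = g then a else \<zero>"]) (auto simp: fin_supp_sub)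

lemma D_add:
  assumes S: "S \<subseteq> carrier A" "\<And>x y. x \<in> S \<Longrightarrow> y \<in> S \<Longrightarrow> x \<oplus> y \<in> S" and xy: "x \<in> D S" "y \<in> D S"
  shows "x \<oplus>\<^bsub>B\<^esub> y \<in> D S"
proof -
  obtain f f' where f: "x = reg f" "f \<in> I \<rightarrow> S" "finite {g \<in> I. f g \<noteq> \<zero>}"
    "y = reg f'" "f' \<in> I \<rightarrow> S" "finite {g \<in> I. f' g \<noteq> \<zero>}"
    using xy by (auto simp: D_def fin_supp_sub)
  have "finite {g \<in> I. f g \<oplus> f' g \<noteq> \<zero>}"
    by (rule finite_subset[of _ "{g \<in> I. f g \<noteq> \<zero>} \<union> {g \<in> I. f' g \<noteq> \<zero>}"]) (use f in auto)
  then have mem: "(\<lambda>g. f g \<oplus> f' g) \<in> fin_supp_funs G (A\<lparr>carrier := S\<rparr>)" using f S by (auto simp: fin_supp_sub Pi_iff)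
  have eq: "reg (\<lambda>g. f g \<oplus> f' g) = x \<oplus>\<^bsub>B\<^esub> y"
    unfolding f(1,4) using f S by (intro reg_add) (auto simp: fin_supp_iff)
  show ?thesis unfolding D_def eq[symmetric] by (rule imageI[OF mem])
qed

text \<open>Reduces claims about finite sums to single generators, so the closure properties of
  \<open>D S\<close> can be read off the formulas for \<open>u\<close>.\<close>

lemma D_induct [consumes 2, case_names zero u add]:
  assumes x: "x \<in> D S" and S: "S \<subseteq> carrier A" and zero: "P \<zero>\<^bsub>B\<^esub>"
    and u: "\<And>a g. a \<in> S \<Longrightarrow> g \<in> I \<Longrightarrow> P (u a g)"
    and add: "\<And>x y. x \<in> carrier B \<Longrightarrow> y \<in> carrier B \<Longrightarrow> P x \<Longrightarrow> P y \<Longrightarrow> P (x \<oplus>\<^bsub>B\<^esub> y)"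
  shows "P x"
proof -
  obtain f where f: "x = reg f" "f \<in> I \<rightarrow> S" "finite {g \<in> I. f g \<noteq> \<zero>}" using x by (auto simp: D_def fin_supp_sub)
  have "P (\<Oplus>\<^bsub>B\<^esub>g\<in>F. u (f g) g)" if "finite F" "F \<subseteq> I" for F
    using that
  proof (induction F)
    case (insert g F)
    then have c: "(\<lambda>g. u (f g) g) \<in> F \<rightarrow> carrier B" "u (f g) g \<in> carrier B"
      using f(2) S by (auto intro!: u_closed)
    have "P (u (f g) g \<oplus>\<^bsub>B\<^esub> (\<Oplus>\<^bsub>B\<^esub>g\<in>F. u (f g) g))"
      using insert c f(2) by (intro add u op.finsum_closed) auto
    then show ?case using insert c by simp
  qed (simp add: zero)
  from this[OF f(3)] have "P (\<Oplus>\<^bsub>B\<^esub>g\<in>{g \<in> I. f g \<noteq> \<zero>}. u (f g) g)" by blast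
  then show ?thesis unfolding f(1) by (simp add: reg_rep_def u_def)
qed

lemma D_zero: "\<zero> \<in> S \<Longrightarrow> S \<subseteq> carrier A \<Longrightarrow> \<zero>\<^bsub>B\<^esub> \<in> D S"
  using D_u[of \<zero> S "\<one>\<^bsub>G\<^esub>"] by (simp add: u_zero)

lemma D_smult:
  assumes S: "S \<subseteq> carrier A" "\<zero> \<in> S" "\<And>x y. x \<in> S \<Longrightarrow> y \<in> S \<Longrightarrow> x \<oplus> y \<in> S" "\<And>x. x \<in> S \<Longrightarrow> c \<odot> x \<in> S"
    and x: "x \<in> D S"
  shows "c \<odot>\<^bsub>B\<^esub> x \<in> D S"
  using x S(1)
proof (induction rule: D_induct)
  case zero
  then show ?case by (simp add: op.smult_zero_right D_zero S)
next
  case (u a g)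
  then have "c \<odot>\<^bsub>B\<^esub> u a g = u (c \<odot> a) g" using S by (intro u_smult[symmetric]) auto
  then show ?case using u S by (simp add: D_u)
next
  case (add x y)
  then show ?case by (simp add: op.smult_r_distr D_add[OF S(1,3)])
qed

lemma D_mult:
  assumes S: "S \<subseteq> carrier A" "T \<subseteq> carrier A" and R: "R \<subseteq> carrier A" "\<zero> \<in> R" "\<And>x y. x \<in> R \<Longrightarrow> y \<in> R \<Longrightarrow> x \<oplus> y \<in> R"
    and m: "\<And>a b g. a \<in> S \<Longrightarrow> b \<in> T \<Longrightarrow> g \<in> I \<Longrightarrow> a \<otimes> \<alpha> g b \<in> R"
    and x: "x \<in> D S" and y: "y \<in> D T"
  shows "x \<otimes>\<^bsub>B\<^esub> y \<in> D R"
  using x S(1)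
proof (induction rule: D_induct)
  have yB: "y \<in> carrier B" using y D_carrier[OF S(2)] by blast
  case zero
  then show ?case using yB by (simp add: op.mult_zero_left D_zero R)
next
  case (u a g)
  note ua = u
  then have ac: "u a g \<in> carrier B" "a \<in> carrier A" using S by (auto intro!: u_closed)
  show ?case using y S(2)
  proof (induction rule: D_induct)
    case zero
    then show ?case using ac by (simp add: op.mult_zero_right D_zero R)
  next
    case (u b h)
    then have "u a g \<otimes>\<^bsub>B\<^esub> u b h = u (a \<otimes> \<alpha> g b) (g \<otimes>\<^bsub>G\<^esub> h)" using ua ac S by (intro u_mult) auto
    then show ?case using u ua m R by (simp add: D_u)
  next
    case (add x y)
    then show ?case using ac by (simp add: op.r_distr D_add[OF R(1,3)])
  qed
next
  case (add x x')
  have "y \<in> carrier B" using y D_carrier[OF S(2)] by blast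
  then show ?case using add by (simp add: op.l_distr D_add[OF R(1,3)])
qed

lemma D_star:
  assumes S: "S \<subseteq> carrier A" "\<zero> \<in> S" "\<And>x y. x \<in> S \<Longrightarrow> y \<in> S \<Longrightarrow> x \<oplus> y \<in> S"
    "\<And>x. x \<in> S \<Longrightarrow> star A x \<in> S" "\<And>x g. x \<in> S \<Longrightarrow> g \<in> I \<Longrightarrow> \<alpha> g x \<in> S" and x: "x \<in> D S"
  shows "star B x \<in> D S"
  using x S(1)
proof (induction rule: D_induct)
  case zero
  then show ?case by (simp add: op.star_zero D_zero S)
next
  case (u a g)
  then have "star B (u a g) = u (\<alpha> (inv\<^bsub>G\<^esub> g) (star A a)) (inv\<^bsub>G\<^esub> g)" using S by (intro u_star) auto
  then show ?case using u S by (simp add: D_u)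
next
  case (add x y)
  then show ?case by (simp add: op.star_add D_add[OF S(1,3)])
qed

lemma red_crossed_eq: "red_crossed G A \<alpha> = B\<lparr>carrier := op.clos (D (carrier A))\<rparr>"
  unfolding red_crossed_def using op.closure_of_eq_clos[OF D_carrier[of "carrier A"]] by (simp add: D_def)

abbreviation "Cr \<equiv> op.clos (D (carrier A))"

lemma crossed_subalgebra: "cstar_subalgebra B Cr"
  by (rule op.clos_subalgebra)
    (auto intro!: D_carrier[THEN subsetD] D_zero D_add D_smult D_mult[where S = "carrier A" and T = "carrier A"] D_star
      smult_closed m_closed star_closed alpha_closed)

end

sublocale cs_dyn \<subseteq> cr: cstar_subalgebra B Cr
  by (rule crossed_subalgebra)

section \<open>Quotient C*-algebras\<close>

lemma UN_eq_const: "a \<in> X \<Longrightarrow> (\<And>x. x \<in> X \<Longrightarrow> f x = c) \<Longrightarrow> (\<Union>x\<in>X. f x) = c"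
  by blast

locale cstar_quotient = cstar_algebra A for A :: "'a cstar" (structure) +
  fixes K :: "'a set"
  assumes K: "cs_ideal A K"
begin

lemmas ideal = cs_idealD[OF K]

lemma ideal_carrier: "k \<in> K \<Longrightarrow> k \<in> carrier A"
  using ideal(1) by blast

lemmas emb_simps = emb_add emb_diff emb_minus emb_mult emb_smult emb_star emb_zero

abbreviation "q a \<equiv> K +> a"
abbreviation "Q \<equiv> cs_quot A K"

lemma diff_zero: "x \<in> carrier A \<Longrightarrow> x \<ominus> \<zero> = x"
  by (subst emb_eq_iff[symmetric]) (simp_all add: emb_simps)

lemma abelian_subgroup: "abelian_subgroup K A"
  using K by (intro abelian_subgroupI3 is_abelian_group) (simp add: cs_ideal_def)

lemma q_mem: "a \<in> carrier A \<Longrightarrow> x \<in> q a \<longleftrightarrow> x \<in> carrier A \<and> x \<ominus> a \<in> K"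
proof
  assume a: "a \<in> carrier A" and "x \<in> q a"
  then obtain k where k: "k \<in> K" "x = k \<oplus> a" by (auto simp: a_r_coset_def')
  then have "x \<ominus> a = k" using a ideal_carrier by (simp add: a_minus_def a_assoc r_neg)
  then show "x \<in> carrier A \<and> x \<ominus> a \<in> K" using k a ideal_carrier by simp
next
  assume a: "a \<in> carrier A" and x: "x \<in> carrier A \<and> x \<ominus> a \<in> K"
  then have "x = (x \<ominus> a) \<oplus> a" by (simp add: a_minus_def a_assoc l_neg)
  then show "x \<in> q a" using x by (auto simp: a_r_coset_def')
qed

lemma q_self: "a \<in> carrier A \<Longrightarrow> a \<in> q a"
  by (simp add: q_mem a_diff_self ideal(2))

lemma q_eq: "a \<in> carrier A \<Longrightarrow> b \<in> carrier A \<Longrightarrow> q a = q b \<longleftrightarrow> a \<ominus> b \<in> K"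
proof
  assume ab: "a \<in> carrier A" "b \<in> carrier A" "q a = q b"
  then show "a \<ominus> b \<in> K" using q_self[of a] q_mem[of b a] by simp
next
  assume ab: "a \<in> carrier A" "b \<in> carrier A" "a \<ominus> b \<in> K"
  have ba: "b \<ominus> a \<in> K" using cs_ideal_minus[OF K ab(3)] ab by (simp add: minus_diff)
  have "x \<ominus> a \<in> K \<longleftrightarrow> x \<ominus> b \<in> K" if x: "x \<in> carrier A" for x
  proof
    assume "x \<ominus> a \<in> K"
    from ideal(3)[OF this ab(3)] show "x \<ominus> b \<in> K" by (simp only: diff_telescope[OF x ab(1,2)])
  next
    assume "x \<ominus> b \<in> K"
    from ideal(3)[OF this ba] show "x \<ominus> a \<in> K" by (simp only: diff_telescope[OF x ab(2,1)])
  qed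
  then show "q a = q b" using ab by (auto simp: q_mem)
qed

lemma Q_carrier: "carrier Q = q ` carrier A"
  by (auto simp: cs_quot_def A_RCOSETS_def')

lemma Q_zero: "\<zero>\<^bsub>Q\<^esub> = q \<zero>"
proof -
  have "x \<in> K \<longleftrightarrow> x \<in> q \<zero>" for x
    using ideal_carrier by (auto simp: q_mem diff_zero)
  then show ?thesis by (auto simp: cs_quot_def)
qed

lemma Q_add: "a \<in> carrier A \<Longrightarrow> b \<in> carrier A \<Longrightarrow> q a \<oplus>\<^bsub>Q\<^esub> q b = q (a \<oplus> b)"
  using abelian_subgroup.a_rcos_sum[OF abelian_subgroup] by (simp add: cs_quot_def)

lemma Q_mult:
  assumes ab: "a \<in> carrier A" "b \<in> carrier A"
  shows "q a \<otimes>\<^bsub>Q\<^esub> q b = q (a \<otimes> b)"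
proof -
  \<comment> \<open>The product of cosets in \<open>cs_quot\<close> is a union over all
    representatives; it collapses because every pair of representatives gives the same
    coset.\<close>
  have "q (x \<otimes> y) = q (a \<otimes> b)" if "x \<in> q a" "y \<in> q b" for x y
  proof -
    have xy: "x \<in> carrier A" "y \<in> carrier A" "x \<ominus> a \<in> K" "y \<ominus> b \<in> K" using that ab by (simp_all add: q_mem)
    have "x \<otimes> y \<ominus> a \<otimes> b = (x \<ominus> a) \<otimes> y \<oplus> a \<otimes> (y \<ominus> b)"
      using xy(1,2) ab by (subst emb_eq_iff[symmetric]) (simp_all add: emb_simps m_closed algebra_simps)
    then show ?thesis using xy ab ideal by (simp add: q_eq m_closed)
  qed
  then have "(\<Union>x\<in>q a. \<Union>y\<in>q b. q (x \<otimes> y)) = q (a \<otimes> b)"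
    by (intro UN_eq_const[OF q_self[OF ab(1)]] UN_eq_const[OF q_self[OF ab(2)]])
  then show ?thesis by (simp add: cs_quot_def rcoset_mult_def)
qed

lemma Q_smult:
  assumes a: "a \<in> carrier A"
  shows "c \<odot>\<^bsub>Q\<^esub> q a = q (c \<odot> a)"
proof -
  have "q (c \<odot> x) = q (c \<odot> a)" if "x \<in> q a" for x
  proof -
    have x: "x \<in> carrier A" "x \<ominus> a \<in> K" using that a by (simp_all add: q_mem)
    have "c \<odot> x \<ominus> c \<odot> a = c \<odot> (x \<ominus> a)"
      using x(1) a by (subst emb_eq_iff[symmetric]) (simp_all add: emb_simps smult_closed cscale_diff_right)
    then show ?thesis using x a ideal by (simp add: q_eq smult_closed)
  qed
  from UN_eq_const[OF q_self[OF a] this] show ?thesis by (simp add: cs_quot_def)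
qed

lemma Q_star:
  assumes a: "a \<in> carrier A"
  shows "star Q (q a) = q (star A a)"
proof -
  have "q (star A x) = q (star A a)" if "x \<in> q a" for x
  proof -
    have x: "x \<in> carrier A" "x \<ominus> a \<in> K" using that a by (simp_all add: q_mem)
    then show ?thesis using cs_ideal_star[OF K x(2)] a by (simp add: q_eq star_closed star_diff)
  qed
  from UN_eq_const[OF q_self[OF a] this] show ?thesis by (simp add: cs_quot_def)
qed

lemma Q_nrm: "nrm Q (q a) = (INF x\<in>q a. nrm A x)"
  by (simp add: cs_quot_def)

lemma Q_nrm_le: "a \<in> carrier A \<Longrightarrow> x \<in> q a \<Longrightarrow> nrm Q (q a) \<le> nrm A x"
  unfolding Q_nrm by (intro cINF_lower bdd_belowI2[of _ 0]) (auto simp: q_mem nrm_nonneg)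

lemma Q_nrm_ge: "a \<in> carrier A \<Longrightarrow> (\<And>x. x \<in> q a \<Longrightarrow> r \<le> nrm A x) \<Longrightarrow> r \<le> nrm Q (q a)"
  unfolding Q_nrm using q_self by (intro cINF_greatest) auto

lemma Q_nrm_less:
  assumes "a \<in> carrier A" "nrm Q (q a) < r"
  obtains x where "x \<in> q a" "nrm A x < r"
  using Q_nrm_ge[OF assms(1), of r] assms(2) by (meson not_le)

lemma Q_nrm_nonneg: "a \<in> carrier A \<Longrightarrow> 0 \<le> nrm Q (q a)"
  by (rule Q_nrm_ge) (auto simp: q_mem nrm_nonneg)

lemma Q_nrm_zero: "nrm Q (q \<zero>) = 0"
  using Q_nrm_le[OF zero_closed q_self[OF zero_closed]] Q_nrm_nonneg[OF zero_closed] by (simp add: nrm_zero)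

lemma Q_nrm_zero_imp: "a \<in> carrier A \<Longrightarrow> nrm Q (q a) = 0 \<Longrightarrow> q a = q \<zero>"
proof -
  assume a: "a \<in> carrier A" and 0: "nrm Q (q a) = 0"
  have "a \<in> K"
  proof (rule closed_limitI[OF ideal(1,7) a])
    fix d :: real assume "0 < d"
    then obtain x where x: "x \<in> q a" "nrm A x < d" using Q_nrm_less[OF a, of d] 0 by auto
    then have c: "x \<in> carrier A" "x \<ominus> a \<in> K" using a by (simp_all add: q_mem)
    have "a \<ominus> (a \<ominus> x) = x" using a c(1) by (subst emb_eq_iff[symmetric]) (simp_all add: emb_simps)
    moreover have "a \<ominus> x \<in> K" using cs_ideal_minus[OF K c(2)] a c by (simp add: minus_diff)
    ultimately show "\<exists>y\<in>K. nrm A (a \<ominus> y) < d" using x by metis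
  qed
  then show ?thesis using a by (simp add: q_eq diff_zero)
qed

lemma Q_nrm_triangle:
  assumes ab: "a \<in> carrier A" "b \<in> carrier A"
  shows "nrm Q (q (a \<oplus> b)) \<le> nrm Q (q a) + nrm Q (q b)"
proof (rule field_le_epsilon)
  fix e :: real assume e: "0 < e"
  obtain x where x: "x \<in> q a" "nrm A x < nrm Q (q a) + e / 2" using Q_nrm_less[OF ab(1)] e by (metis half_gt_zero less_add_same_cancel1)
  obtain y where y: "y \<in> q b" "nrm A y < nrm Q (q b) + e / 2" using Q_nrm_less[OF ab(2)] e by (metis half_gt_zero less_add_same_cancel1)
  have c: "x \<in> carrier A" "y \<in> carrier A" "x \<ominus> a \<in> K" "y \<ominus> b \<in> K" using x y ab by (simp_all add: q_mem)
  have "x \<oplus> y \<ominus> (a \<oplus> b) = (x \<ominus> a) \<oplus> (y \<ominus> b)"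
    using c(1,2) ab by (subst emb_eq_iff[symmetric]) (simp_all add: emb_simps)
  then have "x \<oplus> y \<in> q (a \<oplus> b)" using c ab ideal by (simp add: q_mem)
  then have "nrm Q (q (a \<oplus> b)) \<le> nrm A (x \<oplus> y)" using ab by (intro Q_nrm_le) auto
  also have "\<dots> \<le> nrm A x + nrm A y" by (rule nrm_triangle[OF c(1,2)])
  finally show "nrm Q (q (a \<oplus> b)) \<le> nrm Q (q a) + nrm Q (q b) + e" using x y by linarith
qed

lemma Q_nrm_mult:
  assumes ab: "a \<in> carrier A" "b \<in> carrier A"
  shows "nrm Q (q (a \<otimes> b)) \<le> nrm Q (q a) * nrm Q (q b)"
proof (rule tendsto_lowerbound)
  have "((\<lambda>e. (nrm Q (q a) + e) * (nrm Q (q b) + e)) \<longlongrightarrow> (nrm Q (q a) + 0) * (nrm Q (q b) + 0)) (at_right 0)"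
    by (intro tendsto_intros)
  then show "((\<lambda>e. (nrm Q (q a) + e) * (nrm Q (q b) + e)) \<longlongrightarrow> nrm Q (q a) * nrm Q (q b)) (at_right 0)" by simp
  show "\<forall>\<^sub>F e in at_right 0. nrm Q (q (a \<otimes> b)) \<le> (nrm Q (q a) + e) * (nrm Q (q b) + e)"
    using eventually_at_right_less[of 0]
  proof eventually_elim
    fix e :: real assume e: "0 < e"
    obtain x where x: "x \<in> q a" "nrm A x < nrm Q (q a) + e" using Q_nrm_less[OF ab(1)] e by (metis less_add_same_cancel1)
    obtain y where y: "y \<in> q b" "nrm A y < nrm Q (q b) + e" using Q_nrm_less[OF ab(2)] e by (metis less_add_same_cancel1)
    have c: "x \<in> carrier A" "y \<in> carrier A" using x y ab by (simp_all add: q_mem)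
    have "q x = q a" "q y = q b" using x y ab c by (simp_all add: q_eq q_mem)
    then have "q (a \<otimes> b) = q (x \<otimes> y)" using Q_mult[OF c] Q_mult[OF ab] by simp
    then have "nrm Q (q (a \<otimes> b)) \<le> nrm A (x \<otimes> y)" using Q_nrm_le[OF m_closed[OF c] q_self[OF m_closed[OF c]]] by simp
    also have "\<dots> \<le> nrm A x * nrm A y" by (rule nrm_mult[OF c])
    also have "\<dots> \<le> (nrm Q (q a) + e) * (nrm Q (q b) + e)"
      using x y c e by (intro mult_mono) (auto simp: nrm_nonneg Q_nrm_nonneg ab add_nonneg_nonneg)
    finally show "nrm Q (q (a \<otimes> b)) \<le> (nrm Q (q a) + e) * (nrm Q (q b) + e)" .
  qed
qed simp

lemma Q_nrm_smult:
  assumes a: "a \<in> carrier A"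
  shows "nrm Q (q (c \<odot> a)) = cmod c * nrm Q (q a)"
proof -
  have le: "nrm Q (q (c \<odot> b)) \<le> cmod c * nrm Q (q b)" if b: "b \<in> carrier A" for b c
  proof (cases "c = 0")
    case True
    then show ?thesis using b by (simp add: smult_zero_left Q_nrm_zero)
  next
    case False
    have "nrm Q (q (c \<odot> b)) / cmod c \<le> nrm Q (q b)"
    proof (rule Q_nrm_ge[OF b])
      fix x assume x: "x \<in> q b"
      then have xc: "x \<in> carrier A" "q x = q b" using b by (simp_all add: q_mem q_eq)
      have "q (c \<odot> b) = q (c \<odot> x)" using Q_smult[OF xc(1), of c] Q_smult[OF b, of c] xc(2) by simp
      then have "nrm Q (q (c \<odot> b)) \<le> nrm A (c \<odot> x)"
        using Q_nrm_le[OF smult_closed[OF xc(1)] q_self[OF smult_closed[OF xc(1)]], of c] by simp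
      then show "nrm Q (q (c \<odot> b)) / cmod c \<le> nrm A x" using False xc by (simp add: nrm_smult field_simps)
    qed
    then show ?thesis using False by (simp add: field_simps)
  qed
  show ?thesis
  proof (cases "c = 0")
    case True
    then show ?thesis using a by (simp add: smult_zero_left Q_nrm_zero)
  next
    case False
    then have "inverse c \<odot> (c \<odot> a) = a" using a by (simp add: smult_one flip: smult_assoc)
    then have "nrm Q (q a) \<le> inverse (cmod c) * nrm Q (q (c \<odot> a))"
      using le[OF smult_closed[OF a], of "inverse c" c] by (simp add: norm_inverse)
    then have "cmod c * nrm Q (q a) \<le> nrm Q (q (c \<odot> a))" using False by (simp add: field_simps)
    then show ?thesis using le[OF a, of c] by simp
  qed
qed

text \<open>Choose a representative x of norm below \<open>s\<close> and \<open>e\<close> suited to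
  k = r - x. Compression by 1 - e does not increase the norm of x, and it makes the contribution of
  k smaller than the gap s - nrm x. Compressions are preferred to arbitrary representatives because
  they keep squares: if r is b^* b, its compression is the square of b (1 - e).\<close>

lemma Q_nrm_unit:
  assumes r: "r \<in> carrier A" and s: "nrm Q (q r) < s"
  obtains e where "e \<in> K" "star A e = e" "norm ((1 - E e) * E r * (1 - E e)) < s"
proof -
  obtain x where x: "x \<in> q r" "nrm A x < s" using Q_nrm_less[OF r s] by blast
  then have xc: "x \<in> carrier A" "x \<ominus> r \<in> K" using r by (simp_all add: q_mem)
  define k where "k = r \<ominus> x"
  have k: "k \<in> K" "k \<in> carrier A"
    unfolding k_def using cs_ideal_minus[OF K xc(2)] xc r by (simp_all add: minus_diff)
  obtain e where e: "e \<in> K" "star A e = e" "norm (1 - E e) \<le> 1" "norm (E k * (1 - E e)) < s - nrm A x"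
    using ideal_approx_unit[OF K k(2) ideal(5)[OF star_closed[OF k(2)] k(1)], of "s - nrm A x"] x(2) by auto
  have er: "E r = E x + E k" using xc r by (simp add: k_def emb_simps)
  have "norm ((1 - E e) * E r * (1 - E e)) \<le> norm ((1 - E e) * E x * (1 - E e)) + norm ((1 - E e) * (E k * (1 - E e)))"
    unfolding er distrib_left distrib_right mult.assoc by (rule norm_triangle_ineq)
  also have "norm ((1 - E e) * E x * (1 - E e)) \<le> norm (1 - E e) * norm (E x) * norm (1 - E e)"
    by (rule order_trans[OF norm_mult_ineq]) (intro mult_right_mono norm_mult_ineq norm_ge_zero)
  also have "\<dots> \<le> 1 * norm (E x) * 1" using e(3) by (intro mult_mono) auto
  also have "norm ((1 - E e) * (E k * (1 - E e))) \<le> norm (1 - E e) * norm (E k * (1 - E e))" by (rule norm_mult_ineq)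
  also have "\<dots> \<le> 1 * norm (E k * (1 - E e))" using e(3) by (intro mult_right_mono) auto
  finally have "norm ((1 - E e) * E r * (1 - E e)) < s" using e(4) xc by (simp add: norm_emb)
  then show ?thesis using that e by blast
qed

text \<open>For the nontrivial inequality, b = a (1 - e) is again in the coset of \<open>a\<close>,
  and b^* b is the compression of a^* a delivered by \<open>Q_nrm_unit\<close>.\<close>

lemma Q_cstar_identity:
  assumes a: "a \<in> carrier A"
  shows "nrm Q (q (star A a \<otimes> a)) = (nrm Q (q a))\<^sup>2"
proof (rule antisym)
  have sa: "star A a \<in> carrier A" using a by (rule star_closed)
  have "nrm Q (q (star A a)) \<le> nrm Q (q a)"
  proof (rule Q_nrm_ge[OF a])
    fix x assume x: "x \<in> q a"
    then have xc: "x \<in> carrier A" "q x = q a" using a by (simp_all add: q_mem q_eq)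
    have "q (star A a) = q (star A x)" using Q_star[OF xc(1)] Q_star[OF a] xc(2) by simp
    then show "nrm Q (q (star A a)) \<le> nrm A x"
      using Q_nrm_le[OF star_closed[OF xc(1)] q_self[OF star_closed[OF xc(1)]]] xc(1) by (simp add: nrm_star)
  qed
  then have "nrm Q (q (star A a)) * nrm Q (q a) \<le> nrm Q (q a) * nrm Q (q a)"
    by (intro mult_right_mono Q_nrm_nonneg a)
  then show "nrm Q (q (star A a \<otimes> a)) \<le> (nrm Q (q a))\<^sup>2"
    using Q_nrm_mult[OF sa a] by (simp add: power2_eq_square)
  show "(nrm Q (q a))\<^sup>2 \<le> nrm Q (q (star A a \<otimes> a))"
  proof (rule dense_ge)
    fix s assume "nrm Q (q (star A a \<otimes> a)) < s"
    then obtain e where e: "e \<in> K" "star A e = e" "norm ((1 - E e) * E (star A a \<otimes> a) * (1 - E e)) < s"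
      using Q_nrm_unit[OF m_closed[OF sa a]] by blast
    have ec: "e \<in> carrier A" "a \<otimes> e \<in> K" using e(1) ideal(1) ideal(5)[OF a] by auto
    define b where "b = a \<ominus> a \<otimes> e"
    have bc: "b \<in> carrier A" using a ec by (simp add: b_def m_closed)
    have "b \<ominus> a = \<ominus> (a \<otimes> e)" using a ec(1) by (subst emb_eq_iff[symmetric]) (simp_all add: b_def emb_simps m_closed)
    then have "b \<in> q a" using bc a cs_ideal_minus[OF K ec(2)] by (simp add: q_mem)
    then have "nrm Q (q a) \<le> norm (E b)" using Q_nrm_le[OF a] bc by (simp add: norm_emb)
    then have "(nrm Q (q a))\<^sup>2 \<le> (norm (E b))\<^sup>2" using Q_nrm_nonneg[OF a] by (rule power_mono)
    also have "\<dots> = norm (adj (E b) * E b)" by (simp add: norm_adj_mult)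
    also have "adj (E b) * E b = (1 - E e) * E (star A a \<otimes> a) * (1 - E e)"
    proof -
      have ae: "adj (E e) = E e" using e(2) ec(1) emb_star[of e] by simp
      have "E b = E a * (1 - E e)" using a ec(1) by (simp add: b_def emb_mult_one_minus)
      then show ?thesis using a sa by (simp add: adj_mult adj_diff ae emb_mult emb_star mult.assoc)
    qed
    finally show "(nrm Q (q a))\<^sup>2 \<le> s" using e(3) by simp
  qed
qed

lemma Q_abelian_group: "abelian_group Q"
proof (rule abelian_groupI)
  show "\<zero>\<^bsub>Q\<^esub> \<in> carrier Q" by (simp add: Q_zero Q_carrier)
  fix X assume "X \<in> carrier Q"
  then obtain a where a: "a \<in> carrier A" "X = q a" by (auto simp: Q_carrier)
  then show "\<zero>\<^bsub>Q\<^esub> \<oplus>\<^bsub>Q\<^esub> X = X" by (simp add: Q_zero Q_add)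
  have "q (\<ominus> a) \<oplus>\<^bsub>Q\<^esub> X = \<zero>\<^bsub>Q\<^esub>" using a by (simp add: Q_zero Q_add l_neg)
  then show "\<exists>Y\<in>carrier Q. Y \<oplus>\<^bsub>Q\<^esub> X = \<zero>\<^bsub>Q\<^esub>" using a by (auto simp: Q_carrier)
  fix Y assume "Y \<in> carrier Q"
  then obtain b where b: "b \<in> carrier A" "Y = q b" by (auto simp: Q_carrier)
  then show "X \<oplus>\<^bsub>Q\<^esub> Y \<in> carrier Q" "X \<oplus>\<^bsub>Q\<^esub> Y = Y \<oplus>\<^bsub>Q\<^esub> X"
    using a by (simp_all add: Q_add Q_carrier a_comm)
  fix Z assume "Z \<in> carrier Q"
  then obtain c where "c \<in> carrier A" "Z = q c" by (auto simp: Q_carrier)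
  then show "X \<oplus>\<^bsub>Q\<^esub> Y \<oplus>\<^bsub>Q\<^esub> Z = X \<oplus>\<^bsub>Q\<^esub> (Y \<oplus>\<^bsub>Q\<^esub> Z)" using a b by (simp add: Q_add a_assoc)
qed

lemma Q_minus: "a \<in> carrier A \<Longrightarrow> \<ominus>\<^bsub>Q\<^esub> q a = q (\<ominus> a)"
proof -
  interpret Q: abelian_group Q by (rule Q_abelian_group)
  assume a: "a \<in> carrier A"
  then show ?thesis by (intro Q.minus_equality) (auto simp: Q_add Q_zero l_neg Q_carrier)
qed

lemma Q_diff: "a \<in> carrier A \<Longrightarrow> b \<in> carrier A \<Longrightarrow> q a \<ominus>\<^bsub>Q\<^esub> q b = q (a \<ominus> b)"
  by (simp add: a_minus_def Q_minus Q_add)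

lemma Q_Metric_space: "Metric_space (carrier Q) (cs_dist Q)"
proof (rule Metric_space_cs_dist[OF Q_abelian_group])
  show "nrm Q \<zero>\<^bsub>Q\<^esub> = 0" by (simp only: Q_zero Q_nrm_zero)
  fix X assume "X \<in> carrier Q"
  then obtain a where a: "a \<in> carrier A" and X: "X = q a" by (auto simp: Q_carrier)
  show "nrm Q X = 0 \<Longrightarrow> X = \<zero>\<^bsub>Q\<^esub>" unfolding X Q_zero by (rule Q_nrm_zero_imp[OF a])
  show "nrm Q (\<ominus>\<^bsub>Q\<^esub> X) = nrm Q X"
    unfolding X Q_minus[OF a] using Q_nrm_smult[OF a, of "- 1"] a by (simp add: smult_minus_one)
  fix Y assume "Y \<in> carrier Q"
  then obtain b where b: "b \<in> carrier A" and Y: "Y = q b" by (auto simp: Q_carrier)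
  show "nrm Q (X \<oplus>\<^bsub>Q\<^esub> Y) \<le> nrm Q X + nrm Q Y"
    unfolding X Y Q_add[OF a b] by (rule Q_nrm_triangle[OF a b])
qed

text \<open>The usual lifting argument: along a subsequence with steps below (1/2)^j,
  representatives can be chosen with increments below (1/2)^j, and these converge in
  \<open>A\<close>.\<close>

lemma Q_mcomplete: "Metric_space.mcomplete (carrier Q) (cs_dist Q)"
proof (rule cs_mcompleteI[OF Q_Metric_space])
  interpret Q: abelian_group Q by (rule Q_abelian_group)
  fix X :: "nat \<Rightarrow> 'a set"
  assume "\<And>n. X n \<in> carrier Q"
  then have "\<forall>n. \<exists>a. a \<in> carrier A \<and> X n = q a" by (auto simp: Q_carrier)
  then obtain x where x: "\<And>n. x n \<in> carrier A" "\<And>n. X n = q (x n)" by metis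
  assume C: "\<And>e. 0 < e \<Longrightarrow> \<exists>N. \<forall>m\<ge>N. \<forall>n\<ge>N. nrm Q (X m \<ominus>\<^bsub>Q\<^esub> X n) < e"
  have "\<forall>j. \<exists>N. \<forall>m\<ge>N. \<forall>n\<ge>N. nrm Q (q (x m \<ominus> x n)) < (1/2) ^ j"
    using C x by (simp add: Q_diff)
  then obtain N where N: "\<And>j m n. m \<ge> N j \<Longrightarrow> n \<ge> N j \<Longrightarrow> nrm Q (q (x m \<ominus> x n)) < (1/2) ^ j" by metis
  \<comment> \<open>The maximum over all earlier indices makes \<open>M\<close> monotone, and the
    added \<open>j\<close> makes it unbounded.\<close>
  define M where "M j = Max (N ` {..j}) + j" for j
  have M: "N j \<le> M j" "j \<le> M j" "M j \<le> M (Suc j)" for j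
  proof -
    show "N j \<le> M j" unfolding M_def by (intro trans_le_add1 Max_ge) auto
    show "j \<le> M j" by (simp add: M_def)
    have "Max (N ` {..j}) \<le> Max (N ` {..Suc j})" by (intro Max_mono) auto
    then show "M j \<le> M (Suc j)" unfolding M_def by (rule add_le_mono) simp
  qed
  \<comment> \<open>The next representative is the present one plus a lift, of norm below (1/2)^j,
    of the difference of the two cosets.\<close>
  have "\<exists>y. \<forall>j. (y j \<in> carrier A \<and> q (y j) = q (x (M j))) \<and> nrm A (y (Suc j) \<ominus> y j) < (1/2) ^ j"
  proof (rule dependent_nat_choice)
    show "\<exists>y. y \<in> carrier A \<and> q y = q (x (M 0))" using x by blast
    fix y j assume y: "y \<in> carrier A \<and> q y = q (x (M j))"
    have "nrm Q (q (x (M (Suc j)) \<ominus> x (M j))) < (1/2) ^ j"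
      using M[of j] by (intro N) auto
    then obtain z where z: "z \<in> q (x (M (Suc j)) \<ominus> x (M j))" "nrm A z < (1/2) ^ j"
      using Q_nrm_less x by (metis minus_closed)
    then have zc: "z \<in> carrier A" "q z = q (x (M (Suc j)) \<ominus> x (M j))" using x by (simp_all add: q_mem q_eq)
    have "q (y \<oplus> z) = q (x (M j)) \<oplus>\<^bsub>Q\<^esub> q (x (M (Suc j)) \<ominus> x (M j))"
      using y zc Q_add[of y z] by simp
    also have "\<dots> = q (x (M j) \<oplus> (x (M (Suc j)) \<ominus> x (M j)))" using x by (simp add: Q_add)
    also have "x (M j) \<oplus> (x (M (Suc j)) \<ominus> x (M j)) = x (M (Suc j))"
      using x(1)[of "M j"] x(1)[of "M (Suc j)"] by (subst emb_eq_iff[symmetric]) (simp_all add: emb_simps)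
    finally have "q (y \<oplus> z) = q (x (M (Suc j)))" .
    moreover have "(y \<oplus> z) \<ominus> y = z" using y zc by (subst emb_eq_iff[symmetric]) (simp_all add: emb_simps)
    ultimately show "\<exists>y'. (y' \<in> carrier A \<and> q y' = q (x (M (Suc j)))) \<and> nrm A (y' \<ominus> y) < (1/2) ^ j"
      using y zc z by (intro exI[of _ "y \<oplus> z"]) simp
  qed
  then obtain y where y: "\<And>j. y j \<in> carrier A" "\<And>j. q (y j) = q (x (M j))"
    "\<And>j. nrm A (y (Suc j) \<ominus> y j) < (1/2) ^ j" by blast
  have "summable (\<lambda>j. E (y (Suc j)) - E (y j))"
  proof (rule summable_comparison_test')
    show "summable (\<lambda>j. (1/2 :: real) ^ j)" by (rule summable_geometric) simp
    show "norm (E (y (Suc j)) - E (y j)) \<le> (1/2) ^ j" if "j \<ge> 0" for j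
      using y(3)[of j] y(1) by (simp add: norm_emb flip: emb_diff)
  qed
  then have "convergent (\<lambda>n. \<Sum>j<n. E (y (Suc j)) - E (y j))" by (simp add: summable_iff_convergent)
  then obtain z where "(\<lambda>n. E (y n) - E (y 0)) \<longlonglongrightarrow> z"
    unfolding convergent_def sum_lessThan_telescope[of "\<lambda>j. E (y j)"] by blast
  from tendsto_add[OF this tendsto_const, of "E (y 0)"]
  have lim: "(\<lambda>n. E (y n)) \<longlonglongrightarrow> z + E (y 0)" by (simp only: diff_add_cancel)
  then obtain l where l: "l \<in> carrier A" "z + E (y 0) = E l" using emb_Cauchy_limit[OF y(1) lim] by (elim bexE) (rule that)
  show "\<exists>L\<in>carrier Q. \<forall>e>0. \<exists>N. \<forall>n\<ge>N. nrm Q (X n \<ominus>\<^bsub>Q\<^esub> L) < e"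
  proof (intro bexI[of _ "q l"] allI impI)
    show "q l \<in> carrier Q" using l by (simp add: Q_carrier)
    fix e :: real assume e: "0 < e"
    obtain J where J: "\<And>j. j \<ge> J \<Longrightarrow> norm (E (y j) - E l) < e / 2"
      using LIMSEQ_D[OF lim[unfolded l(2)] half_gt_zero[OF e]] by blast
    obtain N' where N': "\<And>m n. m \<ge> N' \<Longrightarrow> n \<ge> N' \<Longrightarrow> nrm Q (q (x m \<ominus> x n)) < e / 2"
      using C[OF half_gt_zero[OF e]] unfolding x(2) Q_diff[OF x(1) x(1)] by blast
    define j where "j = max J N'"
    have "nrm Q (X n \<ominus>\<^bsub>Q\<^esub> q l) < e" if n: "n \<ge> N'" for n
    proof -
      have "nrm Q (q (x n \<ominus> x (M j))) < e / 2" using n M(2)[of j] by (intro N') (auto simp: j_def)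
      moreover have "nrm Q (q (y j \<ominus> l)) \<le> nrm A (y j \<ominus> l)" using y(1) l by (intro Q_nrm_le q_self) auto
      moreover have "nrm A (y j \<ominus> l) < e / 2" using J[of j] y(1) l by (simp add: j_def norm_emb flip: emb_diff)
      moreover have "X n \<ominus>\<^bsub>Q\<^esub> q l = q (x n \<ominus> x (M j)) \<oplus>\<^bsub>Q\<^esub> q (y j \<ominus> l)"
      proof -
        have "X n \<ominus>\<^bsub>Q\<^esub> q l = (q (x n) \<ominus>\<^bsub>Q\<^esub> q (x (M j))) \<oplus>\<^bsub>Q\<^esub> (q (y j) \<ominus>\<^bsub>Q\<^esub> q l)"
          unfolding x(2) y(2) by (rule Q.diff_telescope) (use x l in \<open>auto simp: Q_carrier\<close>)
        then show ?thesis using x y(1) l by (simp add: Q_diff)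
      qed
      moreover have "nrm Q (q (x n \<ominus> x (M j)) \<oplus>\<^bsub>Q\<^esub> q (y j \<ominus> l)) \<le> nrm Q (q (x n \<ominus> x (M j))) + nrm Q (q (y j \<ominus> l))"
        using x y(1) l by (simp add: Q_add Q_nrm_triangle)
      ultimately show ?thesis by simp
    qed
    then show "\<exists>N. \<forall>n\<ge>N. nrm Q (X n \<ominus>\<^bsub>Q\<^esub> q l) < e" by blast
  qed
qed

lemma Q_cstar: "cstar_algebra Q"
proof (intro cstar_algebra.intro Q_abelian_group cstar_algebra_axioms.intro)
  note ops = Q_add Q_mult Q_smult Q_star
  fix X Y Z c d
  assume "X \<in> carrier Q"
  then obtain x where x: "x \<in> carrier A" and X: "X = q x" by (auto simp: Q_carrier)
  show "c \<odot>\<^bsub>Q\<^esub> X \<in> carrier Q" "star Q X \<in> carrier Q"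
    using x by (simp_all add: X ops Q_carrier smult_closed star_closed)
  show "(c + d) \<odot>\<^bsub>Q\<^esub> X = c \<odot>\<^bsub>Q\<^esub> X \<oplus>\<^bsub>Q\<^esub> d \<odot>\<^bsub>Q\<^esub> X" "(c * d) \<odot>\<^bsub>Q\<^esub> X = c \<odot>\<^bsub>Q\<^esub> (d \<odot>\<^bsub>Q\<^esub> X)" "1 \<odot>\<^bsub>Q\<^esub> X = X"
    using x by (simp_all add: X ops smult_closed smult_l_distr smult_assoc smult_one)
  show "star Q (star Q X) = X" "star Q (c \<odot>\<^bsub>Q\<^esub> X) = cnj c \<odot>\<^bsub>Q\<^esub> star Q X"
    using x by (simp_all add: X ops star_closed smult_closed star_star star_smult)
  show "nrm Q X = 0 \<Longrightarrow> X = \<zero>\<^bsub>Q\<^esub>" using Q_nrm_zero_imp[OF x] by (simp add: X Q_zero)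
  show "nrm Q (c \<odot>\<^bsub>Q\<^esub> X) = cmod c * nrm Q X" using x by (simp add: X ops Q_nrm_smult)
  show "nrm Q (star Q X \<otimes>\<^bsub>Q\<^esub> X) = (nrm Q X)\<^sup>2" using x by (simp add: X ops star_closed Q_cstar_identity)
  assume "Y \<in> carrier Q"
  then obtain y where y: "y \<in> carrier A" and Y: "Y = q y" by (auto simp: Q_carrier)
  show "X \<otimes>\<^bsub>Q\<^esub> Y \<in> carrier Q" using x y by (simp add: X Y ops Q_carrier m_closed)
  show "c \<odot>\<^bsub>Q\<^esub> (X \<oplus>\<^bsub>Q\<^esub> Y) = c \<odot>\<^bsub>Q\<^esub> X \<oplus>\<^bsub>Q\<^esub> c \<odot>\<^bsub>Q\<^esub> Y" "(c \<odot>\<^bsub>Q\<^esub> X) \<otimes>\<^bsub>Q\<^esub> Y = c \<odot>\<^bsub>Q\<^esub> (X \<otimes>\<^bsub>Q\<^esub> Y)"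
    "X \<otimes>\<^bsub>Q\<^esub> (c \<odot>\<^bsub>Q\<^esub> Y) = c \<odot>\<^bsub>Q\<^esub> (X \<otimes>\<^bsub>Q\<^esub> Y)"
    using x y by (simp_all add: X Y ops smult_closed m_closed smult_r_distr smult_mult_left smult_mult_right)
  show "star Q (X \<oplus>\<^bsub>Q\<^esub> Y) = star Q X \<oplus>\<^bsub>Q\<^esub> star Q Y" "star Q (X \<otimes>\<^bsub>Q\<^esub> Y) = star Q Y \<otimes>\<^bsub>Q\<^esub> star Q X"
    using x y by (simp_all add: X Y ops star_closed m_closed star_add star_mult)
  show "nrm Q (X \<oplus>\<^bsub>Q\<^esub> Y) \<le> nrm Q X + nrm Q Y" using x y by (simp add: X Y ops Q_nrm_triangle)
  show "nrm Q (X \<otimes>\<^bsub>Q\<^esub> Y) \<le> nrm Q X * nrm Q Y" using x y by (simp add: X Y ops Q_nrm_mult)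
  assume "Z \<in> carrier Q"
  then obtain z where z: "z \<in> carrier A" and Z: "Z = q z" by (auto simp: Q_carrier)
  show "X \<otimes>\<^bsub>Q\<^esub> Y \<otimes>\<^bsub>Q\<^esub> Z = X \<otimes>\<^bsub>Q\<^esub> (Y \<otimes>\<^bsub>Q\<^esub> Z)" "(X \<oplus>\<^bsub>Q\<^esub> Y) \<otimes>\<^bsub>Q\<^esub> Z = X \<otimes>\<^bsub>Q\<^esub> Z \<oplus>\<^bsub>Q\<^esub> Y \<otimes>\<^bsub>Q\<^esub> Z"
    "Z \<otimes>\<^bsub>Q\<^esub> (X \<oplus>\<^bsub>Q\<^esub> Y) = Z \<otimes>\<^bsub>Q\<^esub> X \<oplus>\<^bsub>Q\<^esub> Z \<otimes>\<^bsub>Q\<^esub> Y"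
    using x y z by (simp_all add: X Y Z ops m_closed m_assoc l_distr r_distr)
qed (rule Q_mcomplete)

lemma q_star_hom: "q \<in> star_hom A Q"
  by (auto simp: star_hom_def Q_carrier Q_add Q_mult Q_star Q_smult)

end

section \<open>Functoriality of the reduced crossed product\<close>

lemma (in cs_dyn) reg_cong:
  assumes "\<And>g. g \<in> I \<Longrightarrow> f g = f' g" "f \<in> I \<rightarrow> carrier A"
  shows "reg f = reg f'"
proof -
  have s: "{g \<in> I. f' g \<noteq> \<zero>} = {g \<in> I. f g \<noteq> \<zero>}" using assms(1) by auto
  have "(\<lambda>g. u (f' g) g) \<in> {g \<in> I. f g \<noteq> \<zero>} \<rightarrow> carrier B"
    using assms(2) by (auto intro!: u_closed simp flip: assms(1))
  then show ?thesis unfolding reg_rep_def u_def[symmetric] s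
    by (intro op.finsum_cong') (simp_all add: assms(1))
qed

locale cs_dyn_hom = A: cs_dyn A G \<alpha> + C: cs_dyn C G \<beta>
  for A :: "'a cstar" and G :: "('g, 'm) monoid_scheme" and \<alpha> :: "'g \<Rightarrow> 'a \<Rightarrow> 'a"
    and C :: "'b cstar" and \<beta> :: "'g \<Rightarrow> 'b \<Rightarrow> 'b" +
  fixes \<phi> :: "'a \<Rightarrow> 'b"
  assumes hom: "\<phi> \<in> star_hom A C"
    and equivariant: "g \<in> carrier G \<Longrightarrow> x \<in> carrier A \<Longrightarrow> \<phi> (\<alpha> g x) = \<beta> g (\<phi> x)"
begin

lemmas phi = star_homD[OF hom]
lemmas phi_zero = star_hom_zero[OF A.cstar C.cstar hom]
lemmas phi_diff = star_hom_diff[OF A.cstar C.cstar hom]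

lemma phi_dist_le:
  assumes "x \<in> carrier A" "y \<in> carrier A"
  shows "dist (C.E (\<phi> x)) (C.E (\<phi> y)) \<le> dist (A.E x) (A.E y)"
proof -
  have "nrm C (\<phi> (x \<ominus>\<^bsub>A\<^esub> y)) \<le> nrm A (x \<ominus>\<^bsub>A\<^esub> y)"
    using assms by (intro star_hom_nrm_le[OF A.cstar C.cstar hom]) simp
  then show ?thesis using assms
    by (simp add: phi_diff dist_norm phi A.norm_emb C.norm_emb flip: A.emb_diff C.emb_diff)
qed

lemma phi_finsum: "f \<in> F \<rightarrow> carrier A \<Longrightarrow> \<phi> (finsum A f F) = (\<Oplus>\<^bsub>C\<^esub>i\<in>F. \<phi> (f i))"
  by (rule finsum_hom[OF A.abelian_monoid_axioms C.abelian_monoid_axioms]) (auto simp: phi phi_zero)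

definition push :: "('g \<Rightarrow> 'a) \<Rightarrow> 'g \<Rightarrow> 'b" where
  "push \<xi> = (\<lambda>h\<in>carrier G. \<phi> (\<xi> h))"

text \<open>Since \<phi> commutes with finite sums and is contractive, their convergence in
  \<open>A\<close> carries over to \<open>C\<close>. Square summability of the pushed vector is then
  a consequence.\<close>

lemma push_has_ip:
  assumes "\<xi> \<in> A.H" "\<eta> \<in> A.H"
  shows "l2_has_ip G C (push \<xi>) (push \<eta>) (\<phi> (l2_ip G A \<xi> \<eta>))"
proof -
  let ?s = "l2_ip G A \<xi> \<eta>"
  let ?f = "\<lambda>F. \<Oplus>\<^bsub>A\<^esub>g\<in>F. star A (\<xi> g) \<otimes>\<^bsub>A\<^esub> \<eta> g"
  let ?g = "\<lambda>F. \<Oplus>\<^bsub>C\<^esub>g\<in>F. star C (push \<xi> g) \<otimes>\<^bsub>C\<^esub> push \<eta> g"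
  have s: "?s \<in> carrier A" "((\<lambda>F. A.E (?f F)) \<longlongrightarrow> A.E ?s) (finite_subsets_at_top (carrier G))"
    using A.l2_ip_has[OF assms] by (simp_all add: l2_has_ip_def A.limitin_cs_top)
  have c: "(\<lambda>g. star A (\<xi> g) \<otimes>\<^bsub>A\<^esub> \<eta> g) \<in> F \<rightarrow> carrier A" if "F \<subseteq> carrier G" for F
    using that A.l2_carrier[OF assms(1)] A.l2_carrier[OF assms(2)] by (auto intro!: A.m_closed A.star_closed)
  have g: "?g F = \<phi> (?f F)" if F: "F \<subseteq> carrier G" for F
  proof -
    have "\<phi> (?f F) = (\<Oplus>\<^bsub>C\<^esub>g\<in>F. \<phi> (star A (\<xi> g) \<otimes>\<^bsub>A\<^esub> \<eta> g))" by (rule phi_finsum[OF c[OF F]])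
    also have "\<dots> = ?g F"
    proof (rule C.finsum_cong')
      fix g assume "g \<in> F"
      then have "g \<in> carrier G" "\<xi> g \<in> carrier A" "\<eta> g \<in> carrier A"
        using F A.l2_carrier[OF assms(1)] A.l2_carrier[OF assms(2)] by auto
      then show "\<phi> (star A (\<xi> g) \<otimes>\<^bsub>A\<^esub> \<eta> g) = star C (push \<xi> g) \<otimes>\<^bsub>C\<^esub> push \<eta> g"
        by (simp add: push_def phi A.star_closed)
    next
      show "(\<lambda>g. star C (push \<xi> g) \<otimes>\<^bsub>C\<^esub> push \<eta> g) \<in> F \<rightarrow> carrier C"
        using F A.l2_carrier[OF assms(1)] A.l2_carrier[OF assms(2)]
        by (auto simp: push_def intro!: C.m_closed C.star_closed phi(1))
    qed simp
    finally show ?thesis by simp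
  qed
  have le: "dist (C.E (?g F)) (C.E (\<phi> ?s)) \<le> dist (A.E (?f F)) (A.E ?s)" if F: "F \<subseteq> carrier G" for F
    unfolding g[OF F] by (intro phi_dist_le s A.finsum_closed c F)
  have "((\<lambda>F. dist (A.E (?f F)) (A.E ?s)) \<longlongrightarrow> 0) (finite_subsets_at_top (carrier G))"
    using s(2) unfolding tendsto_dist_iff[symmetric] .
  then have "((\<lambda>F. dist (C.E (?g F)) (C.E (\<phi> ?s))) \<longlongrightarrow> 0) (finite_subsets_at_top (carrier G))"
    by (rule Lim_null_comparison[rotated]) (rule eventually_finite_subsets_at_top_weakI, simp add: le)
  then have "((\<lambda>F. C.E (?g F)) \<longlongrightarrow> C.E (\<phi> ?s)) (finite_subsets_at_top (carrier G))"
    by (subst tendsto_dist_iff)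
  moreover have "\<forall>\<^sub>F F in finite_subsets_at_top (carrier G). ?g F \<in> carrier C"
  proof (rule eventually_finite_subsets_at_top_weakI)
    fix F assume F: "F \<subseteq> carrier G"
    show "?g F \<in> carrier C" unfolding g[OF F] by (intro phi A.finsum_closed c F)
  qed
  ultimately show ?thesis unfolding l2_has_ip_def C.limitin_cs_top using phi(1)[OF s(1)] by blast
qed

lemma push_H: "\<xi> \<in> A.H \<Longrightarrow> push \<xi> \<in> C.H"
  using push_has_ip[of \<xi> \<xi>] A.l2_carrier[of \<xi>] by (auto simp: l2_def push_def phi)

lemma push_ip: "\<xi> \<in> A.H \<Longrightarrow> \<eta> \<in> A.H \<Longrightarrow> l2_ip G C (push \<xi>) (push \<eta>) = \<phi> (l2_ip G A \<xi> \<eta>)"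
  by (rule C.l2_ip_eqI[OF push_H push_H push_has_ip])

lemma fin_supp_push: "f \<in> fin_supp_funs G A \<Longrightarrow> \<phi> \<circ> f \<in> fin_supp_funs G C"
  unfolding A.fin_supp_iff C.fin_supp_iff
  by (auto simp: phi phi_zero Pi_iff elim!: finite_subset[rotated])

text \<open>\<open>push\<close> intertwines the two regular representations on finite sums;
  equivariance of \<phi> takes care of the twisted coefficients.\<close>

lemma reg_push:
  assumes f: "f \<in> fin_supp_funs G A" and \<xi>: "\<xi> \<in> A.H"
  shows "C.reg (\<phi> \<circ> f) (push \<xi>) = push (A.reg f \<xi>)"
proof (rule C.l2_eqI)
  let ?F = "{g \<in> carrier G. f g \<noteq> \<zero>\<^bsub>A\<^esub>}"
  have f': "f \<in> carrier G \<rightarrow> carrier A" "finite ?F" "\<phi> \<circ> f \<in> carrier G \<rightarrow> carrier C"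
    using f fin_supp_push[OF f] unfolding A.fin_supp_iff C.fin_supp_iff by blast+
  show "C.reg (\<phi> \<circ> f) (push \<xi>) \<in> C.H" by (rule C.op_closed[OF C.reg_closed[OF f'(3)] push_H[OF \<xi>]])
  have r: "A.reg f \<xi> \<in> A.H" by (rule A.op_closed[OF A.reg_closed[OF f'(1)] \<xi>])
  then show "push (A.reg f \<xi>) \<in> C.H" by (rule push_H)
  fix h assume h: "h \<in> carrier G"
  have supp: "{g \<in> carrier G. (\<phi> \<circ> f) g \<noteq> \<zero>\<^bsub>C\<^esub>} \<subseteq> ?F" by (auto simp: phi_zero)
  let ?t = "\<lambda>g. \<alpha> (inv\<^bsub>G\<^esub> h) (f g) \<otimes>\<^bsub>A\<^esub> \<xi> (inv\<^bsub>G\<^esub> g \<otimes>\<^bsub>G\<^esub> h)"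
  have c: "?t \<in> ?F \<rightarrow> carrier A"
    using f' h by (auto intro!: A.m_closed A.alpha_closed A.l2_carrier[OF \<xi>])
  have "push (A.reg f \<xi>) h = \<phi> (finsum A ?t ?F)"
    using h A.reg_apply[OF f'(1,2) _ order_refl \<xi> h] by (simp add: push_def)
  also have "\<dots> = (\<Oplus>\<^bsub>C\<^esub>g\<in>?F. \<phi> (?t g))" by (rule phi_finsum[OF c])
  also have "\<dots> = (\<Oplus>\<^bsub>C\<^esub>g\<in>?F. \<beta> (inv\<^bsub>G\<^esub> h) ((\<phi> \<circ> f) g) \<otimes>\<^bsub>C\<^esub> push \<xi> (inv\<^bsub>G\<^esub> g \<otimes>\<^bsub>G\<^esub> h))"
  proof (rule C.finsum_cong')
    show "\<phi> (?t g) = \<beta> (inv\<^bsub>G\<^esub> h) ((\<phi> \<circ> f) g) \<otimes>\<^bsub>C\<^esub> push \<xi> (inv\<^bsub>G\<^esub> g \<otimes>\<^bsub>G\<^esub> h)" if "g \<in> ?F" for g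
      using that h f'(1) A.l2_carrier[OF \<xi>] by (auto simp: phi A.alpha_closed equivariant push_def Pi_iff)
    show "(\<lambda>g. \<beta> (inv\<^bsub>G\<^esub> h) ((\<phi> \<circ> f) g) \<otimes>\<^bsub>C\<^esub> push \<xi> (inv\<^bsub>G\<^esub> g \<otimes>\<^bsub>G\<^esub> h)) \<in> ?F \<rightarrow> carrier C"
      using f'(3) h by (auto intro!: C.m_closed C.alpha_closed C.l2_carrier[OF push_H[OF \<xi>]])
  qed simp
  also have "\<dots> = C.reg (\<phi> \<circ> f) (push \<xi>) h"
    by (rule C.reg_apply[OF f'(3,2) _ supp push_H[OF \<xi>] h, symmetric]) auto
  finally show "C.reg (\<phi> \<circ> f) (push \<xi>) h = push (A.reg f \<xi>) h" by simp
qed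

end

text \<open>Boundedness on finite sums is isolated as an assumption: given it, the extension to the
  closures is formal, while its verification for quotient maps needs an approximate unit of the
  ideal.\<close>

locale cs_dyn_hom_bounded = cs_dyn_hom A G \<alpha> C \<beta> \<phi>
  for A :: "'a cstar" and G :: "('g, 'm) monoid_scheme" and \<alpha> :: "'g \<Rightarrow> 'a \<Rightarrow> 'a"
    and C :: "'b cstar" and \<beta> :: "'g \<Rightarrow> 'b \<Rightarrow> 'b" and \<phi> :: "'a \<Rightarrow> 'b" +
  assumes bound: "f \<in> fin_supp_funs G A \<Longrightarrow> nrm C.B (C.reg (\<phi> \<circ> f)) \<le> nrm A.B (A.reg f)"
begin

abbreviation "RA f \<equiv> A.op.E (A.reg f)"
abbreviation "RC f \<equiv> C.op.E (C.reg (\<phi> \<circ> f))"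

lemma reg_A_closed: "f \<in> fin_supp_funs G A \<Longrightarrow> A.reg f \<in> carrier A.B"
  by (rule A.reg_closed) (simp add: A.fin_supp_iff)

lemma reg_C_closed: "f \<in> fin_supp_funs G A \<Longrightarrow> C.reg (\<phi> \<circ> f) \<in> carrier C.B"
  using fin_supp_push[of f] by (intro C.reg_closed) (simp add: C.fin_supp_iff)

lemma reg_dist_le:
  assumes f: "f \<in> fin_supp_funs G A" "f' \<in> fin_supp_funs G A"
  shows "dist (RC f) (RC f') \<le> dist (RA f) (RA f')"
proof -
  \<comment> \<open>The bound concerns a single function, so it is applied to the difference; off
    the group \<open>d\<close> is set to 0, which does not affect \<open>reg\<close>.\<close>
  define d where "d = (\<lambda>g. if g \<in> carrier G then f g \<ominus>\<^bsub>A\<^esub> f' g else \<zero>\<^bsub>A\<^esub>)"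
  have supp: "finite {g \<in> carrier G. f g \<ominus>\<^bsub>A\<^esub> f' g \<noteq> \<zero>\<^bsub>A\<^esub>}"
    by (rule finite_subset[of _ "{g \<in> carrier G. f g \<noteq> \<zero>\<^bsub>A\<^esub>} \<union> {g \<in> carrier G. f' g \<noteq> \<zero>\<^bsub>A\<^esub>}"])
      (use f in \<open>auto simp: A.fin_supp_iff A.a_diff_self\<close>)
  have d: "d \<in> fin_supp_funs G A"
    using f supp by (auto simp: A.fin_supp_iff d_def Pi_iff elim!: finite_subset[rotated])
  have A1: "A.reg f = A.reg (\<lambda>g. f' g \<oplus>\<^bsub>A\<^esub> d g)"
  proof -
    have "f g = f' g \<oplus>\<^bsub>A\<^esub> d g" if "g \<in> carrier G" for g
    proof -
      have "f g \<in> carrier A" "f' g \<in> carrier A" using f that by (auto simp: A.fin_supp_iff)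
      then show ?thesis using that
        by (subst A.emb_eq_iff[symmetric]) (simp_all add: d_def A.emb_add A.emb_diff)
    qed
    then show ?thesis using f by (intro A.reg_cong) (simp_all add: A.fin_supp_iff)
  qed
  have C1: "C.reg (\<phi> \<circ> f) = C.reg (\<lambda>g. (\<phi> \<circ> f') g \<oplus>\<^bsub>C\<^esub> (\<phi> \<circ> d) g)"
  proof -
    have "(\<phi> \<circ> f) g = (\<phi> \<circ> f') g \<oplus>\<^bsub>C\<^esub> (\<phi> \<circ> d) g" if "g \<in> carrier G" for g
    proof -
      have "f g \<in> carrier A" "f' g \<in> carrier A" using f that by (auto simp: A.fin_supp_iff)
      then show ?thesis using that
        by (subst C.emb_eq_iff[symmetric]) (simp_all add: d_def phi phi_diff C.emb_add C.emb_diff)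
    qed
    then show ?thesis using fin_supp_push[OF f(1)] by (intro C.reg_cong) (simp_all add: C.fin_supp_iff)
  qed
  note cl = reg_A_closed[OF f(1)] reg_A_closed[OF f(2)] reg_A_closed[OF d]
    reg_C_closed[OF f(1)] reg_C_closed[OF f(2)] reg_C_closed[OF d]
  have "RA f = RA f' + RA d" unfolding A1 A.reg_add[OF f(2) d] using cl by (simp add: A.op.emb_add)
  moreover have "RC f = RC f' + RC d"
    unfolding C1 C.reg_add[OF fin_supp_push[OF f(2)] fin_supp_push[OF d]] using cl by (simp add: C.op.emb_add)
  ultimately show ?thesis using bound[OF d] cl by (simp add: dist_norm A.op.norm_emb C.op.norm_emb)
qed

lemma crossed_seqE:
  assumes "x \<in> A.Cr"
  obtains s where "\<And>n. s n \<in> fin_supp_funs G A" "(\<lambda>n. RA (s n)) \<longlonglongrightarrow> A.op.E x"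
proof -
  obtain t where t: "\<And>n. t n \<in> A.D (carrier A)" "(\<lambda>n. A.op.E (t n)) \<longlonglongrightarrow> A.op.E x"
    using assms by (rule A.op.clos_seqE) blast
  have "\<forall>n. \<exists>f. f \<in> fin_supp_funs G A \<and> t n = A.reg f" using t(1) by (auto simp: A.D_def)
  then obtain s where "\<And>n. s n \<in> fin_supp_funs G A" "\<And>n. t n = A.reg (s n)" by metis
  moreover from this t(2) have "(\<lambda>n. RA (s n)) \<longlonglongrightarrow> A.op.E x" by simp
  ultimately show ?thesis by (intro that[of s]) auto
qed

lemma RC_limit:
  assumes s: "\<And>n. s n \<in> fin_supp_funs G A" "(\<lambda>n. RA (s n)) \<longlonglongrightarrow> z"
  shows "\<exists>y\<in>C.Cr. (\<lambda>n. RC (s n)) \<longlonglongrightarrow> C.op.E y"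
proof -
  have "Cauchy (\<lambda>n. RC (s n))"
  proof (rule metric_CauchyI)
    fix e :: real assume "0 < e"
    then obtain M where "\<And>m n. m \<ge> M \<Longrightarrow> n \<ge> M \<Longrightarrow> dist (RA (s m)) (RA (s n)) < e"
      using LIMSEQ_imp_Cauchy[OF s(2)] unfolding Cauchy_def by blast
    then show "\<exists>M. \<forall>m\<ge>M. \<forall>n\<ge>M. dist (RC (s m)) (RC (s n)) < e"
      using reg_dist_le[OF s(1) s(1)] le_less_trans by blast
  qed
  then obtain w where w: "(\<lambda>n. RC (s n)) \<longlonglongrightarrow> w" using Cauchy_convergent convergent_def by blast
  obtain y where y: "y \<in> carrier C.B" "w = C.op.E y"
    using C.op.emb_Cauchy_limit[of "\<lambda>n. C.reg (\<phi> \<circ> s n)", OF reg_C_closed[OF s(1)] w] by (elim bexE) (rule that)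
  have "C.reg (\<phi> \<circ> s n) \<in> C.D (carrier C)" for n
    using fin_supp_push[OF s(1)[of n]] by (simp add: C.D_def)
  then have "y \<in> C.Cr" using w y by (intro C.op.clos_seqI[of _ "\<lambda>n. C.reg (\<phi> \<circ> s n)"]) auto
  then show ?thesis using w y by blast
qed

definition approx :: "(('g \<Rightarrow> 'a) \<Rightarrow> 'g \<Rightarrow> 'a) \<Rightarrow> nat \<Rightarrow> 'g \<Rightarrow> 'a" where
  "approx x = (SOME s. (\<forall>n. s n \<in> fin_supp_funs G A) \<and> (\<lambda>n. RA (s n)) \<longlonglongrightarrow> A.op.E x)"

lemma approx:
  assumes "x \<in> A.Cr"
  shows "approx x n \<in> fin_supp_funs G A" "(\<lambda>n. RA (approx x n)) \<longlonglongrightarrow> A.op.E x"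
proof -
  have "\<exists>s. (\<forall>n. s n \<in> fin_supp_funs G A) \<and> (\<lambda>n. RA (s n)) \<longlonglongrightarrow> A.op.E x"
    using assms by (rule crossed_seqE) blast
  from someI_ex[OF this] show "approx x n \<in> fin_supp_funs G A" "(\<lambda>n. RA (approx x n)) \<longlonglongrightarrow> A.op.E x"
    unfolding approx_def by blast+
qed

text \<open>The limit along one chosen approximating sequence; by \<open>ext_seq\<close> the choice
  is immaterial. The restriction to \<open>A.Cr\<close> matches the extensionality demanded in
  \<open>red_crossed_map\<close>.\<close>

definition ext :: "(('g \<Rightarrow> 'a) \<Rightarrow> 'g \<Rightarrow> 'a) \<Rightarrow> ('g \<Rightarrow> 'b) \<Rightarrow> 'g \<Rightarrow> 'b" where
  "ext = (\<lambda>x\<in>A.Cr. SOME y. y \<in> C.Cr \<and> (\<lambda>n. RC (approx x n)) \<longlonglongrightarrow> C.op.E y)"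

lemma ext:
  assumes "x \<in> A.Cr"
  shows "ext x \<in> C.Cr" "(\<lambda>n. RC (approx x n)) \<longlonglongrightarrow> C.op.E (ext x)"
proof -
  have "\<exists>y. y \<in> C.Cr \<and> (\<lambda>n. RC (approx x n)) \<longlonglongrightarrow> C.op.E y"
    using RC_limit[OF approx[OF assms]] by blast
  from someI_ex[OF this] show "ext x \<in> C.Cr" "(\<lambda>n. RC (approx x n)) \<longlonglongrightarrow> C.op.E (ext x)"
    using assms unfolding ext_def by simp_all
qed

text \<open>Two sequences with the same limit differ by a null sequence, and
  \<open>reg_dist_le\<close> carries this over to their images.\<close>

lemma ext_seq:
  assumes x: "x \<in> A.Cr" and s: "\<And>n. s n \<in> fin_supp_funs G A" "(\<lambda>n. RA (s n)) \<longlonglongrightarrow> A.op.E x"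
  shows "(\<lambda>n. RC (s n)) \<longlonglongrightarrow> C.op.E (ext x)"
proof -
  have "(\<lambda>n. RA (s n) - RA (approx x n)) \<longlonglongrightarrow> A.op.E x - A.op.E x"
    by (intro tendsto_diff s approx[OF x])
  then have "(\<lambda>n. dist (RA (s n)) (RA (approx x n))) \<longlonglongrightarrow> 0"
    by (simp add: dist_norm tendsto_norm_zero)
  then have "(\<lambda>n. RC (s n) - RC (approx x n)) \<longlonglongrightarrow> 0"
    by (rule Lim_null_comparison[rotated]) (use reg_dist_le[OF s(1) approx(1)[OF x]] in \<open>simp add: dist_norm\<close>)
  from tendsto_add[OF this ext(2)[OF x]] show ?thesis by simp
qed

lemma ext_reg: "f \<in> fin_supp_funs G A \<Longrightarrow> ext (A.reg f) = C.reg (\<phi> \<circ> f)"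
proof -
  assume f: "f \<in> fin_supp_funs G A"
  have "A.D (carrier A) \<subseteq> A.Cr" by (intro A.op.clos_subset A.D_carrier) simp
  then have x: "A.reg f \<in> A.Cr" using f by (auto simp: A.D_def)
  have "(\<lambda>n. RC f) \<longlonglongrightarrow> C.op.E (ext (A.reg f))" by (rule ext_seq[OF x f]) simp
  then have "RC f = C.op.E (ext (A.reg f))" by (rule LIMSEQ_unique[OF tendsto_const])
  moreover have "ext (A.reg f) \<in> carrier C.B" using ext(1)[OF x] C.op.clos_carrier by blast
  ultimately show ?thesis using reg_C_closed[OF f] by (simp add: C.op.emb_eq_iff)
qed

lemma ext_dist_le:
  assumes "x \<in> A.Cr" "y \<in> A.Cr"
  shows "dist (C.op.E (ext x)) (C.op.E (ext y)) \<le> dist (A.op.E x) (A.op.E y)"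
proof (rule tendsto_le[OF sequentially_bot])
  show "(\<lambda>n. dist (RA (approx x n)) (RA (approx y n))) \<longlonglongrightarrow> dist (A.op.E x) (A.op.E y)"
    by (intro tendsto_dist approx assms)
  show "(\<lambda>n. dist (RC (approx x n)) (RC (approx y n))) \<longlonglongrightarrow> dist (C.op.E (ext x)) (C.op.E (ext y))"
    by (intro tendsto_dist ext assms)
qed (simp add: reg_dist_le approx assms)

abbreviation "XA \<equiv> red_crossed G A \<alpha>"
abbreviation "XC \<equiv> red_crossed G C \<beta>"

lemma cs_dist_XA: "x \<in> A.Cr \<Longrightarrow> y \<in> A.Cr \<Longrightarrow> cs_dist XA x y = dist (A.op.E x) (A.op.E y)"
  using A.cr.sub_carrier
  by (simp add: A.red_crossed_eq cs_dist_def A.cr.sub_diff dist_norm A.op.norm_emb flip: A.op.emb_diff)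

lemma cs_dist_XC: "x \<in> C.Cr \<Longrightarrow> y \<in> C.Cr \<Longrightarrow> cs_dist XC x y = dist (C.op.E x) (C.op.E y)"
  using C.cr.sub_carrier
  by (simp add: C.red_crossed_eq cs_dist_def C.cr.sub_diff dist_norm C.op.norm_emb flip: C.op.emb_diff)

lemma carrier_XA: "carrier XA = A.Cr"
  by (simp add: A.red_crossed_eq)

lemma carrier_XC: "carrier XC = C.Cr"
  by (simp add: C.red_crossed_eq)

lemma XA_cstar: "cstar_algebra XA"
  unfolding A.red_crossed_eq by (rule A.cr.sub_cstar)

lemma XC_cstar: "cstar_algebra XC"
  unfolding C.red_crossed_eq by (rule C.cr.sub_cstar)

lemma ext_continuous: "continuous_map (cs_top XA) (cs_top XC) ext"
proof -
  interpret XA: cstar_algebra XA by (rule XA_cstar)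
  interpret XC: cstar_algebra XC by (rule XC_cstar)
  show ?thesis
    unfolding cs_top_def XA.metric.metric_continuous_map[OF XC.metric.Metric_space_axioms]
  proof (intro conjI ballI allI impI)
    show "ext ` carrier XA \<subseteq> carrier XC" using ext(1) by (auto simp: carrier_XA carrier_XC)
    fix a and e :: real assume a: "a \<in> carrier XA" and e: "0 < e"
    show "\<exists>d>0. \<forall>x. x \<in> carrier XA \<and> cs_dist XA a x < d \<longrightarrow> cs_dist XC (ext a) (ext x) < e"
      using a e le_less_trans[OF ext_dist_le[of a]] ext(1)
      by (intro exI[of _ e]) (auto simp: carrier_XA cs_dist_XA cs_dist_XC)
  qed
qed

text \<open>Finite sums are dense and limits in a metric space are unique, so continuity and the
  prescribed values leave no freedom; the description operator therefore selects
  \<open>ext\<close>.\<close>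

lemma red_crossed_map_eq: "red_crossed_map G A \<alpha> C \<beta> \<phi> = ext"
  unfolding red_crossed_map_def
proof (rule the_equality)
  show "ext \<in> extensional (carrier XA) \<and> continuous_map (cs_top XA) (cs_top XC) ext \<and>
      (\<forall>f\<in>fin_supp_funs G A. ext (A.reg f) = C.reg (\<phi> \<circ> f))"
    using ext_continuous ext_reg by (simp add: carrier_XA ext_def)
  fix \<Phi> assume \<Phi>: "\<Phi> \<in> extensional (carrier XA) \<and> continuous_map (cs_top XA) (cs_top XC) \<Phi> \<and>
      (\<forall>f\<in>fin_supp_funs G A. \<Phi> (A.reg f) = C.reg (\<phi> \<circ> f))"
  interpret XA: cstar_algebra XA by (rule XA_cstar)
  interpret XC: cstar_algebra XC by (rule XC_cstar)
  show "\<Phi> = ext"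
  proof (rule extensionalityI[of _ A.Cr])
    show "\<Phi> \<in> extensional A.Cr" using \<Phi> by (simp add: carrier_XA)
    show "ext \<in> extensional A.Cr" by (simp add: ext_def)
    fix x assume x: "x \<in> A.Cr"
    have D: "A.D (carrier A) \<subseteq> A.Cr" by (intro A.op.clos_subset A.D_carrier) simp
    have rc: "A.reg (approx x n) \<in> A.Cr" for n using approx(1)[OF x, of n] D by (auto simp: A.D_def)
    have lim: "limitin (cs_top XA) (\<lambda>n. A.reg (approx x n)) x sequentially"
      unfolding cs_top_def XA.metric.limit_metric_sequentially
    proof (intro conjI allI impI)
      fix e :: real assume "0 < e"
      then show "\<exists>N. \<forall>n\<ge>N. A.reg (approx x n) \<in> carrier XA \<and> cs_dist XA (A.reg (approx x n)) x < e"
        using approx(2)[OF x] rc x by (simp add: carrier_XA cs_dist_XA metric_LIMSEQ_D)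
    qed (simp add: carrier_XA x)
    have "limitin (cs_top XC) (\<Phi> \<circ> (\<lambda>n. A.reg (approx x n))) (\<Phi> x) sequentially"
      by (rule continuous_map_limit[OF _ lim]) (use \<Phi> in simp)
    moreover have "\<Phi> \<circ> (\<lambda>n. A.reg (approx x n)) = ext \<circ> (\<lambda>n. A.reg (approx x n))"
      using \<Phi> approx(1)[OF x] ext_reg by auto
    moreover have "limitin (cs_top XC) (ext \<circ> (\<lambda>n. A.reg (approx x n))) (ext x) sequentially"
      by (rule continuous_map_limit[OF ext_continuous lim])
    ultimately show "\<Phi> x = ext x"
      using XC.metric.limitin_metric_unique unfolding cs_top_def by (metis sequentially_bot)
  qed
qed

end

lemma (in cs_dyn_hom) nrm_push: "\<xi> \<in> A.H \<Longrightarrow> (l2_norm G C (push \<xi>))\<^sup>2 = nrm C (\<phi> (l2_ip G A \<xi> \<xi>))"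
  by (simp add: C.l2_norm_power2 push_H push_ip)

text \<open>The intertwining relation \<open>reg_push\<close> passed to the limit coordinate by
  coordinate. It determines \<open>ext x\<close> on all vectors that come from
  \<open>A\<close>.\<close>

lemma (in cs_dyn_hom_bounded) ext_push:
  assumes x: "x \<in> A.Cr" and \<xi>: "\<xi> \<in> A.H"
  shows "ext x (push \<xi>) = push (x \<xi>)"
proof (rule C.l2_eqI)
  have xc: "x \<in> carrier A.B" "ext x \<in> carrier C.B"
    using x ext(1)[OF x] A.op.clos_carrier C.op.clos_carrier by auto
  show "ext x (push \<xi>) \<in> C.H" "push (x \<xi>) \<in> C.H"
    by (rule C.op_closed[OF xc(2) push_H[OF \<xi>]], rule push_H[OF A.op_closed[OF xc(1) \<xi>]])
  fix h assume h: "h \<in> carrier G"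
  let ?s = "approx x"
  have sc: "A.reg (?s n) \<in> carrier A.B" "C.reg (\<phi> \<circ> ?s n) \<in> carrier C.B" for n
    by (rule reg_A_closed reg_C_closed, rule approx[OF x])+
  have 1: "(\<lambda>n. A.E (A.reg (?s n) \<xi> h)) \<longlonglongrightarrow> A.E (x \<xi> h)"
    by (rule A.op_tendsto_apply[OF sc(1) xc(1) approx(2)[OF x] \<xi> h])
  have 2: "(\<lambda>n. C.E (C.reg (\<phi> \<circ> ?s n) (push \<xi>) h)) \<longlonglongrightarrow> C.E (ext x (push \<xi>) h)"
    by (rule C.op_tendsto_apply[OF sc(2) xc(2) ext(2)[OF x] push_H[OF \<xi>] h])
  have c: "A.reg (?s n) \<xi> h \<in> carrier A" "x \<xi> h \<in> carrier A" for n
    by (rule A.l2_carrier[OF A.op_closed[OF sc(1) \<xi>] h], rule A.l2_carrier[OF A.op_closed[OF xc(1) \<xi>] h])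
  have "(\<lambda>n. dist (A.E (A.reg (?s n) \<xi> h)) (A.E (x \<xi> h))) \<longlonglongrightarrow> 0"
    using 1 unfolding tendsto_dist_iff[symmetric] .
  then have "(\<lambda>n. dist (C.E (C.reg (\<phi> \<circ> ?s n) (push \<xi>) h)) (C.E (push (x \<xi>) h))) \<longlonglongrightarrow> 0"
  proof (rule Lim_null_comparison[rotated])
    have "dist (C.E (C.reg (\<phi> \<circ> ?s n) (push \<xi>) h)) (C.E (push (x \<xi>) h))
        \<le> dist (A.E (A.reg (?s n) \<xi> h)) (A.E (x \<xi> h))" for n
      unfolding reg_push[OF approx(1)[OF x] \<xi>] using phi_dist_le[OF c] h by (simp add: push_def)
    then show "\<forall>\<^sub>F n in sequentially. norm (dist (C.E (C.reg (\<phi> \<circ> ?s n) (push \<xi>) h)) (C.E (push (x \<xi>) h)))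
        \<le> dist (A.E (A.reg (?s n) \<xi> h)) (A.E (x \<xi> h))" by simp
  qed
  then have "(\<lambda>n. C.E (C.reg (\<phi> \<circ> ?s n) (push \<xi>) h)) \<longlonglongrightarrow> C.E (push (x \<xi>) h)" by (subst tendsto_dist_iff)
  then have "C.E (ext x (push \<xi>) h) = C.E (push (x \<xi>) h)" by (rule LIMSEQ_unique[OF 2])
  moreover have "ext x (push \<xi>) h \<in> carrier C" "push (x \<xi>) h \<in> carrier C"
    by (rule C.l2_carrier[OF C.op_closed[OF xc(2) push_H[OF \<xi>]] h], rule C.l2_carrier[OF push_H[OF A.op_closed[OF xc(1) \<xi>]] h])
  ultimately show "ext x (push \<xi>) h = push (x \<xi>) h" by (simp add: C.emb_eq_iff)
qed

section \<open>Quotients by invariant ideals\<close>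

locale cs_dyn_ideal = cs_dyn A G \<alpha> + cstar_quotient A K
  for A :: "'a cstar" (structure) and G :: "('g, 'm) monoid_scheme" and \<alpha> and K +
  assumes invariant: "g \<in> I \<Longrightarrow> k \<in> K \<Longrightarrow> \<alpha> g k \<in> K"
begin

abbreviation "\<alpha>Q \<equiv> \<lambda>g X. \<alpha> g ` X"

lemma alpha_quot:
  assumes g: "g \<in> I" and a: "a \<in> carrier A"
  shows "\<alpha> g ` q a = q (\<alpha> g a)"
proof (intro equalityI subsetI)
  fix y assume "y \<in> \<alpha> g ` q a"
  then obtain x where x: "x \<in> carrier A" "x \<ominus> a \<in> K" "y = \<alpha> g x" using q_mem[OF a] by auto
  have "\<alpha> g x \<ominus> \<alpha> g a = \<alpha> g (x \<ominus> a)" using g a x by (simp add: alpha_diff)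
  then show "y \<in> q (\<alpha> g a)" using x g a invariant by (simp add: q_mem alpha_closed)
next
  fix y assume "y \<in> q (\<alpha> g a)"
  then have y: "y \<in> carrier A" "y \<ominus> \<alpha> g a \<in> K" using g a by (simp_all add: q_mem alpha_closed)
  define x where "x = \<alpha> (inv\<^bsub>G\<^esub> g) y"
  have x: "x \<in> carrier A" "\<alpha> g x = y" using y g by (simp_all add: x_def alpha_closed alpha_inv)
  have "\<alpha> (inv\<^bsub>G\<^esub> g) (y \<ominus> \<alpha> g a) = x \<ominus> a"
    using g a y by (simp add: alpha_diff alpha_closed x_def alpha_inv)
  then have "x \<ominus> a \<in> K" using invariant[OF G.inv_closed[OF g] y(2)] by simp
  then show "y \<in> \<alpha> g ` q a" using x by (auto simp: q_mem[OF a])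
qed

lemma quot_dyn: "cs_dyn Q G \<alpha>Q"
proof (intro cs_dyn.intro cs_dyn_axioms.intro l2_space.intro Q_cstar G.is_group)
  show "\<alpha>Q g \<in> star_hom Q Q" if "g \<in> I" for g
    using that by (auto simp: star_hom_def Q_carrier alpha_quot alpha_closed Q_add Q_mult Q_star Q_smult
        alpha_add alpha_prod alpha_star alpha_smult m_closed star_closed smult_closed)
  show "\<alpha>Q \<one>\<^bsub>G\<^esub> X = X" if "X \<in> carrier Q" for X
    using that unfolding Q_carrier by (elim imageE) (simp only: alpha_quot[OF G.one_closed] alpha_one)
  show "\<alpha>Q (g \<otimes>\<^bsub>G\<^esub> h) X = \<alpha>Q g (\<alpha>Q h X)" if gh: "g \<in> I" "h \<in> I" and "X \<in> carrier Q" for g h X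
    using that(3) unfolding Q_carrier
    by (elim imageE) (simp only: alpha_quot gh G.m_closed alpha_closed alpha_mult)
qed

end

sublocale cs_dyn_ideal \<subseteq> Qh: cs_dyn_hom A G \<alpha> Q \<alpha>Q q
proof (intro cs_dyn_hom.intro cs_dyn_hom_axioms.intro cs_dyn_axioms quot_dyn q_star_hom)
  show "q (\<alpha> g x) = \<alpha> g ` q x" if "g \<in> I" "x \<in> carrier A" for g x
    using that by (simp add: alpha_quot)
qed

context cs_dyn_ideal
begin

text \<open>Finitely many coordinates can be lifted with no control of norms, and the lift is 0
  elsewhere. After truncation nothing more is needed.\<close>

lemma push_lift:
  assumes F: "finite F" "F \<subseteq> I" and \<eta>: "\<eta> = (\<lambda>g\<in>I. if g \<in> F then \<zeta> g else \<zero>\<^bsub>Q\<^esub>)" "\<eta> \<in> Qh.C.H"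
  shows "\<exists>\<xi>\<in>H. Qh.push \<xi> = \<eta>"
proof -
  have "\<forall>g\<in>I. \<exists>a. a \<in> carrier A \<and> q a = \<eta> g"
    using Qh.C.l2_carrier[OF \<eta>(2)] unfolding Q_carrier by (metis imageE)
  then obtain r where r: "\<And>g. g \<in> I \<Longrightarrow> r g \<in> carrier A" "\<And>g. g \<in> I \<Longrightarrow> q (r g) = \<eta> g" by metis
  define \<xi> where "\<xi> = (\<lambda>g\<in>I. if g \<in> F then r g else \<zero>)"
  have "\<xi> \<in> H"
    by (rule l2_finite_support) (use F r in \<open>auto simp: \<xi>_def elim!: finite_subset[rotated] split: if_splits\<close>)
  moreover have "Qh.push \<xi> = \<eta>"
  proof
    fix g show "Qh.push \<xi> g = \<eta> g"
      using r(2)[of g] \<eta>(1) by (cases "g \<in> I") (auto simp: Qh.push_def \<xi>_def Q_zero)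
  qed
  ultimately show ?thesis by blast
qed

text \<open>Pushed vectors are dense in the module over the quotient, as they include the finitely
  supported ones. Since \<open>R\<close> is already bounded, an estimate on them extends with the
  same constant.\<close>

lemma quot_norm_leI:
  assumes R: "R \<in> carrier Qh.C.B" and M: "0 \<le> M"
    and le: "\<And>\<xi>. \<xi> \<in> H \<Longrightarrow> l2_norm G Q (R (Qh.push \<xi>)) \<le> M * l2_norm G Q (Qh.push \<xi>)"
  shows "nrm Qh.C.B R \<le> M"
proof (rule Qh.C.op_nrm_leI[OF M])
  fix \<eta> assume \<eta>: "\<eta> \<in> Qh.C.H"
  let ?N = "l2_norm G Q"
  define c where "c = nrm Qh.C.B R"
  have c: "0 \<le> c" unfolding c_def by (rule Qh.C.op_nrm_nonneg[OF R])
  show "?N (R \<eta>) \<le> M * ?N \<eta>"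
  proof (rule field_le_epsilon)
    fix e :: real assume e: "0 < e"
    \<comment> \<open>Keeps the truncation error c d below \<open>e\<close>, also for c = 0.\<close>
    define d where "d = e / (c + 1)"
    have d: "0 < d" "c * d \<le> e" using c e by (simp_all add: d_def field_simps)
    obtain F \<eta>' where F: "finite F" "F \<subseteq> I" and \<eta>'_eq: "\<eta>' = (\<lambda>g\<in>I. if g \<in> F then \<eta> g else \<zero>\<^bsub>Q\<^esub>)"
      and \<eta>': "\<eta>' \<in> Qh.C.H" and near: "?N (Qh.C.vadd \<eta> (Qh.C.vsm (- 1) \<eta>')) \<le> d" and small: "?N \<eta>' \<le> ?N \<eta>"
      by (rule Qh.C.l2_truncation[OF \<eta> d(1)])
    obtain \<xi> where \<xi>: "\<xi> \<in> H" "Qh.push \<xi> = \<eta>'" using push_lift[OF F \<eta>'_eq \<eta>'] by blast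
    define \<delta> where "\<delta> = Qh.C.vadd \<eta> (Qh.C.vsm (- 1) \<eta>')"
    have \<delta>: "\<delta> \<in> Qh.C.H" using \<eta> \<eta>' by (simp add: \<delta>_def)
    have "Qh.C.vadd \<delta> \<eta>' = \<eta>"
    proof (rule Qh.C.l2_eqI)
      show "Qh.C.vadd \<delta> \<eta>' \<in> Qh.C.H" "\<eta> \<in> Qh.C.H" using \<delta> \<eta> \<eta>' by simp_all
      fix g assume g: "g \<in> I"
      then have "Qh.C.E (Qh.C.vadd \<delta> \<eta>' g) = Qh.C.E (\<eta> g)"
        using \<delta> \<eta> \<eta>' unfolding Qh.C.em_vadd[OF \<delta> \<eta>' g] unfolding \<delta>_def
        by (simp add: Qh.C.em_vadd Qh.C.vdiff_apply Qh.C.l2_carrier Qh.C.emb_diff)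
      then show "Qh.C.vadd \<delta> \<eta>' g = \<eta> g"
        using Qh.C.l2_carrier[OF Qh.C.vadd_closed[OF \<delta> \<eta>'] g] Qh.C.l2_carrier[OF \<eta> g] by (simp add: Qh.C.emb_eq_iff)
    qed
    then have "?N (R \<eta>) = ?N (Qh.C.vadd (R \<delta>) (R \<eta>'))" using Qh.C.op_linear(1)[OF R \<delta> \<eta>'] by simp
    also have "\<dots> \<le> ?N (R \<delta>) + ?N (R \<eta>')"
      by (rule Qh.C.l2_norm_vadd_le[OF Qh.C.op_closed[OF R \<delta>] Qh.C.op_closed[OF R \<eta>']])
    also have "?N (R \<delta>) \<le> c * ?N \<delta>" unfolding c_def by (rule Qh.C.op_norm_le[OF R \<delta>])
    also have "c * ?N \<delta> \<le> c * d" using near c by (simp add: \<delta>_def mult_left_mono)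
    also have "c * d \<le> e" by (rule d(2))
    also have "?N (R \<eta>') \<le> M * ?N \<eta>'" using le[OF \<xi>(1)] \<xi>(2) by simp
    also have "M * ?N \<eta>' \<le> M * ?N \<eta>" using small M by (rule mult_left_mono)
    finally show "?N (R \<eta>) \<le> M * ?N \<eta> + e" by simp
  qed
qed

text \<open>For a suitable \<open>e \<in> K\<close>, the vector \<open>\<xi> (1 - e)\<close> has the same image as \<open>\<xi>\<close> in the quotient and its norm
  is arbitrarily close to the norm of this image.\<close>

lemma quot_bound_push:
  assumes f: "f \<in> fin_supp_funs G A" and \<xi>: "\<xi> \<in> H"
  shows "l2_norm G Q (Qh.C.reg (q \<circ> f) (Qh.push \<xi>)) \<le> nrm B (reg f) * l2_norm G Q (Qh.push \<xi>)"
proof -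
  let ?N = "l2_norm G Q" and ?R = "Qh.C.reg (q \<circ> f)" and ?r = "l2_ip G A \<xi> \<xi>"
  have T: "reg f \<in> carrier B" using f by (intro reg_closed) (simp add: fin_supp_iff)
  define M where "M = nrm B (reg f)"
  have M: "0 \<le> M" unfolding M_def by (rule op_nrm_nonneg[OF T])
  have r: "?r \<in> carrier A" by (rule l2_ip_closed[OF \<xi> \<xi>])
  have step: "(?N (?R (Qh.push \<xi>)))\<^sup>2 \<le> M\<^sup>2 * s" if s: "(?N (Qh.push \<xi>))\<^sup>2 < s" for s
  proof -
    obtain e where e: "e \<in> K" "star A e = e" "norm ((1 - E e) * E ?r * (1 - E e)) < s"
      using Q_nrm_unit[OF r, of s] s Qh.nrm_push[OF \<xi>] by auto
    have ec: "e \<in> carrier A" using e(1) by (rule ideal_carrier)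
    define \<zeta> where "\<zeta> = vadd \<xi> (vsm (- 1) (vmul \<xi> e))"
    have v: "vmul \<xi> e \<in> H" "vsm (- 1) (vmul \<xi> e) \<in> H" using \<xi> ec by simp_all
    have \<zeta>: "\<zeta> \<in> H" unfolding \<zeta>_def using \<xi> v by simp
    have T\<zeta>: "reg f \<zeta> \<in> H" by (rule op_closed[OF T \<zeta>])
    have "Qh.push \<zeta> = Qh.push \<xi>"
      unfolding Qh.push_def
    proof (rule restrict_ext)
      fix h assume h: "h \<in> I"
      have c: "\<xi> h \<in> carrier A" "\<xi> h \<otimes> e \<in> K" "\<zeta> h \<in> carrier A"
        by (intro l2_carrier[OF \<xi> h], intro ideal(5) l2_carrier[OF \<xi> h] e, intro l2_carrier[OF \<zeta> h])
      have "\<zeta> h = \<xi> h \<ominus> \<xi> h \<otimes> e"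
        unfolding \<zeta>_def vdiff_apply[OF \<xi> v(1) h] using h by (simp add: vmul_def)
      then have "\<xi> h \<ominus> \<zeta> h = \<xi> h \<otimes> e"
        using c ideal_carrier[OF c(2)] by (subst emb_eq_iff[symmetric]) (simp_all add: emb_diff)
      then have "q (\<xi> h) = q (\<zeta> h)" using c by (simp add: q_eq)
      then show "q (\<zeta> h) = q (\<xi> h)" by simp
    qed
    \<comment> \<open>The two vectors have the same image, so \<zeta> may replace \<xi>. Then
      \<open>reg_push\<close> moves the operator to \<open>A\<close>, where the norm dominates the
      quotient norm and \<open>reg f\<close> is bounded by \<open>M\<close>.\<close>
    then have "(?N (?R (Qh.push \<xi>)))\<^sup>2 = (?N (Qh.push (reg f \<zeta>)))\<^sup>2" using Qh.reg_push[OF f \<zeta>] by simp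
    also have "\<dots> = nrm Q (q (l2_ip G A (reg f \<zeta>) (reg f \<zeta>)))" by (rule Qh.nrm_push[OF T\<zeta>])
    also have "\<dots> \<le> nrm A (l2_ip G A (reg f \<zeta>) (reg f \<zeta>))"
      by (intro Q_nrm_le q_self l2_ip_closed T\<zeta>)
    also have "\<dots> = (l2_norm G A (reg f \<zeta>))\<^sup>2" by (rule l2_norm_power2[OF T\<zeta>, symmetric])
    also have "\<dots> \<le> (M * l2_norm G A \<zeta>)\<^sup>2"
      unfolding M_def by (intro power_mono op_norm_le[OF T \<zeta>] l2_norm_nonneg[OF T\<zeta>])
    also have "\<dots> = M\<^sup>2 * nrm A (l2_ip G A \<zeta> \<zeta>)" by (simp add: power_mult_distrib l2_norm_power2 \<zeta>)
    also have "nrm A (l2_ip G A \<zeta> \<zeta>) \<le> s"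
    proof -
      let ?p = "(1 - E e) * E ?r * (1 - E e)"
      \<comment> \<open>The inner product of \<xi> - \<xi> e with itself, expanded with operations
        of \<open>A\<close>. In the ambient type it is (1 - e) r (1 - e) for r the inner product of
        \<xi> with itself, which is the compression of norm below \<open>s\<close>.\<close>
      have "l2_ip G A \<zeta> \<zeta> = (?r \<oplus> (- 1) \<odot> (?r \<otimes> e)) \<oplus> cnj (- 1) \<odot> (star A e \<otimes> (?r \<oplus> (- 1) \<odot> (?r \<otimes> e)))"
      proof -
        have "l2_ip G A \<eta> \<zeta> = l2_ip G A \<eta> \<xi> \<oplus> (- 1) \<odot> (l2_ip G A \<eta> \<xi> \<otimes> e)" if "\<eta> \<in> H" for \<eta>
          unfolding \<zeta>_def using that \<xi> v ec by (simp add: ip_vadd_right ip_vsm_right ip_vmul_right)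
        note 1 = this[OF \<xi>]
        have "l2_ip G A \<zeta> \<zeta> = l2_ip G A \<xi> \<zeta> \<oplus> cnj (- 1) \<odot> (star A e \<otimes> l2_ip G A \<xi> \<zeta>)"
          by (subst \<zeta>_def) (use \<xi> v \<zeta> ec in \<open>simp add: ip_vadd_left ip_vsm_left ip_vmul_left\<close>)
        then show ?thesis unfolding 1 .
      qed
      moreover have "cscale (- 1) x = - x" for x :: "'a fam unitz"
        using cscale_of_real[of "- 1" x] by simp
      ultimately have "E (l2_ip G A \<zeta> \<zeta>) = ?p"
        using r ec by (simp add: e(2) emb_add emb_smult emb_mult m_closed smult_closed algebra_simps)
      then have "nrm A (l2_ip G A \<zeta> \<zeta>) = norm ?p" using l2_ip_closed[OF \<zeta> \<zeta>] by (simp flip: norm_emb)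
      then show ?thesis using e(3) by simp
    qed
    finally show ?thesis by (simp add: mult_left_mono)
  qed
  have "(?N (?R (Qh.push \<xi>)))\<^sup>2 \<le> (M * ?N (Qh.push \<xi>))\<^sup>2"
  proof (rule field_le_epsilon)
    fix e :: real assume e: "0 < e"
    define d where "d = e / (M\<^sup>2 + 1)"
    have p: "0 < M\<^sup>2 + 1" by (rule add_nonneg_pos) simp_all
    have d: "0 < d" using e p by (simp add: d_def)
    have "d * (M\<^sup>2 + 1) = e" using p by (simp add: d_def)
    then have d2: "M\<^sup>2 * d \<le> e" using d by (simp add: algebra_simps)
    have "(?N (?R (Qh.push \<xi>)))\<^sup>2 \<le> M\<^sup>2 * ((?N (Qh.push \<xi>))\<^sup>2 + d)" using d by (intro step) simp
    then show "(?N (?R (Qh.push \<xi>)))\<^sup>2 \<le> (M * ?N (Qh.push \<xi>))\<^sup>2 + e"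
      using d2 by (simp add: power_mult_distrib distrib_left)
  qed
  then have "?N (?R (Qh.push \<xi>)) \<le> M * ?N (Qh.push \<xi>)"
    by (rule power2_le_imp_le) (intro mult_nonneg_nonneg M Qh.C.l2_norm_nonneg Qh.push_H \<xi>)
  then show ?thesis by (simp add: M_def)
qed

end

sublocale cs_dyn_ideal \<subseteq> Qh: cs_dyn_hom_bounded A G \<alpha> Q \<alpha>Q q
proof (intro cs_dyn_hom_bounded.intro cs_dyn_hom_bounded_axioms.intro Qh.cs_dyn_hom_axioms)
  fix f assume f: "f \<in> fin_supp_funs G A"
  have T: "reg f \<in> carrier B" using f by (intro reg_closed) (simp add: fin_supp_iff)
  have R: "Qh.C.reg (q \<circ> f) \<in> carrier Qh.C.B"
    using Qh.fin_supp_push[OF f] by (intro Qh.C.reg_closed) (simp add: Qh.C.fin_supp_iff)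
  show "nrm Qh.C.B (Qh.C.reg (q \<circ> f)) \<le> nrm B (reg f)"
    by (rule quot_norm_leI[OF R op_nrm_nonneg[OF T] quot_bound_push[OF f]])
qed

context cs_dyn
begin

text \<open>For an exact action and an invariant ideal \<open>K\<close> the set \<open>rel K\<close> turns out to be \<open>K \<rtimes>\<^sub>r G\<close>.\<close>

definition rel :: "'a set \<Rightarrow> (('g \<Rightarrow> 'a) \<Rightarrow> 'g \<Rightarrow> 'a) set" where
  "rel S = {x \<in> Cr. \<forall>\<xi>\<in>H. \<forall>h\<in>I. x \<xi> h \<in> S}"

end

text \<open>By \<open>quot_norm_leI\<close> with constant 0, \<open>ext x\<close> vanishes as soon
  as it vanishes on pushed vectors, and there \<open>ext_push\<close> says that its coordinates are
  the cosets of the values of \<open>x\<close>.\<close>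

lemma (in cs_dyn_ideal) kernel_eq_rel:
  "a_kernel (red_crossed G A \<alpha>) (red_crossed G Q \<alpha>Q) (red_crossed_map G A \<alpha> Q \<alpha>Q q) = rel K"
proof -
  have zero: "\<zero>\<^bsub>red_crossed G Q \<alpha>Q\<^esub> = \<zero>\<^bsub>Qh.C.B\<^esub>" by (simp add: red_crossed_def)
  have "Qh.ext x = \<zero>\<^bsub>Qh.C.B\<^esub> \<longleftrightarrow> (\<forall>\<xi>\<in>H. \<forall>h\<in>I. x \<xi> h \<in> K)" if x: "x \<in> Cr" for x
  proof -
    have X: "Qh.ext x \<in> carrier Qh.C.B" using Qh.ext(1)[OF x] Qh.C.op.clos_carrier by blast
    have xB: "x \<in> carrier B" using x op.clos_carrier by blast
    have c: "x \<xi> h \<in> carrier A" if "\<xi> \<in> H" "h \<in> I" for \<xi> h by (rule l2_carrier[OF op_closed[OF xB that(1)] that(2)])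
    have qz: "q a = \<zero>\<^bsub>Q\<^esub> \<longleftrightarrow> a \<in> K" if "a \<in> carrier A" for a
      using that by (simp add: Q_zero q_eq diff_zero)
    show ?thesis
    proof
      assume 0: "Qh.ext x = \<zero>\<^bsub>Qh.C.B\<^esub>"
      show "\<forall>\<xi>\<in>H. \<forall>h\<in>I. x \<xi> h \<in> K"
      proof (intro ballI)
        fix \<xi> h assume \<xi>: "\<xi> \<in> H" and h: "h \<in> I"
        have "q (x \<xi> h) = Qh.ext x (Qh.push \<xi>) h" unfolding Qh.ext_push[OF x \<xi>] using h by (simp add: Qh.push_def)
        also have "\<dots> = \<zero>\<^bsub>Q\<^esub>" unfolding 0 by (rule Qh.C.op_zero_apply[OF Qh.push_H[OF \<xi>] h])
        finally show "x \<xi> h \<in> K" using qz[OF c[OF \<xi> h]] by simp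
      qed
    next
      assume K: "\<forall>\<xi>\<in>H. \<forall>h\<in>I. x \<xi> h \<in> K"
      have "nrm Qh.C.B (Qh.ext x) \<le> 0"
      proof (rule quot_norm_leI[OF X order_refl])
        fix \<xi> assume \<xi>: "\<xi> \<in> H"
        have "Qh.ext x (Qh.push \<xi>) = Qh.C.vzero"
          unfolding Qh.ext_push[OF x \<xi>] unfolding Qh.push_def Qh.C.vzero_def
          by (rule restrict_ext) (use K \<xi> c qz in auto)
        then show "l2_norm G Q (Qh.ext x (Qh.push \<xi>)) \<le> 0 * l2_norm G Q (Qh.push \<xi>)"
          by (simp add: Qh.C.l2_norm_vzero)
      qed
      then show "Qh.ext x = \<zero>\<^bsub>Qh.C.B\<^esub>"
        using Qh.C.op_nrm_nonneg[OF X] by (intro Qh.C.op_nrm_zero_imp[OF X]) simp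
    qed
  qed
  then show ?thesis
    unfolding a_kernel_def kernel_def Qh.red_crossed_map_eq rel_def
    by (auto simp: zero Qh.carrier_XA)
qed

section \<open>Annihilators in the reduced crossed product\<close>

text \<open>Products of elements of the two ideals, in either order, lie in the
  intersection.\<close>

lemma (in cstar_algebra) ideal_subset_annihilator:
  assumes "cs_ideal A J" "cs_ideal A K" "J \<inter> K \<subseteq> {\<zero>}"
  shows "J \<subseteq> annihilator A K"
proof
  note J = cs_idealD[OF assms(1)] and K = cs_idealD[OF assms(2)]
  fix x assume x: "x \<in> J"
  then have xc: "x \<in> carrier A" using J(1) by blast
  have "x \<otimes> y \<in> J \<inter> K" "y \<otimes> x \<in> J \<inter> K" if y: "y \<in> K" for y
  proof -
    have yc: "y \<in> carrier A" using y K(1) by blast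
    show "x \<otimes> y \<in> J \<inter> K" "y \<otimes> x \<in> J \<inter> K"
      using J(5)[OF yc x] J(6)[OF yc x] K(5)[OF xc y] K(6)[OF xc y] by simp_all
  qed
  then show "x \<in> annihilator A K" using assms(3) xc by (auto simp: annihilator_def)
qed

context cs_dyn
begin

abbreviation "X \<equiv> red_crossed G A \<alpha>"

lemma X_cstar: "cstar_algebra X"
  unfolding red_crossed_eq by (rule cr.sub_cstar)

lemma X_simps: "carrier X = Cr" "x \<otimes>\<^bsub>X\<^esub> y = x \<otimes>\<^bsub>B\<^esub> y" "x \<oplus>\<^bsub>X\<^esub> y = x \<oplus>\<^bsub>B\<^esub> y" "\<zero>\<^bsub>X\<^esub> = \<zero>\<^bsub>B\<^esub>"
  "c \<odot>\<^bsub>X\<^esub> x = c \<odot>\<^bsub>B\<^esub> x" "star X x = star B x"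
  by (simp_all add: red_crossed_eq)

lemma Cr_apply: "x \<in> Cr \<Longrightarrow> \<xi> \<in> H \<Longrightarrow> x \<xi> \<in> H"
  by (rule op_closed[OF cr.sub_carrier])

lemma Cr_apply_carrier: "x \<in> Cr \<Longrightarrow> \<xi> \<in> H \<Longrightarrow> h \<in> I \<Longrightarrow> x \<xi> h \<in> carrier A"
  by (rule l2_carrier[OF Cr_apply])

lemma Cr_eq_zeroI:
  assumes "x \<in> Cr" "\<And>\<xi> h. \<xi> \<in> H \<Longrightarrow> h \<in> I \<Longrightarrow> x \<xi> h = \<zero>"
  shows "x = \<zero>\<^bsub>B\<^esub>"
  by (rule u_eqI) (use assms cr.sub_carrier op_zero_closed in \<open>simp_all add: op_zero_apply\<close>)

lemma rpi_Cr: "a \<in> carrier A \<Longrightarrow> rpi a \<in> Cr"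
  using D_u[of a "carrier A" "\<one>\<^bsub>G\<^esub>"] op.clos_subset[OF D_carrier[OF order_refl]] u_one[of a] by auto

lemma u_Cr: "a \<in> carrier A \<Longrightarrow> g \<in> I \<Longrightarrow> u a g \<in> Cr"
  using D_u[of a "carrier A" g] op.clos_subset[OF D_carrier[OF order_refl]] by auto

text \<open>Testing \<open>\<pi>(a)\<close> on the vector \<open>a\<^sup>* \<delta>\<^sub>1\<close> recovers \<open>a a\<^sup>*\<close>.\<close>

lemma pi_test_vector:
  assumes a: "a \<in> carrier A"
  obtains \<xi> where "\<xi> \<in> H" "rpi a \<xi> \<one>\<^bsub>G\<^esub> = a \<otimes> star A a"
proof -
  define \<xi> where "\<xi> = (\<lambda>h\<in>I. if h = \<one>\<^bsub>G\<^esub> then star A a else \<zero>)"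
  have \<xi>: "\<xi> \<in> H"
    by (rule l2_finite_support) (use a star_closed[OF a] in \<open>auto simp: \<xi>_def\<close>)
  moreover have "rpi a \<xi> \<one>\<^bsub>G\<^esub> = a \<otimes> star A a"
    unfolding pi_apply[OF \<xi> G.one_closed] using a by (simp add: alpha_one \<xi>_def)
  ultimately show ?thesis by (rule that)
qed

lemma rpi_eq_zero: "a \<in> carrier A \<Longrightarrow> rpi a = \<zero>\<^bsub>B\<^esub> \<Longrightarrow> a = \<zero>"
proof -
  assume a: "a \<in> carrier A" and 0: "rpi a = \<zero>\<^bsub>B\<^esub>"
  obtain \<xi> where \<xi>: "\<xi> \<in> H" "rpi a \<xi> \<one>\<^bsub>G\<^esub> = a \<otimes> star A a" by (rule pi_test_vector[OF a])
  have "star A (star A a) \<otimes> star A a = \<zero>"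
    using op_zero_apply[OF \<xi>(1) G.one_closed] \<xi>(2) by (simp only: 0 star_star[OF a])
  then have "star A a = \<zero>" by (rule nrm_star_mult_eq_0[OF star_closed[OF a]])
  then show "a = \<zero>" using star_star[OF a] star_zero by simp
qed

lemma invariant_idealD:
  assumes "invariant_ideal G A \<alpha> K"
  shows "cs_ideal A K" "g \<in> I \<Longrightarrow> k \<in> K \<Longrightarrow> \<alpha> g k \<in> K"
  using assms by (auto simp: invariant_ideal_def)

text \<open>The product of an element of \<open>K\<close> with \<open>\<alpha> g c\<close> is the
  image under \<open>\<alpha> g\<close> of a product of another element of \<open>K\<close> with
  \<open>c\<close>.\<close>

lemma annihilator_invariant:
  assumes K: "invariant_ideal G A \<alpha> K"
  shows "invariant_ideal G A \<alpha> (annihilator A K)"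
proof -
  note I = invariant_idealD[OF K]
  have "\<alpha> g c \<in> annihilator A K" if g: "g \<in> I" and c: "c \<in> annihilator A K" for g c
  proof (rule annihilatorI_left[OF I(1)])
    have cc: "c \<in> carrier A" using c by (simp add: annihilator_def)
    then show "\<alpha> g c \<in> carrier A" by (rule alpha_closed[OF g])
    fix x assume x: "x \<in> K"
    define y where "y = \<alpha> (inv\<^bsub>G\<^esub> g) x"
    have y: "y \<in> K" "\<alpha> g y = x" using g x I cs_idealD(1)[OF I(1)] by (auto simp: y_def alpha_inv)
    then have "y \<in> carrier A" using cs_idealD(1)[OF I(1)] by blast
    then have "x \<otimes> \<alpha> g c = \<alpha> g (y \<otimes> c)" using g cc y by (simp add: alpha_prod)
    then show "x \<otimes> \<alpha> g c = \<zero>" using c y g by (simp add: annihilator_def alpha_zero)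
  qed
  then show ?thesis using annihilator_ideal[OF I(1)] by (auto simp: invariant_ideal_def)
qed

lemma relD: "x \<in> rel S \<Longrightarrow> x \<in> Cr" "x \<in> rel S \<Longrightarrow> \<xi> \<in> H \<Longrightarrow> h \<in> I \<Longrightarrow> x \<xi> h \<in> S"
  by (auto simp: rel_def)

lemma relI: "x \<in> Cr \<Longrightarrow> (\<And>\<xi> h. \<xi> \<in> H \<Longrightarrow> h \<in> I \<Longrightarrow> x \<xi> h \<in> S) \<Longrightarrow> x \<in> rel S"
  by (auto simp: rel_def)

lemma closed_limit_mem:
  assumes "cs_ideal A K" "\<And>n. s n \<in> K" "l \<in> carrier A" "(\<lambda>n. E (s n)) \<longlonglongrightarrow> E l"
  shows "l \<in> K"
proof -
  note D = cs_idealD[OF assms(1)]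
  have "E l \<in> E ` K" by (rule closed_sequentially[OF D(7) _ assms(4)]) (simp add: assms(2))
  then show ?thesis using D(1) assms(3) emb_eq_iff by blast
qed

text \<open>Generators permute the coordinates and multiply them from the left, so a vector with
  values in \<open>K\<close> keeps that property; limits respect it because \<open>K\<close> is
  closed. This provides the left ideal property of \<open>rel K\<close>.\<close>

lemma Cr_preserves_ideal:
  assumes K: "cs_ideal A K" and x: "x \<in> Cr" and \<xi>: "\<xi> \<in> H" "\<And>h. h \<in> I \<Longrightarrow> \<xi> h \<in> K" and h: "h \<in> I"
  shows "x \<xi> h \<in> K"
proof -
  note D = cs_idealD[OF K]
  obtain s where s: "\<And>n. s n \<in> D (carrier A)" "(\<lambda>n. op.E (s n)) \<longlonglongrightarrow> op.E x"
    using x by (rule op.clos_seqE) blast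
  have "y \<xi> h \<in> K" if "y \<in> D (carrier A)" for y
    using that order_refl
  proof (induction rule: D_induct)
    case zero
    then show ?case using \<xi> h D(2) by (simp add: op_zero_apply)
  next
    case (u a g)
    then show ?case using \<xi> h by (simp add: u_apply D(5) alpha_closed)
  next
    case (add y z)
    then show ?case using \<xi> h D(3) by (simp add: op_add_apply)
  qed
  then have "s n \<xi> h \<in> K" for n using s(1) by blast
  moreover have sc: "s n \<in> carrier B" for n using s(1) D_carrier[OF order_refl] by blast
  ultimately show ?thesis
    by (intro closed_limit_mem[OF K _ Cr_apply_carrier[OF x \<xi>(1) h] op_tendsto_apply[OF sc cr.sub_carrier[OF x] s(2) \<xi>(1) h]])
qed

text \<open>Right multiplication only changes the vector, over which \<open>rel K\<close> quantifies
  universally; left multiplication is \<open>Cr_preserves_ideal\<close>. Closedness is checked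
  coordinatewise.\<close>

lemma rel_ideal:
  assumes K: "cs_ideal A K"
  shows "cs_ideal X (rel K)"
proof -
  interpret X: cstar_algebra X by (rule X_cstar)
  note D = cs_idealD[OF K]
  show ?thesis
  proof (rule X.cs_idealI; (unfold X_simps)?)
    show "rel K \<subseteq> Cr" by (auto simp: rel_def)
    show "\<zero>\<^bsub>B\<^esub> \<in> rel K" by (rule relI) (simp_all add: cr.sub_zero op_zero_apply D(2))
    show "x \<oplus>\<^bsub>B\<^esub> y \<in> rel K" if "x \<in> rel K" "y \<in> rel K" for x y
      using that by (intro relI) (simp_all add: relD cr.sub_add op_add_apply D(3))
    show "c \<odot>\<^bsub>B\<^esub> x \<in> rel K" if "x \<in> rel K" for c x
      using that by (intro relI) (simp_all add: relD cr.sub_smult op_smult_apply D(4))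
    show "x \<otimes>\<^bsub>B\<^esub> y \<in> rel K" if "x \<in> Cr" "y \<in> rel K" for x y
      using that by (intro relI) (simp_all add: relD cr.sub_mult op_mult_apply Cr_preserves_ideal[OF K] Cr_apply)
    show "y \<otimes>\<^bsub>B\<^esub> x \<in> rel K" if "x \<in> Cr" "y \<in> rel K" for x y
      using that by (intro relI) (simp_all add: relD cr.sub_mult op_mult_apply Cr_apply)
    have sub: "rel K \<subseteq> Cr" by (auto simp: rel_def)
    have "closed (op.E ` rel K)"
    proof (unfold closed_sequential_limits, intro allI impI, elim conjE)
      fix z l assume z: "\<forall>n. z n \<in> op.E ` rel K" "z \<longlonglongrightarrow> l"
      from z(1) obtain s where s: "\<And>n. s n \<in> rel K" "z = (\<lambda>n. op.E (s n))" by (rule image_seqE) blast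
      have sB: "s n \<in> carrier B" for n using s(1) relD(1) cr.sub_carrier by blast
      have lim: "(\<lambda>n. op.E (s n)) \<longlonglongrightarrow> l" using z(2) s(2) by simp
      obtain x where x: "x \<in> carrier B" "l = op.E x" using op.emb_Cauchy_limit[OF sB lim] by (elim bexE) (rule that)
      note lim' = lim[unfolded x(2)]
      have "op.E x \<in> op.E ` Cr" by (rule closed_sequentially[OF cr.sub_closed _ lim']) (use s(1) relD(1) in blast)
      then have xC: "x \<in> Cr" using x(1) op.emb_eq_iff cr.sub_carrier by blast
      have "x \<in> rel K"
      proof (rule relI[OF xC])
        fix \<xi> h assume \<xi>: "\<xi> \<in> H" and h: "h \<in> I"
        show "x \<xi> h \<in> K"
          by (rule closed_limit_mem[OF K relD(2)[OF s(1) \<xi> h] Cr_apply_carrier[OF xC \<xi> h] op_tendsto_apply[OF sB x(1) lim' \<xi> h]])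
      qed
      then show "l \<in> op.E ` rel K" using x(2) by blast
    qed
    then show "closed (emb X ` rel K)" using cr.sub_closed_iff[OF sub] by (simp add: red_crossed_eq)
  qed
qed

text \<open>Thus \<open>K\<close> is recovered from \<open>rel K\<close> by intersecting with
  \<open>A\<close>. In the forward direction the test vector yields only a a^* in \<open>K\<close>,
  from which \<open>a\<close> itself is regained by an approximate unit.\<close>

lemma rpi_rel:
  assumes K: "invariant_ideal G A \<alpha> K" and a: "a \<in> carrier A"
  shows "rpi a \<in> rel K \<longleftrightarrow> a \<in> K"
proof
  note I = invariant_idealD[OF K]
  assume "rpi a \<in> rel K"
  then have "a \<otimes> star A a \<in> K" using pi_test_vector[OF a] relD(2) by (metis G.one_closed)
  then show "a \<in> K" by (rule cs_ideal_if_mult_star[OF I(1) a])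
next
  note I = invariant_idealD[OF K]
  assume k: "a \<in> K"
  show "rpi a \<in> rel K"
    using k by (intro relI rpi_Cr a) (simp add: pi_apply cs_idealD(6)[OF I(1)] I(2) l2_carrier)
qed

text \<open>For one inclusion, \<open>rpi (\<alpha> h k)\<close> is evaluated at the coordinate
  \<open>h\<close>, where its coefficient is exactly \<open>k\<close>; so annihilation in the
  crossed product becomes annihilation of each value. For the other, an operator in both ideals has
  values in the intersection of \<open>K\<close> with its annihilator and hence vanishes.\<close>

lemma annihilator_rel:
  assumes K: "invariant_ideal G A \<alpha> K"
  shows "annihilator X (rel K) = rel (annihilator A K)"
proof (intro equalityI subsetI)
  interpret X: cstar_algebra X by (rule X_cstar)
  note I = invariant_idealD[OF K]
  {
    fix x assume "x \<in> annihilator X (rel K)"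
    then have x: "x \<in> Cr" "\<And>y. y \<in> rel K \<Longrightarrow> y \<otimes>\<^bsub>B\<^esub> x = \<zero>\<^bsub>B\<^esub>" by (simp_all add: annihilator_def X_simps)
    show "x \<in> rel (annihilator A K)"
    proof (rule relI[OF x(1)])
      fix \<xi> h assume \<xi>: "\<xi> \<in> H" and h: "h \<in> I"
      show "x \<xi> h \<in> annihilator A K"
      proof (rule annihilatorI_left[OF I(1) Cr_apply_carrier[OF x(1) \<xi> h]])
        fix k assume k: "k \<in> K"
        then have kc: "k \<in> carrier A" using cs_idealD(1)[OF I(1)] by blast
        have "rpi (\<alpha> h k) \<in> rel K" using rpi_rel[OF K alpha_closed[OF h kc]] I(2)[OF h k] by blast
        then have 0: "rpi (\<alpha> h k) \<otimes>\<^bsub>B\<^esub> x = \<zero>\<^bsub>B\<^esub>" by (rule x(2))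
        have "k \<otimes> x \<xi> h = rpi (\<alpha> h k) (x \<xi>) h"
          using h kc by (simp add: pi_apply[OF Cr_apply[OF x(1) \<xi>] h] alpha_inv)
        also have "\<dots> = (rpi (\<alpha> h k) \<otimes>\<^bsub>B\<^esub> x) \<xi> h" by (simp add: op_mult_apply \<xi>)
        also have "\<dots> = \<zero>" unfolding 0 by (rule op_zero_apply[OF \<xi> h])
        finally show "k \<otimes> x \<xi> h = \<zero>" .
      qed
    qed
  next
    have "rel (annihilator A K) \<subseteq> annihilator X (rel K)"
    proof (rule X.ideal_subset_annihilator[OF rel_ideal[OF annihilator_ideal[OF I(1)]] rel_ideal[OF I(1)]])
      show "rel (annihilator A K) \<inter> rel K \<subseteq> {\<zero>\<^bsub>X\<^esub>}"
      proof
        fix x assume "x \<in> rel (annihilator A K) \<inter> rel K"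
        then have "x = \<zero>\<^bsub>B\<^esub>"
          by (intro Cr_eq_zeroI) (auto intro: relD annihilator_inter[OF I(1)])
        then show "x \<in> {\<zero>\<^bsub>X\<^esub>}" by (simp add: X_simps)
      qed
    qed
    then show "x \<in> rel (annihilator A K) \<Longrightarrow> x \<in> annihilator X (rel K)" for x by blast
  }
qed

lemma regular_rel:
  assumes K: "invariant_ideal G A \<alpha> K" and r: "regular_ideal A K"
  shows "regular_ideal X (rel K)"
proof -
  have "annihilator X (annihilator X (rel K)) = rel (annihilator A (annihilator A K))"
    by (simp only: annihilator_rel[OF K] annihilator_rel[OF annihilator_invariant[OF K]])
  then show ?thesis using r rel_ideal[OF invariant_idealD(1)[OF K]] by (simp add: regular_ideal_def)
qed

text \<open>As \<open>A\<close> need not be unital, \<open>u\<^sub>g\<close> itself does not belong to the crossed product.  With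
  \<open>b = \<alpha>\<^sub>g(a)\<close> and \<open>p = b\<^sup>*b\<close>, invariance follows from \<open>(b\<^sup>* u\<^sub>g) a (\<alpha>\<^sub>g\<^sup>-\<^sup>1(p) u\<^sub>g\<^sup>-\<^sup>1) = p\<^sup>2\<close>.\<close>

lemma rpi_preimage_ideal:
  assumes J: "cs_ideal X J"
  shows "invariant_ideal G A \<alpha> {a \<in> carrier A. rpi a \<in> J}"
proof -
  interpret X: cstar_algebra X by (rule X_cstar)
  let ?K = "{a \<in> carrier A. rpi a \<in> J}"
  note D = X.cs_idealD[OF J, unfolded X_simps]
  have JB: "J \<subseteq> carrier B" using D(1) cr.sub by blast
  have closedJ: "closed (op.E ` J)" using D(7) cr.sub_closed_iff[OF D(1)] by (simp add: red_crossed_eq)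
  have r: "rpi a = u a \<one>\<^bsub>G\<^esub>" if "a \<in> carrier A" for a using that by (simp add: u_one)
  have K: "cs_ideal A ?K"
  proof (rule cs_idealI)
    show "\<zero> \<in> ?K" using D(2) by (simp add: r u_zero)
    show "x \<oplus> y \<in> ?K" if "x \<in> ?K" "y \<in> ?K" for x y
    proof -
      have "rpi (x \<oplus> y) = rpi x \<oplus>\<^bsub>B\<^esub> rpi y" using that by (simp add: r u_add)
      then show ?thesis using that D(3) by simp
    qed
    show "c \<odot> x \<in> ?K" if "x \<in> ?K" for c x
    proof -
      have "rpi (c \<odot> x) = c \<odot>\<^bsub>B\<^esub> rpi x" using that by (simp add: r u_smult smult_closed)
      then show ?thesis using that D(4) by (simp add: smult_closed)
    qed
    show "a \<otimes> x \<in> ?K" if a: "a \<in> carrier A" and x: "x \<in> ?K" for a x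
    proof -
      have "rpi (a \<otimes> x) = rpi a \<otimes>\<^bsub>B\<^esub> rpi x" using a x by (simp add: r m_closed u_mult alpha_one)
      then show ?thesis using a x D(5)[OF rpi_Cr[OF a]] by (simp add: m_closed)
    qed
    show "x \<otimes> a \<in> ?K" if a: "a \<in> carrier A" and x: "x \<in> ?K" for a x
    proof -
      have "rpi (x \<otimes> a) = rpi x \<otimes>\<^bsub>B\<^esub> rpi a" using a x by (simp add: r m_closed u_mult alpha_one)
      then show ?thesis using a x D(6)[OF rpi_Cr[OF a]] by (simp add: m_closed)
    qed
    show "closed (E ` ?K)"
    proof (unfold closed_sequential_limits, intro allI impI, elim conjE)
      fix z l assume z: "\<forall>n. z n \<in> E ` ?K" "z \<longlonglongrightarrow> l"
      from z(1) obtain s where s: "\<And>n. s n \<in> ?K" "z = (\<lambda>n. E (s n))" by (rule image_seqE) blast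
      have sA: "s n \<in> carrier A" for n using s(1)[of n] by simp
      have lim: "(\<lambda>n. E (s n)) \<longlonglongrightarrow> l" using z(2) s(2) by simp
      obtain a where a: "a \<in> carrier A" "l = E a" using emb_Cauchy_limit[OF sA lim] by (elim bexE) (rule that)
      have "(\<lambda>n. dist (E (s n)) (E a)) \<longlonglongrightarrow> 0" using lim unfolding a(2) tendsto_dist_iff[symmetric] .
      \<comment> \<open>\<open>rpi\<close> is additive and contractive, so convergence in
        \<open>A\<close> gives convergence of the represented elements, and closedness of
        \<open>J\<close> can be used.\<close>
      then have "(\<lambda>n. dist (op.E (rpi (s n))) (op.E (rpi a))) \<longlonglongrightarrow> 0"
      proof (rule Lim_null_comparison[rotated])
        have "dist (op.E (rpi (s n))) (op.E (rpi a)) \<le> dist (E (s n)) (E a)" for n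
        proof -
          have c: "s n \<ominus> a \<in> carrier A" using sA a by simp
          have "s n = (s n \<ominus> a) \<oplus> a" using sA[of n] a(1) by (simp add: a_minus_def a_assoc l_neg)
          then have "rpi (s n) = rpi (s n \<ominus> a) \<oplus>\<^bsub>B\<^esub> rpi a"
            using u_add[OF c a(1) G.one_closed] sA[of n] by (simp only: r[OF sA] r[OF c] r[OF a(1)])
          then have "op.E (rpi (s n)) - op.E (rpi a) = op.E (rpi (s n \<ominus> a))"
            using c a(1) by (simp add: op.emb_add pi_closed)
          then have "dist (op.E (rpi (s n))) (op.E (rpi a)) = nrm B (u (s n \<ominus> a) \<one>\<^bsub>G\<^esub>)"
            using c by (simp add: dist_norm op.norm_emb pi_closed u_one)
          also have "\<dots> \<le> nrm A (s n \<ominus> a)" by (rule nrm_u_le[OF c G.one_closed])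
          also have "\<dots> = dist (E (s n)) (E a)" using sA[of n] a(1) c by (simp add: dist_norm flip: norm_emb emb_diff)
          finally show ?thesis .
        qed
        then show "\<forall>\<^sub>F n in sequentially. norm (dist (op.E (rpi (s n))) (op.E (rpi a))) \<le> dist (E (s n)) (E a)" by simp
      qed
      then have "(\<lambda>n. op.E (rpi (s n))) \<longlonglongrightarrow> op.E (rpi a)" by (subst tendsto_dist_iff)
      then have "op.E (rpi a) \<in> op.E ` J" by (rule closed_sequentially[OF closedJ, rotated]) (use s(1) in simp)
      then have "rpi a \<in> J" using JB pi_closed[OF a(1)] op.emb_eq_iff by blast
      then show "l \<in> E ` ?K" using a by simp
    qed
  qed simp
  have "\<alpha> g a \<in> ?K" if g: "g \<in> I" and a: "a \<in> ?K" for g a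
  proof -
    define b where "b = \<alpha> g a"
    have ac: "a \<in> carrier A" and bc: "b \<in> carrier A" using a g by (simp_all add: b_def alpha_closed)
    define p where "p = star A b \<otimes> b"
    have p: "p \<in> carrier A" "star A p = p" using bc by (simp_all add: p_def m_closed star_closed star_mult star_star)
    have "u (star A b) g \<otimes>\<^bsub>B\<^esub> rpi a = u p g"
      using ac bc g by (simp add: r u_mult star_closed p_def b_def)
    then have "u p g \<in> J" using D(5)[OF u_Cr[OF star_closed[OF bc] g]] a by (metis (mono_tags, lifting) mem_Collect_eq)
    moreover have q: "\<alpha> (inv\<^bsub>G\<^esub> g) p \<in> carrier A" using g p by (simp add: alpha_closed)
    moreover have "u p g \<otimes>\<^bsub>B\<^esub> u (\<alpha> (inv\<^bsub>G\<^esub> g) p) (inv\<^bsub>G\<^esub> g) = rpi (star A p \<otimes> p)"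
      using p g q by (simp add: u_mult alpha_inv r m_closed)
    ultimately have "rpi (star A p \<otimes> p) \<in> J" using D(6)[OF u_Cr[OF q G.inv_closed[OF g]]] by metis
    then have "p \<in> ?K" using p by (intro cs_ideal_if_star_mult[OF K p(1)]) (simp add: m_closed)
    then show ?thesis unfolding b_def[symmetric] by (intro cs_ideal_if_star_mult[OF K bc]) (simp add: p_def)
  qed
  then show ?thesis using K by (auto simp: invariant_ideal_def)
qed

text \<open>The contrapositive of the ideal intersection property, in the form used for both
  inclusions of the second claim.\<close>

lemma ideal_intersection_propertyD:
  assumes iip: "ideal_intersection_property G A \<alpha>" and N: "cs_ideal X N"
    and 0: "\<And>a. a \<in> carrier A \<Longrightarrow> rpi a \<in> N \<Longrightarrow> a = \<zero>"
  shows "N \<subseteq> {\<zero>\<^bsub>X\<^esub>}"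
proof -
  interpret X: cstar_algebra X by (rule X_cstar)
  have z: "rpi \<zero> = \<zero>\<^bsub>X\<^esub>" using u_zero[OF G.one_closed] u_one[of \<zero>] by (simp add: X_simps)
  have "N \<inter> rpi ` carrier A = {\<zero>\<^bsub>X\<^esub>}"
    using 0 z X.cs_idealD(2)[OF N] by (auto intro!: image_eqI[of _ _ \<zero>])
  then show ?thesis using iip N unfolding ideal_intersection_property_def by blast
qed

lemma regular_ideal_eq_rel:
  assumes iip: "ideal_intersection_property G A \<alpha>" and J: "regular_ideal X J"
  defines "K \<equiv> {a \<in> carrier A. rpi a \<in> J}"
  shows "invariant_ideal G A \<alpha> K" "regular_ideal A K" "J = rel K"
proof -
  interpret X: cstar_algebra X by (rule X_cstar)
  have Ji: "cs_ideal X J" and JJ: "annihilator X (annihilator X J) = J" using J by (simp_all add: regular_ideal_def)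
  show K: "invariant_ideal G A \<alpha> K" unfolding K_def by (rule rpi_preimage_ideal[OF Ji])
  note I = invariant_idealD[OF K]
  let ?K' = "annihilator A (annihilator A K)" and ?N = "annihilator X J"
  have N: "cs_ideal X ?N" by (rule X.annihilator_ideal[OF Ji])
  have K': "invariant_ideal G A \<alpha> ?K'" by (intro annihilator_invariant K)
  note I' = invariant_idealD[OF K']
  have "rel ?K' \<inter> ?N \<subseteq> {\<zero>\<^bsub>X\<^esub>}"
  proof (rule ideal_intersection_propertyD[OF iip X.cs_ideal_inter[OF rel_ideal[OF I'(1)] N]])
    fix a assume a: "a \<in> carrier A" "rpi a \<in> rel ?K' \<inter> ?N"
    have "a \<in> annihilator A K"
    proof (rule annihilatorI_left[OF I(1) a(1)])
      fix k assume k: "k \<in> K"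
      then have kc: "k \<in> carrier A" by (simp add: K_def)
      have "rpi (k \<otimes> a) = rpi k \<otimes>\<^bsub>B\<^esub> rpi a"
        using kc a(1) by (simp add: m_closed u_mult alpha_one flip: u_one)
      also have "\<dots> = \<zero>\<^bsub>B\<^esub>" using a(2) k by (simp add: annihilator_def X_simps K_def)
      finally show "k \<otimes> a = \<zero>" using kc a(1) by (intro rpi_eq_zero m_closed)
    qed
    moreover have "a \<in> ?K'" using a rpi_rel[OF K'] by blast
    ultimately show "a = \<zero>" by (rule annihilator_inter[OF annihilator_ideal[OF I(1)]])
  qed
  from X.ideal_subset_annihilator[OF rel_ideal[OF I'(1)] N this] have K'J: "rel ?K' \<subseteq> J" by (simp only: JJ)
  \<comment> \<open>If \<open>a\<close> lies in the double annihilator, then \<open>rpi a\<close>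
    lies in \<open>rel ?K'\<close> and hence in \<open>J\<close>, which is the defining condition of
    \<open>K\<close>.\<close>
  have "?K' \<subseteq> K"
  proof
    fix a assume a: "a \<in> ?K'"
    then have "a \<in> carrier A" by (simp add: annihilator_def)
    then show "a \<in> K" using a rpi_rel[OF K'] K'J by (auto simp: K_def)
  qed
  moreover have "K \<subseteq> ?K'" using cs_idealD(1)[OF I(1)] by (auto simp: annihilator_def)
  ultimately have KK: "?K' = K" by blast
  then show "regular_ideal A K" using I(1) by (simp add: regular_ideal_def)
  have rr: "annihilator X (annihilator X (rel K)) = rel K"
    by (simp only: annihilator_rel[OF K] annihilator_rel[OF annihilator_invariant[OF K]] KK)
  have M: "cs_ideal X (annihilator X (rel K))" by (rule X.annihilator_ideal[OF rel_ideal[OF I(1)]])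
  have "J \<inter> annihilator X (rel K) \<subseteq> {\<zero>\<^bsub>X\<^esub>}"
  proof (rule ideal_intersection_propertyD[OF iip X.cs_ideal_inter[OF Ji M]])
    fix a assume a: "a \<in> carrier A" "rpi a \<in> J \<inter> annihilator X (rel K)"
    then have "a \<in> K" by (simp add: K_def)
    then have "rpi a \<in> rel K" using a rpi_rel[OF K] by blast
    then have "rpi a = \<zero>\<^bsub>X\<^esub>" using a(2) by (intro X.annihilator_inter[OF rel_ideal[OF I(1)]]) auto
    then show "a = \<zero>" using a(1) by (intro rpi_eq_zero) (simp_all add: X_simps)
  qed
  from X.ideal_subset_annihilator[OF Ji M this] have "J \<subseteq> rel K" by (simp only: rr)
  then show "J = rel K" using K'J unfolding KK by (rule equalityI)
qed

text \<open>The point where exactness enters: it identifies \<open>crossed_ideal\<close> with a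
  kernel, and \<open>kernel_eq_rel\<close> describes that kernel, so everything known about
  \<open>rel\<close> carries over.\<close>

lemma exact_crossed_ideal:
  assumes ex: "exact_action G A \<alpha>" and inv: "invariant_ideal G A \<alpha> K"
  shows "crossed_ideal G A \<alpha> K = rel K"
proof -
  interpret cs_dyn_ideal A G \<alpha> K
    by (intro cs_dyn_ideal.intro cs_dyn_axioms cstar_quotient.intro cstar_quotient_axioms.intro
        cs_dyn_ideal_axioms.intro cstar invariant_idealD[OF inv])
  show ?thesis using ex inv kernel_eq_rel by (simp add: exact_action_def Let_def)
qed

end

lemma cs_dyn_if_cstar_action:
  assumes "cstar_action G A \<alpha>"
  shows "cs_dyn A G \<alpha>"
proof -
  interpret cstar_action G A \<alpha> by (rule assms)
  show ?thesis
  proof (intro cs_dyn.intro l2_space.intro cs_dyn_axioms.intro automorphism)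
    show "cstar_algebra A" by (rule cstar_algebra_axioms)
    show "group G" by (rule group_hom.axioms(1)[OF group_hom])
    show "\<alpha> \<one>\<^bsub>G\<^esub> x = x" if "x \<in> carrier A" for x
      using that id_eq_one by (metis restrict_apply')
    show "\<alpha> (g \<otimes>\<^bsub>G\<^esub> h) x = \<alpha> g (\<alpha> h x)" if "g \<in> carrier G" "h \<in> carrier G" "x \<in> carrier A" for g h x
      using that by (intro composition_rule)
  qed
qed

theorem theorem6p5:
  fixes G :: "('g, 'm) monoid_scheme" and A :: "'a cstar" and \<alpha> :: "'g \<Rightarrow> 'a \<Rightarrow> 'a"
  assumes "cstar_action G A \<alpha>"
    and "exact_action G A \<alpha>"
  shows "(\<forall>K. invariant_ideal G A \<alpha> K \<and> regular_ideal A K \<longrightarrow>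
            regular_ideal (red_crossed G A \<alpha>) (crossed_ideal G A \<alpha> K)) \<and>
         (ideal_intersection_property G A \<alpha> \<longrightarrow>
            (\<forall>J. regular_ideal (red_crossed G A \<alpha>) J \<longrightarrow>
               (\<exists>K. invariant_ideal G A \<alpha> K \<and> regular_ideal A K \<and>
                    J = crossed_ideal G A \<alpha> K)))"
proof -
  interpret cs_dyn A G \<alpha> by (rule cs_dyn_if_cstar_action[OF assms(1)])
  show ?thesis
  proof (intro conjI allI impI)
    fix K assume K: "invariant_ideal G A \<alpha> K \<and> regular_ideal A K"
    then show "regular_ideal X (crossed_ideal G A \<alpha> K)"
      using regular_rel[of K] exact_crossed_ideal[OF assms(2), of K] by simp
  next
    fix J assume iip: "ideal_intersection_property G A \<alpha>" and J: "regular_ideal X J"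
    note K = regular_ideal_eq_rel[OF iip J]
    then show "\<exists>K. invariant_ideal G A \<alpha> K \<and> regular_ideal A K \<and> J = crossed_ideal G A \<alpha> K"
      unfolding exact_crossed_ideal[OF assms(2) K(1), symmetric] by blast
  qed
qed

end
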